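(* Let $\Omega\subset\mathbb{C}$ be a bounded simply connected domain with real-analytic boundary, and let $\rho$ be a positive real-analytic density on $\partial\Omega$. For $N\ge 1$ let $\mathbf{E}^N_{\partial\Omega,\rho}$ denote expectation with respect to the Gaussian measure $\gamma^N_{\partial\Omega,\rho}$ on the space $\mathcal{P}_N$ of polynomials of degree $\le N$ induced by the inner product $\langle f,\bar g\rangle_{\partial\Omega,\rho}=\int_{\partial\Omega} f(z)\overline{g(z)}\,\rho(z)\,|dz|$. Then $$\mathbf{E}^N_{\partial\Omega,\rho}\big(\widetilde Z^N_f\big)=\nu_\Omega+O(1/N),$$ where $\nu_\Omega$ is the equilibrium measure of $\overline\Omega$; that is, for every test function $\varphi\in C_c^\infty(\mathbb{C})$ there is a constant $C_\varphi$, independent of $N$, such that $$\Big|\mathbf{E}^N_{\partial\Omega,\rho}\Big(\frac1N\sum_{f(z)=0}\varphi(z)\Big)-\int\varphi\,d\nu_\Omega\Big|\le \frac{C_\varphi}{N}\qquad\text{for all }N\ge1 .$$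
   Context: $\mathcal{P}_N$ is the complex vector space of polynomials in one complex variable of degree $\le N$. An inner product on $\mathcal{P}_N$ induces a Gaussian probability measure: if $P_0,\dots,P_N$ is an orthonormal basis of $\mathcal{P}_N$ and $f=\sum_{j=0}^N a_jP_j$, then the $a_j$ are i.i.d. complex Gaussian random variables with $\mathbf{E}(a_j)=0$, $\mathbf{E}(a_j\bar a_k)=\delta_{jk}$, $\mathbf{E}(a_ja_k)=0$, i.e. the measure is $\pi^{-(N+1)}e^{-|a|^2}\,da$ in terms of $a\in\mathbb{C}^{N+1}$. For $f\in\mathcal{P}_N$, the normalized distribution of zeros is $\widetilde Z^N_f=\frac1N\sum_{f(z)=0}\delta_z$ (almost surely $f$ has degree exactly $N$ and only simple zeros). The expectation $\mathbf{E}(\widetilde Z^N_f)$ is the measure defined by $(\mathbf{E}(\widetilde Z^N_f),\varphi)=\mathbf{E}\big((\widetilde Z^N_f,\varphi)\big)$. The equilibrium measure of a compact set $K\subset\mathbb{C}$ is the unique probability measure $\nu_K$ on $K$ minimizing the energy $E(\mu)=-\int_K\int_K\log|z-w|\,d\mu(z)\,d\mu(w)$; $\nu_\Omega$ denotes the equilibrium measure of $\overline\Omega$. Equivalently, if $\Phi$ is an exterior Riemann mapping function from the exterior of $\Omega$ to the exterior of the unit disk with $\Phi(\infty)=\infty$, then $\int\varphi\,d\nu_\Omega=\frac1{2\pi}\int_0^{2\pi}\varphi(\Phi^{-1}(e^{i\theta}))\,d\theta$. *)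

theory Defs
  imports "HOL-Probability.Probability" "HOL-Computational_Algebra.Polynomial"
begin

section \<open>Real-analytic curves and test functions\<close>

definition real_analytic :: "(real \<Rightarrow> 'a::real_normed_vector) \<Rightarrow> bool" where
  "real_analytic f \<longleftrightarrow>
     (\<forall>t. \<exists>r>0. \<exists>c. \<forall>s. \<bar>s - t\<bar> < r \<longrightarrow> (\<lambda>n. ((s - t) ^ n) *\<^sub>R c n) sums f s)"

text \<open>A 1-periodic, regular, real-analytic parametrisation of a Jordan curve.\<close>

definition analytic_jordan_curve :: "(real \<Rightarrow> complex) \<Rightarrow> bool" where
  "analytic_jordan_curve \<gamma> \<longleftrightarrow>
     real_analytic \<gamma> \<and> (\<forall>t. \<gamma> (t + 1) = \<gamma> t) \<and> inj_on \<gamma> {0..<1} \<and>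
     (\<forall>t. vector_derivative \<gamma> (at t) \<noteq> 0)"

primrec cont_diff :: "nat \<Rightarrow> ('a::real_normed_vector \<Rightarrow> 'b::real_normed_vector) \<Rightarrow> bool" where
  "cont_diff 0 f \<longleftrightarrow> continuous_on UNIV f"
| "cont_diff (Suc k) f \<longleftrightarrow>
     (\<forall>x. f differentiable (at x)) \<and> (\<forall>v. cont_diff k (\<lambda>x. frechet_derivative f (at x) v))"

text \<open>Smoothness is in the real sense; in particular \<open>\<phi>\<close> need not be holomorphic.\<close>

definition test_function :: "(complex \<Rightarrow> complex) \<Rightarrow> bool" where
  "test_function \<phi> \<longleftrightarrow> (\<forall>k. cont_diff k \<phi>) \<and> compact (closure {z. \<phi> z \<noteq> 0})"


section \<open>Gaussian random polynomials\<close>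

text \<open>The integral of \<open>f (cnj g) \<rho>\<close> against arc length along the curve \<open>\<gamma>\<close>. Its value depends
  only on the image of an injective regular \<open>\<gamma>\<close>, not on the parametrisation.\<close>

definition curve_inner ::
  "(real \<Rightarrow> complex) \<Rightarrow> (complex \<Rightarrow> real) \<Rightarrow> complex poly \<Rightarrow> complex poly \<Rightarrow> complex" where
  "curve_inner \<gamma> \<rho> f g =
     integral {0..1} (\<lambda>t. poly f (\<gamma> t) * cnj (poly g (\<gamma> t)) *
       of_real (\<rho> (\<gamma> t) * norm (vector_derivative \<gamma> (at t))))"

definition orthonormal_basis ::
  "(complex poly \<Rightarrow> complex poly \<Rightarrow> complex) \<Rightarrow> nat \<Rightarrow> (nat \<Rightarrow> complex poly) \<Rightarrow> bool" where
  "orthonormal_basis ip N P \<longleftrightarrow>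
     (\<forall>j\<le>N. degree (P j) \<le> N) \<and>
     (\<forall>f. degree f \<le> N \<longrightarrow> (\<exists>a. f = (\<Sum>j\<le>N. smult (a j) (P j)))) \<and>
     (\<forall>j\<le>N. \<forall>k\<le>N. ip (P j) (P k) = (if j = k then 1 else 0))"

definition std_complex_gaussian :: "complex measure" where
  "std_complex_gaussian = density lborel (\<lambda>z. ennreal (exp (- (cmod z)\<^sup>2) / pi))"

text \<open>The polynomials of degree at most \<open>N\<close> with the Borel sets of the coefficient space.\<close>

definition poly_borel :: "nat \<Rightarrow> complex poly measure" where
  "poly_borel N =
     vimage_algebra {f. degree f \<le> N} (\<lambda>f. \<lambda>j\<in>{..N}. coeff f j) (\<Pi>\<^sub>M j\<in>{..N}. borel)"

text \<open>The law of \<open>\<Sum>j\<le>N. a j P j\<close> with i.i.d. standard complex Gaussian \<open>a j\<close>. By unitary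
  invariance it is the same for all orthonormal bases \<open>P\<close> of a given inner product.\<close>

definition gaussian_poly :: "nat \<Rightarrow> (nat \<Rightarrow> complex poly) \<Rightarrow> complex poly measure" where
  "gaussian_poly N P =
     distr (\<Pi>\<^sub>M j\<in>{..N}. std_complex_gaussian) (poly_borel N) (\<lambda>a. \<Sum>j\<le>N. smult (a j) (P j))"

text \<open>The normalised zero distribution of \<open>f\<close>, paired with \<open>\<phi>\<close>. Each zero is counted once
  (almost surely all are simple); for \<open>f = 0\<close> the sum is over an infinite set, hence 0.\<close>

definition zero_distribution :: "nat \<Rightarrow> complex poly \<Rightarrow> (complex \<Rightarrow> complex) \<Rightarrow> complex" where
  "zero_distribution N f \<phi> = (\<Sum>z | poly f z = 0. \<phi> z) / of_nat N"


section \<open>Equilibrium measure\<close>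

text \<open>Extended-real-valued, since \<open>ln 0 = 0\<close> would give point masses finite energy.\<close>

definition log_kernel :: "complex \<Rightarrow> complex \<Rightarrow> ereal" where
  "log_kernel z w = (if z = w then \<infinity> else ereal (- ln (cmod (z - w))))"

text \<open>Positive part minus negative part of the double integral; \<open>e2ennreal\<close> truncates negative
  values to 0. For a finite measure on a bounded set the negative part is finite.\<close>

definition log_energy :: "complex measure \<Rightarrow> ereal" where
  "log_energy \<mu> =
     enn2ereal (\<integral>\<^sup>+z. \<integral>\<^sup>+w. e2ennreal (log_kernel z w) \<partial>\<mu> \<partial>\<mu>) -
     enn2ereal (\<integral>\<^sup>+z. \<integral>\<^sup>+w. e2ennreal (- log_kernel z w) \<partial>\<mu> \<partial>\<mu>)"

definition prob_measures_on :: "complex set \<Rightarrow> complex measure set" where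
  "prob_measures_on K = {\<mu>. prob_space \<mu> \<and> sets \<mu> = sets borel \<and> emeasure \<mu> K = 1}"

definition equilibrium_measure :: "complex set \<Rightarrow> complex measure" where
  "equilibrium_measure K =
     (THE \<nu>. \<nu> \<in> prob_measures_on K \<and> (\<forall>\<mu>\<in>prob_measures_on K. log_energy \<nu> \<le> log_energy \<mu>))"

end

theory Submission
 imports Defs "HOL-Complex_Analysis.Complex_Analysis" "HOL-Computational_Algebra.Fundamental_Theorem_Algebra"
begin

text \<open>
 Write $f = \sum_j a_j P_j$ and $K_N(z) = \sum_j |P_j(z)|^2$. Each value $f(z)$ is a centred complex
 Gaussian of variance $K_N(z)$, so the mean of $\ln |f(z)|^2$ is $\ln K_N(z)$ up to a bounded error.
 Because the Laplacian of $\ln |f|^2$ is a multiple of the sum of the point masses at the zeros, the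
 expected number of zeros, paired with a test function \<open>\<phi>\<close>, is the integral of $\ln K_N$ against
 the Laplacian of \<open>\<phi>\<close>, again up to a bounded error (\<open>expected_zeros\<close>). After division by \<open>N\<close> the error
 is of the required order, and the theorem becomes a statement about the kernel:
 $\ln K_N - 2 N g$ is bounded in $L^1$ on every disc, uniformly in \<open>N\<close> (\<open>kernel_diag_green_L1\<close>), where
 \<open>g\<close> is the Green function of the exterior with pole at infinity, extended by 0 to the domain. Indeed
 the Laplacian of \<open>g\<close> is a multiple of the equilibrium measure (\<open>green_laplacian\<close>,
 \<open>equilibrium_measure_eq\<close>).

 The bounds for $K_N$ come from its extremal property: $K_N(z)$ is the largest value of $|p(z)|^2$ among
 polynomials of degree at most \<open>N\<close> and norm at most 1. Upper bound: Cauchy's formula on the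
 curve, applied to \<open>p\<close> inside and to $s^N p(\psi(s))$ outside, where \<open>\<psi>\<close> maps the punctured disc onto the
 exterior, costs only a power of the distance to the curve (\<open>polynomial_growth\<close>), whose logarithm is
 integrable. Lower bound: the constant 1 inside, and the Faber polynomials outside, which satisfy
 $F_N(\psi(s)) = s^{-N} + O(1)$ up to the boundary (\<open>faber_polynomials\<close>).

 All this needs \<open>\<psi>\<close> beyond the unit circle (\<open>exterior_map\<close>). The curve extends to an injective
 holomorphic map \<open>G\<close> of an annulus. Composed with the Riemann map of the inverted exterior, \<open>G\<close> becomes a
 map into the disc whose modulus tends to 1 at the circle; such a map continues by reflection
 (\<open>circle_reflection\<close>), and its inverse carries \<open>G\<close> over to the continuation of \<open>\<psi>\<close>.

 The equilibrium measure is recognised by its constant potential (\<open>equilibrium_measure_eqI\<close>). Both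
 minimality and uniqueness rest on the positive definiteness of the logarithmic kernel, which is a
 mixture of Gaussian kernels.
\<close>

section \<open>Lebesgue measure on the plane\<close>

lemma measurable_Complex [measurable]:
 "(\<lambda>(x,y). Complex x y) \<in> borel_measurable (borel \<Otimes>\<^sub>M borel)"
 "(\<lambda>p. Complex (fst p) (snd p)) \<in> borel_measurable (borel \<Otimes>\<^sub>M borel)"
proof -
 show "(\<lambda>p. Complex (fst p) (snd p)) \<in> borel_measurable (borel \<Otimes>\<^sub>M borel)"
  unfolding Complex_eq borel_prod[symmetric] by measurable
 then show "(\<lambda>(x,y). Complex x y) \<in> borel_measurable (borel \<Otimes>\<^sub>M borel)"
  by (simp add: case_prod_beta')
qed

text \<open>Product form of plane measure, by which Fubini's theorem reduces plane integrals to integrals over the axes.\<close>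
lemma lborel_complex:
 "(lborel :: complex measure) = distr (lborel \<Otimes>\<^sub>M lborel) borel (\<lambda>(x,y). Complex x y)"
proof (rule lborel_eqI)
 fix l u :: complex assume le: "\<And>b. b \<in> Basis \<Longrightarrow> l \<bullet> b \<le> u \<bullet> b"
 have le': "Re l \<le> Re u" "Im l \<le> Im u"
  using le[of 1] le[of \<i>] by (simp_all add: Basis_complex_def)
 have v: "(\<lambda>(x,y). Complex x y) -` box l u \<inter> space (lborel \<Otimes>\<^sub>M lborel) =
   {Re l<..<Re u} \<times> {Im l<..<Im u}"
  by (auto simp: space_pair_measure in_box_complex_iff)
 have "emeasure (distr (lborel \<Otimes>\<^sub>M lborel) borel (\<lambda>(x,y). Complex x y)) (box l u) =
   emeasure (lborel \<Otimes>\<^sub>M lborel) ({Re l<..<Re u} \<times> {Im l<..<Im u})"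
  by (subst emeasure_distr) (auto simp: v)
 also have "\<dots> = ennreal (Re u - Re l) * ennreal (Im u - Im l)"
  using le' by (simp add: lborel.emeasure_pair_measure_Times)
 also have "\<dots> = (\<Prod>b\<in>Basis. (u - l) \<bullet> b)"
  using le' by (simp add: Basis_complex_def ennreal_mult'[symmetric])
 finally show "emeasure (distr (lborel \<Otimes>\<^sub>M lborel) borel (\<lambda>(x,y). Complex x y)) (box l u) =
   (\<Prod>b\<in>Basis. (u - l) \<bullet> b)" .
qed simp

lemma nn_integral_complex:
 fixes f :: "complex \<Rightarrow> ennreal"
 assumes [measurable]: "f \<in> borel_measurable borel"
 shows "(\<integral>\<^sup>+z. f z \<partial>lborel) = (\<integral>\<^sup>+x. \<integral>\<^sup>+y. f (Complex x y) \<partial>lborel \<partial>lborel)"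
 by (subst lborel_complex, subst nn_integral_distr)
   (auto simp: case_prod_beta' lborel.nn_integral_fst[symmetric])

lemma integrable_complex_iff:
 fixes f :: "complex \<Rightarrow> 'a::{banach,second_countable_topology}"
 assumes [measurable]: "f \<in> borel_measurable borel"
 shows "integrable lborel f \<longleftrightarrow> integrable (lborel \<Otimes>\<^sub>M lborel) (\<lambda>(x,y). f (Complex x y))"
 by (subst lborel_complex, subst integrable_distr_eq) (auto simp: case_prod_beta')

lemma integral_complex:
 fixes f :: "complex \<Rightarrow> 'a::{banach,second_countable_topology}"
 assumes i: "integrable lborel f"
 shows "(\<integral>z. f z \<partial>lborel) = (\<integral>x. \<integral>y. f (Complex x y) \<partial>lborel \<partial>lborel)"
  and "(\<integral>z. f z \<partial>lborel) = (\<integral>y. \<integral>x. f (Complex x y) \<partial>lborel \<partial>lborel)"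
proof -
 have [measurable]: "f \<in> borel_measurable borel" using i by auto
 have i': "integrable (lborel \<Otimes>\<^sub>M lborel) (\<lambda>(x,y). f (Complex x y))"
  using integrable_complex_iff[of f] i by simp
 have e: "(\<integral>z. f z \<partial>lborel) = (\<integral>p. f (Complex (fst p) (snd p)) \<partial>(lborel \<Otimes>\<^sub>M lborel))"
  by (subst lborel_complex, subst integral_distr) (auto simp: case_prod_beta')
 show "(\<integral>z. f z \<partial>lborel) = (\<integral>x. \<integral>y. f (Complex x y) \<partial>lborel \<partial>lborel)"
  unfolding e using i' lborel_pair.integral_fst'[of "\<lambda>p. f (Complex (fst p) (snd p))"]
  by (simp add: case_prod_beta')
 show "(\<integral>z. f z \<partial>lborel) = (\<integral>y. \<integral>x. f (Complex x y) \<partial>lborel \<partial>lborel)"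
  unfolding e using i' lborel_pair.integral_snd[of "\<lambda>x y. f (Complex x y)"]
  by (simp add: case_prod_beta')
qed

lemma nn_integral_complex_affine:
 fixes f :: "complex \<Rightarrow> ennreal" and c :: real
 assumes [measurable]: "f \<in> borel_measurable borel" and c: "c \<noteq> 0"
 shows "(\<integral>\<^sup>+z. f z \<partial>lborel) = ennreal (c\<^sup>2) * (\<integral>\<^sup>+z. f (t + c *\<^sub>R z) \<partial>lborel)"
 by (subst lborel_affine[OF c, of t], subst nn_integral_density)
   (auto simp: nn_integral_distr nn_integral_cmult)

lemma integral_complex_affine:
 fixes f :: "complex \<Rightarrow> complex" and c :: real
 assumes [measurable]: "f \<in> borel_measurable borel" and c: "c \<noteq> 0"
 shows "(\<integral>z. f z \<partial>lborel) = c\<^sup>2 *\<^sub>R (\<integral>z. f (t + c *\<^sub>R z) \<partial>lborel)"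
 by (subst lborel_affine[OF c, of t], subst integral_density)
   (auto simp: integral_distr)

section \<open>Integrable singularities\<close>

lemma cball_borel [measurable]: "cball (a::'a::metric_space) r \<in> sets borel"
 by simp

lemma nn_integral_abs_powr_finite:
 "(\<integral>\<^sup>+x. indicator {-R..R} x * ennreal (\<bar>x\<bar> powr (-3/4)) \<partial>lborel) < \<infinity>"
proof -
 let ?f = "\<lambda>x::real. indicator {0..R} x * ennreal (x powr (-3/4))"
 have fin: "(\<integral>\<^sup>+x. ?f x \<partial>lborel) < \<infinity>"
 proof (cases "R \<ge> 0")
  case True
  have "((\<lambda>x. x powr (-3/4)) has_integral (R powr (-3/4+1) / (-3/4+1))) {0..R}"
   by (rule has_integral_powr_from_0) (use True in auto)
  then have "(\<integral>\<^sup>+x. ennreal (x powr (-3/4)) * indicator {0..R} x \<partial>lborel) = ennreal (R powr (-3/4+1) / (-3/4+1))"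
   by (rule nn_integral_has_integral_lebesgue'[rotated]) simp
  then show ?thesis by (simp add: mult.commute)
 qed auto
 have "(\<integral>\<^sup>+x. indicator {-R..R} x * ennreal (\<bar>x\<bar> powr (-3/4)) \<partial>lborel)
   \<le> (\<integral>\<^sup>+x. ?f x + ?f (0 + (-1) * x) \<partial>lborel)"
  by (intro nn_integral_mono) (auto simp: indicator_def abs_if)
 also have "\<dots> = (\<integral>\<^sup>+x. ?f x \<partial>lborel) + (\<integral>\<^sup>+x. ?f (0 + (-1) * x) \<partial>lborel)"
  by (intro nn_integral_add) measurable
 also have "(\<integral>\<^sup>+x. ?f (0 + (-1) * x) \<partial>lborel) = (\<integral>\<^sup>+x. ?f x \<partial>lborel)"
  using nn_integral_real_affine[of ?f "-1" 0] by simp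
 also have "(\<integral>\<^sup>+x. ?f x \<partial>lborel) + (\<integral>\<^sup>+x. ?f x \<partial>lborel) < \<infinity>" using fin by simp
 finally show ?thesis .
qed

text \<open>Since $|x| |y| \le |z|^2$, the singularity is dominated by $|x|^{-3/4} |y|^{-3/4}$, a product of two integrable one-dimensional singularities. The power \<open>-3/2\<close> serves throughout as an integrable majorant of the logarithm.\<close>
lemma nn_integral_cmod_powr_finite:
 "(\<integral>\<^sup>+z. indicator (cball 0 R) z * ennreal (cmod z powr (-3/2)) \<partial>lborel) < \<infinity>"
proof -
 let ?f = "\<lambda>x::real. indicator {-R..R} x * ennreal (\<bar>x\<bar> powr (-3/4))"
 have le: "cmod (Complex x y) powr (-3/2) \<le> \<bar>x\<bar> powr (-3/4) * \<bar>y\<bar> powr (-3/4)"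
  if "x \<noteq> 0" "y \<noteq> 0" for x y :: real
 proof -
  have "\<bar>x\<bar> * \<bar>y\<bar> \<le> (cmod (Complex x y))\<^sup>2"
   using sum_squares_bound[of "\<bar>x\<bar>" "\<bar>y\<bar>"] mult_nonneg_nonneg[OF abs_ge_zero[of x] abs_ge_zero[of y]]
   unfolding cmod_power2 complex.sel power2_abs by linarith
  then have "(cmod (Complex x y) powr 2) powr (-3/4) \<le> (\<bar>x\<bar> * \<bar>y\<bar>) powr (-3/4)"
   using that by (intro powr_mono2') (auto simp: complex_eq_iff)
  moreover have "(cmod (Complex x y) powr 2) powr (-3/4) = cmod (Complex x y) powr (-3/2)"
   by (simp only: powr_powr) simp
  moreover have "(\<bar>x\<bar> * \<bar>y\<bar>) powr (-3/4) = \<bar>x\<bar> powr (-3/4) * \<bar>y\<bar> powr (-3/4)"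
   by (simp add: powr_mult)
  ultimately show ?thesis by simp
 qed
 have AEx: "AE x in lborel. (x::real) \<noteq> 0" by (rule AE_lborel_singleton)
 have "(\<integral>\<^sup>+z. indicator (cball 0 R) z * ennreal (cmod z powr (-3/2)) \<partial>lborel) =
  (\<integral>\<^sup>+x. \<integral>\<^sup>+y. indicator (cball 0 R) (Complex x y) * ennreal (cmod (Complex x y) powr (-3/2)) \<partial>lborel \<partial>lborel)"
  by (subst nn_integral_complex) auto
 also have "\<dots> \<le> (\<integral>\<^sup>+x. \<integral>\<^sup>+y. ?f x * ?f y \<partial>lborel \<partial>lborel)"
 proof (rule nn_integral_mono_AE, use AEx in eventually_elim, rule nn_integral_mono_AE, use AEx in eventually_elim)
  fix x y :: real assume xy: "x \<noteq> 0" "y \<noteq> 0"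
  have "indicator (cball 0 R) (Complex x y) \<le> (indicator {-R..R} x * indicator {-R..R} y :: ennreal)"
   using abs_Re_le_cmod[of "Complex x y"] abs_Im_le_cmod[of "Complex x y"]
   by (auto simp: indicator_def split: if_splits)
  then show "indicator (cball 0 R) (Complex x y) * ennreal (cmod (Complex x y) powr (-3/2)) \<le> ?f x * ?f y"
   using le[OF xy]
   by (auto simp: indicator_def ennreal_mult'[symmetric] split: if_splits intro!: ennreal_leI)
 qed
 also have "\<dots> = (\<integral>\<^sup>+x. ?f x \<partial>lborel) * (\<integral>\<^sup>+x. ?f x \<partial>lborel)"
  by (subst nn_integral_cmult, measurable, subst nn_integral_multc) auto
 also have "\<dots> < \<infinity>"
  using nn_integral_abs_powr_finite[of R] by (simp add: ennreal_mult_less_top)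
 finally show ?thesis .
qed

text \<open>Translating the pole to 0 moves the disc into a larger disc around 0, so one constant serves all poles in a bounded set. This uniformity permits Fubini's theorem when the pole itself is averaged.\<close>
lemma nn_integral_cmod_diff_powr_uniform:
 "\<exists>C. \<forall>w. cmod w \<le> r \<longrightarrow>
   (\<integral>\<^sup>+z. indicator (cball 0 R) z * ennreal (cmod (z - w) powr (-3/2)) \<partial>lborel) \<le> ennreal C"
proof -
 let ?S = "(\<integral>\<^sup>+z. indicator (cball 0 (R + r)) z * ennreal (cmod z powr (-3/2)) \<partial>lborel)"
 obtain C where C: "?S = ennreal C"
  using nn_integral_cmod_powr_finite[of "R + r"] by (cases ?S) auto
 show ?thesis
 proof (intro exI[of _ C] allI impI)
  fix w assume w: "cmod w \<le> r"
  have "(\<integral>\<^sup>+z. indicator (cball 0 R) z * ennreal (cmod (z - w) powr (-3/2)) \<partial>lborel) =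
   (\<integral>\<^sup>+z. indicator (cball 0 R) (w + z) * ennreal (cmod z powr (-3/2)) \<partial>lborel)"
  proof -
   have [measurable]: "(\<lambda>z::complex. cmod (z - w) powr (-3/2)) \<in> borel_measurable borel"
    by measurable
   show ?thesis by (subst nn_integral_complex_affine[where c=1 and t=w]) simp_all
  qed
  also have "\<dots> \<le> ?S"
  proof (rule nn_integral_mono)
   fix z
   have "cmod z \<le> cmod (w + z) + cmod w" using norm_triangle_ineq4[of "w + z" w] by simp
   then show "indicator (cball 0 R) (w + z) * ennreal (cmod z powr (-3/2)) \<le>
     indicator (cball 0 (R + r)) z * ennreal (cmod z powr (-3/2))"
    using w by (auto simp: indicator_def)
  qed
  finally show "(\<integral>\<^sup>+z. indicator (cball 0 R) z * ennreal (cmod (z - w) powr (-3/2)) \<partial>lborel) \<le> ennreal C"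
   using C by simp
 qed
qed

lemma abs_ln_le_powr:
 assumes "r > (0::real)" shows "\<bar>ln r\<bar> \<le> r + r powr (-3/2)"
proof (cases "r \<ge> 1")
 case True
 then show ?thesis using ln_le_minus_one[of r] by (smt (verit) ln_ge_zero powr_ge_zero)
next
 case False
 have "- ln r = ln (1/r)" using assms by (simp add: ln_div)
 also have "\<dots> \<le> 1/r" using ln_le_minus_one[of "1/r"] assms by simp
 also have "\<dots> = r powr (-1)" using assms by (simp add: powr_minus_divide)
 also have "\<dots> \<le> r powr (-3/2)" using assms False by (intro powr_mono') auto
 finally show ?thesis using assms False by (simp add: abs_if)
qed

section \<open>The Laplacian of a test function\<close>

text \<open>Directional derivatives are the form in which \<open>cont_diff\<close> iterates differentiation.\<close>
definition dir_deriv :: "complex \<Rightarrow> (complex \<Rightarrow> complex) \<Rightarrow> complex \<Rightarrow> complex" where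
 "dir_deriv v f z = frechet_derivative f (at z) v"

definition laplacian :: "(complex \<Rightarrow> complex) \<Rightarrow> complex \<Rightarrow> complex" where
 "laplacian f z = dir_deriv 1 (dir_deriv 1 f) z + dir_deriv \<i> (dir_deriv \<i> f) z"

lemma smooth_dir_deriv:
 assumes "\<forall>k. cont_diff k f" shows "\<forall>k. cont_diff k (dir_deriv v f)"
proof
 fix k have "cont_diff (Suc k) f" using assms by blast
 then show "cont_diff k (dir_deriv v f)" by (simp add: dir_deriv_def[abs_def])
qed

lemma smooth_imp_continuous:
 assumes "\<forall>k. cont_diff k f" shows "continuous_on UNIV f"
 using assms[rule_format, of 0] by simp

lemma smooth_has_dir_deriv:
 fixes f :: "complex \<Rightarrow> complex"
 assumes "\<forall>k. cont_diff k f"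
 shows "((\<lambda>t::real. f (z + t *\<^sub>R v)) has_vector_derivative dir_deriv v f z) (at 0)"
proof -
 have d: "f differentiable (at z)" using assms[rule_format, of "Suc 0"] by simp
 then have f': "(f has_derivative frechet_derivative f (at z)) (at z)"
  using frechet_derivative_works by blast
 have "((\<lambda>t::real. z + t *\<^sub>R v) has_derivative (\<lambda>t. t *\<^sub>R v)) (at 0)"
  by (auto intro!: derivative_eq_intros)
 from diff_chain_at[OF this, of f] f'
 have "((\<lambda>t::real. f (z + t *\<^sub>R v)) has_derivative (\<lambda>t. frechet_derivative f (at z) (t *\<^sub>R v))) (at 0)"
  by (simp add: o_def)
 then show ?thesis
  using linear_frechet_derivative[OF d]
  by (simp add: has_vector_derivative_def dir_deriv_def linear_cmul)
qed

lemma dir_deriv_zero_outside: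
 assumes "\<And>z. cmod z > R \<Longrightarrow> f z = 0" "cmod z > R"
 shows "dir_deriv v f z = 0"
proof -
 have "(f has_derivative (\<lambda>_. 0)) (at z)"
 proof (rule has_derivative_transform_within_open[of "\<lambda>_. 0" _ _ _ "- cball 0 R"])
  show "open (- cball 0 R :: complex set)" by (simp add: open_Compl)
 qed (use assms in auto)
 then have "frechet_derivative f (at z) = (\<lambda>_. 0)" using frechet_derivative_at by metis
 then show ?thesis by (simp add: dir_deriv_def)
qed

lemma integrable_continuous_bounded_support:
 fixes f :: "complex \<Rightarrow> complex"
 assumes "continuous_on UNIV f" "\<And>z. cmod z > R \<Longrightarrow> f z = 0"
 shows "integrable lborel f"
proof -
 have "integrable lborel (\<lambda>z. indicator (cball 0 R) z *\<^sub>R f z)"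
  using assms(1) by (intro borel_integrable_compact) (auto intro: continuous_on_subset)
 also have "(\<lambda>z. indicator (cball 0 R) z *\<^sub>R f z) = f"
  using assms(2) by (auto simp: fun_eq_iff indicator_def)
 finally show ?thesis .
qed

lemma integral_line_derivative_zero:
 fixes g g' :: "real \<Rightarrow> complex"
 assumes "\<And>x. (g has_vector_derivative g' x) (at x)" "continuous_on UNIV g'"
  and "\<And>x. \<bar>x\<bar> > R \<Longrightarrow> g x = 0" "\<And>x. \<bar>x\<bar> > R \<Longrightarrow> g' x = 0"
 shows "(\<integral>x. g' x \<partial>lborel) = 0"
proof -
 let ?b = "\<bar>R\<bar> + 1"
 have "has_bochner_integral lborel (\<lambda>x. indicator {-?b..?b} x *\<^sub>R g' x) (g ?b - g (-?b))"
  by (rule has_bochner_integral_FTC_Icc)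
    (auto intro: has_vector_derivative_at_within assms continuous_on_subset[OF assms(2)])
 also have "(\<lambda>x. indicator {-?b..?b} x *\<^sub>R g' x) = g'"
  using assms(4) by (auto simp: fun_eq_iff indicator_def)
 finally show ?thesis using assms(3)[of ?b] assms(3)[of "-?b"] has_bochner_integral_integral_eq by fastforce
qed

lemma integral_dir_derivative_zero:
 fixes f f' :: "complex \<Rightarrow> complex"
 assumes v: "v = 1 \<or> v = \<i>"
  and d: "\<And>z. ((\<lambda>t::real. f (z + t *\<^sub>R v)) has_vector_derivative f' z) (at 0)"
  and c: "continuous_on UNIV f'"
  and 0: "\<And>z. cmod z > R \<Longrightarrow> f z = 0" "\<And>z. cmod z > R \<Longrightarrow> f' z = 0"
 shows "(\<integral>z. f' z \<partial>lborel) = 0"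
proof -
 have i: "integrable lborel f'" by (rule integrable_continuous_bounded_support[OF c 0(2)])
 have d': "((\<lambda>t. f (z + t *\<^sub>R v)) has_vector_derivative f' (z + s *\<^sub>R v)) (at s)" for z s
 proof -
  have "((\<lambda>t. t - s) has_vector_derivative 1) (at s)"
   by (auto intro!: derivative_eq_intros)
  moreover have "((\<lambda>t. f ((z + s *\<^sub>R v) + t *\<^sub>R v)) has_vector_derivative f' (z + s *\<^sub>R v)) (at (s - s))"
   using d[of "z + s *\<^sub>R v"] by simp
  ultimately show ?thesis
   using vector_diff_chain_at[of "\<lambda>t. t - s" 1 s "\<lambda>t. f ((z + s *\<^sub>R v) + t *\<^sub>R v)"]
   by (simp add: o_def algebra_simps)
 qed
 have cl: "continuous_on UNIV (\<lambda>s::real. f' (z + s *\<^sub>R v))" for z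
  by (rule continuous_on_compose2[OF c]) (auto intro!: continuous_intros)
 from v show ?thesis
 proof
  assume v1: "v = 1"
  have "(\<integral>x. f' (Complex x y) \<partial>lborel) = 0" for y
  proof -
   define q where "q = Complex 0 y"
   have e: "Complex x y = q + x *\<^sub>R v" for x by (simp add: v1 q_def complex_eq_iff)
   have n: "cmod (q + x *\<^sub>R v) > R" if "\<bar>x\<bar> > R" for x
    using less_le_trans[OF that abs_Re_le_cmod[of "Complex x y", simplified complex.sel]] unfolding e .
   show ?thesis unfolding e
    by (rule integral_line_derivative_zero[OF d' cl, of R]) (auto intro!: 0 n)
  qed
  then show ?thesis using integral_complex(2)[OF i] by simp
 next
  assume v1: "v = \<i>"
  have "(\<integral>y. f' (Complex x y) \<partial>lborel) = 0" for x
  proof -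
   define q where "q = Complex x 0"
   have e: "Complex x y = q + y *\<^sub>R v" for y by (simp add: v1 q_def complex_eq_iff)
   have n: "cmod (q + y *\<^sub>R v) > R" if "\<bar>y\<bar> > R" for y
    using less_le_trans[OF that abs_Im_le_cmod[of "Complex x y", simplified complex.sel]] unfolding e .
   show ?thesis unfolding e
    by (rule integral_line_derivative_zero[OF d' cl, of R]) (auto intro!: 0 n)
  qed
  then show ?thesis using integral_complex(1)[OF i] by simp
 qed
qed

lemma continuous_laplacian:
 assumes "\<forall>k. cont_diff k f" shows "continuous_on UNIV (laplacian f)"
 unfolding laplacian_def[abs_def]
 by (intro continuous_on_add smooth_imp_continuous smooth_dir_deriv assms)

lemma laplacian_zero_outside:
 assumes "\<And>z. cmod z > R \<Longrightarrow> f z = 0" "cmod z > R"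
 shows "laplacian f z = 0"
 unfolding laplacian_def by (simp add: dir_deriv_zero_outside[of R "dir_deriv _ f"] dir_deriv_zero_outside[of R f] assms)

lemma integral_laplacian_eq_0:
 assumes sm: "\<forall>k. cont_diff k f" and 0: "\<And>z. cmod z > R \<Longrightarrow> f z = 0"
 shows "(\<integral>z. laplacian f z \<partial>lborel) = 0"
proof -
 have *: "integrable lborel (dir_deriv v (dir_deriv v f))"
    "v = 1 \<or> v = \<i> \<Longrightarrow> (\<integral>z. dir_deriv v (dir_deriv v f) z \<partial>lborel) = 0" for v
 proof -
  have c: "continuous_on UNIV (dir_deriv v (dir_deriv v f))"
   by (intro smooth_imp_continuous smooth_dir_deriv sm)
  show "integrable lborel (dir_deriv v (dir_deriv v f))"
   by (rule integrable_continuous_bounded_support[OF c]) (rule dir_deriv_zero_outside[OF dir_deriv_zero_outside[OF 0]])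
  show "(\<integral>z. dir_deriv v (dir_deriv v f) z \<partial>lborel) = 0" if "v = 1 \<or> v = \<i>"
   by (rule integral_dir_derivative_zero[OF that smooth_has_dir_deriv[OF smooth_dir_deriv[OF sm]] c])
     (auto intro: dir_deriv_zero_outside[OF dir_deriv_zero_outside[OF 0]] dir_deriv_zero_outside[OF 0])
 qed
 then show ?thesis unfolding laplacian_def by simp
qed

text \<open>The function $\ln(|z-w|^2 + e)$ is a smooth regularisation of the fundamental solution, with Laplacian $4e/(|z-w|^2+e)^2$; integration by parts along the two axes moves the Laplacian onto it.\<close>
lemma integral_laplacian_mult_smooth_log:
 assumes sm: "\<forall>k. cont_diff k f" and 0: "\<And>z. cmod z > R \<Longrightarrow> f z = 0" and e: "e > 0"
 shows "(\<integral>z. ln ((cmod (z - w))\<^sup>2 + e) *\<^sub>R laplacian f z \<partial>lborel) =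
     (\<integral>z. (4 * e / ((cmod (z - w))\<^sup>2 + e)\<^sup>2) *\<^sub>R f z \<partial>lborel)"
proof -
 define S where "S z = (cmod (z - w))\<^sup>2 + e" for z
 have S0: "S z > 0" for z unfolding S_def using e by (simp add: add_nonneg_pos)
 have cS: "continuous_on UNIV S" unfolding S_def by (intro continuous_intros)
 define p where "p v z = (z - w) \<bullet> v" for v z
 have cp: "continuous_on UNIV (p v)" for v unfolding p_def by (intro continuous_intros)
 define G2 where "G2 v z = 2 / S z - 4 * (p v z)\<^sup>2 / (S z)\<^sup>2" for v z
 define F where "F v z = ln (S z) *\<^sub>R dir_deriv v (dir_deriv v f) z - G2 v z *\<^sub>R f z" for v z
 have cF: "continuous_on UNIV (F v)" for v
  unfolding F_def G2_def using S0
  by (intro continuous_intros cS cp smooth_imp_continuous smooth_dir_deriv sm) (auto simp: less_le)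
 have dS: "((\<lambda>t::real. S (z + t *\<^sub>R v)) has_field_derivative 2 * p v z) (at 0)" for z v
 proof -
  have "S (z + t *\<^sub>R v) = S z + 2 * t * p v z + t\<^sup>2 * (v \<bullet> v)" for t
   unfolding S_def p_def power2_norm_eq_inner
   by (simp add: inner_simps algebra_simps power2_eq_square inner_commute)
  then have "(\<lambda>t::real. S (z + t *\<^sub>R v)) = (\<lambda>t. S z + 2 * t * p v z + t\<^sup>2 * (v \<bullet> v))" by (rule ext)
  then show ?thesis by (simp only:) (auto intro!: derivative_eq_intros)
 qed
 have dp: "((\<lambda>t::real. p v (z + t *\<^sub>R v)) has_field_derivative 1) (at 0)" if "v = 1 \<or> v = \<i>" for z v
  unfolding p_def using that by (auto simp: inner_simps intro!: derivative_eq_intros)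
 have F0: "F v z = 0" if "cmod z > R" for v z
  unfolding F_def using that by (simp add: 0 dir_deriv_zero_outside[of R "dir_deriv _ f"] dir_deriv_zero_outside[of R f])
 have iF: "integrable lborel (F v)" for v
  by (rule integrable_continuous_bounded_support[OF cF F0])
 have I: "(\<integral>z. F v z \<partial>lborel) = 0" if v: "v = 1 \<or> v = \<i>" for v
 proof (rule integral_dir_derivative_zero[where f'="F v" and R=R and f="\<lambda>z. ln (S z) *\<^sub>R dir_deriv v f z - (2 * p v z / S z) *\<^sub>R f z", OF v _ cF])
  fix z
  have l: "((\<lambda>t::real. ln (S (z + t *\<^sub>R v))) has_field_derivative 2 * p v z / S z) (at 0)"
   using S0[of z] by (auto intro!: derivative_eq_intros dS)
  have q: "((\<lambda>t::real. 2 * p v (z + t *\<^sub>R v) / S (z + t *\<^sub>R v)) has_field_derivative G2 v z) (at 0)"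
   using S0[of z] unfolding G2_def
   by (auto intro!: derivative_eq_intros dS dp[OF v] simp: field_simps power2_eq_square)
  have "((\<lambda>t. ln (S (z + t *\<^sub>R v)) *\<^sub>R dir_deriv v f (z + t *\<^sub>R v) - (2 * p v (z + t *\<^sub>R v) / S (z + t *\<^sub>R v)) *\<^sub>R f (z + t *\<^sub>R v))
    has_vector_derivative
    (ln (S (z + 0 *\<^sub>R v)) *\<^sub>R dir_deriv v (dir_deriv v f) z + (2 * p v z / S z) *\<^sub>R dir_deriv v f (z + 0 *\<^sub>R v))
     - ((2 * p v (z + 0 *\<^sub>R v) / S (z + 0 *\<^sub>R v)) *\<^sub>R dir_deriv v f z + G2 v z *\<^sub>R f (z + 0 *\<^sub>R v))) (at 0)"
   by (intro has_vector_derivative_diff has_vector_derivative_scaleR l q smooth_has_dir_deriv smooth_dir_deriv sm)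
  then show "((\<lambda>t. ln (S (z + t *\<^sub>R v)) *\<^sub>R dir_deriv v f (z + t *\<^sub>R v) - (2 * p v (z + t *\<^sub>R v) / S (z + t *\<^sub>R v)) *\<^sub>R f (z + t *\<^sub>R v))
    has_vector_derivative F v z) (at 0)"
   by (simp add: F_def)
 qed (simp_all add: F0 0 dir_deriv_zero_outside[of R f])
 have eq: "F 1 z + F \<i> z = ln (S z) *\<^sub>R laplacian f z - (4 * e / (S z)\<^sup>2) *\<^sub>R f z" for z
 proof -
  have "(p 1 z)\<^sup>2 + (p \<i> z)\<^sup>2 = S z - e"
   unfolding p_def S_def by (simp add: cmod_power2)
  then have q: "(p \<i> z)\<^sup>2 = S z - e - (p 1 z)\<^sup>2" by simp
  have "G2 1 z + G2 \<i> z = 4 * e / (S z)\<^sup>2"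
   unfolding G2_def q using S0[of z] by (simp add: field_simps power2_eq_square)
  then show ?thesis unfolding F_def laplacian_def
   by (metis (no_types, opaque_lifting) add_diff_add scaleR_add_left scaleR_add_right)
 qed
 have "(\<integral>z. F 1 z + F \<i> z \<partial>lborel) = 0" using I iF by simp
 then have "(\<integral>z. ln (S z) *\<^sub>R laplacian f z - (4 * e / (S z)\<^sup>2) *\<^sub>R f z \<partial>lborel) = 0" unfolding eq .
 moreover have "integrable lborel (\<lambda>z. ln (S z) *\<^sub>R laplacian f z)"
  using S0 by (intro integrable_continuous_bounded_support[of _ R] continuous_intros cS continuous_laplacian sm)
    (auto simp: less_le laplacian_zero_outside[of R f] 0)
 moreover have "integrable lborel (\<lambda>z. (4 * e / (S z)\<^sup>2) *\<^sub>R f z)"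
  using S0 by (intro integrable_continuous_bounded_support[of _ R] continuous_intros cS smooth_imp_continuous sm)
    (auto simp: less_le 0)
 ultimately show ?thesis unfolding S_def by simp
qed

text \<open>The total mass of the Laplacian of $\ln(|u|^2+1)$, which is $4\pi$.\<close>
definition green_const :: real where
 "green_const = (\<integral>u. 4 / ((cmod u)\<^sup>2 + 1)\<^sup>2 \<partial>lborel)"

lemma integrable_cauchy_kernel:
 "integrable lborel (\<lambda>u::complex. 4 / ((cmod u)\<^sup>2 + 1)\<^sup>2)"
proof (rule integrableI_nonneg)
 let ?f = "\<lambda>x::real. ennreal (1 / (1 + x\<^sup>2))"
 have f: "(\<integral>\<^sup>+x. ?f x \<partial>lborel) < \<infinity>"
 proof -
  have "(\<integral>\<^sup>+x. ?f x * indicator {0..} x \<partial>lborel) = ennreal (pi/2 - arctan 0)"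
   by (rule nn_integral_FTC_atLeast[where F=arctan])
     (use DERIV_arctan tendsto_arctan_at_top in \<open>simp_all add: inverse_eq_divide\<close>)
  then have h: "(\<integral>\<^sup>+x. ?f x * indicator {0..} x \<partial>lborel) < \<infinity>" by simp
  have "(\<integral>\<^sup>+x. ?f x \<partial>lborel) \<le> (\<integral>\<^sup>+x. ?f x * indicator {0..} x + ?f (0 + -1 * x) * indicator {0..} (0 + -1 * x) \<partial>lborel)"
   by (intro nn_integral_mono) (auto simp: indicator_def)
  also have "\<dots> = (\<integral>\<^sup>+x. ?f x * indicator {0..} x \<partial>lborel) + (\<integral>\<^sup>+x. ?f (0 + -1 * x) * indicator {0..} (0 + -1 * x) \<partial>lborel)"
   by (rule nn_integral_add) measurable
  also have "(\<integral>\<^sup>+x. ?f (0 + -1 * x) * indicator {0..} (0 + -1 * x) \<partial>lborel) = (\<integral>\<^sup>+x. ?f x * indicator {0..} x \<partial>lborel)"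
   using nn_integral_real_affine[of "\<lambda>x. ?f x * indicator {0..} x" "-1" 0] by simp
  also have "(\<integral>\<^sup>+x. ?f x * indicator {0..} x \<partial>lborel) + (\<integral>\<^sup>+x. ?f x * indicator {0..} x \<partial>lborel) < \<infinity>" using h by simp
  finally show ?thesis .
 qed
 have "(\<integral>\<^sup>+ u. ennreal (4 / ((cmod u)\<^sup>2 + 1)\<^sup>2) \<partial>lborel) =
   (\<integral>\<^sup>+x. \<integral>\<^sup>+y. ennreal (4 / ((cmod (Complex x y))\<^sup>2 + 1)\<^sup>2) \<partial>lborel \<partial>lborel)"
  by (subst nn_integral_complex) auto
 also have "\<dots> \<le> (\<integral>\<^sup>+x. \<integral>\<^sup>+y. 4 * (?f x * ?f y) \<partial>lborel \<partial>lborel)"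
 proof (intro nn_integral_mono)
  fix x y :: real
  have "(1 + x\<^sup>2) * (1 + y\<^sup>2) \<le> ((x\<^sup>2 + y\<^sup>2) + 1)\<^sup>2"
  proof -
   have "((x\<^sup>2 + y\<^sup>2) + 1)\<^sup>2 = (1 + x\<^sup>2) * (1 + y\<^sup>2) + (x\<^sup>2 + y\<^sup>2 + x\<^sup>2 * y\<^sup>2 + (x\<^sup>2)\<^sup>2 + (y\<^sup>2)\<^sup>2)"
    by (simp add: power2_eq_square algebra_simps)
   moreover have "x\<^sup>2 + y\<^sup>2 + x\<^sup>2 * y\<^sup>2 + (x\<^sup>2)\<^sup>2 + (y\<^sup>2)\<^sup>2 \<ge> 0" by (intro add_nonneg_nonneg mult_nonneg_nonneg) auto
   ultimately show ?thesis by linarith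
  qed
  then have "4 / ((x\<^sup>2 + y\<^sup>2) + 1)\<^sup>2 \<le> 4 / ((1 + x\<^sup>2) * (1 + y\<^sup>2))"
   by (intro divide_left_mono mult_pos_pos zero_less_power add_pos_nonneg add_nonneg_pos) auto
  also have "\<dots> = 4 * (1 / (1 + x\<^sup>2) * (1 / (1 + y\<^sup>2)))" by simp
  finally have "4 / ((cmod (Complex x y))\<^sup>2 + 1)\<^sup>2 \<le> 4 * (1 / (1 + x\<^sup>2) * (1 / (1 + y\<^sup>2)))" by (simp add: cmod_power2)
  then have "ennreal (4 / ((cmod (Complex x y))\<^sup>2 + 1)\<^sup>2) \<le> ennreal (4 * (1 / (1 + x\<^sup>2) * (1 / (1 + y\<^sup>2))))"
   by (rule ennreal_leI)
  also have "\<dots> = 4 * (?f x * ?f y)"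
   by (subst ennreal_mult) (auto simp: ennreal_mult[symmetric])
  finally show "ennreal (4 / ((cmod (Complex x y))\<^sup>2 + 1)\<^sup>2) \<le> 4 * (?f x * ?f y)" .
 qed
 also have "\<dots> = (\<integral>\<^sup>+x. 4 * (?f x * (\<integral>\<^sup>+y. ?f y \<partial>lborel)) \<partial>lborel)"
  by (intro nn_integral_cong) (simp add: nn_integral_cmult)
 also have "\<dots> = 4 * ((\<integral>\<^sup>+x. ?f x \<partial>lborel) * (\<integral>\<^sup>+x. ?f x \<partial>lborel))"
  by (simp add: nn_integral_cmult nn_integral_multc)
 also have "\<dots> < \<infinity>"
  using f by (auto simp: ennreal_mult_less_top)
 finally show "(\<integral>\<^sup>+ u. ennreal (4 / ((cmod (u::complex))\<^sup>2 + 1)\<^sup>2) \<partial>lborel) < \<infinity>" .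
qed auto

lemma green_const_pos: "green_const > 0"
proof -
 have "green_const \<noteq> 0"
 proof
  assume "green_const = 0"
  then have "AE u::complex in lborel. 4 / ((cmod u)\<^sup>2 + 1)\<^sup>2 = 0"
   using integral_nonneg_eq_0_iff_AE[OF integrable_cauchy_kernel] by (simp add: green_const_def)
  moreover have "4 / ((cmod u)\<^sup>2 + 1)\<^sup>2 \<noteq> 0" for u :: complex
   using add_nonneg_pos[of "(cmod u)\<^sup>2" 1] by simp
  ultimately have "AE u::complex in lborel. False" by simp
  then show False
   using ae_filter_eq_bot_iff[of "lborel :: complex measure"] by (simp add: eventually_False)
 qed
 moreover have "green_const \<ge> 0" unfolding green_const_def by (rule integral_nonneg_AE) simp
 ultimately show ?thesis by simp
qed

lemma integrable_log_kernel:
 assumes c: "continuous_on UNIV g" and 0: "\<And>z. cmod z > R \<Longrightarrow> g z = 0"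
 shows "integrable lborel (\<lambda>z. \<bar>ln ((cmod (z - w))\<^sup>2)\<bar> *\<^sub>R (g z :: complex))"
  and "integrable lborel (\<lambda>z. ln ((cmod (z - w))\<^sup>2) *\<^sub>R (g z :: complex))"
proof -
 have [measurable]: "g \<in> borel_measurable borel" using c by (rule borel_measurable_continuous_onI)
 obtain M where M: "\<And>z. cmod z \<le> R \<Longrightarrow> cmod (g z) \<le> M" and M0: "M \<ge> 0"
 proof -
  have "compact (g ` cball 0 R)"
   by (intro compact_continuous_image continuous_on_subset[OF c]) auto
  then obtain B where "B > 0" "\<forall>x\<in>g ` cball 0 R. norm x \<le> B"
   using compact_imp_bounded bounded_pos by blast
  then show ?thesis by (intro that[of B]) auto
 qed
 have "integrable lborel (\<lambda>z. \<bar>ln ((cmod (z - w))\<^sup>2)\<bar> *\<^sub>R g z)"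
 proof (rule integrableI_bounded)
  obtain C where C: "(\<integral>\<^sup>+z. indicator (cball 0 R) z * ennreal (cmod (z - w) powr (-3/2)) \<partial>lborel) \<le> ennreal C"
   using nn_integral_cmod_diff_powr_uniform[of "cmod w" R] by blast
  have "(\<integral>\<^sup>+ z. ennreal (norm (\<bar>ln ((cmod (z - w))\<^sup>2)\<bar> *\<^sub>R g z)) \<partial>lborel) \<le>
    (\<integral>\<^sup>+z. ennreal (2 * M) * (indicator (cball 0 R) z * ennreal (cmod (z - w) powr (-3/2))) + ennreal (2 * M * (\<bar>R\<bar> + cmod w)) * indicator (cball 0 R) z \<partial>lborel)"
  proof (rule nn_integral_mono)
   fix z
   have "norm (\<bar>ln ((cmod (z - w))\<^sup>2)\<bar> *\<^sub>R g z) \<le> 2 * M * cmod (z - w) powr (-3/2) + 2 * M * (\<bar>R\<bar> + cmod w)"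
    if z: "cmod z \<le> R"
   proof (cases "z = w")
    case False
    have "norm (\<bar>ln ((cmod (z - w))\<^sup>2)\<bar> *\<^sub>R g z) = 2 * \<bar>ln (cmod (z - w))\<bar> * cmod (g z)"
     using False by (simp add: ln_realpow abs_mult)
    also have "\<dots> \<le> 2 * (cmod (z - w) + cmod (z - w) powr (-3/2)) * M"
     using False M[OF z] abs_ln_le_powr[of "cmod (z - w)"] by (intro mult_mono) auto
    also have "\<dots> \<le> 2 * ((\<bar>R\<bar> + cmod w) + cmod (z - w) powr (-3/2)) * M"
     using M0 z norm_triangle_ineq4[of z w] by (intro mult_right_mono mult_left_mono) auto
    finally show ?thesis by (simp add: algebra_simps)
   qed (use M0 in simp)
   then show "ennreal (norm (\<bar>ln ((cmod (z - w))\<^sup>2)\<bar> *\<^sub>R g z)) \<le>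
    ennreal (2 * M) * (indicator (cball 0 R) z * ennreal (cmod (z - w) powr (-3/2))) + ennreal (2 * M * (\<bar>R\<bar> + cmod w)) * indicator (cball 0 R) z"
    using M0 0[of z] by (cases "cmod z \<le> R") (auto simp: ennreal_mult[symmetric] ennreal_plus[symmetric] intro!: ennreal_leI simp del: ennreal_plus)
  qed
  also have "\<dots> = ennreal (2 * M) * (\<integral>\<^sup>+z. indicator (cball 0 R) z * ennreal (cmod (z - w) powr (-3/2)) \<partial>lborel)
    + ennreal (2 * M * (\<bar>R\<bar> + cmod w)) * emeasure lborel (cball (0::complex) R)"
  proof -
   have "(\<lambda>z. indicator (cball 0 R) z * ennreal (cmod (z - w) powr (-3/2))) \<in> borel_measurable lborel" by measurable
   then show ?thesis by (subst nn_integral_add) (auto simp: nn_integral_cmult nn_integral_cmult_indicator)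
  qed
  also have "\<dots> < \<infinity>"
   using C emeasure_lborel_cball_finite[of "0::complex" R] by (auto simp: ennreal_mult_less_top intro: le_less_trans)
  finally show "(\<integral>\<^sup>+ z. ennreal (norm (\<bar>ln ((cmod (z - w))\<^sup>2)\<bar> *\<^sub>R g z)) \<partial>lborel) < \<infinity>" .
 qed measurable
 then show "integrable lborel (\<lambda>z. \<bar>ln ((cmod (z - w))\<^sup>2)\<bar> *\<^sub>R g z)" .
 then show "integrable lborel (\<lambda>z. ln ((cmod (z - w))\<^sup>2) *\<^sub>R g z)"
  by (rule Bochner_Integration.integrable_bound) auto
qed

text \<open>The Laplacian of $\ln |z-w|^2$ is a multiple of the point mass at \<open>w\<close>. In the regularised identity with parameter $d_n^2 \to 0$ the left-hand side converges by domination, and the kernel on the right-hand side, a rescaling of a fixed integrable function, concentrates at \<open>w\<close>.\<close>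
theorem green_representation:
 assumes sm: "\<forall>k. cont_diff k f" and 0: "\<And>z. cmod z > R \<Longrightarrow> f z = 0"
 shows "(\<integral>z. ln ((cmod (z - w))\<^sup>2) *\<^sub>R laplacian f z \<partial>lborel) = green_const *\<^sub>R f w"
proof -
 define d where "d n = 1 / real (Suc n)" for n
 have d: "d n > 0" "d n \<le> 1" for n by (auto simp: d_def)
 have dl: "d \<longlonglongrightarrow> 0" unfolding d_def using LIMSEQ_inverse_real_of_nat by (simp add: inverse_eq_divide)
 have cL: "continuous_on UNIV (laplacian f)" by (rule continuous_laplacian[OF sm])
 have [measurable]: "laplacian f \<in> borel_measurable borel" using cL by (rule borel_measurable_continuous_onI)
 have cf: "continuous_on UNIV f" by (rule smooth_imp_continuous[OF sm])
 have [measurable]: "f \<in> borel_measurable borel" using cf by (rule borel_measurable_continuous_onI)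
 have lz: "\<And>z. cmod z > R \<Longrightarrow> laplacian f z = 0" using 0 by (rule laplacian_zero_outside)
 have "(\<lambda>n. \<integral>z. ln ((cmod (z - w))\<^sup>2 + (d n)\<^sup>2) *\<^sub>R laplacian f z \<partial>lborel) \<longlonglongrightarrow>
   (\<integral>z. ln ((cmod (z - w))\<^sup>2) *\<^sub>R laplacian f z \<partial>lborel)"
 proof (rule integral_dominated_convergence)
  let ?w = "\<lambda>z. \<bar>ln ((cmod (z - w))\<^sup>2)\<bar> *\<^sub>R laplacian f z + (cmod (z - w))\<^sup>2 *\<^sub>R laplacian f z"
  have i2: "integrable lborel (\<lambda>z. (cmod (z - w))\<^sup>2 *\<^sub>R laplacian f z)"
   by (rule integrable_continuous_bounded_support[of _ R]) (auto intro!: continuous_intros cL simp: lz)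
  show "integrable lborel (\<lambda>z. norm (\<bar>ln ((cmod (z - w))\<^sup>2)\<bar> *\<^sub>R laplacian f z) + norm ((cmod (z - w))\<^sup>2 *\<^sub>R laplacian f z))"
   using integrable_log_kernel(1)[OF cL lz] i2 by (intro Bochner_Integration.integrable_add integrable_norm)
  have AEw: "AE z in lborel. z \<noteq> w" by (rule AE_lborel_singleton)
  show "AE z in lborel. (\<lambda>n. ln ((cmod (z - w))\<^sup>2 + (d n)\<^sup>2) *\<^sub>R laplacian f z) \<longlonglongrightarrow> ln ((cmod (z - w))\<^sup>2) *\<^sub>R laplacian f z"
   using AEw
  proof eventually_elim
   case (elim z)
   have "(\<lambda>n. ln ((cmod (z - w))\<^sup>2 + (d n)\<^sup>2) *\<^sub>R laplacian f z) \<longlonglongrightarrow> ln ((cmod (z - w))\<^sup>2 + 0\<^sup>2) *\<^sub>R laplacian f z"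
    using elim by (intro tendsto_intros dl) auto
   then show ?case by simp
  qed
  show "AE z in lborel. norm (ln ((cmod (z - w))\<^sup>2 + (d n)\<^sup>2) *\<^sub>R laplacian f z) \<le>
    norm (\<bar>ln ((cmod (z - w))\<^sup>2)\<bar> *\<^sub>R laplacian f z) + norm ((cmod (z - w))\<^sup>2 *\<^sub>R laplacian f z)" for n
   using AEw
  proof eventually_elim
   case (elim z)
   let ?s = "(cmod (z - w))\<^sup>2"
   have s: "?s > 0" using elim by simp
   have d2: "(d n)\<^sup>2 \<le> 1" "(d n)\<^sup>2 > 0" using d[of n] by (auto simp: power_le_one)
   have "ln ?s \<le> ln (?s + (d n)\<^sup>2)" by (subst ln_le_cancel_iff) (use s d2 in linarith)+
   moreover have "ln (?s + (d n)\<^sup>2) \<le> ?s" using ln_add_one_self_le_self2[of "?s + (d n)\<^sup>2 - 1"] ln_le_minus_one[of "?s + (d n)\<^sup>2"] s d2 by linarith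
   ultimately have "\<bar>ln (?s + (d n)\<^sup>2)\<bar> \<le> \<bar>ln ?s\<bar> + ?s" using s by linarith
   from mult_right_mono[OF this norm_ge_zero[of "laplacian f z"]]
   show ?case by (simp add: algebra_simps)
  qed
 qed measurable
 moreover have "(\<integral>z. ln ((cmod (z - w))\<^sup>2 + (d n)\<^sup>2) *\<^sub>R laplacian f z \<partial>lborel) =
   (\<integral>u. (4 / ((cmod u)\<^sup>2 + 1)\<^sup>2) *\<^sub>R f (w + d n *\<^sub>R u) \<partial>lborel)" for n
 proof -
  have "(\<integral>z. ln ((cmod (z - w))\<^sup>2 + (d n)\<^sup>2) *\<^sub>R laplacian f z \<partial>lborel) =
    (\<integral>z. (4 * (d n)\<^sup>2 / ((cmod (z - w))\<^sup>2 + (d n)\<^sup>2)\<^sup>2) *\<^sub>R f z \<partial>lborel)"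
   using d[of n] by (intro integral_laplacian_mult_smooth_log[OF sm 0]) auto
  also have "\<dots> = (d n)\<^sup>2 *\<^sub>R (\<integral>u. (4 * (d n)\<^sup>2 / ((cmod (w + d n *\<^sub>R u - w))\<^sup>2 + (d n)\<^sup>2)\<^sup>2) *\<^sub>R f (w + d n *\<^sub>R u) \<partial>lborel)"
   using d[of n] by (intro integral_complex_affine) auto
  also have "\<dots> = (\<integral>u. (d n)\<^sup>2 *\<^sub>R ((4 * (d n)\<^sup>2 / ((cmod (w + d n *\<^sub>R u - w))\<^sup>2 + (d n)\<^sup>2)\<^sup>2) *\<^sub>R f (w + d n *\<^sub>R u)) \<partial>lborel)"
   by (rule integral_scaleR_right[symmetric])
  also have "\<dots> = (\<integral>u. (4 / ((cmod u)\<^sup>2 + 1)\<^sup>2) *\<^sub>R f (w + d n *\<^sub>R u) \<partial>lborel)"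
  proof (rule Bochner_Integration.integral_cong)
   fix u
   have "(cmod (w + d n *\<^sub>R u - w))\<^sup>2 + (d n)\<^sup>2 = (d n)\<^sup>2 * ((cmod u)\<^sup>2 + 1)"
    by (simp add: power_mult_distrib algebra_simps)
   moreover have "(d n)\<^sup>2 * (4 * (d n)\<^sup>2 / ((d n)\<^sup>2 * ((cmod u)\<^sup>2 + 1))\<^sup>2) = 4 / ((cmod u)\<^sup>2 + 1)\<^sup>2"
   proof -
    have "D * (4 * D / (D * q)\<^sup>2) = 4 / q\<^sup>2" if "D \<noteq> 0" for D q :: real
     using that by (cases "q = 0") (auto simp: field_simps power2_eq_square)
    then show ?thesis using d(1)[of n] by simp
   qed
   ultimately show "(d n)\<^sup>2 *\<^sub>R ((4 * (d n)\<^sup>2 / ((cmod (w + d n *\<^sub>R u - w))\<^sup>2 + (d n)\<^sup>2)\<^sup>2) *\<^sub>R f (w + d n *\<^sub>R u)) =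
    (4 / ((cmod u)\<^sup>2 + 1)\<^sup>2) *\<^sub>R f (w + d n *\<^sub>R u)" by simp
  qed simp
  finally show ?thesis .
 qed
 moreover have "(\<lambda>n. \<integral>u. (4 / ((cmod u)\<^sup>2 + 1)\<^sup>2) *\<^sub>R f (w + d n *\<^sub>R u) \<partial>lborel) \<longlonglongrightarrow>
   (\<integral>u. (4 / ((cmod u)\<^sup>2 + 1)\<^sup>2) *\<^sub>R f w \<partial>lborel)"
 proof -
  obtain M where M: "\<And>z. cmod (f z) \<le> M"
  proof -
   have "compact (f ` cball 0 R)" by (intro compact_continuous_image continuous_on_subset[OF cf]) auto
   then obtain B where "B > 0" "\<forall>x\<in>f ` cball 0 R. norm x \<le> B"
    using compact_imp_bounded bounded_pos by blast
   then have "cmod (f z) \<le> B" for z using 0[of z] by (cases "cmod z \<le> R") auto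
   then show ?thesis by (rule that)
  qed
  show ?thesis
  proof (rule integral_dominated_convergence[where w="\<lambda>u. 4 / ((cmod u)\<^sup>2 + 1)\<^sup>2 * M"])
   show "integrable lborel (\<lambda>u. 4 / ((cmod u)\<^sup>2 + 1)\<^sup>2 * M)"
    using integrable_cauchy_kernel by (rule integrable_mult_left)
   have "(\<lambda>n. f (w + d n *\<^sub>R u)) \<longlonglongrightarrow> f w" for u
   proof -
    have "(\<lambda>n. w + d n *\<^sub>R u) \<longlonglongrightarrow> w + 0 *\<^sub>R u" by (intro tendsto_intros dl)
    then show ?thesis using continuous_on_tendsto_compose[OF cf] by fastforce
   qed
   then show "AE u in lborel. (\<lambda>n. (4 / ((cmod u)\<^sup>2 + 1)\<^sup>2) *\<^sub>R f (w + d n *\<^sub>R u)) \<longlonglongrightarrow> (4 / ((cmod u)\<^sup>2 + 1)\<^sup>2) *\<^sub>R f w"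
    by (intro AE_I2 tendsto_intros)
   show "AE u in lborel. norm ((4 / ((cmod u)\<^sup>2 + 1)\<^sup>2) *\<^sub>R f (w + d n *\<^sub>R u)) \<le> 4 / ((cmod u)\<^sup>2 + 1)\<^sup>2 * M" for n
    using M by (intro AE_I2) (simp add: divide_right_mono)
  qed measurable
 qed
 ultimately have "(\<integral>z. ln ((cmod (z - w))\<^sup>2) *\<^sub>R laplacian f z \<partial>lborel) = (\<integral>u. (4 / ((cmod u)\<^sup>2 + 1)\<^sup>2) *\<^sub>R f w \<partial>lborel)"
  using LIMSEQ_unique by simp
 also have "\<dots> = green_const *\<^sub>R f w"
  unfolding green_const_def by (rule integral_scaleR_left) (use integrable_cauchy_kernel in auto)
 finally show ?thesis .
qed

section \<open>The logarithm of a complex Gaussian\<close>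

text \<open>The parameter is the variance, the mean of $|z|^2$.\<close>
definition gauss_dens :: "real \<Rightarrow> complex \<Rightarrow> real" where
 "gauss_dens s z = exp (- (cmod z)\<^sup>2 / s) / (pi * s)"

lemma gauss_dens_measurable [measurable]: "gauss_dens s \<in> borel_measurable borel"
 unfolding gauss_dens_def[abs_def] by measurable

lemma nn_integral_gauss_line:
 assumes "c > 0"
 shows "(\<integral>\<^sup>+(x::real). ennreal (exp (- c * x\<^sup>2)) \<partial>lborel) = ennreal (sqrt (pi / c))"
proof -
 define \<sigma> where "\<sigma> = sqrt (1 / (2 * c))"
 have \<sigma>: "\<sigma> > 0" "2 * \<sigma>\<^sup>2 = 1 / c" using assms by (auto simp: \<sigma>_def)
 have "emeasure (density lborel (normal_density 0 \<sigma>)) UNIV = 1"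
  using prob_space.emeasure_space_1[OF prob_space_normal_density[OF \<sigma>(1), of 0]] by simp
 then have 1: "(\<integral>\<^sup>+x. ennreal (normal_density 0 \<sigma> x) \<partial>lborel) = 1"
  by (simp add: emeasure_density)
 have e: "normal_density 0 \<sigma> x = 1 / sqrt (pi / c) * exp (- c * x\<^sup>2)" for x
 proof -
  have "2 * pi * \<sigma>\<^sup>2 = pi / c" using \<sigma>(2) by (simp add: field_simps)
  moreover have "- (x - 0)\<^sup>2 / (2 * \<sigma>\<^sup>2) = - c * x\<^sup>2" unfolding \<sigma>(2) by simp
  ultimately show ?thesis unfolding normal_density_def by simp
 qed
 have sq: "sqrt (pi / c) > 0" using assms by simp
 have "(\<integral>\<^sup>+(x::real). ennreal (exp (- c * x\<^sup>2)) \<partial>lborel) =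
   (\<integral>\<^sup>+x. ennreal (sqrt (pi / c)) * ennreal (normal_density 0 \<sigma> x) \<partial>lborel)"
  using sq assms by (intro nn_integral_cong) (simp add: e ennreal_mult[symmetric])
 also have "\<dots> = ennreal (sqrt (pi / c))"
  by (subst nn_integral_cmult) (auto simp: 1)
 finally show ?thesis .
qed

lemma nn_integral_gauss_plane:
 assumes "c > 0"
 shows "(\<integral>\<^sup>+z. ennreal (exp (- c * (cmod (z - m))\<^sup>2)) \<partial>lborel) = ennreal (pi / c)"
proof -
 have "(\<integral>\<^sup>+z. ennreal (exp (- c * (cmod (z - m))\<^sup>2)) \<partial>lborel) = (\<integral>\<^sup>+z. ennreal (exp (- c * (cmod z)\<^sup>2)) \<partial>lborel)"
  by (subst nn_integral_complex_affine[where c=1 and t=m]) auto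
 also have "\<dots> = (\<integral>\<^sup>+x. \<integral>\<^sup>+y. ennreal (exp (- c * x\<^sup>2)) * ennreal (exp (- c * y\<^sup>2)) \<partial>lborel \<partial>lborel)"
  by (subst nn_integral_complex)
    (auto simp: cmod_power2 ennreal_mult[symmetric] exp_add[symmetric] algebra_simps intro!: nn_integral_cong)
 also have "\<dots> = ennreal (sqrt (pi / c)) * ennreal (sqrt (pi / c))"
  by (simp add: nn_integral_cmult nn_integral_multc nn_integral_gauss_line[OF assms, simplified])
 also have "\<dots> = ennreal (pi / c)" using assms by (simp add: ennreal_mult[symmetric])
 finally show ?thesis .
qed

lemma std_complex_gaussian_eq: "std_complex_gaussian = density lborel (\<lambda>z. ennreal (gauss_dens 1 z))"
 by (simp add: std_complex_gaussian_def gauss_dens_def divide_ennreal[symmetric])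

lemma sets_std_complex_gaussian [measurable_cong, simp]: "sets std_complex_gaussian = sets borel"
 by (simp add: std_complex_gaussian_def)

lemma space_std_complex_gaussian [simp]: "space std_complex_gaussian = UNIV"
 by (simp add: std_complex_gaussian_def)

lemma nn_integral_std_complex_gaussian:
 assumes [measurable]: "h \<in> borel_measurable borel"
 shows "(\<integral>\<^sup>+a. h a \<partial>std_complex_gaussian) = (\<integral>\<^sup>+a. ennreal (gauss_dens 1 a) * h a \<partial>lborel)"
 unfolding std_complex_gaussian_eq by (subst nn_integral_density) auto

lemma prob_space_std_complex_gaussian: "prob_space std_complex_gaussian"
proof
 have "emeasure std_complex_gaussian UNIV = (\<integral>\<^sup>+a. ennreal (gauss_dens 1 a) \<partial>lborel)"
  unfolding std_complex_gaussian_eq by (subst emeasure_density) auto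
 also have "\<dots> = (\<integral>\<^sup>+a. ennreal (1/pi) * ennreal (exp (- 1 * (cmod (a - 0))\<^sup>2)) \<partial>lborel)"
  by (intro nn_integral_cong) (simp add: gauss_dens_def ennreal_mult[symmetric])
 also have "\<dots> = 1"
  by (subst nn_integral_cmult, simp, subst nn_integral_gauss_plane) (auto simp: ennreal_mult[symmetric])
 finally show "emeasure std_complex_gaussian (space std_complex_gaussian) = 1" by simp
qed

text \<open>Completing the square: adding to a Gaussian of variance \<open>K\<close> the independent variable \<open>a b\<close> increases the variance by $|b|^2$.\<close>
lemma gauss_dens_convolution:
 assumes K: "K > 0"
 shows "(\<integral>\<^sup>+a. ennreal (gauss_dens K (y - a * b)) * ennreal (gauss_dens 1 a) \<partial>lborel)
   = ennreal (gauss_dens (K + (cmod b)\<^sup>2) y)"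
proof -
 define B where "B = (cmod b)\<^sup>2"
 have B: "B \<ge> 0" "K + B > 0" using K by (auto simp: B_def add_pos_nonneg)
 define m where "m = cnj b * y / of_real (K + B)"
 have sq: "(cmod (y - a * b))\<^sup>2 / K + (cmod a)\<^sup>2 = ((K + B) / K) * (cmod (a - m))\<^sup>2 + (cmod y)\<^sup>2 / (K + B)" for a
 proof -
  have expand: "(cmod (u - v))\<^sup>2 = (cmod u)\<^sup>2 - 2 * Re (cnj u * v) + (cmod v)\<^sup>2" for u v
   unfolding cmod_power2 by (simp add: power2_eq_square algebra_simps)
  have m2: "(cmod m)\<^sup>2 = B * (cmod y)\<^sup>2 / (K + B)\<^sup>2"
  proof -
   have "cmod (complex_of_real (K + B)) = K + B" using B by (simp only: norm_of_real)
   then show ?thesis unfolding m_def norm_mult norm_divide complex_mod_cnj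
    by (simp add: power_mult_distrib power_divide B_def)
  qed
  have am: "Re (cnj a * m) = Re (cnj y * (a * b)) / (K + B)"
  proof -
   have "Re (cnj a * m) = Re (cnj a * (cnj b * y)) / (K + B)"
    unfolding m_def using Re_divide_of_real[of "cnj a * (cnj b * y)" "K + B"] by (simp only: times_divide_eq_right)
   also have "cnj a * (cnj b * y) = cnj (cnj y * (a * b))" by simp
   also have "Re (cnj (cnj y * (a * b))) = Re (cnj y * (a * b))" by (rule cnj.sel(1))
   finally show ?thesis .
  qed
  have ab: "(cmod (a * b))\<^sup>2 = (cmod a)\<^sup>2 * B" by (simp add: B_def norm_mult power_mult_distrib)
  define A Y P where "A = (cmod a)\<^sup>2" and "Y = (cmod y)\<^sup>2" and "P = Re (cnj y * (a * b))"
  have "(Y - 2 * P + A * B) / K + A = ((K + B) / K) * (A - 2 * (P / (K + B)) + B * Y / (K + B)\<^sup>2) + Y / (K + B)"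
   using K B(2) by (simp add: divide_simps) (simp add: power2_eq_square algebra_simps)
  then show ?thesis unfolding expand[of y] expand[of a] m2 am ab A_def Y_def P_def .
 qed
 have "(\<integral>\<^sup>+a. ennreal (gauss_dens K (y - a * b)) * ennreal (gauss_dens 1 a) \<partial>lborel) =
   (\<integral>\<^sup>+a. ennreal (exp (- (cmod y)\<^sup>2 / (K + B)) / (pi * K * pi)) * ennreal (exp (- ((K + B) / K) * (cmod (a - m))\<^sup>2)) \<partial>lborel)"
 proof (rule nn_integral_cong)
  fix a
  have "gauss_dens K (y - a * b) * gauss_dens 1 a = exp (- ((cmod (y - a * b))\<^sup>2 / K + (cmod a)\<^sup>2)) / (pi * K * pi)"
   by (simp add: gauss_dens_def exp_add[symmetric] exp_diff exp_minus field_simps)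
  also have "\<dots> = exp (- (cmod y)\<^sup>2 / (K + B)) / (pi * K * pi) * exp (- ((K + B) / K) * (cmod (a - m))\<^sup>2)"
   unfolding sq by (simp add: exp_add[symmetric])
  finally show "ennreal (gauss_dens K (y - a * b)) * ennreal (gauss_dens 1 a) =
   ennreal (exp (- (cmod y)\<^sup>2 / (K + B)) / (pi * K * pi)) * ennreal (exp (- ((K + B) / K) * (cmod (a - m))\<^sup>2))"
   using K by (subst (1 2) ennreal_mult[symmetric]) (auto simp: gauss_dens_def)
 qed
 also have "\<dots> = ennreal (exp (- (cmod y)\<^sup>2 / (K + B)) / (pi * K * pi)) * ennreal (pi / ((K + B) / K))"
  using K B by (subst nn_integral_cmult, simp, subst nn_integral_gauss_plane) auto
 also have "\<dots> = ennreal (gauss_dens (K + B) y)"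
  using K B by (subst ennreal_mult[symmetric]) (auto simp: gauss_dens_def)
 finally show ?thesis by (simp add: B_def)
qed

lemma nn_integral_gauss_smoothing:
 assumes K: "K > 0" and [measurable]: "h \<in> borel_measurable borel"
 shows "(\<integral>\<^sup>+a. (\<integral>\<^sup>+y. h (y + a * b) * ennreal (gauss_dens K y) \<partial>lborel) \<partial>std_complex_gaussian) =
   (\<integral>\<^sup>+y. h y * ennreal (gauss_dens (K + (cmod b)\<^sup>2) y) \<partial>lborel)"
proof -
 have "(\<integral>\<^sup>+a. (\<integral>\<^sup>+y. h (y + a * b) * ennreal (gauss_dens K y) \<partial>lborel) \<partial>std_complex_gaussian) =
   (\<integral>\<^sup>+a. (\<integral>\<^sup>+y. h y * ennreal (gauss_dens K (y - a * b)) \<partial>lborel) \<partial>std_complex_gaussian)"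
 proof (rule nn_integral_cong)
  fix a
  show "(\<integral>\<^sup>+y. h (y + a * b) * ennreal (gauss_dens K y) \<partial>lborel) = (\<integral>\<^sup>+y. h y * ennreal (gauss_dens K (y - a * b)) \<partial>lborel)"
   by (subst (2) nn_integral_complex_affine[where c=1 and t="a * b"]) (auto simp: add.commute)
 qed
 also have "\<dots> = (\<integral>\<^sup>+a. ennreal (gauss_dens 1 a) * (\<integral>\<^sup>+y. h y * ennreal (gauss_dens K (y - a * b)) \<partial>lborel) \<partial>lborel)"
  by (rule nn_integral_std_complex_gaussian) measurable
 also have "\<dots> = (\<integral>\<^sup>+a. (\<integral>\<^sup>+y. h y * (ennreal (gauss_dens K (y - a * b)) * ennreal (gauss_dens 1 a)) \<partial>lborel) \<partial>lborel)"
  by (intro nn_integral_cong) (subst nn_integral_cmult[symmetric], auto simp: ac_simps)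
 also have "\<dots> = (\<integral>\<^sup>+y. (\<integral>\<^sup>+a. h y * (ennreal (gauss_dens K (y - a * b)) * ennreal (gauss_dens 1 a)) \<partial>lborel) \<partial>lborel)"
  by (rule lborel_pair.Fubini') measurable
 also have "\<dots> = (\<integral>\<^sup>+y. h y * ennreal (gauss_dens (K + (cmod b)\<^sup>2) y) \<partial>lborel)"
  by (intro nn_integral_cong) (simp add: nn_integral_cmult gauss_dens_convolution[OF K])
 finally show ?thesis .
qed

abbreviation gauss_prod :: "'i set \<Rightarrow> ('i \<Rightarrow> complex) measure" where
 "gauss_prod J \<equiv> (\<Pi>\<^sub>M j\<in>J. std_complex_gaussian)"

interpretation gauss: product_sigma_finite "\<lambda>_. std_complex_gaussian"
 by (intro product_sigma_finite.intro prob_space_imp_sigma_finite prob_space_std_complex_gaussian)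

lemma prob_space_gauss_prod: "prob_space (gauss_prod J)"
 by (intro prob_space_PiM prob_space_std_complex_gaussian)

text \<open>The law of a linear combination of independent Gaussians, smoothed by a further independent Gaussian of variance \<open>s\<close>. The smoothing variable absorbs one summand at a time, so the induction never meets a degenerate law, even if some coefficients vanish.\<close>
lemma nn_integral_gauss_prod_smoothing:
 assumes "finite J" "s > 0" and [measurable]: "h \<in> borel_measurable borel"
 shows "(\<integral>\<^sup>+a. (\<integral>\<^sup>+y. h (y + (\<Sum>j\<in>J. a j * b j)) * ennreal (gauss_dens s y) \<partial>lborel) \<partial>gauss_prod J) =
   (\<integral>\<^sup>+y. h y * ennreal (gauss_dens (s + (\<Sum>j\<in>J. (cmod (b j))\<^sup>2)) y) \<partial>lborel)"
 using assms(1,2)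
proof (induction J arbitrary: s rule: finite_induct)
 case empty
 then show ?case by (simp add: PiM_empty nn_integral_count_space_finite)
next
 case (insert i J)
 have mc[measurable]: "(\<lambda>a. \<Sum>j\<in>J. a j * b j) \<in> borel_measurable (gauss_prod J)"
  by measurable
 have "(\<integral>\<^sup>+a. (\<integral>\<^sup>+y. h (y + (\<Sum>j\<in>insert i J. a j * b j)) * ennreal (gauss_dens s y) \<partial>lborel) \<partial>gauss_prod (insert i J))
  = (\<integral>\<^sup>+x. (\<integral>\<^sup>+a. (\<integral>\<^sup>+y. h (y + (\<Sum>j\<in>insert i J. (x(i := a)) j * b j)) * ennreal (gauss_dens s y) \<partial>lborel) \<partial>std_complex_gaussian) \<partial>gauss_prod J)"
  using insert.hyps by (intro gauss.product_nn_integral_insert) measurable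
 also have "\<dots> = (\<integral>\<^sup>+x. (\<integral>\<^sup>+a. (\<integral>\<^sup>+y. h ((y + a * b i) + (\<Sum>j\<in>J. x j * b j)) * ennreal (gauss_dens s y) \<partial>lborel) \<partial>std_complex_gaussian) \<partial>gauss_prod J)"
 proof -
  have "(\<Sum>j\<in>insert i J. (x(i := a)) j * b j) = a * b i + (\<Sum>j\<in>J. x j * b j)" for x a
   using insert.hyps by (auto simp: sum.insert intro!: sum.cong)
  then show ?thesis by (simp add: add.assoc)
 qed
 also have "\<dots> = (\<integral>\<^sup>+x. (\<integral>\<^sup>+y. h (y + (\<Sum>j\<in>J. x j * b j)) * ennreal (gauss_dens (s + (cmod (b i))\<^sup>2) y) \<partial>lborel) \<partial>gauss_prod J)"
  by (intro nn_integral_cong nn_integral_gauss_smoothing[of s "\<lambda>y. h (y + (\<Sum>j\<in>J. _ j * b j))"] insert.prems) measurable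
 also have "\<dots> = (\<integral>\<^sup>+y. h y * ennreal (gauss_dens ((s + (cmod (b i))\<^sup>2) + (\<Sum>j\<in>J. (cmod (b j))\<^sup>2)) y) \<partial>lborel)"
  using insert.prems by (intro insert.IH) (simp add: add_pos_nonneg)
 finally show ?case using insert.hyps by (simp add: add.assoc)
qed

text \<open>The deviation of $\ln|z|$ from its typical size for a Gaussian of variance \<open>K\<close>. The value at 0 is set to infinity, since \<open>ln 0 = 0\<close> would hide the singularity.\<close>
definition log_dev :: "real \<Rightarrow> complex \<Rightarrow> ennreal" where
 "log_dev K z = (if z = 0 then \<infinity> else ennreal \<bar>ln (cmod z) - ln K / 2\<bar>)"

lemma log_dev_measurable [measurable]: "log_dev K \<in> borel_measurable borel"
 unfolding log_dev_def[abs_def] by measurable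

text \<open>The deviation is continuous off 0, and at 0 the shifted values tend to infinity.\<close>
lemma log_dev_le_liminf:
 assumes d: "d \<longlonglongrightarrow> 0" and dpos: "\<And>n. d n > (0::real)"
 shows "log_dev K x \<le> liminf (\<lambda>n. log_dev K (d n *\<^sub>R \<xi> + x))"
proof -
 have "(\<lambda>n. log_dev K (d n *\<^sub>R \<xi> + x)) \<longlonglongrightarrow> log_dev K x"
 proof (cases "x = 0")
  case False
  have l: "(\<lambda>n. d n *\<^sub>R \<xi> + x) \<longlonglongrightarrow> 0 *\<^sub>R \<xi> + x" by (intro tendsto_intros d)
  then have "\<forall>\<^sub>F n in sequentially. d n *\<^sub>R \<xi> + x \<noteq> 0"
   using False tendsto_imp_eventually_ne by fastforce
  then have "\<forall>\<^sub>F n in sequentially. log_dev K (d n *\<^sub>R \<xi> + x) = ennreal \<bar>ln (cmod (d n *\<^sub>R \<xi> + x)) - ln K / 2\<bar>"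
   by eventually_elim (simp add: log_dev_def)
  moreover have "(\<lambda>n. ennreal \<bar>ln (cmod (d n *\<^sub>R \<xi> + x)) - ln K / 2\<bar>) \<longlonglongrightarrow> ennreal \<bar>ln (cmod x) - ln K / 2\<bar>"
   using l False by (intro tendsto_intros) auto
  ultimately show ?thesis using False by (simp add: log_dev_def tendsto_cong)
 next
  case True
  show ?thesis
  proof (cases "\<xi> = 0")
   case False
   have "filterlim (\<lambda>n. d n * cmod \<xi>) (at_right 0) sequentially"
    unfolding filterlim_at using tendsto_mult_left_zero[OF d] dpos False by (auto simp: less_imp_neq[THEN not_sym])
   then have "filterlim (\<lambda>n. ln (d n * cmod \<xi>)) at_bot sequentially"
    by (rule filterlim_compose[OF ln_at_0])
   then have "filterlim (\<lambda>n. - ln (d n * cmod \<xi>)) at_top sequentially"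
    by (simp add: filterlim_uminus_at_bot)
   then have "filterlim (\<lambda>n. ln K / 2 + - ln (d n * cmod \<xi>)) at_top sequentially"
    by (intro filterlim_tendsto_add_at_top[OF tendsto_const])
   then have "filterlim (\<lambda>n. \<bar>ln (d n * cmod \<xi>) - ln K / 2\<bar>) at_top sequentially"
    by (rule filterlim_at_top_mono) (intro always_eventually allI, linarith)
   then have "(\<lambda>n. ennreal \<bar>ln (d n * cmod \<xi>) - ln K / 2\<bar>) \<longlonglongrightarrow> \<infinity>"
    by (simp add: ennreal_tendsto_top_eq_at_top)
   then show ?thesis using True False dpos by (simp add: log_dev_def less_imp_neq[THEN not_sym] abs_of_pos)
  qed (simp add: True log_dev_def)
 qed
 then show ?thesis by (simp add: lim_imp_Liminf)
qed

text \<open>The exponent is $-|u|^2/2$ rather than $-|u|^2$, which leaves room for a smoothing that at most doubles the variance.\<close>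
definition log_gauss_const :: ennreal where
 "log_gauss_const = (\<integral>\<^sup>+u. log_dev 1 u * ennreal (exp (- (cmod u)\<^sup>2 / 2) / pi) \<partial>lborel)"

lemma log_gauss_const_finite: "log_gauss_const < \<infinity>"
proof -
 have AEn: "AE u::complex in lborel. u \<noteq> 0" by (rule AE_lborel_singleton)
 have "log_gauss_const \<le> (\<integral>\<^sup>+u. (indicator (cball 0 1) u + indicator (cball 0 1) u * ennreal (cmod u powr (-3/2))) + 2 * ennreal (exp (- (1/4) * (cmod (u - 0))\<^sup>2)) \<partial>lborel)"
  unfolding log_gauss_const_def
 proof (rule nn_integral_mono_AE, use AEn in eventually_elim)
  fix u :: complex assume u: "u \<noteq> 0"
  define r where "r = cmod u"
  have r: "r > 0" using u by (simp add: r_def)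
  have l: "\<bar>ln r\<bar> \<le> r + r powr (-3/2)" by (rule abs_ln_le_powr[OF r])
  have e1: "exp (- r\<^sup>2 / 2) / pi \<le> 1"
  proof -
   have "exp (- r\<^sup>2 / 2) / pi \<le> 1 / 1" using pi_gt3 by (intro frac_le) auto
   then show ?thesis by simp
  qed
  show "log_dev 1 u * ennreal (exp (- (cmod u)\<^sup>2 / 2) / pi) \<le> (indicator (cball 0 1) u + indicator (cball 0 1) u * ennreal (cmod u powr (-3/2))) + 2 * ennreal (exp (- (1/4) * (cmod (u - 0))\<^sup>2))"
  proof (cases "r \<le> 1")
   case True
   have "\<bar>ln r\<bar> * (exp (- r\<^sup>2 / 2) / pi) \<le> (r + r powr (-3/2)) * 1"
    using l e1 by (intro mult_mono) auto
   also have "\<dots> \<le> 1 + r powr (-3/2)" using True by simp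
   finally have "ennreal (\<bar>ln r\<bar> * (exp (- r\<^sup>2 / 2) / pi)) \<le> ennreal (1 + r powr (-3/2))" by (rule ennreal_leI)
   also have "\<dots> = 1 + ennreal (r powr (-3/2))" by (subst ennreal_plus) auto
   finally have "log_dev 1 u * ennreal (exp (- (cmod u)\<^sup>2 / 2) / pi) \<le> 1 + ennreal (cmod u powr (-3/2))"
    using u by (simp add: log_dev_def r_def ennreal_mult[symmetric])
   also have "\<dots> = indicator (cball 0 1) u + indicator (cball 0 1) u * ennreal (cmod u powr (-3/2))"
    using True by (simp add: r_def)
   finally show ?thesis by (rule add_increasing2[rotated]) simp
  next
   case False
   have "r powr (-3/2) \<le> 1" using False powr_mono[of "-3/2" 0 r] by simp
   then have "\<bar>ln r\<bar> \<le> 2 * r" using l False by linarith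
   moreover have "r \<le> exp (r\<^sup>2 / 4)"
   proof -
    have "0 \<le> (r / 2 - 1)\<^sup>2" by simp
    then have "r \<le> 1 + r\<^sup>2 / 4" by (simp add: power2_eq_square field_simps)
    also have "\<dots> \<le> exp (r\<^sup>2 / 4)" by (rule exp_ge_add_one_self)
    finally show ?thesis .
   qed
   ultimately have "\<bar>ln r\<bar> \<le> 2 * exp (r\<^sup>2 / 4)" by linarith
   then have "\<bar>ln r\<bar> * (exp (- r\<^sup>2 / 2) / pi) \<le> (2 * exp (r\<^sup>2 / 4)) * (exp (- r\<^sup>2 / 2) / 1)"
    using pi_gt3 by (intro mult_mono divide_left_mono) auto
   also have "\<dots> = 2 * exp (- (1/4) * r\<^sup>2)" by (simp add: exp_add[symmetric])
   finally have "ennreal (\<bar>ln r\<bar> * (exp (- r\<^sup>2 / 2) / pi)) \<le> ennreal (2 * exp (- (1/4) * r\<^sup>2))" by (rule ennreal_leI)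
   also have "\<dots> = 2 * ennreal (exp (- (1/4) * r\<^sup>2))" by (subst ennreal_mult) auto
   finally have "log_dev 1 u * ennreal (exp (- (cmod u)\<^sup>2 / 2) / pi) \<le> 2 * ennreal (exp (- (1/4) * (cmod (u - 0))\<^sup>2))"
    using u by (simp add: log_dev_def r_def ennreal_mult[symmetric])
   then show ?thesis by (rule add_increasing[rotated]) simp
  qed
 qed
 also have "\<dots> = (\<integral>\<^sup>+u. indicator (cball 0 1) u + indicator (cball 0 1) u * ennreal (cmod u powr (-3/2)) \<partial>lborel) + (\<integral>\<^sup>+u. 2 * ennreal (exp (- (1/4) * (cmod (u - 0))\<^sup>2)) \<partial>lborel)"
  by (rule nn_integral_add) measurable
 also have "(\<integral>\<^sup>+u. 2 * ennreal (exp (- (1/4) * (cmod (u - 0))\<^sup>2)) \<partial>lborel) = 2 * ennreal (pi / (1/4))"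
  by (subst nn_integral_cmult, simp, subst nn_integral_gauss_plane) auto
 also have "(\<integral>\<^sup>+u. indicator (cball 0 1) u + indicator (cball 0 1) u * ennreal (cmod u powr (-3/2)) \<partial>lborel) =
   emeasure lborel (cball (0::complex) 1) + (\<integral>\<^sup>+u. indicator (cball 0 1) u * ennreal (cmod u powr (-3/2)) \<partial>lborel)"
  by (subst nn_integral_add) auto
 also have "\<dots> + 2 * ennreal (pi / (1/4)) < \<infinity>"
  using nn_integral_cmod_powr_finite[of 1] emeasure_lborel_cball_finite[of "0::complex" 1]
  by (auto simp: ennreal_mult_less_top)
 finally show ?thesis .
qed

text \<open>The sum is Gaussian of variance \<open>K\<close>, so rescaling by \<open>sqrt K\<close> makes the mean deviation independent of the coefficients. The law is known only after smoothing; Fatou's lemma removes the smoothing.\<close>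
theorem nn_integral_log_dev_gauss_le:
 assumes J: "finite J" and K: "(\<Sum>j\<in>J. (cmod (b j))\<^sup>2) = K" "K > 0"
 shows "(\<integral>\<^sup>+a. log_dev K (\<Sum>j\<in>J. a j * b j) \<partial>gauss_prod J) \<le> log_gauss_const"
proof -
 \<comment> \<open>The smoothing variance stays below \<open>K\<close>, so the total variance is at most \<open>2 K\<close>.\<close>
 define s where "s n = K / real (Suc n)" for n
 have s: "s n > 0" "s n \<le> K" for n using K by (auto simp: s_def field_simps)
 define d where "d n = sqrt (s n)" for n
 have d: "d n > 0" "(d n)\<^sup>2 = s n" for n using s[of n] by (auto simp: d_def less_imp_le)
 have "s \<longlonglongrightarrow> 0" unfolding s_def by real_asymp
 then have dl: "d \<longlonglongrightarrow> 0" unfolding d_def using tendsto_real_sqrt by force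
 define X where "X a = (\<Sum>j\<in>J. a j * b j)" for a
 have Xm[measurable]: "X \<in> borel_measurable (gauss_prod J)" unfolding X_def by measurable
 have "(\<integral>\<^sup>+a. log_dev K (X a) \<partial>gauss_prod J) = (\<integral>\<^sup>+a. (\<integral>\<^sup>+\<xi>. log_dev K (X a) \<partial>std_complex_gaussian) \<partial>gauss_prod J)"
  using prob_space.emeasure_space_1[OF prob_space_std_complex_gaussian] by simp
 also have "\<dots> \<le> (\<integral>\<^sup>+a. (\<integral>\<^sup>+\<xi>. liminf (\<lambda>n. log_dev K (d n *\<^sub>R \<xi> + X a)) \<partial>std_complex_gaussian) \<partial>gauss_prod J)"
  by (intro nn_integral_mono log_dev_le_liminf dl d)
 also have "\<dots> \<le> (\<integral>\<^sup>+a. liminf (\<lambda>n. \<integral>\<^sup>+\<xi>. log_dev K (d n *\<^sub>R \<xi> + X a) \<partial>std_complex_gaussian) \<partial>gauss_prod J)"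
  by (intro nn_integral_mono nn_integral_liminf) measurable
 also have "\<dots> \<le> liminf (\<lambda>n. \<integral>\<^sup>+a. (\<integral>\<^sup>+\<xi>. log_dev K (d n *\<^sub>R \<xi> + X a) \<partial>std_complex_gaussian) \<partial>gauss_prod J)"
  by (intro nn_integral_liminf) measurable
 also have "\<dots> \<le> liminf (\<lambda>n. log_gauss_const)"
 proof (intro Liminf_mono always_eventually allI)
  fix n
  have in1: "(\<integral>\<^sup>+\<xi>. log_dev K (d n *\<^sub>R \<xi> + X a) \<partial>std_complex_gaussian) =
    (\<integral>\<^sup>+y. log_dev K (y + X a) * ennreal (gauss_dens (s n) y) \<partial>lborel)" for a
  proof -
   have "(\<integral>\<^sup>+y. log_dev K (y + X a) * ennreal (gauss_dens (s n) y) \<partial>lborel) = ennreal ((d n)\<^sup>2) *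
     (\<integral>\<^sup>+\<xi>. log_dev K (d n *\<^sub>R \<xi> + X a) * ennreal (gauss_dens (s n) (d n *\<^sub>R \<xi>)) \<partial>lborel)"
    using d[of n] by (subst nn_integral_complex_affine[where c="d n" and t=0]) auto
   also have "\<dots> = (\<integral>\<^sup>+\<xi>. ennreal ((d n)\<^sup>2) * (log_dev K (d n *\<^sub>R \<xi> + X a) * ennreal (gauss_dens (s n) (d n *\<^sub>R \<xi>))) \<partial>lborel)"
    by (subst nn_integral_cmult) auto
   also have "\<dots> = (\<integral>\<^sup>+\<xi>. ennreal (gauss_dens 1 \<xi>) * log_dev K (d n *\<^sub>R \<xi> + X a) \<partial>lborel)"
   proof (rule nn_integral_cong)
    fix \<xi>
    have "(d n)\<^sup>2 * gauss_dens (s n) (d n *\<^sub>R \<xi>) = gauss_dens 1 \<xi>"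
     using s[of n] d[of n] by (simp add: gauss_dens_def power_mult_distrib)
    then have "ennreal ((d n)\<^sup>2) * ennreal (gauss_dens (s n) (d n *\<^sub>R \<xi>)) = ennreal (gauss_dens 1 \<xi>)"
     using s[of n] by (subst ennreal_mult[symmetric]) (auto simp: gauss_dens_def)
    then show "ennreal ((d n)\<^sup>2) * (log_dev K (d n *\<^sub>R \<xi> + X a) * ennreal (gauss_dens (s n) (d n *\<^sub>R \<xi>))) = ennreal (gauss_dens 1 \<xi>) * log_dev K (d n *\<^sub>R \<xi> + X a)"
     by (metis mult.assoc mult.commute)
   qed
   also have "\<dots> = (\<integral>\<^sup>+\<xi>. log_dev K (d n *\<^sub>R \<xi> + X a) \<partial>std_complex_gaussian)"
    by (rule nn_integral_std_complex_gaussian[symmetric]) measurable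
   finally show ?thesis by simp
  qed
  have "(\<integral>\<^sup>+a. (\<integral>\<^sup>+\<xi>. log_dev K (d n *\<^sub>R \<xi> + X a) \<partial>std_complex_gaussian) \<partial>gauss_prod J) =
   (\<integral>\<^sup>+y. log_dev K y * ennreal (gauss_dens (s n + K) y) \<partial>lborel)"
   unfolding in1 unfolding X_def using nn_integral_gauss_prod_smoothing[OF J s(1)[of n], of "log_dev K" b] K(1) by simp
  also have "\<dots> \<le> (\<integral>\<^sup>+y. log_dev K y * ennreal (exp (- (cmod y)\<^sup>2 / (2 * K)) / (pi * K)) \<partial>lborel)"
  proof (intro nn_integral_mono mult_left_mono ennreal_leI)
   fix y
   have "(cmod y)\<^sup>2 / (2 * K) \<le> (cmod y)\<^sup>2 / (s n + K)" using s[of n] K by (intro divide_left_mono) auto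
   then show "gauss_dens (s n + K) y \<le> exp (- (cmod y)\<^sup>2 / (2 * K)) / (pi * K)"
    unfolding gauss_dens_def using s[of n] K by (intro frac_le) auto
  qed auto
  also have "\<dots> = ennreal ((sqrt K)\<^sup>2) * (\<integral>\<^sup>+u. log_dev K (sqrt K *\<^sub>R u) * ennreal (exp (- (cmod (sqrt K *\<^sub>R u))\<^sup>2 / (2 * K)) / (pi * K)) \<partial>lborel)"
   using K by (subst nn_integral_complex_affine[where c="sqrt K" and t=0]) auto
  also have "\<dots> = (\<integral>\<^sup>+u. ennreal K * (log_dev K (sqrt K *\<^sub>R u) * ennreal (exp (- (cmod (sqrt K *\<^sub>R u))\<^sup>2 / (2 * K)) / (pi * K))) \<partial>lborel)"
   using K by (subst nn_integral_cmult) auto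
  also have "\<dots> = log_gauss_const" unfolding log_gauss_const_def
  proof (rule nn_integral_cong)
   fix u
   have "ln (sqrt K * cmod u) = ln K / 2 + ln (cmod u)" if "u \<noteq> 0"
    using K that by (simp add: ln_mult ln_sqrt)
   then have 1: "log_dev K (sqrt K *\<^sub>R u) = log_dev 1 u"
    using K by (simp add: log_dev_def)
   have "exp (- (cmod (sqrt K *\<^sub>R u))\<^sup>2 / (2 * K)) = exp (- (cmod u)\<^sup>2 / 2)" using K by (simp add: power_mult_distrib)
   then have "ennreal K * ennreal (exp (- (cmod (sqrt K *\<^sub>R u))\<^sup>2 / (2 * K)) / (pi * K)) = ennreal (exp (- (cmod u)\<^sup>2 / 2) / pi)"
    using K by (subst ennreal_mult[symmetric]) (auto simp del: norm_scaleR)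
   then show "ennreal K * (log_dev K (sqrt K *\<^sub>R u) * ennreal (exp (- (cmod (sqrt K *\<^sub>R u))\<^sup>2 / (2 * K)) / (pi * K))) = log_dev 1 u * ennreal (exp (- (cmod u)\<^sup>2 / 2) / pi)"
    unfolding 1 by (metis mult.assoc mult.commute)
  qed
  finally show "(\<integral>\<^sup>+a. (\<integral>\<^sup>+\<xi>. log_dev K (d n *\<^sub>R \<xi> + X a) \<partial>std_complex_gaussian) \<partial>gauss_prod J) \<le> log_gauss_const" .
 qed
 also have "\<dots> = log_gauss_const" by (simp add: Liminf_const)
 finally show ?thesis unfolding X_def .
qed

text \<open>Applied to a value of a Gaussian polynomial, this bounds the distance of the mean of its logarithmic modulus from half the logarithm of the variance, uniformly in the point and the degree.\<close>
lemma log_gauss_expectation: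
 assumes J: "finite J" and K: "(\<Sum>j\<in>J. (cmod (b j))\<^sup>2) = K" "K > 0"
 shows "AE a in gauss_prod J. (\<Sum>j\<in>J. a j * b j) \<noteq> 0"
  and "(\<integral>\<^sup>+a. ennreal \<bar>ln (cmod (\<Sum>j\<in>J. a j * b j))\<bar> \<partial>gauss_prod J) \<le> ennreal (enn2real log_gauss_const + \<bar>ln K\<bar> / 2)"
  and "integrable (gauss_prod J) (\<lambda>a. ln (cmod (\<Sum>j\<in>J. a j * b j)))"
  and "\<bar>(\<integral>a. ln (cmod (\<Sum>j\<in>J. a j * b j)) \<partial>gauss_prod J) - ln K / 2\<bar> \<le> enn2real log_gauss_const"
proof -
 define X where "X a = (\<Sum>j\<in>J. a j * b j)" for a
 have Xm[measurable]: "X \<in> borel_measurable (gauss_prod J)" unfolding X_def by measurable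
 interpret P: prob_space "gauss_prod J" by (rule prob_space_gauss_prod)
 have C: "log_gauss_const = ennreal (enn2real log_gauss_const)" using log_gauss_const_finite by simp
 have le: "(\<integral>\<^sup>+a. log_dev K (X a) \<partial>gauss_prod J) \<le> log_gauss_const"
  unfolding X_def by (rule nn_integral_log_dev_gauss_le[OF J K])
 then have "(\<integral>\<^sup>+a. log_dev K (X a) \<partial>gauss_prod J) \<noteq> \<infinity>" using log_gauss_const_finite by (auto simp: top_unique)
 then have "AE a in gauss_prod J. log_dev K (X a) \<noteq> \<infinity>" by (intro nn_integral_PInf_AE) measurable
 then have nz: "AE a in gauss_prod J. X a \<noteq> 0"
  by eventually_elim (auto simp: log_dev_def)
 then show "AE a in gauss_prod J. (\<Sum>j\<in>J. a j * b j) \<noteq> 0" unfolding X_def .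
 have le2: "(\<integral>\<^sup>+a. ennreal \<bar>ln (cmod (X a)) - ln K / 2\<bar> \<partial>gauss_prod J) \<le> ennreal (enn2real log_gauss_const)"
 proof -
  have "(\<integral>\<^sup>+a. ennreal \<bar>ln (cmod (X a)) - ln K / 2\<bar> \<partial>gauss_prod J) \<le> (\<integral>\<^sup>+a. log_dev K (X a) \<partial>gauss_prod J)"
   by (rule nn_integral_mono) (auto simp: log_dev_def)
  with le C show ?thesis by simp
 qed
 show "(\<integral>\<^sup>+a. ennreal \<bar>ln (cmod (\<Sum>j\<in>J. a j * b j))\<bar> \<partial>gauss_prod J) \<le> ennreal (enn2real log_gauss_const + \<bar>ln K\<bar> / 2)"
 proof -
  have "(\<integral>\<^sup>+a. ennreal \<bar>ln (cmod (X a))\<bar> \<partial>gauss_prod J) \<le> (\<integral>\<^sup>+a. ennreal \<bar>ln (cmod (X a)) - ln K / 2\<bar> + ennreal (\<bar>ln K\<bar> / 2) \<partial>gauss_prod J)"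
   by (intro nn_integral_mono) (auto simp: ennreal_plus[symmetric] intro!: ennreal_leI simp del: ennreal_plus)
  also have "\<dots> = (\<integral>\<^sup>+a. ennreal \<bar>ln (cmod (X a)) - ln K / 2\<bar> \<partial>gauss_prod J) + ennreal (\<bar>ln K\<bar> / 2)"
   by (subst nn_integral_add) (auto simp: P.emeasure_space_1)
  also have "\<dots> \<le> ennreal (enn2real log_gauss_const) + ennreal (\<bar>ln K\<bar> / 2)"
   using le2 by (rule add_right_mono)
  finally show ?thesis unfolding X_def by simp
 qed
 have i1: "integrable (gauss_prod J) (\<lambda>a. ln (cmod (X a)) - ln K / 2)"
  using le2 by (intro integrableI_bounded) (auto simp: le_less_trans)
 have i: "integrable (gauss_prod J) (\<lambda>a. ln (cmod (X a)))"
  using Bochner_Integration.integrable_add[OF i1, of "\<lambda>_. ln K / 2"] by simp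
 then show "integrable (gauss_prod J) (\<lambda>a. ln (cmod (\<Sum>j\<in>J. a j * b j)))" unfolding X_def .
 have "(\<integral>a. ln (cmod (X a)) \<partial>gauss_prod J) - ln K / 2 = (\<integral>a. ln (cmod (X a)) - ln K / 2 \<partial>gauss_prod J)"
  using i by (subst Bochner_Integration.integral_diff) (auto simp: P.prob_space)
 also have "\<bar>\<dots>\<bar> \<le> (\<integral>a. \<bar>ln (cmod (X a)) - ln K / 2\<bar> \<partial>gauss_prod J)" by simp
 also have "\<dots> = enn2real (\<integral>\<^sup>+a. ennreal \<bar>ln (cmod (X a)) - ln K / 2\<bar> \<partial>gauss_prod J)"
  by (rule integral_eq_nn_integral) auto
 also have "\<dots> \<le> enn2real log_gauss_const"
  using le2 C by (intro enn2real_mono) (use log_gauss_const_finite in auto)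
 finally show "\<bar>(\<integral>a. ln (cmod (\<Sum>j\<in>J. a j * b j)) \<partial>gauss_prod J) - ln K / 2\<bar> \<le> enn2real log_gauss_const"
  unfolding X_def .
qed

section \<open>Measurability of the zero distribution\<close>

text \<open>On a compact set a nonnegative continuous function has a zero iff it takes arbitrarily small values on a countable dense subset, and this is a countable combination of measurable conditions.\<close>
lemma measurable_exists_zero_compact:
 fixes F :: "'a \<Rightarrow> complex \<Rightarrow> real"
 assumes K: "compact K" and m: "\<And>z. (\<lambda>a. F a z) \<in> borel_measurable M"
  and c: "\<And>a. a \<in> space M \<Longrightarrow> continuous_on UNIV (F a)" and nn: "\<And>a z. F a z \<ge> 0"
 shows "{a \<in> space M. \<exists>z\<in>K. F a z = 0} \<in> sets M"
proof -
 obtain T where T: "countable T" "T \<subseteq> K" "K \<subseteq> closure T"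
  using separable by metis
 have "{a \<in> space M. \<exists>z\<in>K. F a z = 0} = {a \<in> space M. \<forall>n. \<exists>q\<in>T. F a q < 1 / real (Suc n)}"
 proof (intro Collect_cong conj_cong refl iffI)
  fix a assume a: "a \<in> space M" and "\<exists>z\<in>K. F a z = 0"
  then obtain z where z: "z \<in> K" "F a z = 0" by blast
  show "\<forall>n. \<exists>q\<in>T. F a q < 1 / real (Suc n)"
  proof
   fix n
   have "continuous (at z) (F a)" using c[OF a] by (simp add: continuous_on_eq_continuous_at)
   then obtain d where d: "d > 0" "\<And>q. dist q z < d \<Longrightarrow> dist (F a q) (F a z) < 1 / real (Suc n)"
    unfolding continuous_at_eps_delta by (metis of_nat_0_less_iff zero_less_Suc zero_less_divide_1_iff)
   obtain q where "q \<in> T" "dist q z < d"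
    using T(3) z(1) d(1) by (metis closure_approachable subsetD)
   then show "\<exists>q\<in>T. F a q < 1 / real (Suc n)" using d(2)[of q] z(2) by (intro bexI[of _ q]) (auto simp: dist_real_def)
  qed
 next
  fix a assume a: "a \<in> space M" and *: "\<forall>n. \<exists>q\<in>T. F a q < 1 / real (Suc n)"
  then have "K \<noteq> {}" using T(2) by blast
  then obtain z where z: "z \<in> K" "\<And>y. y \<in> K \<Longrightarrow> F a z \<le> F a y"
   using continuous_attains_inf[OF K _ continuous_on_subset[OF c[OF a]]] by blast
  have "F a z \<le> 1 / real (Suc n)" for n
   using * z(2) T(2) by (metis less_imp_le order_trans subsetD)
  then have "F a z \<le> 0"
   by (intro LIMSEQ_le_const[OF LIMSEQ_Suc[OF lim_1_over_n[where 'a=real]]]) auto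
  then show "\<exists>z\<in>K. F a z = 0" using z(1) nn[of a z] by force
 qed
 also have "\<dots> \<in> sets M"
  using m T(1) by measurable
 finally show ?thesis .
qed

lemma space_poly_borel [simp]: "space (poly_borel N) = {f. degree f \<le> N}"
 by (simp add: poly_borel_def)

lemma measurable_coeff_poly_borel:
 assumes "j \<le> N" shows "(\<lambda>f. coeff f j) \<in> borel_measurable (poly_borel N)"
proof -
 have "(\<lambda>f. \<lambda>j\<in>{..N}. coeff f j) \<in> measurable (poly_borel N) (\<Pi>\<^sub>M j\<in>{..N}. borel)"
  unfolding poly_borel_def by (rule measurable_vimage_algebra1) (auto simp: space_PiM)
 from measurable_compose[OF this measurable_component_singleton[of j]] assms
 show ?thesis by simp
qed

lemma measurable_poly_borel_eval: "(\<lambda>f. poly f z) \<in> borel_measurable (poly_borel N)"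
proof -
 have "(\<lambda>f. \<Sum>j\<le>N. coeff f j * z ^ j) \<in> borel_measurable (poly_borel N)"
  by (intro borel_measurable_sum borel_measurable_times measurable_coeff_poly_borel) auto
 moreover have "poly f z = (\<Sum>j\<le>N. coeff f j * z ^ j)" if "f \<in> space (poly_borel N)" for f
 proof -
  have "(\<Sum>j\<le>degree f. coeff f j * z ^ j) = (\<Sum>j\<le>N. coeff f j * z ^ j)"
   using that by (intro sum.mono_neutral_left) (auto simp: coeff_eq_0)
  then show ?thesis by (simp add: poly_altdef)
 qed
 ultimately show ?thesis by (subst measurable_cong)
qed

text \<open>Half-open dyadic squares of side $2^{-n}$, so that every zero lies in exactly one of them.\<close>
definition grid_cell :: "nat \<Rightarrow> complex \<Rightarrow> int \<times> int" where
 "grid_cell n z = (\<lfloor>2 ^ n * Re z\<rfloor>, \<lfloor>2 ^ n * Im z\<rfloor>)"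

definition grid_corner :: "nat \<Rightarrow> int \<times> int \<Rightarrow> complex" where
 "grid_corner n p = Complex (of_int (fst p) / 2 ^ n) (of_int (snd p) / 2 ^ n)"

text \<open>The cells are not compact; exhausting them by closed boxes brings the criterion for zeros in compact sets to bear.\<close>
lemma grid_cell_eq_compact_union:
 "{z. grid_cell n z = p} =
   (\<Union>k. cbox (grid_corner n p)
       (Complex ((of_int (fst p) + 1 - 1 / real (Suc k)) / 2 ^ n) ((of_int (snd p) + 1 - 1 / real (Suc k)) / 2 ^ n)))"
proof -
 have 1: "\<lfloor>x\<rfloor> = i \<longleftrightarrow> real_of_int i \<le> x \<and> (\<exists>k. x \<le> real_of_int i + 1 - 1 / real (Suc k))" for x i
 proof
  assume "\<lfloor>x\<rfloor> = i"
  then have x: "real_of_int i \<le> x" "x < real_of_int i + 1" by linarith+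
  then obtain k where "1 / real (Suc k) < real_of_int i + 1 - x"
   using reals_Archimedean[of "real_of_int i + 1 - x"] by (auto simp: inverse_eq_divide)
  then show "real_of_int i \<le> x \<and> (\<exists>k. x \<le> real_of_int i + 1 - 1 / real (Suc k))"
   using x by (intro conjI exI[of _ k]) auto
 next
  assume "real_of_int i \<le> x \<and> (\<exists>k. x \<le> real_of_int i + 1 - 1 / real (Suc k))"
  then obtain k where "real_of_int i \<le> x" "x \<le> real_of_int i + 1 - 1 / real (Suc k)" by blast
  moreover have "1 / real (Suc k) > 0" by simp
  ultimately show "\<lfloor>x\<rfloor> = i" by linarith
 qed
 have mono: "1 / real (Suc (max k l)) \<le> 1 / real (Suc k)" "1 / real (Suc (max k l)) \<le> 1 / real (Suc l)" for k l
  by (auto intro!: divide_left_mono)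
 show ?thesis
 proof (intro set_eqI iffI)
  fix z assume "z \<in> {z. grid_cell n z = p}"
  then have "\<lfloor>2 ^ n * Re z\<rfloor> = fst p" "\<lfloor>2 ^ n * Im z\<rfloor> = snd p" by (auto simp: grid_cell_def)
  then obtain k l where kl: "real_of_int (fst p) \<le> 2 ^ n * Re z" "2 ^ n * Re z \<le> real_of_int (fst p) + 1 - 1 / real (Suc k)"
   "real_of_int (snd p) \<le> 2 ^ n * Im z" "2 ^ n * Im z \<le> real_of_int (snd p) + 1 - 1 / real (Suc l)"
   unfolding 1 by blast
  define m where "m = max k l"
  have "2 ^ n * Re z \<le> real_of_int (fst p) + 1 - 1 / real (Suc m)" "2 ^ n * Im z \<le> real_of_int (snd p) + 1 - 1 / real (Suc m)"
   using kl mono[of k l] unfolding m_def by linarith+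
  then have "z \<in> cbox (grid_corner n p)
       (Complex ((of_int (fst p) + 1 - 1 / real (Suc m)) / 2 ^ n) ((of_int (snd p) + 1 - 1 / real (Suc m)) / 2 ^ n))"
   using kl(1,3) by (simp add: in_cbox_complex_iff grid_corner_def field_simps del: of_nat_Suc)
  then show "z \<in> (\<Union>k. cbox (grid_corner n p)
       (Complex ((of_int (fst p) + 1 - 1 / real (Suc k)) / 2 ^ n) ((of_int (snd p) + 1 - 1 / real (Suc k)) / 2 ^ n)))" by blast
 next
  fix z assume "z \<in> (\<Union>k. cbox (grid_corner n p)
       (Complex ((of_int (fst p) + 1 - 1 / real (Suc k)) / 2 ^ n) ((of_int (snd p) + 1 - 1 / real (Suc k)) / 2 ^ n)))"
  then obtain m where "z \<in> cbox (grid_corner n p)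
       (Complex ((of_int (fst p) + 1 - 1 / real (Suc m)) / 2 ^ n) ((of_int (snd p) + 1 - 1 / real (Suc m)) / 2 ^ n))" by blast
  then have "real_of_int (fst p) \<le> 2 ^ n * Re z" "2 ^ n * Re z \<le> real_of_int (fst p) + 1 - 1 / real (Suc m)"
   "real_of_int (snd p) \<le> 2 ^ n * Im z" "2 ^ n * Im z \<le> real_of_int (snd p) + 1 - 1 / real (Suc m)"
   by (simp_all add: in_cbox_complex_iff grid_corner_def field_simps del: of_nat_Suc)
  then have "\<lfloor>2 ^ n * Re z\<rfloor> = fst p" "\<lfloor>2 ^ n * Im z\<rfloor> = snd p" unfolding 1 by blast+
  then show "z \<in> {z. grid_cell n z = p}" by (simp add: grid_cell_def)
 qed
qed

lemma measurable_zero_in_grid_cell: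
 "{f \<in> space (poly_borel N). \<exists>z. grid_cell n z = p \<and> poly f z = 0} \<in> sets (poly_borel N)"
proof -
 let ?B = "\<lambda>k. cbox (grid_corner n p)
       (Complex ((of_int (fst p) + 1 - 1 / real (Suc k)) / 2 ^ n) ((of_int (snd p) + 1 - 1 / real (Suc k)) / 2 ^ n))"
 have "{f \<in> space (poly_borel N). \<exists>z. grid_cell n z = p \<and> poly f z = 0} =
    (\<Union>k. {f \<in> space (poly_borel N). \<exists>z\<in>?B k. cmod (poly f z) = 0})"
  using grid_cell_eq_compact_union[of n p] by (fastforce simp: set_eq_iff)
 moreover have "{f \<in> space (poly_borel N). \<exists>z\<in>?B k. cmod (poly f z) = 0} \<in> sets (poly_borel N)" for k
 proof (rule measurable_exists_zero_compact)
  show "(\<lambda>f. cmod (poly f z)) \<in> borel_measurable (poly_borel N)" for z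
   using measurable_poly_borel_eval[of z N] by measurable
 qed (auto intro!: continuous_intros)
 ultimately show ?thesis by auto
qed

lemma grid_cell_bounds:
 "real_of_int (fst (grid_cell n z)) / 2 ^ n \<le> Re z" "Re z < real_of_int (fst (grid_cell n z)) / 2 ^ n + 1 / 2 ^ n"
 "real_of_int (snd (grid_cell n z)) / 2 ^ n \<le> Im z" "Im z < real_of_int (snd (grid_cell n z)) / 2 ^ n + 1 / 2 ^ n"
proof -
 have *: "real_of_int \<lfloor>2 ^ n * x\<rfloor> / 2 ^ n \<le> x \<and> x < real_of_int \<lfloor>2 ^ n * x\<rfloor> / 2 ^ n + 1 / 2 ^ n" for x :: real
 proof -
  have "real_of_int \<lfloor>2 ^ n * x\<rfloor> \<le> 2 ^ n * x" "2 ^ n * x < real_of_int \<lfloor>2 ^ n * x\<rfloor> + 1" by linarith+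
  then show ?thesis by (simp add: field_simps)
 qed
 show "real_of_int (fst (grid_cell n z)) / 2 ^ n \<le> Re z" "Re z < real_of_int (fst (grid_cell n z)) / 2 ^ n + 1 / 2 ^ n"
 "real_of_int (snd (grid_cell n z)) / 2 ^ n \<le> Im z" "Im z < real_of_int (snd (grid_cell n z)) / 2 ^ n + 1 / 2 ^ n"
  using *[of "Re z"] *[of "Im z"] by (auto simp: grid_cell_def)
qed

lemma grid_corner_close: "cmod (z - grid_corner n (grid_cell n z)) \<le> 2 * (1 / 2) ^ n"
proof -
 have "cmod (z - grid_corner n (grid_cell n z)) \<le> \<bar>Re (z - grid_corner n (grid_cell n z))\<bar> + \<bar>Im (z - grid_corner n (grid_cell n z))\<bar>"
  by (rule cmod_le)
 also have "\<dots> \<le> 1 / 2 ^ n + 1 / 2 ^ n"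
  using grid_cell_bounds[where n=n and z=z] by (intro add_mono) (auto simp: grid_corner_def)
 finally show ?thesis by (simp add: power_one_over)
qed

lemma grid_corner_tendsto: "(\<lambda>n. grid_corner n (grid_cell n z)) \<longlonglongrightarrow> z"
proof -
 have "(\<lambda>n. 2 * (1 / 2 :: real) ^ n) \<longlonglongrightarrow> 0" by real_asymp
 then have "(\<lambda>n. z - grid_corner n (grid_cell n z)) \<longlonglongrightarrow> 0"
  by (rule Lim_null_comparison[rotated]) (intro always_eventually allI grid_corner_close)
 from tendsto_diff[OF tendsto_const[of z] this] show ?thesis by simp
qed

lemma grid_cell_eventually_inj:
 assumes "finite A" shows "\<forall>\<^sub>F n in sequentially. inj_on (grid_cell n) A"
proof -
 have "\<forall>\<^sub>F n in sequentially. grid_cell n x \<noteq> grid_cell n y" if "x \<noteq> y" for x y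
 proof -
  have "\<forall>\<^sub>F n in sequentially. grid_corner n (grid_cell n x) - grid_corner n (grid_cell n y) \<noteq> 0"
  proof (rule tendsto_imp_eventually_ne)
   show "(\<lambda>n. grid_corner n (grid_cell n x) - grid_corner n (grid_cell n y)) \<longlonglongrightarrow> x - y"
    by (intro tendsto_diff grid_corner_tendsto)
  qed (use that in auto)
  then show ?thesis by eventually_elim auto
 qed
 then have "\<forall>\<^sub>F n in sequentially. \<forall>x\<in>A. \<forall>y\<in>A. x \<noteq> y \<longrightarrow> grid_cell n x \<noteq> grid_cell n y"
  using assms by (auto simp: eventually_ball_finite_distrib)
 then show ?thesis by eventually_elim (auto simp: inj_on_def)
qed

lemma grid_cell_eventually_bounded:
 "\<forall>\<^sub>F n in sequentially. grid_cell n z \<in> {- int (4 ^ n)..int (4 ^ n)} \<times> {- int (4 ^ n)..int (4 ^ n)}"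
proof -
 have "\<forall>\<^sub>F n in sequentially. cmod z + 1 \<le> 2 ^ n"
  by real_asymp
 then show ?thesis
 proof eventually_elim
  case (elim n)
  have *: "\<lfloor>2 ^ n * x\<rfloor> \<in> {- int (4 ^ n)..int (4 ^ n)}" if "\<bar>x\<bar> \<le> cmod z" for x :: real
  proof -
   have "\<bar>2 ^ n * x\<bar> \<le> 2 ^ n * (2 ^ n - 1)" using that elim by (auto simp: abs_mult intro!: mult_left_mono)
   also have "\<dots> = 4 ^ n - 2 ^ n" by (simp add: algebra_simps power_mult_distrib[symmetric])
   finally have "\<bar>2 ^ n * x\<bar> \<le> 4 ^ n - 1" using one_le_power[of "2::real" n] by linarith
   then have "real_of_int (- int (4 ^ n)) \<le> 2 ^ n * x" "2 ^ n * x \<le> real_of_int (int (4 ^ n))" by auto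
   then show ?thesis by (simp add: le_floor_iff floor_le_iff)
  qed
  show ?case using *[OF abs_Re_le_cmod] *[OF abs_Im_le_cmod] by (simp add: grid_cell_def)
 qed
qed

text \<open>Once the grid separates the zeros, summing \<open>\<phi>\<close> over the corners of the cells that contain a zero approximates the sum over the zeros, so the latter is a limit of measurable functions. The zero polynomial is split off, as its set of zeros is infinite.\<close>
lemma measurable_zero_distribution:
 assumes c: "continuous_on UNIV \<phi>"
 shows "(\<lambda>f. zero_distribution N f \<phi>) \<in> borel_measurable (poly_borel N)"
proof -
 define I where "I n = {- int (4 ^ n)..int (4 ^ n)} \<times> {- int (4 ^ n)..int (4 ^ n)}" for n :: nat
 define F where "F n f = (\<Sum>p\<in>I n. indicator {f \<in> space (poly_borel N). \<exists>z. grid_cell n z = p \<and> poly f z = 0} f *\<^sub>R \<phi> (grid_corner n p))" for n f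
 have Fm: "F n \<in> borel_measurable (poly_borel N)" for n
  unfolding F_def
  by (intro borel_measurable_sum borel_measurable_scaleR borel_measurable_indicator measurable_zero_in_grid_cell) auto
 define Z where "Z = {f \<in> space (poly_borel N). \<forall>j\<in>{..N}. coeff f j = 0}"
 have Zm: "Z \<in> sets (poly_borel N)" unfolding Z_def
  by (intro sets.sets_Collect_finite_All' pred_eq_const1[unfolded pred_def] borel_measurable_eq)
    (auto intro: measurable_coeff_poly_borel)
 have Z: "f \<in> Z \<longleftrightarrow> f = 0" if "f \<in> space (poly_borel N)" for f
 proof
  assume "f \<in> Z"
  then have "coeff f j = 0" for j
   using that coeff_eq_0[of f j] unfolding Z_def by (cases "j \<le> N") auto
  then show "f = 0" by (simp add: poly_eq_iff)
 qed (simp add: Z_def)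
 have "(\<lambda>f. indicator (space (poly_borel N) - Z) f *\<^sub>R F n f) \<in> borel_measurable (poly_borel N)" for n
  using Zm by (intro borel_measurable_scaleR borel_measurable_indicator Fm sets.Diff sets.top)
 then have "(\<lambda>f. \<Sum>z | poly f z = 0. \<phi> z) \<in> borel_measurable (poly_borel N)"
 proof (rule borel_measurable_LIMSEQ_metric)
  fix f assume f: "f \<in> space (poly_borel N)"
  show "(\<lambda>n. indicator (space (poly_borel N) - Z) f *\<^sub>R F n f) \<longlonglongrightarrow> (\<Sum>z | poly f z = 0. \<phi> z)"
  proof (cases "f = 0")
   case True
   then show ?thesis using Z[OF f] by (simp add: infinite_UNIV_char_0)
  next
   case False
   define A where "A = {z. poly f z = 0}"
   have A: "finite A" unfolding A_def using False by (rule poly_roots_finite)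
   have "\<forall>\<^sub>F n in sequentially. \<forall>z\<in>A. grid_cell n z \<in> I n"
    unfolding I_def using A grid_cell_eventually_bounded by (auto simp: eventually_ball_finite_distrib)
   then have "\<forall>\<^sub>F n in sequentially. (\<Sum>z\<in>A. \<phi> (grid_corner n (grid_cell n z))) = F n f"
    using grid_cell_eventually_inj[OF A]
   proof eventually_elim
    case (elim n)
    have "(\<Sum>z\<in>A. \<phi> (grid_corner n (grid_cell n z))) = (\<Sum>p\<in>grid_cell n ` A. \<phi> (grid_corner n p))"
     by (rule sum.reindex[OF elim(2), symmetric, unfolded o_def])
    also have "\<dots> = (\<Sum>p\<in>I n. if p \<in> grid_cell n ` A then \<phi> (grid_corner n p) else 0)"
     using elim(1) by (subst sum.inter_restrict[symmetric]) (auto simp: I_def intro!: sum.cong)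
    also have "\<dots> = F n f"
     unfolding F_def
    proof (intro sum.cong refl)
     fix p
     have "p \<in> grid_cell n ` A \<longleftrightarrow> f \<in> {f \<in> space (poly_borel N). \<exists>z. grid_cell n z = p \<and> poly f z = 0}"
      using f unfolding A_def by blast
     then show "(if p \<in> grid_cell n ` A then \<phi> (grid_corner n p) else 0) =
       indicator {f \<in> space (poly_borel N). \<exists>z. grid_cell n z = p \<and> poly f z = 0} f *\<^sub>R \<phi> (grid_corner n p)"

      by (cases "p \<in> grid_cell n ` A") (simp_all only: indicator_simps if_True if_False scaleR_one scaleR_zero_left not_False_eq_True simp_thms)
    qed
    finally show ?case .
   qed
   moreover have "(\<lambda>n. \<Sum>z\<in>A. \<phi> (grid_corner n (grid_cell n z))) \<longlonglongrightarrow> (\<Sum>z\<in>A. \<phi> z)"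
    by (intro tendsto_sum continuous_on_tendsto_compose[OF c grid_corner_tendsto]) auto
   ultimately have "(\<lambda>n. F n f) \<longlonglongrightarrow> (\<Sum>z\<in>A. \<phi> z)" by (rule Lim_transform_eventually[rotated])
   then show ?thesis using Z[OF f] False f by (simp add: A_def)
  qed
 qed
 then show ?thesis unfolding zero_distribution_def by (intro borel_measurable_divide) auto
qed

section \<open>Almost surely all zeros are simple\<close>

text \<open>A double zero \<open>z\<close> of $t p + g$ is a zero of the Wronskian of \<open>p\<close> and \<open>g\<close>, and it determines \<open>t\<close>. The Wronskian has finitely many zeros unless $g/p$ is constant, and then only one \<open>t\<close> is possible.\<close>
lemma double_root_shift_finite:
 fixes p g :: "complex poly"
 assumes p: "p \<noteq> 0"
 shows "finite {t. \<exists>z. poly p z \<noteq> 0 \<and> poly (smult t p + g) z = 0 \<and> poly (pderiv (smult t p + g)) z = 0}"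
proof -
 define W where "W = p * pderiv g - pderiv p * g"
 show ?thesis
 proof (cases "W = 0")
  case False
  have "{t. \<exists>z. poly p z \<noteq> 0 \<and> poly (smult t p + g) z = 0 \<and> poly (pderiv (smult t p + g)) z = 0}
    \<subseteq> (\<lambda>z. - poly g z / poly p z) ` {z. poly W z = 0}"
  proof safe
   fix t z assume pz: "poly p z \<noteq> 0" and 1: "poly (smult t p + g) z = 0" and 2: "poly (pderiv (smult t p + g)) z = 0"
   have g: "poly g z = - (t * poly p z)" using 1 by (simp add: eq_neg_iff_add_eq_0 add.commute)
   have g': "poly (pderiv g) z = - (t * poly (pderiv p) z)"
    using 2 by (simp add: pderiv_add pderiv_smult eq_neg_iff_add_eq_0 add.commute)
   have "poly W z = 0" unfolding W_def by (simp add: g g')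
   moreover have "t = - poly g z / poly p z" using pz g by simp
   ultimately show "t \<in> (\<lambda>z. - poly g z / poly p z) ` {z. poly W z = 0}" by blast
  qed
  then show ?thesis using poly_roots_finite[OF False] finite_surj by blast
 next
  case True
  obtain z0 where z0: "poly p z0 \<noteq> 0" using p poly_all_0_iff_0 by blast
  define c where "c = poly g z0 / poly p z0"
  define h where "h = g - smult c p"
  have W: "p * pderiv h = pderiv p * h"
   using True by (simp add: h_def W_def pderiv_diff pderiv_smult algebra_simps)
  have "h = 0"
  proof (rule ccontr)
   assume h: "h \<noteq> 0"
   have hz: "poly h z0 = 0" using z0 by (simp add: h_def c_def)
   have o: "order z0 h = Suc (order z0 (pderiv h))" by (rule order_pderiv[OF h hz])
   have "pderiv h \<noteq> 0"
   proof
    assume "pderiv h = 0"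
    then have "pderiv p * h = 0" using W by simp
    then have "degree h = 0" using \<open>pderiv h = 0\<close> pderiv_eq_0_iff by blast
    then show False using hz h by (metis degree_eq_zeroE poly_pCons mult_zero_right poly_0 add.right_neutral pCons_eq_0_iff)
   qed
   then have ne: "p * pderiv h \<noteq> 0" using p by simp
   have "order z0 (p * pderiv h) = order z0 (pderiv h)"
    using order_mult[OF ne] z0 order_root[of p z0] by simp
   moreover have "order z0 (pderiv p * h) \<ge> order z0 h"
    using order_mult[of "pderiv p" h z0] ne W by simp
   ultimately show False using o W by simp
  qed
  then have g: "g = smult c p" by (simp add: h_def)
  have "{t. \<exists>z. poly p z \<noteq> 0 \<and> poly (smult t p + g) z = 0 \<and> poly (pderiv (smult t p + g)) z = 0} \<subseteq> {-c}"
  proof safe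
   fix t z assume "poly p z \<noteq> 0" "poly (smult t p + g) z = 0"
   then have "(t + c) * poly p z = 0" by (simp add: g algebra_simps)
   then show "t = - c" using \<open>poly p z \<noteq> 0\<close> by (simp add: eq_neg_iff_add_eq_0)
  qed
  then show ?thesis using finite_subset by blast
 qed
qed

lemma emeasure_std_complex_gaussian_finite_set:
 assumes "finite A" shows "emeasure std_complex_gaussian A = 0"
proof -
 have "AE z in lborel. z \<notin> A"
  using assms by (intro AE_not_in) (auto intro: finite_imp_null_set_lborel)
 then have "AE z in std_complex_gaussian. z \<notin> A"
  unfolding std_complex_gaussian_eq by (subst AE_density) (auto elim: eventually_mono)
 then show ?thesis
  using assms by (subst (asm) AE_iff_measurable[of A]) (auto intro: borel_closed finite_imp_closed)
qed

definition random_poly :: "nat \<Rightarrow> (nat \<Rightarrow> complex poly) \<Rightarrow> (nat \<Rightarrow> complex) \<Rightarrow> complex poly" where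
 "random_poly N P a = (\<Sum>j\<le>N. smult (a j) (P j))"

lemma poly_random_poly: "poly (random_poly N P a) z = (\<Sum>j\<le>N. a j * poly (P j) z)"
 by (simp add: random_poly_def poly_sum)

lemma poly_pderiv_random_poly: "poly (pderiv (random_poly N P a)) z = (\<Sum>j\<le>N. a j * poly (pderiv (P j)) z)"
 proof -
 have "pderiv (\<Sum>j\<in>A. smult (a j) (P j)) = (\<Sum>j\<in>A. smult (a j) (pderiv (P j)))" for A :: "nat set"
  by (induction A rule: infinite_finite_induct) (auto simp: pderiv_add pderiv_smult)
 then show ?thesis by (simp add: random_poly_def poly_sum)
qed

lemma poly_eval_measurable [measurable]: "(\<lambda>z. poly (p :: complex poly) z) \<in> borel_measurable borel"
 by (intro borel_measurable_continuous_onI continuous_intros)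

lemma measurable_random_poly_eval [measurable]:
 "(\<lambda>a. poly (random_poly N P a) z) \<in> borel_measurable (gauss_prod {..N})"
 "(\<lambda>a. poly (pderiv (random_poly N P a)) z) \<in> borel_measurable (gauss_prod {..N})"
 unfolding poly_random_poly poly_pderiv_random_poly by measurable

text \<open>With all coefficients but the first fixed, a double zero off the zeros of \<open>P 0\<close> confines the first coefficient to a finite set, which is null. At each of the finitely many zeros of \<open>P 0\<close> the random value is a nondegenerate Gaussian and almost surely not 0.\<close>
lemma AE_random_poly_simple_zeros:
 assumes pos: "\<And>z. (\<Sum>j\<le>N. (cmod (poly (P j) z))\<^sup>2) > 0" and P0: "P 0 \<noteq> 0"
 shows "AE a in gauss_prod {..N}. random_poly N P a \<noteq> 0 \<and> rsquarefree (random_poly N P a)"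
proof -
 let ?M = "gauss_prod {..N}"
 let ?f = "random_poly N P"
 define D where "D = {a \<in> space ?M. \<exists>z. poly (?f a) z = 0 \<and> poly (pderiv (?f a)) z = 0}"
 define R where "R = {z. poly (P 0) z = 0}"
 have R: "finite R" unfolding R_def using P0 by (rule poly_roots_finite)
 have Dm: "D \<in> sets ?M"
 proof -
  have "D = (\<Union>n. {a \<in> space ?M. \<exists>z\<in>cball 0 (real n). cmod (poly (?f a) z) + cmod (poly (pderiv (?f a)) z) = 0})"
   (is "_ = ?U")
  proof (intro set_eqI iffI)
   fix a assume "a \<in> D"
   then obtain z where z: "a \<in> space ?M" "poly (?f a) z = 0" "poly (pderiv (?f a)) z = 0" unfolding D_def by blast
   obtain n where "cmod z \<le> real n" using real_arch_simple by blast
   then show "a \<in> ?U" using z by (intro UN_I[of n] CollectI conjI bexI[of _ z]) auto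
  next
   fix a assume "a \<in> ?U"
   then obtain z where "a \<in> space ?M" "cmod (poly (?f a) z) + cmod (poly (pderiv (?f a)) z) = 0" by blast
   then show "a \<in> D" unfolding D_def by (auto simp: add_nonneg_eq_0_iff)
  qed
  moreover have "{a \<in> space ?M. \<exists>z\<in>cball 0 (real n). cmod (poly (?f a) z) + cmod (poly (pderiv (?f a)) z) = 0} \<in> sets ?M" for n
   by (rule measurable_exists_zero_compact) (auto intro!: continuous_intros)
  ultimately show ?thesis by auto
 qed
 define B where "B = {a \<in> D. \<forall>z\<in>R. poly (?f a) z \<noteq> 0}"
 have Bm: "B \<in> sets ?M"
 proof -
  have "B = D \<inter> {a \<in> space ?M. \<forall>z\<in>R. poly (?f a) z \<noteq> 0}" by (auto simp: B_def D_def)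
  moreover have "{a \<in> space ?M. \<forall>z\<in>R. poly (?f a) z \<noteq> 0} \<in> sets ?M"
   using R by measurable
  ultimately show ?thesis using Dm by auto
 qed
 have ins: "{..N} = insert 0 {1..N}" by auto
 have "emeasure ?M B = (\<integral>\<^sup>+a. indicator B a \<partial>?M)" using Bm by simp
 also have "\<dots> = (\<integral>\<^sup>+x. (\<integral>\<^sup>+y. indicator B (x(0 := y)) \<partial>std_complex_gaussian) \<partial>gauss_prod {1..N})"
  using Bm unfolding ins by (intro gauss.product_nn_integral_insert) auto
 also have "\<dots> = (\<integral>\<^sup>+x. 0 \<partial>gauss_prod {1..N})"
 proof (rule nn_integral_cong)
  fix x assume "x \<in> space (gauss_prod {1..N})"
  define g where "g = (\<Sum>j=1..N. smult (x j) (P j))"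
  have f: "?f (x(0 := y)) = smult y (P 0) + g" for y
  proof -
   have "?f (x(0 := y)) = (\<Sum>j\<in>insert 0 {1..N}. smult ((x(0 := y)) j) (P j))"
    unfolding random_poly_def ins ..
   also have "\<dots> = smult y (P 0) + g" unfolding g_def by (subst sum.insert) (auto intro!: sum.cong)
   finally show ?thesis .
  qed
  let ?T = "{t. \<exists>z. poly (P 0) z \<noteq> 0 \<and> poly (smult t (P 0) + g) z = 0 \<and> poly (pderiv (smult t (P 0) + g)) z = 0}"
  have T: "finite ?T" by (rule double_root_shift_finite[OF P0])
  have "(\<integral>\<^sup>+y. indicator B (x(0 := y)) \<partial>std_complex_gaussian) \<le> (\<integral>\<^sup>+y. indicator ?T y \<partial>std_complex_gaussian)"
  proof (rule nn_integral_mono)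
   fix y
   have "y \<in> ?T" if "x(0 := y) \<in> B"
   proof -
    have "\<exists>z. poly (?f (x(0 := y))) z = 0 \<and> poly (pderiv (?f (x(0 := y)))) z = 0"
     and nz: "\<And>z. poly (P 0) z = 0 \<Longrightarrow> poly (?f (x(0 := y))) z \<noteq> 0"
     using that by (auto simp: B_def D_def R_def)
    then obtain z where z: "poly (smult y (P 0) + g) z = 0" "poly (pderiv (smult y (P 0) + g)) z = 0"
     unfolding f by blast
    moreover have "poly (P 0) z \<noteq> 0" using nz[of z] z(1) unfolding f by blast
    ultimately show ?thesis by blast
   qed
   then show "indicator B (x(0 := y)) \<le> (indicator ?T y :: ennreal)" by (simp add: indicator_def)
  qed
  also have "\<dots> = emeasure std_complex_gaussian ?T"
   using T by (intro nn_integral_indicator) (auto intro: borel_closed finite_imp_closed)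
  also have "\<dots> = 0" by (rule emeasure_std_complex_gaussian_finite_set[OF T])
  finally show "(\<integral>\<^sup>+y. indicator B (x(0 := y)) \<partial>std_complex_gaussian) = 0" by simp
 qed
 finally have "emeasure ?M B = 0" by simp
 then have B0: "AE a in ?M. a \<notin> B" using Bm by (intro AE_not_in) auto
 have nz: "AE a in ?M. poly (?f a) z \<noteq> 0" for z
  unfolding poly_random_poly using log_gauss_expectation(1)[of "{..N}" "\<lambda>j. poly (P j) z", OF _ refl pos] by simp
 then have "AE a in ?M. \<forall>z\<in>R. poly (?f a) z \<noteq> 0" using R by (intro AE_finite_allI)
 then show ?thesis using B0 nz[of 0] AE_space
 proof eventually_elim
  case (elim a)
  then have ne: "?f a \<noteq> 0" by auto
  have "\<not> (poly (?f a) z = 0 \<and> poly (pderiv (?f a)) z = 0)" for z using elim by (auto simp: B_def D_def)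
  then have "rsquarefree (?f a)" by (simp add: rsquarefree_roots)
  then show ?case using ne by simp
 qed
qed

section \<open>The expected zero distribution\<close>

text \<open>Up to an additive constant, which integrates to 0 against a Laplacian, $\ln|f|^2$ is the sum of the fundamental solutions at the zeros.\<close>
lemma green_formula_poly:
 assumes sm: "\<forall>k. cont_diff k \<phi>" and 0: "\<And>z. cmod z > R \<Longrightarrow> \<phi> z = 0"
  and f: "rsquarefree f" "f \<noteq> 0"
 shows "(\<integral>z. ln ((cmod (poly f z))\<^sup>2) *\<^sub>R laplacian \<phi> z \<partial>lborel) = green_const *\<^sub>R (\<Sum>z | poly f z = 0. \<phi> z)"
  and "integrable lborel (\<lambda>z. ln ((cmod (poly f z))\<^sup>2) *\<^sub>R laplacian \<phi> z)"
proof -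
 let ?A = "{z. poly f z = 0}" and ?L = "laplacian \<phi>"
 have A: "finite ?A" using f(2) by (rule poly_roots_finite)
 have cL: "continuous_on UNIV ?L" by (rule continuous_laplacian[OF sm])
 have lz: "\<And>z. cmod z > R \<Longrightarrow> ?L z = 0" using 0 by (rule laplacian_zero_outside)
 have [measurable]: "?L \<in> borel_measurable borel" using cL by (rule borel_measurable_continuous_onI)
 define c where "c = ln ((cmod (lead_coeff f))\<^sup>2)"
 have AEA: "AE z in lborel. z \<notin> ?A"
  using A by (intro AE_not_in) (auto intro: finite_imp_null_set_lborel)
 have ln_eq: "ln ((cmod (poly f z))\<^sup>2) = c + (\<Sum>\<zeta>\<in>?A. ln ((cmod (z - \<zeta>))\<^sup>2))" if "z \<notin> ?A" for z
 proof -
  have "poly f z = lead_coeff f * (\<Prod>\<zeta>\<in>?A. z - \<zeta>)"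
   by (subst complex_poly_decompose_rsquarefree[OF f(1), symmetric]) (simp add: poly_prod)
  then have "(cmod (poly f z))\<^sup>2 = (cmod (lead_coeff f))\<^sup>2 * (\<Prod>\<zeta>\<in>?A. (cmod (z - \<zeta>))\<^sup>2)"
   by (simp add: norm_mult power_mult_distrib prod_norm[symmetric] prod_power_distrib)
  moreover have "(cmod (z - \<zeta>))\<^sup>2 > 0" if "\<zeta> \<in> ?A" for \<zeta> using that \<open>z \<notin> ?A\<close> by auto
  moreover from this have "ln (\<Prod>\<zeta>\<in>?A. (cmod (z - \<zeta>))\<^sup>2) = (\<Sum>\<zeta>\<in>?A. ln ((cmod (z - \<zeta>))\<^sup>2))"
   using A by (intro ln_prod) auto
  moreover have "(\<Prod>\<zeta>\<in>?A. (cmod (z - \<zeta>))\<^sup>2) > 0" using calculation(2) by (intro prod_pos) auto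
  moreover have "(cmod (lead_coeff f))\<^sup>2 > 0" using f(2) by simp
  ultimately show ?thesis unfolding c_def by (simp only: ln_mult_pos)
 qed
 have AEeq: "AE z in lborel. ln ((cmod (poly f z))\<^sup>2) *\<^sub>R ?L z = c *\<^sub>R ?L z + (\<Sum>\<zeta>\<in>?A. ln ((cmod (z - \<zeta>))\<^sup>2) *\<^sub>R ?L z)"
  using AEA
 proof eventually_elim
  case (elim z)
  show ?case unfolding ln_eq[OF elim] scaleR_add_left scaleR_sum_left ..
 qed
 have iL: "integrable lborel ?L" by (rule integrable_continuous_bounded_support[OF cL lz])
 have i1: "integrable lborel (\<lambda>z. ln ((cmod (z - \<zeta>))\<^sup>2) *\<^sub>R ?L z)" for \<zeta>
  by (rule integrable_log_kernel(2)[OF cL lz])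
 have i2: "integrable lborel (\<lambda>z. c *\<^sub>R ?L z + (\<Sum>\<zeta>\<in>?A. ln ((cmod (z - \<zeta>))\<^sup>2) *\<^sub>R ?L z))"
  using iL i1 by auto
 show "integrable lborel (\<lambda>z. ln ((cmod (poly f z))\<^sup>2) *\<^sub>R laplacian \<phi> z)"

 proof (rule integrable_cong_AE_imp[OF i2])
  show "AE z in lborel. c *\<^sub>R ?L z + (\<Sum>\<zeta>\<in>?A. ln ((cmod (z - \<zeta>))\<^sup>2) *\<^sub>R ?L z) = ln ((cmod (poly f z))\<^sup>2) *\<^sub>R ?L z"
   using AEeq by eventually_elim (rule sym)
 qed measurable
 have "(\<integral>z. ln ((cmod (poly f z))\<^sup>2) *\<^sub>R ?L z \<partial>lborel) = (\<integral>z. c *\<^sub>R ?L z + (\<Sum>\<zeta>\<in>?A. ln ((cmod (z - \<zeta>))\<^sup>2) *\<^sub>R ?L z) \<partial>lborel)"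
  by (rule integral_cong_AE[OF _ _ AEeq]) measurable
 also have "\<dots> = (\<Sum>\<zeta>\<in>?A. green_const *\<^sub>R \<phi> \<zeta>)"
  using iL i1 by (simp add: integral_laplacian_eq_0[OF sm 0] green_representation[OF sm 0])
 finally show "(\<integral>z. ln ((cmod (poly f z))\<^sup>2) *\<^sub>R laplacian \<phi> z \<partial>lborel) = green_const *\<^sub>R (\<Sum>z | poly f z = 0. \<phi> z)"
  by (simp add: scaleR_sum_right)
qed

text \<open>The variance of the Gaussian polynomial at \<open>z\<close>, that is, the reproducing kernel on the diagonal.\<close>
definition kernel_diag :: "nat \<Rightarrow> (nat \<Rightarrow> complex poly) \<Rightarrow> complex \<Rightarrow> real" where
 "kernel_diag N P z = (\<Sum>j\<le>N. (cmod (poly (P j) z))\<^sup>2)"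

lemma continuous_kernel_diag: "continuous_on UNIV (kernel_diag N P)"
 unfolding kernel_diag_def[abs_def] by (intro continuous_intros)

lemma measurable_random_poly_pair:
 "(\<lambda>p. poly (random_poly N P (fst p)) (snd p)) \<in> borel_measurable (gauss_prod {..N} \<Otimes>\<^sub>M lborel)"
 unfolding poly_random_poly by measurable

text \<open>Taking means in \<open>green_formula_poly\<close>, Fubini's theorem leaves the mean of $\ln|f(z)|^2$ under the integral, which by \<open>log_gauss_expectation\<close> is $\ln K_N(z)$ up to a bounded error. The error does not depend on \<open>N\<close>; the division by \<open>N\<close> comes from the normalisation of the zero distribution.\<close>
theorem expected_zeros:
 assumes sm: "\<forall>k. cont_diff k \<phi>" and 0: "\<And>z. cmod z > R \<Longrightarrow> \<phi> z = 0"
  and N: "N \<ge> 1" and deg: "\<And>j. j \<le> N \<Longrightarrow> degree (P j) \<le> N"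
  and pos: "\<And>z. kernel_diag N P z > 0" and P0: "P 0 \<noteq> 0"
 shows "cmod ((green_const * real N) *\<^sub>R (\<integral>f. zero_distribution N f \<phi> \<partial>gaussian_poly N P) -
    (\<integral>z. ln (kernel_diag N P z) *\<^sub>R laplacian \<phi> z \<partial>lborel)) \<le>
   2 * enn2real log_gauss_const * (\<integral>z. cmod (laplacian \<phi> z) \<partial>lborel)"
proof -
 let ?M = "gauss_prod {..N}" and ?L = "laplacian \<phi>" and ?K = "kernel_diag N P"
 let ?f = "random_poly N P"
 let ?C = "enn2real log_gauss_const"
 interpret M: prob_space ?M by (rule prob_space_gauss_prod)
 interpret pr: pair_sigma_finite ?M "lborel :: complex measure" ..
 have cL: "continuous_on UNIV ?L" by (rule continuous_laplacian[OF sm])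
 have lz: "\<And>z. cmod z > R \<Longrightarrow> ?L z = 0" using 0 by (rule laplacian_zero_outside)
 have Lm[measurable]: "?L \<in> borel_measurable borel" using cL by (rule borel_measurable_continuous_onI)
 have iL: "integrable lborel ?L" by (rule integrable_continuous_bounded_support[OF cL lz])
 have Km[measurable]: "?K \<in> borel_measurable borel" by (rule borel_measurable_continuous_onI[OF continuous_kernel_diag])
 have fm: "?f \<in> measurable ?M (poly_borel N)"
  unfolding poly_borel_def
 proof (rule measurable_vimage_algebra2)
  show "?f \<in> space ?M \<rightarrow> {f. degree f \<le> N}"
   unfolding random_poly_def using deg
   by (auto intro!: degree_sum_le order_trans[OF degree_smult_le])
  have "(\<lambda>a. \<lambda>j\<in>{..N}. \<Sum>i\<le>N. a i * coeff (P i) j) \<in> ?M \<rightarrow>\<^sub>M (\<Pi>\<^sub>M j\<in>{..N}. borel)"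
   by measurable
  then show "(\<lambda>a. \<lambda>j\<in>{..N}. coeff (?f a) j) \<in> ?M \<rightarrow>\<^sub>M (\<Pi>\<^sub>M j\<in>{..N}. borel)"
   by (simp add: random_poly_def coeff_sum)
 qed
 define H where "H a z = ln ((cmod (poly (?f a) z))\<^sup>2) *\<^sub>R ?L z" for a z
 define S where "S a = (\<integral>z. H a z \<partial>lborel)" for a
 have zd: "AE a in ?M. (green_const * real N) *\<^sub>R zero_distribution N (?f a) \<phi> = S a"
 proof -
  have "AE a in ?M. ?f a \<noteq> 0 \<and> rsquarefree (?f a)"
   using pos P0 unfolding kernel_diag_def by (rule AE_random_poly_simple_zeros)
  then show ?thesis
  proof eventually_elim
   case (elim a)
   have "S a = green_const *\<^sub>R (\<Sum>z | poly (?f a) z = 0. \<phi> z)"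
    unfolding S_def H_def using elim by (intro green_formula_poly(1)[OF sm 0]) auto
   then show ?case using N by (simp add: zero_distribution_def scaleR_conv_of_real)
  qed
 qed
 have lnE: "(\<integral>\<^sup>+a. ennreal \<bar>ln (cmod (poly (?f a) z))\<bar> \<partial>?M) \<le> ennreal (?C + \<bar>ln (?K z)\<bar> / 2)"
    "integrable ?M (\<lambda>a. ln (cmod (poly (?f a) z)))"
    "\<bar>(\<integral>a. ln (cmod (poly (?f a) z)) \<partial>?M) - ln (?K z) / 2\<bar> \<le> ?C" for z
  unfolding poly_random_poly
  using log_gauss_expectation[of "{..N}" "\<lambda>j. poly (P j) z" "?K z"] pos[of z] by (auto simp: kernel_diag_def)
 have ln2: "ln ((cmod w)\<^sup>2) = 2 * ln (cmod w)" for w :: complex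
  by (cases "w = 0") (simp_all add: ln_realpow)
 have [measurable]: "(\<lambda>(a, z). H a z) \<in> borel_measurable (?M \<Otimes>\<^sub>M lborel)"
  unfolding H_def case_prod_beta' using measurable_random_poly_pair[of N P] by measurable
 have iH: "integrable (?M \<Otimes>\<^sub>M lborel) (\<lambda>(a, z). H a z)"
 proof (rule integrableI_bounded)
  have "(\<integral>\<^sup>+p. ennreal (norm (case p of (a, z) \<Rightarrow> H a z)) \<partial>(?M \<Otimes>\<^sub>M lborel)) =
   (\<integral>\<^sup>+z. (\<integral>\<^sup>+a. ennreal (norm (H a z)) \<partial>?M) \<partial>lborel)"
   by (subst pr.nn_integral_snd[symmetric]) (auto simp: case_prod_beta')
  also have "\<dots> \<le> (\<integral>\<^sup>+z. ennreal (norm ((2 * ?C + \<bar>ln (?K z)\<bar>) *\<^sub>R ?L z)) \<partial>lborel)"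
  proof (rule nn_integral_mono)
   fix z
   have "(\<integral>\<^sup>+a. ennreal (norm (H a z)) \<partial>?M) = (\<integral>\<^sup>+a. ennreal (2 * cmod (?L z)) * ennreal \<bar>ln (cmod (poly (?f a) z))\<bar> \<partial>?M)"
    by (intro nn_integral_cong) (simp add: H_def ln2 ennreal_mult[symmetric] abs_mult algebra_simps)
   also have "\<dots> = ennreal (2 * cmod (?L z)) * (\<integral>\<^sup>+a. ennreal \<bar>ln (cmod (poly (?f a) z))\<bar> \<partial>?M)"
    by (rule nn_integral_cmult) measurable
   also have "\<dots> \<le> ennreal (2 * cmod (?L z)) * ennreal (?C + \<bar>ln (?K z)\<bar> / 2)"
    by (intro mult_left_mono lnE) auto
   also have "\<dots> = ennreal (norm ((2 * ?C + \<bar>ln (?K z)\<bar>) *\<^sub>R ?L z))"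
   proof -
    have "0 \<le> ?C" by simp
    then have "norm ((2 * ?C + \<bar>ln (?K z)\<bar>) *\<^sub>R ?L z) = 2 * cmod (?L z) * (?C + \<bar>ln (?K z)\<bar> / 2)"
     by (simp only: norm_scaleR) (simp add: algebra_simps)
    then have "ennreal (norm ((2 * ?C + \<bar>ln (?K z)\<bar>) *\<^sub>R ?L z)) = ennreal (2 * cmod (?L z) * (?C + \<bar>ln (?K z)\<bar> / 2))"
     by (rule arg_cong)
    also have "\<dots> = ennreal (2 * cmod (?L z)) * ennreal (?C + \<bar>ln (?K z)\<bar> / 2)"
     by (rule ennreal_mult) (use \<open>0 \<le> ?C\<close> in auto)
    finally show ?thesis by (rule sym)
   qed
   finally show "(\<integral>\<^sup>+a. ennreal (norm (H a z)) \<partial>?M) \<le> ennreal (norm ((2 * ?C + \<bar>ln (?K z)\<bar>) *\<^sub>R ?L z))" .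
  qed
  also have "\<dots> < \<infinity>"
  proof -
   have "integrable lborel (\<lambda>z. (2 * ?C + \<bar>ln (?K z)\<bar>) *\<^sub>R ?L z)"
    using pos by (intro integrable_continuous_bounded_support[of _ R] continuous_intros cL continuous_kernel_diag)
     (auto simp: lz less_imp_neq[THEN not_sym])
   then show ?thesis by (auto simp: integrable_iff_bounded)
  qed
  finally show "(\<integral>\<^sup>+p. ennreal (norm (case p of (a, z) \<Rightarrow> H a z)) \<partial>(?M \<Otimes>\<^sub>M lborel)) < \<infinity>" .
 qed measurable
 have "(green_const * real N) *\<^sub>R (\<integral>f. zero_distribution N f \<phi> \<partial>gaussian_poly N P) =
   (green_const * real N) *\<^sub>R (\<integral>a. zero_distribution N (?f a) \<phi> \<partial>?M)"
  unfolding gaussian_poly_def random_poly_def[symmetric]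
  by (subst integral_distr[OF fm measurable_zero_distribution[OF smooth_imp_continuous[OF sm]]]) simp
 also have "\<dots> = (\<integral>a. (green_const * real N) *\<^sub>R zero_distribution N (?f a) \<phi> \<partial>?M)"
  by (rule integral_scaleR_right[symmetric])
 also have "\<dots> = (\<integral>a. S a \<partial>?M)"
 proof (rule integral_cong_AE[OF _ _ zd])
  show "(\<lambda>a. (green_const * real N) *\<^sub>R zero_distribution N (?f a) \<phi>) \<in> borel_measurable ?M"
   using measurable_compose[OF fm measurable_zero_distribution[OF smooth_imp_continuous[OF sm]]] by measurable
  show "S \<in> borel_measurable ?M" unfolding S_def by measurable
 qed
 also have "\<dots> = (\<integral>z. (\<integral>a. H a z \<partial>?M) \<partial>lborel)"
  unfolding S_def by (rule pr.Fubini_integral[OF iH, symmetric])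
 also have "\<dots> = (\<integral>z. (2 * (\<integral>a. ln (cmod (poly (?f a) z)) \<partial>?M)) *\<^sub>R ?L z \<partial>lborel)"
  unfolding H_def ln2 by (intro Bochner_Integration.integral_cong refl) (simp add: lnE(2))
 finally have main: "(green_const * real N) *\<^sub>R (\<integral>f. zero_distribution N f \<phi> \<partial>gaussian_poly N P) =
   (\<integral>z. (2 * (\<integral>a. ln (cmod (poly (?f a) z)) \<partial>?M)) *\<^sub>R ?L z \<partial>lborel)" .
 define E where "E z = 2 * (\<integral>a. ln (cmod (poly (?f a) z)) \<partial>?M)" for z
 have iE: "integrable lborel (\<lambda>z. E z *\<^sub>R ?L z)"
 proof -
  have "integrable lborel (\<lambda>z. \<integral>a. H a z \<partial>?M)" using pr.integrable_snd[OF iH] by simp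
  then show ?thesis unfolding H_def ln2 E_def by (simp add: lnE(2))
 qed
 have iK: "integrable lborel (\<lambda>z. ln (?K z) *\<^sub>R ?L z)"
  using pos by (intro integrable_continuous_bounded_support[of _ R] continuous_intros cL continuous_kernel_diag)
    (auto simp: lz less_imp_neq[THEN not_sym])
 have "cmod ((\<integral>z. E z *\<^sub>R ?L z \<partial>lborel) - (\<integral>z. ln (?K z) *\<^sub>R ?L z \<partial>lborel)) =
   cmod (\<integral>z. E z *\<^sub>R ?L z - ln (?K z) *\<^sub>R ?L z \<partial>lborel)"
  using iE iK by simp
 also have "\<dots> \<le> (\<integral>z. 2 * ?C * cmod (?L z) \<partial>lborel)"
 proof (rule Bochner_Integration.integral_norm_bound_integral)
  show "integrable lborel (\<lambda>z. E z *\<^sub>R ?L z - ln (?K z) *\<^sub>R ?L z)" using iE iK by auto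
  show "integrable lborel (\<lambda>z. 2 * ?C * cmod (?L z))" using iL by auto
  fix z
  have "norm (E z *\<^sub>R ?L z - ln (?K z) *\<^sub>R ?L z) = \<bar>E z - ln (?K z)\<bar> * cmod (?L z)"
   by (simp add: scaleR_diff_left[symmetric] del: scaleR_diff_left)
  also have "\<dots> \<le> 2 * ?C * cmod (?L z)"
   using lnE(3)[of z] unfolding E_def by (intro mult_right_mono) auto
  finally show "norm (E z *\<^sub>R ?L z - ln (?K z) *\<^sub>R ?L z) \<le> 2 * ?C * cmod (?L z)" .
 qed
 also have "\<dots> = 2 * ?C * (\<integral>z. cmod (?L z) \<partial>lborel)" by simp
 finally show ?thesis unfolding main E_def .
qed

section \<open>Positive definiteness of the logarithmic kernel\<close>

text \<open>On a set of diameter at most \<open>d\<close> the shift by \<open>ln d\<close> makes the kernel nonnegative, so that energies are integrals without cancellation.\<close>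
definition shifted_log_kernel :: "real \<Rightarrow> complex \<Rightarrow> complex \<Rightarrow> ennreal" where
 "shifted_log_kernel d z w = (if z = w then \<infinity> else ennreal (ln (d / cmod (z - w))))"

lemma measurable_shifted_log_kernel [measurable]:
 "(\<lambda>p. shifted_log_kernel d (fst p) (snd p)) \<in> borel_measurable (borel \<Otimes>\<^sub>M borel)"
 unfolding shifted_log_kernel_def by measurable

lemma exp_half_line_tendsto: assumes "s > (0::real)" shows "((\<lambda>t. - exp (- t * s) / (2 * s)) \<longlongrightarrow> 0) at_top"
proof -
 have "filterlim (\<lambda>t. s * t) at_top at_top"
  using assms by (intro filterlim_tendsto_pos_mult_at_top[OF tendsto_const _ filterlim_ident])
 then have "filterlim (\<lambda>t. - (s * t)) at_bot at_top" by (simp add: filterlim_uminus_at_bot)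
 then have "((\<lambda>t. exp (- (s * t))) \<longlongrightarrow> 0) at_top" by (rule filterlim_compose[OF exp_at_bot])
 then have "((\<lambda>t. - exp (- (s * t)) / (2 * s)) \<longlongrightarrow> - 0 / (2 * s)) at_top"
  using assms by (intro tendsto_intros) auto
 then show ?thesis by (simp add: mult.commute)
qed

lemma nn_integral_exp_half_line:
 assumes "s > (0::real)"
 shows "(\<integral>\<^sup>+t. indicator {0..} t * ennreal (exp (- t * s) / 2) \<partial>lborel) = ennreal (1 / (2 * s))"
proof -
 have "(\<integral>\<^sup>+t. ennreal (exp (- t * s) / 2) * indicator {0..} t \<partial>lborel) = ennreal (0 - (- exp (- 0 * s) / (2 * s)))"
 proof (rule nn_integral_FTC_atLeast)
  show "((\<lambda>t. - exp (- t * s) / (2 * s)) has_real_derivative exp (- t * s) / 2) (at t)" for t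
   using assms by (auto intro!: derivative_eq_intros)
  show "((\<lambda>t. - exp (- t * s) / (2 * s)) \<longlongrightarrow> 0) at_top"
   using assms by (rule exp_half_line_tendsto)
 qed auto
 then show ?thesis by (simp add: mult.commute)
qed

lemma nn_integral_inverse_Icc:
 assumes "0 < a" "a \<le> b"
 shows "(\<integral>\<^sup>+s. indicator {a..b} s * ennreal (1 / (2 * s)) \<partial>lborel) = ennreal (ln b / 2 - ln a / 2)"
proof -
 have "(\<integral>\<^sup>+s. ennreal (1 / (2 * s)) * indicator {a..b} s \<partial>lborel) = ennreal (ln b / 2 - ln a / 2)"
 proof (rule nn_integral_FTC_Icc[where F="\<lambda>s. ln s / 2"])
  fix s assume "s \<in> {a..b}"
  then have "((\<lambda>s. ln s / 2) has_real_derivative 1 / s / 2) (at s)"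
   using assms by (intro DERIV_cdivide DERIV_ln_divide) auto
  then show "((\<lambda>s. ln s / 2) has_real_derivative 1 / (2 * s)) (at s)" by (simp add: mult.commute)
 qed (use assms in auto)
 then show ?thesis by (simp add: mult.commute)
qed

text \<open>Frullani's integral for $\ln d^2 - \ln |z-w|^2$. It writes the logarithmic kernel, up to a constant, as a superposition of Gaussian kernels, each of which is positive definite.\<close>
lemma shifted_log_kernel_gauss_mixture:
 assumes d: "d > 0"
 shows "shifted_log_kernel d z w =
  (\<integral>\<^sup>+t. indicator {0<..} t * ennreal ((exp (- t * (cmod (z - w))\<^sup>2) - exp (- t * d\<^sup>2)) / (2 * t)) \<partial>lborel)"
proof -
 define a where "a = (cmod (z - w))\<^sup>2"
 define b where "b = d\<^sup>2"
 have ab: "a \<ge> 0" "b > 0" using d by (auto simp: a_def b_def)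
 have AE0: "AE t in lborel. (t::real) \<noteq> 0" by (rule AE_lborel_singleton)
 have in1: "indicator {0<..} t * ennreal ((exp (- t * a) - exp (- t * b)) / (2 * t)) =
  (\<integral>\<^sup>+s. indicator {0..} t * (indicator {a..b} s * ennreal (exp (- t * s) / 2)) \<partial>lborel)" if "t \<noteq> 0" for t :: real
 proof (cases "t > 0 \<and> a \<le> b")
  case True
  have "(\<integral>\<^sup>+s. ennreal (exp (- t * s) / 2) * indicator {a..b} s \<partial>lborel) = ennreal (- exp (- t * b) / (2 * t) - (- exp (- t * a) / (2 * t)))"
  proof (rule nn_integral_FTC_Icc[where F="\<lambda>s. - exp (- t * s) / (2 * t)"])
   show "((\<lambda>s. - exp (- t * s) / (2 * t)) has_real_derivative exp (- t * s) / 2) (at s)" for s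
    using True by (auto intro!: derivative_eq_intros)
  qed (use True in auto)
  also have "- exp (- t * b) / (2 * t) - (- exp (- t * a) / (2 * t)) = (exp (- t * a) - exp (- t * b)) / (2 * t)"
   by (simp add: diff_divide_distrib)
  finally show ?thesis using True by (simp add: mult.commute)
 next
  case False
  show ?thesis
  proof (cases "t > 0")
   case True
   then have "b < a" using False by simp
   then have "(exp (- t * a) - exp (- t * b)) / (2 * t) \<le> 0" using True by (intro divide_nonpos_pos) auto
   then have "ennreal ((exp (- t * a) - exp (- t * b)) / (2 * t)) = 0" by (rule ennreal_neg)
   then show ?thesis using \<open>b < a\<close> by simp
  qed (use that in auto)
 qed
 have "(\<integral>\<^sup>+t. indicator {0<..} t * ennreal ((exp (- t * a) - exp (- t * b)) / (2 * t)) \<partial>lborel) =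
   (\<integral>\<^sup>+t. \<integral>\<^sup>+s. indicator {0..} t * (indicator {a..b} s * ennreal (exp (- t * s) / 2)) \<partial>lborel \<partial>lborel)"
  by (rule nn_integral_cong_AE, use AE0 in eventually_elim, rule in1)
 also have "\<dots> = (\<integral>\<^sup>+s. \<integral>\<^sup>+t. indicator {0..} t * (indicator {a..b} s * ennreal (exp (- t * s) / 2)) \<partial>lborel \<partial>lborel)"
  by (rule lborel_pair.Fubini') measurable
 also have "\<dots> = (\<integral>\<^sup>+s. indicator {a..b} s * ennreal (1 / (2 * s)) \<partial>lborel)"
 proof (rule nn_integral_cong_AE, use AE0 in eventually_elim)
  fix s :: real assume s: "s \<noteq> 0"
  have "(\<integral>\<^sup>+t. indicator {0..} t * (indicator {a..b} s * ennreal (exp (- t * s) / 2)) \<partial>lborel) =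
    (\<integral>\<^sup>+t. indicator {a..b} s * (indicator {0..} t * ennreal (exp (- t * s) / 2)) \<partial>lborel)"
   by (intro nn_integral_cong) (simp add: ac_simps)
  also have "\<dots> = indicator {a..b} s * (\<integral>\<^sup>+t. indicator {0..} t * ennreal (exp (- t * s) / 2) \<partial>lborel)"
   by (rule nn_integral_cmult) measurable
  also have "\<dots> = indicator {a..b} s * ennreal (1 / (2 * s))"
   using nn_integral_exp_half_line[of s] s ab by (cases "s \<in> {a..b}") auto
  finally show "(\<integral>\<^sup>+t. indicator {0..} t * (indicator {a..b} s * ennreal (exp (- t * s) / 2)) \<partial>lborel) = indicator {a..b} s * ennreal (1 / (2 * s))" .
 qed
 also have "\<dots> = shifted_log_kernel d z w"
 proof (cases "z = w")
  case True
  have ge: "ennreal (real n) \<le> (\<integral>\<^sup>+s. indicator {a..b} s * ennreal (1 / (2 * s)) \<partial>lborel)" for n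
  proof -
   define c where "c = b * exp (- 2 * real n)"
   have c: "0 < c" "c \<le> b" using ab by (simp_all add: c_def mult_le_cancel_left1)
   have "ln b / 2 - ln c / 2 = real n" using ab by (simp add: c_def ln_mult diff_divide_distrib)
   then have "ennreal (real n) = (\<integral>\<^sup>+s. indicator {c..b} s * ennreal (1 / (2 * s)) \<partial>lborel)"
    using nn_integral_inverse_Icc[OF c] by simp
   also have "\<dots> \<le> (\<integral>\<^sup>+s. indicator {a..b} s * ennreal (1 / (2 * s)) \<partial>lborel)"
    using True c by (intro nn_integral_mono) (auto simp: a_def indicator_def)
   finally show ?thesis .
  qed
  have "(\<integral>\<^sup>+s. indicator {a..b} s * ennreal (1 / (2 * s)) \<partial>lborel) = \<infinity>"
  proof (cases "(\<integral>\<^sup>+s. indicator {a..b} s * ennreal (1 / (2 * s)) \<partial>lborel)")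
   case (real r)
   obtain n where "r < real n" using reals_Archimedean2 by blast
   moreover have "real n \<le> r" using ge[of n] real by simp
   ultimately show ?thesis by simp
  qed simp
  then show ?thesis using True by (simp add: shifted_log_kernel_def)
 next
  case False
  then have r: "cmod (z - w) > 0" by simp
  show ?thesis
  proof (cases "a \<le> b")
   case True
   have "ln b / 2 - ln a / 2 = ln (d / cmod (z - w))"
    using r d by (simp add: a_def b_def ln_div ln_realpow)
   then show ?thesis using nn_integral_inverse_Icc[of a b] True False r
    by (simp add: shifted_log_kernel_def a_def)
  next
   case F: False
   then have "d < cmod (z - w)" using d by (simp add: a_def b_def power_less_imp_less_base not_le)
   then have "ln (d / cmod (z - w)) \<le> 0" using d r by simp
   then show ?thesis using F False by (simp add: shifted_log_kernel_def ennreal_neg)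
  qed
 qed
 finally show ?thesis by (simp add: a_def b_def)
qed

definition gauss_energy :: "real \<Rightarrow> complex measure \<Rightarrow> complex measure \<Rightarrow> real" where
 "gauss_energy t \<mu> \<nu> = (\<integral>p. exp (- t * (cmod (fst p - snd p))\<^sup>2) \<partial>(\<mu> \<Otimes>\<^sub>M \<nu>))"

text \<open>The parameter is \<open>2 t\<close> because the product of the Gaussians of parameter \<open>2 t\<close> centred at \<open>z\<close> and \<open>w\<close> has integral proportional to the Gaussian of parameter \<open>t\<close> in $z - w$; hence Gaussian energies are inner products of potentials.\<close>
definition gauss_potential :: "real \<Rightarrow> complex measure \<Rightarrow> complex \<Rightarrow> real" where
 "gauss_potential t \<mu> u = (\<integral>z. exp (- 2 * t * (cmod (z - u))\<^sup>2) \<partial>\<mu>)"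

definition mutual_energy :: "real \<Rightarrow> complex measure \<Rightarrow> complex measure \<Rightarrow> ennreal" where
 "mutual_energy d \<mu> \<nu> = (\<integral>\<^sup>+p. shifted_log_kernel d (fst p) (snd p) \<partial>(\<mu> \<Otimes>\<^sub>M \<nu>))"

locale two_prob =
 fixes \<mu> \<nu> :: "complex measure"
 assumes \<mu>: "prob_space \<mu>" "sets \<mu> = sets borel"
  and \<nu>: "prob_space \<nu>" "sets \<nu> = sets borel"
begin

sublocale \<mu>: prob_space \<mu> by (rule \<mu>)
sublocale \<nu>: prob_space \<nu> by (rule \<nu>)
sublocale pair: pair_prob_space \<mu> \<nu> ..

declare \<mu>(2) [measurable_cong, simp] \<nu>(2) [measurable_cong, simp]

lemma space_eq [simp]: "space \<mu> = UNIV" "space \<nu> = UNIV"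
 using sets_eq_imp_space_eq[OF \<mu>(2)] sets_eq_imp_space_eq[OF \<nu>(2)] by auto

lemma integrable_gauss_pair:
 assumes "t \<ge> 0"
 shows "integrable (\<mu> \<Otimes>\<^sub>M \<nu>) (\<lambda>p. exp (- t * (cmod (fst p - snd p))\<^sup>2))"
 using assms by (intro pair.integrable_const_bound[where B=1]) auto

lemma integrable_gauss_potential:
 assumes "t \<ge> 0"
 shows "integrable \<mu> (\<lambda>z. exp (- 2 * t * (cmod (z - u))\<^sup>2))"
    "integrable \<nu> (\<lambda>z. exp (- 2 * t * (cmod (z - u))\<^sup>2))"
 using assms by (auto intro!: \<mu>.integrable_const_bound[where B=1] \<nu>.integrable_const_bound[where B=1])

lemma gauss_potential_measurable [measurable]:
 "gauss_potential t \<mu> \<in> borel_measurable borel" "gauss_potential t \<nu> \<in> borel_measurable borel"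
 unfolding gauss_potential_def[abs_def] by measurable

lemma gauss_potential_nonneg: "gauss_potential t \<mu> u \<ge> 0" "gauss_potential t \<nu> u \<ge> 0"
 unfolding gauss_potential_def by (auto intro!: integral_nonneg_AE)

lemma gauss_potential_product:
 assumes t: "t > 0"
 shows "(\<integral>\<^sup>+u. ennreal (gauss_potential t \<mu> u * gauss_potential t \<nu> u) \<partial>lborel) =
     ennreal (pi / (4 * t) * gauss_energy t \<mu> \<nu>)"
proof -
 have nn: "ennreal (gauss_potential t \<mu> u) = (\<integral>\<^sup>+z. ennreal (exp (- 2 * t * (cmod (z - u))\<^sup>2)) \<partial>\<mu>)"
      "ennreal (gauss_potential t \<nu> u) = (\<integral>\<^sup>+z. ennreal (exp (- 2 * t * (cmod (z - u))\<^sup>2)) \<partial>\<nu>)" for u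
  using integrable_gauss_potential[of t u] t by (auto simp: gauss_potential_def nn_integral_eq_integral)
 have "(\<integral>\<^sup>+u. ennreal (gauss_potential t \<mu> u * gauss_potential t \<nu> u) \<partial>lborel) =
  (\<integral>\<^sup>+u. (\<integral>\<^sup>+z. (\<integral>\<^sup>+w. ennreal (exp (- 2 * t * (cmod (z - u))\<^sup>2)) * ennreal (exp (- 2 * t * (cmod (w - u))\<^sup>2)) \<partial>\<nu>) \<partial>\<mu>) \<partial>lborel)"
  by (intro nn_integral_cong)
    (simp add: ennreal_mult gauss_potential_nonneg nn nn_integral_cmult nn_integral_multc)
 also have "\<dots> = (\<integral>\<^sup>+u. (\<integral>\<^sup>+p. ennreal (exp (- 2 * t * (cmod (fst p - u))\<^sup>2)) * ennreal (exp (- 2 * t * (cmod (snd p - u))\<^sup>2)) \<partial>(\<mu> \<Otimes>\<^sub>M \<nu>)) \<partial>lborel)"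
  by (intro nn_integral_cong) (subst \<nu>.nn_integral_fst[symmetric], auto)
 also have "\<dots> = (\<integral>\<^sup>+p. (\<integral>\<^sup>+u. ennreal (exp (- 2 * t * (cmod (fst p - u))\<^sup>2)) * ennreal (exp (- 2 * t * (cmod (snd p - u))\<^sup>2)) \<partial>lborel) \<partial>(\<mu> \<Otimes>\<^sub>M \<nu>))"
 proof -
  interpret pl: pair_sigma_finite "\<mu> \<Otimes>\<^sub>M \<nu>" "lborel :: complex measure" ..
  show ?thesis by (rule pl.Fubini') measurable
 qed
 also have "\<dots> = (\<integral>\<^sup>+p. ennreal (exp (- t * (cmod (fst p - snd p))\<^sup>2)) * ennreal (pi / (4 * t)) \<partial>(\<mu> \<Otimes>\<^sub>M \<nu>))"
 proof (rule nn_integral_cong)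
  fix p :: "complex \<times> complex"
  define m where "m = (fst p + snd p) / 2"
  have par: "2 * t * (cmod (fst p - u))\<^sup>2 + 2 * t * (cmod (snd p - u))\<^sup>2 = t * (cmod (fst p - snd p))\<^sup>2 + 4 * t * (cmod (u - m))\<^sup>2" for u
   unfolding cmod_power2 m_def by (simp add: power2_eq_square field_simps)
  have "(\<integral>\<^sup>+u. ennreal (exp (- 2 * t * (cmod (fst p - u))\<^sup>2)) * ennreal (exp (- 2 * t * (cmod (snd p - u))\<^sup>2)) \<partial>lborel) =
   (\<integral>\<^sup>+u. ennreal (exp (- t * (cmod (fst p - snd p))\<^sup>2)) * ennreal (exp (- (4 * t) * (cmod (u - m))\<^sup>2)) \<partial>lborel)"
  proof (rule nn_integral_cong)
   fix u
   have "exp (- 2 * t * (cmod (fst p - u))\<^sup>2) * exp (- 2 * t * (cmod (snd p - u))\<^sup>2) =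
     exp (- t * (cmod (fst p - snd p))\<^sup>2) * exp (- (4 * t) * (cmod (u - m))\<^sup>2)"
    unfolding exp_add[symmetric] using par[of u] by (intro arg_cong[where f=exp]) linarith
   then show "ennreal (exp (- 2 * t * (cmod (fst p - u))\<^sup>2)) * ennreal (exp (- 2 * t * (cmod (snd p - u))\<^sup>2)) =
     ennreal (exp (- t * (cmod (fst p - snd p))\<^sup>2)) * ennreal (exp (- (4 * t) * (cmod (u - m))\<^sup>2))"
    by (simp only: ennreal_mult[symmetric] exp_ge_zero)
  qed
  also have "\<dots> = ennreal (exp (- t * (cmod (fst p - snd p))\<^sup>2)) * ennreal (pi / (4 * t))"
   using t by (subst nn_integral_cmult, measurable, subst nn_integral_gauss_plane) auto
  finally show "(\<integral>\<^sup>+u. ennreal (exp (- 2 * t * (cmod (fst p - u))\<^sup>2)) * ennreal (exp (- 2 * t * (cmod (snd p - u))\<^sup>2)) \<partial>lborel) =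
    ennreal (exp (- t * (cmod (fst p - snd p))\<^sup>2)) * ennreal (pi / (4 * t))" .
 qed
 also have "\<dots> = (\<integral>\<^sup>+p. ennreal (exp (- t * (cmod (fst p - snd p))\<^sup>2)) \<partial>(\<mu> \<Otimes>\<^sub>M \<nu>)) * ennreal (pi / (4 * t))"
  by (rule nn_integral_multc) measurable
 also have "(\<integral>\<^sup>+p. ennreal (exp (- t * (cmod (fst p - snd p))\<^sup>2)) \<partial>(\<mu> \<Otimes>\<^sub>M \<nu>)) = ennreal (gauss_energy t \<mu> \<nu>)"
  unfolding gauss_energy_def using t by (intro nn_integral_eq_integral integrable_gauss_pair) auto
 finally show ?thesis using t
  by (subst mult.commute, subst ennreal_mult') (auto simp: mult.commute)
qed

lemma integral_gauss_potential_product: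
 assumes t: "t > 0"
 shows "integrable lborel (\<lambda>u. gauss_potential t \<mu> u * gauss_potential t \<nu> u)"
  and "(\<integral>u. gauss_potential t \<mu> u * gauss_potential t \<nu> u \<partial>lborel) = pi / (4 * t) * gauss_energy t \<mu> \<nu>"
proof -
 have e: "gauss_energy t \<mu> \<nu> \<ge> 0" unfolding gauss_energy_def by (auto intro!: integral_nonneg_AE)
 have nn: "0 \<le> gauss_potential t \<mu> u * gauss_potential t \<nu> u" for u
  by (intro mult_nonneg_nonneg gauss_potential_nonneg)
 show "integrable lborel (\<lambda>u. gauss_potential t \<mu> u * gauss_potential t \<nu> u)"
  using gauss_potential_product[OF t] nn by (intro integrableI_nonneg) auto
 show "(\<integral>u. gauss_potential t \<mu> u * gauss_potential t \<nu> u \<partial>lborel) = pi / (4 * t) * gauss_energy t \<mu> \<nu>"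
  using gauss_potential_product[OF t] nn e t by (subst integral_eq_nn_integral) auto
qed

text \<open>For each \<open>t\<close> the contribution is nonnegative, since the diameter is at most \<open>d\<close>; therefore the mixture may be integrated in any order.\<close>
lemma mutual_energy_eq:
 assumes d: "d > 0" and K: "K \<in> sets borel" "AE z in \<mu>. z \<in> K" "AE z in \<nu>. z \<in> K"
  and diam: "\<forall>z\<in>K. \<forall>w\<in>K. cmod (z - w) \<le> d"
 shows "mutual_energy d \<mu> \<nu> = (\<integral>\<^sup>+t. indicator {0<..} t * ennreal ((gauss_energy t \<mu> \<nu> - exp (- t * d\<^sup>2)) / (2 * t)) \<partial>lborel)"
  and "\<And>t. t \<ge> 0 \<Longrightarrow> gauss_energy t \<mu> \<nu> \<ge> exp (- t * d\<^sup>2)"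
proof -
 have AEp: "AE p in \<mu> \<Otimes>\<^sub>M \<nu>. cmod (fst p - snd p) \<le> d"
 proof -
  have "AE z in \<mu>. AE w in \<nu>. cmod (fst (z, w) - snd (z, w)) \<le> d"
   using K(2)
  proof eventually_elim
   case (elim z)
   show ?case using K(3) by eventually_elim (use elim diam in auto)
  qed
  then show ?thesis by (intro pair.AE_pair_measure) measurable
 qed
 have AEe: "AE p in \<mu> \<Otimes>\<^sub>M \<nu>. exp (- t * d\<^sup>2) \<le> exp (- t * (cmod (fst p - snd p))\<^sup>2)" if "t \<ge> 0" for t
  using AEp by eventually_elim (use that in \<open>auto intro!: mult_left_mono power_mono\<close>)
 show ge: "gauss_energy t \<mu> \<nu> \<ge> exp (- t * d\<^sup>2)" if "t \<ge> 0" for t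
 proof -
  have "exp (- t * d\<^sup>2) = (\<integral>p. exp (- t * d\<^sup>2) \<partial>(\<mu> \<Otimes>\<^sub>M \<nu>))" by (simp add: pair.prob_space)
  also have "\<dots> \<le> gauss_energy t \<mu> \<nu>"
   unfolding gauss_energy_def by (intro integral_mono_AE integrable_gauss_pair that AEe) auto
  finally show ?thesis .
 qed
 interpret pl: pair_sigma_finite "lborel :: real measure" "\<mu> \<Otimes>\<^sub>M \<nu>" ..
 have "mutual_energy d \<mu> \<nu> = (\<integral>\<^sup>+p. (\<integral>\<^sup>+t. indicator {0<..} t * ennreal ((exp (- t * (cmod (fst p - snd p))\<^sup>2) - exp (- t * d\<^sup>2)) / (2 * t)) \<partial>lborel) \<partial>(\<mu> \<Otimes>\<^sub>M \<nu>))"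
  unfolding mutual_energy_def by (simp add: shifted_log_kernel_gauss_mixture[OF d])
 also have "\<dots> = (\<integral>\<^sup>+t. (\<integral>\<^sup>+p. indicator {0<..} t * ennreal ((exp (- t * (cmod (fst p - snd p))\<^sup>2) - exp (- t * d\<^sup>2)) / (2 * t)) \<partial>(\<mu> \<Otimes>\<^sub>M \<nu>)) \<partial>lborel)"
  by (rule pl.Fubini') measurable
 also have "\<dots> = (\<integral>\<^sup>+t. indicator {0<..} t * ennreal ((gauss_energy t \<mu> \<nu> - exp (- t * d\<^sup>2)) / (2 * t)) \<partial>lborel)"
 proof (rule nn_integral_cong)
  fix t :: real
  show "(\<integral>\<^sup>+p. indicator {0<..} t * ennreal ((exp (- t * (cmod (fst p - snd p))\<^sup>2) - exp (- t * d\<^sup>2)) / (2 * t)) \<partial>(\<mu> \<Otimes>\<^sub>M \<nu>)) =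
   indicator {0<..} t * ennreal ((gauss_energy t \<mu> \<nu> - exp (- t * d\<^sup>2)) / (2 * t))"
  proof (cases "t > 0")
   case True
   have i: "integrable (\<mu> \<Otimes>\<^sub>M \<nu>) (\<lambda>p. (exp (- t * (cmod (fst p - snd p))\<^sup>2) - exp (- t * d\<^sup>2)) / (2 * t))"
    using True by (intro Bochner_Integration.integrable_divide Bochner_Integration.integrable_diff integrable_gauss_pair) auto
   have "(\<integral>\<^sup>+p. ennreal ((exp (- t * (cmod (fst p - snd p))\<^sup>2) - exp (- t * d\<^sup>2)) / (2 * t)) \<partial>(\<mu> \<Otimes>\<^sub>M \<nu>)) =
     ennreal (\<integral>p. (exp (- t * (cmod (fst p - snd p))\<^sup>2) - exp (- t * d\<^sup>2)) / (2 * t) \<partial>(\<mu> \<Otimes>\<^sub>M \<nu>))"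
   proof (rule nn_integral_eq_integral[OF i])
    show "AE p in \<mu> \<Otimes>\<^sub>M \<nu>. 0 \<le> (exp (- t * (cmod (fst p - snd p))\<^sup>2) - exp (- t * d\<^sup>2)) / (2 * t)"
     using AEe[OF less_imp_le[OF True]] by eventually_elim (use True in auto)
   qed
   also have "(\<integral>p. (exp (- t * (cmod (fst p - snd p))\<^sup>2) - exp (- t * d\<^sup>2)) / (2 * t) \<partial>(\<mu> \<Otimes>\<^sub>M \<nu>)) = (gauss_energy t \<mu> \<nu> - exp (- t * d\<^sup>2)) / (2 * t)"
    using integrable_gauss_pair[of t] True
    by (simp add: gauss_energy_def pair.prob_space del: mult_minus_left)
   finally show ?thesis using True by simp
  qed simp
 qed
 finally show "mutual_energy d \<mu> \<nu> = (\<integral>\<^sup>+t. indicator {0<..} t * ennreal ((gauss_energy t \<mu> \<nu> - exp (- t * d\<^sup>2)) / (2 * t)) \<partial>lborel)" .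
qed

lemma gauss_energy_measurable [measurable]: "(\<lambda>t. gauss_energy t \<mu> \<nu>) \<in> borel_measurable borel"
 unfolding gauss_energy_def by measurable

end

text \<open>The Gaussian energy of the signed measure $\mu - \nu$.\<close>
definition gauss_discrepancy :: "real \<Rightarrow> complex measure \<Rightarrow> complex measure \<Rightarrow> real" where
 "gauss_discrepancy t \<mu> \<nu> = gauss_energy t \<mu> \<mu> + gauss_energy t \<nu> \<nu> - 2 * gauss_energy t \<mu> \<nu>"

context two_prob begin

text \<open>The discrepancy is a multiple of the squared $L^2$ distance of the two potentials; this is the positive definiteness of the Gaussian kernel.\<close>
lemma gauss_discrepancy_eq:
 assumes t: "t > 0"
 shows "integrable lborel (\<lambda>u. (gauss_potential t \<mu> u - gauss_potential t \<nu> u)\<^sup>2)"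
  and "(\<integral>u. (gauss_potential t \<mu> u - gauss_potential t \<nu> u)\<^sup>2 \<partial>lborel) = pi / (4 * t) * gauss_discrepancy t \<mu> \<nu>"
proof -
 interpret mm: two_prob \<mu> \<mu> by unfold_locales (rule \<mu>)
 interpret nn: two_prob \<nu> \<nu> by unfold_locales (rule \<nu>)
 note i = mm.integral_gauss_potential_product[OF t] nn.integral_gauss_potential_product[OF t]
   integral_gauss_potential_product[OF t]
 have e: "(gauss_potential t \<mu> u - gauss_potential t \<nu> u)\<^sup>2 = (gauss_potential t \<mu> u * gauss_potential t \<mu> u
   + gauss_potential t \<nu> u * gauss_potential t \<nu> u) - 2 * (gauss_potential t \<mu> u * gauss_potential t \<nu> u)" for u
  by (simp add: power2_eq_square algebra_simps)
 have i2: "integrable lborel (\<lambda>u. 2 * (gauss_potential t \<mu> u * gauss_potential t \<nu> u))"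
  by (intro integrable_mult_right i)
 have i3: "integrable lborel (\<lambda>u. gauss_potential t \<mu> u * gauss_potential t \<mu> u
   + gauss_potential t \<nu> u * gauss_potential t \<nu> u)"
  by (intro Bochner_Integration.integrable_add i)
 show "integrable lborel (\<lambda>u. (gauss_potential t \<mu> u - gauss_potential t \<nu> u)\<^sup>2)"
  unfolding e by (intro Bochner_Integration.integrable_diff i2 i3)
 show "(\<integral>u. (gauss_potential t \<mu> u - gauss_potential t \<nu> u)\<^sup>2 \<partial>lborel) = pi / (4 * t) * gauss_discrepancy t \<mu> \<nu>"
  unfolding e Bochner_Integration.integral_diff[OF i3 i2] Bochner_Integration.integral_add[OF i(1) i(3)]
   integral_mult_right_zero i gauss_discrepancy_def
  by (simp add: algebra_simps)
qed

lemma gauss_discrepancy_nonneg: "t > 0 \<Longrightarrow> gauss_discrepancy t \<mu> \<nu> \<ge> 0"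
proof -
 assume t: "t > 0"
 have "0 \<le> (\<integral>u. (gauss_potential t \<mu> u - gauss_potential t \<nu> u)\<^sup>2 \<partial>lborel)" by (rule integral_nonneg_AE) simp
 then show ?thesis unfolding gauss_discrepancy_eq(2)[OF t] using t using pi_gt_zero by (auto simp: zero_le_divide_iff zero_le_mult_iff)
qed

lemma gauss_discrepancy_measurable [measurable]: "(\<lambda>t. gauss_discrepancy t \<mu> \<nu>) \<in> borel_measurable borel"
proof -
 interpret mm: two_prob \<mu> \<mu> by unfold_locales (rule \<mu>)
 interpret nn: two_prob \<nu> \<nu> by unfold_locales (rule \<nu>)
 show ?thesis unfolding gauss_discrepancy_def by measurable
qed

text \<open>The polarisation identity, stated additively because energies may be infinite.\<close>
lemma mutual_energy_polarization:
 assumes d: "d > 0" and K: "K \<in> sets borel" "AE z in \<mu>. z \<in> K" "AE z in \<nu>. z \<in> K"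
  and diam: "\<forall>z\<in>K. \<forall>w\<in>K. cmod (z - w) \<le> d"
 shows "mutual_energy d \<mu> \<mu> + mutual_energy d \<nu> \<nu> = 2 * mutual_energy d \<mu> \<nu> +
   (\<integral>\<^sup>+t. indicator {0<..} t * ennreal (gauss_discrepancy t \<mu> \<nu> / (2 * t)) \<partial>lborel)"
proof -
 interpret mm: two_prob \<mu> \<mu> by unfold_locales (rule \<mu>)
 interpret nn: two_prob \<nu> \<nu> by unfold_locales (rule \<nu>)
 let ?e = "\<lambda>t. exp (- t * d\<^sup>2)"
 have "mutual_energy d \<mu> \<mu> + mutual_energy d \<nu> \<nu> =
   (\<integral>\<^sup>+t. indicator {0<..} t * ennreal ((gauss_energy t \<mu> \<mu> - ?e t) / (2 * t)) + indicator {0<..} t * ennreal ((gauss_energy t \<nu> \<nu> - ?e t) / (2 * t)) \<partial>lborel)"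
  unfolding mm.mutual_energy_eq(1)[OF d K(1) K(2) K(2) diam] nn.mutual_energy_eq(1)[OF d K(1) K(3) K(3) diam]
  by (rule nn_integral_add[symmetric]) measurable
 also have "\<dots> = (\<integral>\<^sup>+t. 2 * (indicator {0<..} t * ennreal ((gauss_energy t \<mu> \<nu> - ?e t) / (2 * t))) + indicator {0<..} t * ennreal (gauss_discrepancy t \<mu> \<nu> / (2 * t)) \<partial>lborel)"
 proof (rule nn_integral_cong)
  fix t :: real
  show "indicator {0<..} t * ennreal ((gauss_energy t \<mu> \<mu> - ?e t) / (2 * t)) + indicator {0<..} t * ennreal ((gauss_energy t \<nu> \<nu> - ?e t) / (2 * t)) =
    2 * (indicator {0<..} t * ennreal ((gauss_energy t \<mu> \<nu> - ?e t) / (2 * t))) + indicator {0<..} t * ennreal (gauss_discrepancy t \<mu> \<nu> / (2 * t))"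
  proof (cases "t > 0")
   case True
   have ge: "(gauss_energy t \<mu> \<mu> - ?e t) / (2 * t) \<ge> 0" "(gauss_energy t \<nu> \<nu> - ?e t) / (2 * t) \<ge> 0" "(gauss_energy t \<mu> \<nu> - ?e t) / (2 * t) \<ge> 0"
    "gauss_discrepancy t \<mu> \<nu> / (2 * t) \<ge> 0"
    using True mm.mutual_energy_eq(2)[OF d K(1) K(2) K(2) diam, of t] nn.mutual_energy_eq(2)[OF d K(1) K(3) K(3) diam, of t]
     mutual_energy_eq(2)[OF d K diam, of t] gauss_discrepancy_nonneg[OF True] by simp_all
   have "(gauss_energy t \<mu> \<mu> - ?e t) / (2 * t) + (gauss_energy t \<nu> \<nu> - ?e t) / (2 * t) = 2 * ((gauss_energy t \<mu> \<nu> - ?e t) / (2 * t)) + gauss_discrepancy t \<mu> \<nu> / (2 * t)"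
    unfolding gauss_discrepancy_def by (simp add: diff_divide_distrib add_divide_distrib)
   moreover have "ennreal A + ennreal B = 2 * ennreal C + ennreal D"
    if "A + B = 2 * C + D" "A \<ge> 0" "B \<ge> 0" "C \<ge> 0" "D \<ge> 0" for A B C D
   proof -
    have "ennreal A + ennreal B = ennreal (2 * C + D)" using that by (simp add: ennreal_plus[symmetric] del: ennreal_plus)
    also have "\<dots> = ennreal (2 * C) + ennreal D" using that by (intro ennreal_plus) auto
    also have "ennreal (2 * C) = 2 * ennreal C" using that by (simp add: ennreal_mult)
    finally show ?thesis .
   qed
   ultimately show ?thesis using True ge by simp
  qed simp
 qed
 also have "\<dots> = 2 * mutual_energy d \<mu> \<nu> + (\<integral>\<^sup>+t. indicator {0<..} t * ennreal (gauss_discrepancy t \<mu> \<nu> / (2 * t)) \<partial>lborel)"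
  unfolding mutual_energy_eq(1)[OF d K diam]
  by (subst nn_integral_add, measurable, subst nn_integral_cmult) auto
 finally show ?thesis .
qed

lemma gauss_potential_eq_if_discrepancy_zero:
 assumes t: "t > 0" and 0: "gauss_discrepancy t \<mu> \<nu> = 0"
 shows "AE u in lborel. gauss_potential t \<mu> u = gauss_potential t \<nu> u"
proof -
 have "(\<integral>u. (gauss_potential t \<mu> u - gauss_potential t \<nu> u)\<^sup>2 \<partial>lborel) = 0"
  using gauss_discrepancy_eq(2)[OF t] 0 by simp
 then have "AE u in lborel. (gauss_potential t \<mu> u - gauss_potential t \<nu> u)\<^sup>2 = 0"
  using integral_nonneg_eq_0_iff_AE[OF gauss_discrepancy_eq(1)[OF t]] by simp
 then show ?thesis by eventually_elim simp
qed

text \<open>Equality of the potentials at one scale says that the two measures agree after convolution with a Gaussian of width \<open>s\<close>.\<close>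
lemma gauss_convolution_eq:
 assumes s: "s > 0" and 0: "gauss_discrepancy (1 / (2 * s\<^sup>2)) \<mu> \<nu> = 0" and [measurable]: "f \<in> borel_measurable borel"
 shows "(\<integral>\<^sup>+z. (\<integral>\<^sup>+v. f (z + s *\<^sub>R v) \<partial>std_complex_gaussian) \<partial>\<mu>) = (\<integral>\<^sup>+z. (\<integral>\<^sup>+v. f (z + s *\<^sub>R v) \<partial>std_complex_gaussian) \<partial>\<nu>)"
proof -
 define t where "t = 1 / (2 * s\<^sup>2)"
 have t: "t > 0" using s by (simp add: t_def)
 have conv: "(\<integral>\<^sup>+z. (\<integral>\<^sup>+v. f (z + s *\<^sub>R v) \<partial>std_complex_gaussian) \<partial>M) = (\<integral>\<^sup>+u. f u * (ennreal (1 / (pi * s\<^sup>2)) * ennreal (gauss_potential t M u)) \<partial>lborel)"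
  if M: "prob_space M" "sets M = sets borel" for M :: "complex measure"
 proof -
  interpret M: prob_space M by (rule M)
  interpret pl: pair_sigma_finite M "lborel :: complex measure" ..
  note [measurable_cong] = M(2)
  have im: "integrable M (\<lambda>z. exp (- 2 * t * (cmod (z - u))\<^sup>2))" for u
   using t M(2) by (intro M.integrable_const_bound[where B=1]) auto
  have "(\<integral>\<^sup>+z. (\<integral>\<^sup>+v. f (z + s *\<^sub>R v) \<partial>std_complex_gaussian) \<partial>M) =
    (\<integral>\<^sup>+z. (\<integral>\<^sup>+u. f u * (ennreal (1 / (pi * s\<^sup>2)) * ennreal (exp (- 2 * t * (cmod (z - u))\<^sup>2))) \<partial>lborel) \<partial>M)"
  proof (rule nn_integral_cong)
   fix z
   have "(\<integral>\<^sup>+u. f u * (ennreal (1 / (pi * s\<^sup>2)) * ennreal (exp (- 2 * t * (cmod (z - u))\<^sup>2))) \<partial>lborel) =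
     ennreal (s\<^sup>2) * (\<integral>\<^sup>+v. f (z + s *\<^sub>R v) * (ennreal (1 / (pi * s\<^sup>2)) * ennreal (exp (- 2 * t * (cmod (z - (z + s *\<^sub>R v)))\<^sup>2))) \<partial>lborel)"
    using s by (intro nn_integral_complex_affine) auto
   also have "\<dots> = (\<integral>\<^sup>+v. ennreal (s\<^sup>2) * (f (z + s *\<^sub>R v) * (ennreal (1 / (pi * s\<^sup>2)) * ennreal (exp (- 2 * t * (cmod (z - (z + s *\<^sub>R v)))\<^sup>2)))) \<partial>lborel)"
    by (rule nn_integral_cmult[symmetric]) measurable
   also have "\<dots> = (\<integral>\<^sup>+v. ennreal (gauss_dens 1 v) * f (z + s *\<^sub>R v) \<partial>lborel)"
   proof (rule nn_integral_cong)
    fix v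
    have "2 * t * (cmod (z - (z + s *\<^sub>R v)))\<^sup>2 = (cmod v)\<^sup>2" using s by (simp add: t_def power_mult_distrib)
    then have "s\<^sup>2 * (1 / (pi * s\<^sup>2) * exp (- 2 * t * (cmod (z - (z + s *\<^sub>R v)))\<^sup>2)) = gauss_dens 1 v"
     using s by (simp add: gauss_dens_def)
    then have "ennreal (s\<^sup>2) * (ennreal (1 / (pi * s\<^sup>2)) * ennreal (exp (- 2 * t * (cmod (z - (z + s *\<^sub>R v)))\<^sup>2))) = ennreal (gauss_dens 1 v)"
    proof -
     have "ennreal a * (ennreal b * ennreal c) = ennreal (a * (b * c))" if "a \<ge> 0" "b \<ge> 0" "c \<ge> 0" for a b c
      using that by (simp add: ennreal_mult)
     from this[of "s\<^sup>2" "1 / (pi * s\<^sup>2)" "exp (- 2 * t * (cmod (z - (z + s *\<^sub>R v)))\<^sup>2)"] show ?thesis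
      using \<open>s\<^sup>2 * (1 / (pi * s\<^sup>2) * exp (- 2 * t * (cmod (z - (z + s *\<^sub>R v)))\<^sup>2)) = gauss_dens 1 v\<close> by simp
    qed
    have "ennreal (s\<^sup>2) * (f (z + s *\<^sub>R v) * (ennreal (1 / (pi * s\<^sup>2)) * ennreal (exp (- 2 * t * (cmod (z - (z + s *\<^sub>R v)))\<^sup>2)))) =
      (ennreal (s\<^sup>2) * (ennreal (1 / (pi * s\<^sup>2)) * ennreal (exp (- 2 * t * (cmod (z - (z + s *\<^sub>R v)))\<^sup>2)))) * f (z + s *\<^sub>R v)"
     by (simp only: ac_simps)
    also note \<open>ennreal (s\<^sup>2) * (ennreal (1 / (pi * s\<^sup>2)) * ennreal (exp (- 2 * t * (cmod (z - (z + s *\<^sub>R v)))\<^sup>2))) = ennreal (gauss_dens 1 v)\<close>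
    finally show "ennreal (s\<^sup>2) * (f (z + s *\<^sub>R v) * (ennreal (1 / (pi * s\<^sup>2)) * ennreal (exp (- 2 * t * (cmod (z - (z + s *\<^sub>R v)))\<^sup>2)))) = ennreal (gauss_dens 1 v) * f (z + s *\<^sub>R v)" .
   qed
   also have "\<dots> = (\<integral>\<^sup>+v. f (z + s *\<^sub>R v) \<partial>std_complex_gaussian)"
    by (rule nn_integral_std_complex_gaussian[symmetric]) measurable
   finally show "(\<integral>\<^sup>+v. f (z + s *\<^sub>R v) \<partial>std_complex_gaussian) = (\<integral>\<^sup>+u. f u * (ennreal (1 / (pi * s\<^sup>2)) * ennreal (exp (- 2 * t * (cmod (z - u))\<^sup>2))) \<partial>lborel)" by simp
  qed
  also have "\<dots> = (\<integral>\<^sup>+u. (\<integral>\<^sup>+z. f u * (ennreal (1 / (pi * s\<^sup>2)) * ennreal (exp (- 2 * t * (cmod (z - u))\<^sup>2))) \<partial>M) \<partial>lborel)"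
   by (rule pl.Fubini'[symmetric]) measurable
  also have "\<dots> = (\<integral>\<^sup>+u. f u * (ennreal (1 / (pi * s\<^sup>2)) * ennreal (gauss_potential t M u)) \<partial>lborel)"
   using im by (intro nn_integral_cong) (simp add: nn_integral_cmult gauss_potential_def nn_integral_eq_integral)
  finally show ?thesis .
 qed
 show ?thesis unfolding conv[OF \<mu>] conv[OF \<nu>]
  by (rule nn_integral_cong_AE, use gauss_potential_eq_if_discrepancy_zero[OF t 0[folded t_def]] in eventually_elim) simp
qed

text \<open>There are scales \<open>t\<close> tending to infinity at which the discrepancy vanishes. The measures convolved with Gaussians of the corresponding widths agree, and the widths tend to 0.\<close>
lemma measures_eq_if_discrepancies_vanish:
 assumes 0: "AE t in lborel. t > 0 \<longrightarrow> gauss_discrepancy t \<mu> \<nu> = 0"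
 shows "\<mu> = \<nu>"
proof -
 interpret g: prob_space std_complex_gaussian by (rule prob_space_std_complex_gaussian)
 have "\<exists>t > real n. gauss_discrepancy t \<mu> \<nu> = 0" for n
 proof (rule ccontr)
  assume "\<not> (\<exists>t > real n. gauss_discrepancy t \<mu> \<nu> = 0)"
  note none = this
  have "AE t in lborel. t \<notin> {real n<..<real n + 1}"
   using 0
  proof eventually_elim
   case (elim t)
   show ?case
   proof
    assume "t \<in> {real n<..<real n + 1}"
    then have "t > real n" by simp
    moreover from this have "t > 0" by (rule le_less_trans[rotated]) simp
    ultimately show False using elim none by blast
   qed
  qed
  then have "emeasure lborel {real n<..<real n + 1} = 0"
   by (subst (asm) AE_iff_measurable[where N="{real n<..<real n + 1}"]) auto
  then show False by simp
 qed
 then obtain T where T: "\<And>n. T n > real n" "\<And>n. gauss_discrepancy (T n) \<mu> \<nu> = 0" by metis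
 define s where "s n = sqrt (1 / (2 * T n))" for n
 have Tpos: "T n > 0" for n using T(1)[of n] by (meson le_less_trans of_nat_0_le_iff)
 have s: "s n > 0" "1 / (2 * (s n)\<^sup>2) = T n" for n using Tpos[of n] by (simp_all add: s_def)
 have "filterlim T at_top sequentially"
  by (rule filterlim_at_top_mono[OF filterlim_real_sequentially]) (auto intro!: always_eventually less_imp_le T)
 then have "(\<lambda>n. sqrt (1 / (2 * T n))) \<longlonglongrightarrow> sqrt 0"
  by (intro tendsto_real_sqrt tendsto_divide_0[OF tendsto_const] filterlim_at_top_imp_at_infinity
     filterlim_tendsto_pos_mult_at_top[OF tendsto_const]) auto
 then have sl: "s \<longlonglongrightarrow> 0" unfolding s_def[abs_def] by simp
 have cont: "(\<integral>z. f z \<partial>\<mu>) = (\<integral>z. f z \<partial>\<nu>)" if c: "continuous_on UNIV f" and b: "\<And>z. 0 \<le> f z" "\<And>z. f z \<le> 1" for f :: "complex \<Rightarrow> real"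
 proof -
  have fm[measurable]: "f \<in> borel_measurable borel" by (rule borel_measurable_continuous_onI[OF c])
  have lim: "(\<lambda>n. \<integral>p. f (fst p + s n *\<^sub>R snd p) \<partial>(M \<Otimes>\<^sub>M std_complex_gaussian)) \<longlonglongrightarrow> (\<integral>z. f z \<partial>M)"
   "(\<integral>p. f (fst p + s n *\<^sub>R snd p) \<partial>(M \<Otimes>\<^sub>M std_complex_gaussian)) = enn2real (\<integral>\<^sup>+z. (\<integral>\<^sup>+v. ennreal (f (z + s n *\<^sub>R v)) \<partial>std_complex_gaussian) \<partial>M)"
   if M: "prob_space M" "sets M = sets borel" for M :: "complex measure" and n
  proof -
   interpret M: prob_space M by (rule M)
   interpret p: pair_prob_space M std_complex_gaussian ..
   note [measurable_cong] = M(2)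
   have "(\<lambda>n. \<integral>p. f (fst p + s n *\<^sub>R snd p) \<partial>(M \<Otimes>\<^sub>M std_complex_gaussian)) \<longlonglongrightarrow> (\<integral>p. f (fst p) \<partial>(M \<Otimes>\<^sub>M std_complex_gaussian))"
   proof (rule integral_dominated_convergence[where w="\<lambda>_. 1"])
    have "(\<lambda>n. f (fst p + s n *\<^sub>R snd p)) \<longlonglongrightarrow> f (fst p)" for p
    proof -
     have "(\<lambda>n. fst p + s n *\<^sub>R snd p) \<longlonglongrightarrow> fst p + 0 *\<^sub>R snd p" by (intro tendsto_intros sl)
     then show ?thesis using continuous_on_tendsto_compose[OF c] by fastforce
    qed
    then show "AE p in M \<Otimes>\<^sub>M std_complex_gaussian. (\<lambda>n. f (fst p + s n *\<^sub>R snd p)) \<longlonglongrightarrow> f (fst p)" by simp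
    show "AE p in M \<Otimes>\<^sub>M std_complex_gaussian. norm (f (fst p + s n *\<^sub>R snd p)) \<le> 1" for n
     using b by (intro AE_I2) simp
    show "integrable (M \<Otimes>\<^sub>M std_complex_gaussian) (\<lambda>_. 1 :: real)" by simp
   qed measurable
   also have "(\<integral>p. f (fst p) \<partial>(M \<Otimes>\<^sub>M std_complex_gaussian)) = (\<integral>z. f z \<partial>M)"
    using b by (subst p.integral_fst'[symmetric]) (auto intro!: p.P.integrable_const_bound[where B=1] simp: g.prob_space[simplified])
   finally show "(\<lambda>n. \<integral>p. f (fst p + s n *\<^sub>R snd p) \<partial>(M \<Otimes>\<^sub>M std_complex_gaussian)) \<longlonglongrightarrow> (\<integral>z. f z \<partial>M)" .
   show "(\<integral>p. f (fst p + s n *\<^sub>R snd p) \<partial>(M \<Otimes>\<^sub>M std_complex_gaussian)) = enn2real (\<integral>\<^sup>+z. (\<integral>\<^sup>+v. ennreal (f (z + s n *\<^sub>R v)) \<partial>std_complex_gaussian) \<partial>M)"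
    using b by (subst integral_eq_nn_integral, measurable, simp, subst sigma_finite_measure.nn_integral_fst[OF prob_space_imp_sigma_finite[OF prob_space_std_complex_gaussian], symmetric]) auto
  qed
  have "(\<integral>p. f (fst p + s n *\<^sub>R snd p) \<partial>(\<mu> \<Otimes>\<^sub>M std_complex_gaussian)) = (\<integral>p. f (fst p + s n *\<^sub>R snd p) \<partial>(\<nu> \<Otimes>\<^sub>M std_complex_gaussian))" for n
   unfolding lim(2)[OF \<mu>] lim(2)[OF \<nu>]
   using gauss_convolution_eq[OF s(1)[of n], unfolded s(2), OF T(2), of "\<lambda>z. ennreal (f z)"] by simp
  then show ?thesis using lim(1)[OF \<mu>] lim(1)[OF \<nu>] LIMSEQ_unique by simp
 qed
 have op: "emeasure \<mu> U = emeasure \<nu> U" if U: "open U" for U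
 proof (cases "U = UNIV")
  case True
  then show ?thesis using \<mu>.emeasure_space_1 \<nu>.emeasure_space_1 by simp
 next
  case False
  define f where "f k z = min 1 (real k * infdist z (- U))" for k z
  have cf: "continuous_on UNIV (f k)" for k unfolding f_def by (intro continuous_intros)
  have fb: "0 \<le> f k z" "f k z \<le> 1" for k z by (auto simp: f_def infdist_nonneg)
  have fm[measurable]: "f k \<in> borel_measurable borel" for k by (rule borel_measurable_continuous_onI[OF cf])
  have fl: "(\<lambda>k. f k z) \<longlonglongrightarrow> indicator U z" for z
  proof (cases "z \<in> U")
   case True
   have pos: "infdist z (- U) > 0"
   proof -
    have "- U \<noteq> {}" using False by blast
    then have "infdist z (- U) \<noteq> 0"
     using in_closed_iff_infdist_zero[of "- U" z] U True by (simp add: closed_Compl)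
    then show ?thesis using infdist_nonneg[of z "- U"] by linarith
   qed
   have "\<forall>\<^sub>F k in sequentially. 1 / infdist z (- U) \<le> real k"
    using filterlim_real_sequentially unfolding filterlim_at_top by blast
   then have "\<forall>\<^sub>F k in sequentially. f k z = 1"
    by eventually_elim (use pos in \<open>auto simp: f_def min_def field_simps\<close>)
   then show ?thesis using True by (simp add: tendsto_eventually)
  qed (simp add: f_def)
  have "(\<lambda>k. \<integral>z. f k z \<partial>M) \<longlonglongrightarrow> measure M U" if M: "prob_space M" "sets M = sets borel" for M :: "complex measure"
  proof -
   interpret M: prob_space M by (rule M)
   note [measurable_cong] = M(2)
   have [measurable]: "U \<in> sets borel" using U by simp
   have "(\<lambda>k. \<integral>z. f k z \<partial>M) \<longlonglongrightarrow> (\<integral>z. indicator U z \<partial>M)"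
   proof (rule integral_dominated_convergence[where w="\<lambda>_. 1"])
    show "AE z in M. (\<lambda>k. f k z) \<longlonglongrightarrow> indicator U z" using fl by (intro AE_I2)
    show "AE z in M. norm (f k z) \<le> 1" for k using fb by (intro AE_I2) simp
    show "integrable M (\<lambda>_. 1 :: real)" by simp
   qed measurable
   also have "(\<integral>z. indicator U z \<partial>M) = measure M U" using M(2) sets_eq_imp_space_eq[OF M(2)] by simp
   finally show ?thesis .
  qed
  from this[OF \<mu>] this[OF \<nu>] have "measure \<mu> U = measure \<nu> U"
   using cont[OF cf fb] LIMSEQ_unique by simp
  then show ?thesis by (simp add: \<mu>.emeasure_eq_measure \<nu>.emeasure_eq_measure)
 qed
 show ?thesis
 proof (rule measure_eqI_generator_eq[where E="{U. open U}" and \<Omega>=UNIV and A="\<lambda>_. UNIV"])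
  show "sets \<mu> = sigma_sets UNIV {U. open U}" "sets \<nu> = sigma_sets UNIV {U. open U}"
   by (simp_all add: borel_def)
 qed (auto simp: Int_stable_def op)
qed

end

section \<open>The equilibrium measure\<close>

lemma ereal_diff_right_le_iff:
 fixes a b :: ereal shows "a - ereal c \<le> b - ereal c \<longleftrightarrow> a \<le> b"
 by (cases a; cases b) auto

lemma prob_measures_onD:
 assumes "\<mu> \<in> prob_measures_on K"
 shows "prob_space \<mu>" "sets \<mu> = sets borel" "emeasure \<mu> K = 1"
 using assms unfolding prob_measures_on_def by blast+

lemma e2ennreal_ereal_eq: "e2ennreal (ereal x) = ennreal x"
 by (simp add: ennreal.abs_eq e2ennreal_def)

lemma ereal_diff_eq_from_sum:
 fixes I N P :: ennreal
 assumes sum: "I + N = P + ennreal c" and N: "N < \<infinity>" and c: "c \<ge> 0"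
 shows "enn2ereal P - enn2ereal N = enn2ereal I - ereal c"
proof -
 obtain n where n: "N = ennreal n" "n \<ge> 0" using N by (cases N) auto
 show ?thesis
 proof (cases P)
  case (real q)
  then have e: "I + ennreal n = ennreal (q + c)" using sum n c by simp
  obtain i where i: "I = ennreal i" "i \<ge> 0" using e by (cases I) auto
  have "i + n = q + c" using e i n real c by (simp add: ennreal_plus[symmetric] del: ennreal_plus)
  then show ?thesis using i n real by (simp add: enn2ereal_ennreal)
 next
  case top
  then have "I = \<infinity>" using sum n by (cases I) auto
  then show ?thesis using n top by (simp add: enn2ereal_ennreal)
 qed
qed

text \<open>The positive part of the kernel plus \<open>ln d\<close> equals the shifted kernel plus the negative part; the negative part has finite integral because \<open>K\<close> is bounded.\<close>
lemma log_energy_eq_mutual_energy: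
 assumes d: "d \<ge> 1" and K: "K \<in> sets borel" and \<mu>: "\<mu> \<in> prob_measures_on K"
  and diam: "\<forall>z\<in>K. \<forall>w\<in>K. cmod (z - w) \<le> d"
 shows "log_energy \<mu> = enn2ereal (mutual_energy d \<mu> \<mu>) - ereal (ln d)"
proof -
 note p = prob_measures_onD[OF \<mu>]
 interpret two_prob \<mu> \<mu> by (rule two_prob.intro) (rule p)+
 have AEK: "AE z in \<mu>. z \<in> K"
  using p K by (intro \<mu>.AE_in_set_eq_1[THEN iffD2]) (auto simp: \<mu>.emeasure_eq_measure)
 have [measurable]: "(\<lambda>p. log_kernel (fst p) (snd p)) \<in> borel_measurable (\<mu> \<Otimes>\<^sub>M \<mu>)"
  unfolding log_kernel_def by measurable
 let ?P = "(\<integral>\<^sup>+z. \<integral>\<^sup>+w. e2ennreal (log_kernel z w) \<partial>\<mu> \<partial>\<mu>)" and ?N = "(\<integral>\<^sup>+z. \<integral>\<^sup>+w. e2ennreal (- log_kernel z w) \<partial>\<mu> \<partial>\<mu>)"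
 have P: "?P = (\<integral>\<^sup>+p. e2ennreal (log_kernel (fst p) (snd p)) \<partial>(\<mu> \<Otimes>\<^sub>M \<mu>))"
  by (subst \<mu>.nn_integral_fst[symmetric]) auto
 have N: "?N = (\<integral>\<^sup>+p. e2ennreal (- log_kernel (fst p) (snd p)) \<partial>(\<mu> \<Otimes>\<^sub>M \<mu>))"
  by (subst \<mu>.nn_integral_fst[symmetric]) auto
 have pt: "shifted_log_kernel d z w + e2ennreal (- log_kernel z w) = e2ennreal (log_kernel z w) + ennreal (ln d) \<and> e2ennreal (- log_kernel z w) \<le> ennreal (ln d)"
  if "z \<in> K" "w \<in> K" for z w
 proof (cases "z = w")
  case True
  then show ?thesis by (simp add: shifted_log_kernel_def log_kernel_def e2ennreal_neg)
 next
  case False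
  define l where "l = ln (cmod (z - w))"
  have l: "ln (d / cmod (z - w)) = ln d - l" "l \<le> ln d"
   using False d bspec[OF bspec[OF diam that(1)] that(2)] by (auto simp: l_def ln_div)
  have d0: "ln d \<ge> 0" using d by simp
  have e: "log_kernel z w = ereal (- l)" "- log_kernel z w = ereal l" using False by (auto simp: log_kernel_def l_def)
  have e2: "e2ennreal (ereal x) = ennreal x" for x by (rule e2ennreal_ereal_eq)
  show ?thesis
  proof (cases "l \<ge> 0")
   case True
   then show ?thesis using False l d0 unfolding shifted_log_kernel_def e e2
    by (simp add: ennreal_neg ennreal_plus[symmetric] ennreal_leI del: ennreal_plus)
  next
   case F: False
   then show ?thesis using False l d0 unfolding shifted_log_kernel_def e e2
    by (simp add: ennreal_neg ennreal_plus[symmetric] del: ennreal_plus)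
  qed
 qed
 have AEp: "AE p in \<mu> \<Otimes>\<^sub>M \<mu>. fst p \<in> K \<and> snd p \<in> K"
 proof -
  have "AE z in \<mu>. AE w in \<mu>. fst (z, w) \<in> K \<and> snd (z, w) \<in> K"
   using AEK
  proof eventually_elim
   case (elim z)
   show ?case using AEK by eventually_elim (simp add: elim)
  qed
  moreover note [measurable] = K
  ultimately show ?thesis by (intro pair.AE_pair_measure) measurable
 qed
 have sum: "mutual_energy d \<mu> \<mu> + ?N = ?P + ennreal (ln d)"
 proof -
  have "mutual_energy d \<mu> \<mu> + ?N = (\<integral>\<^sup>+p. shifted_log_kernel d (fst p) (snd p) + e2ennreal (- log_kernel (fst p) (snd p)) \<partial>(\<mu> \<Otimes>\<^sub>M \<mu>))"
   unfolding N mutual_energy_def by (rule nn_integral_add[symmetric]) measurable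
  also have "\<dots> = (\<integral>\<^sup>+p. e2ennreal (log_kernel (fst p) (snd p)) + ennreal (ln d) \<partial>(\<mu> \<Otimes>\<^sub>M \<mu>))"
   by (rule nn_integral_cong_AE, use AEp in eventually_elim, use pt in blast)
  also have "\<dots> = ?P + ennreal (ln d)"
   unfolding P by (subst nn_integral_add) (auto simp: pair.emeasure_space_1)
  finally show ?thesis .
 qed
 have "?N \<le> (\<integral>\<^sup>+p. ennreal (ln d) \<partial>(\<mu> \<Otimes>\<^sub>M \<mu>))"
  unfolding N by (rule nn_integral_mono_AE, use AEp in eventually_elim, use pt in blast)
 also have "\<dots> = ennreal (ln d)" by (simp add: pair.emeasure_space_1)
 finally have "?N < \<infinity>" by (rule le_less_trans) simp
 then show ?thesis unfolding log_energy_def using sum d by (intro ereal_diff_eq_from_sum) auto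
qed

text \<open>Constant potential means that the mutual energy of \<open>\<nu>\<close> with every competitor \<open>\<mu>\<close> is \<open>m\<close>. By polarisation the energy of \<open>\<mu>\<close> is \<open>m\<close> plus an integral of discrepancies: it is at least that of \<open>\<nu>\<close>, and equal to it only if all discrepancies vanish.\<close>
theorem equilibrium_measure_eqI:
 assumes d: "d \<ge> 1" and K: "K \<in> sets borel" and hn: "\<nu> \<in> prob_measures_on K"
  and diam: "\<forall>z\<in>K. \<forall>w\<in>K. cmod (z - w) \<le> d"
  and pot: "\<And>z. z \<in> K \<Longrightarrow> (\<integral>\<^sup>+w. shifted_log_kernel d z w \<partial>\<nu>) = ennreal m"
 shows "equilibrium_measure K = \<nu>"
proof -
 have d0: "d > 0" using d by simp
 have AEK: "AE z in \<mu>. z \<in> K" if hm: "\<mu> \<in> prob_measures_on K" for \<mu>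
 proof -
  interpret prob_space \<mu> using hm by (simp add: prob_measures_on_def)
  show ?thesis using hm K by (intro AE_in_set_eq_1[THEN iffD2]) (auto simp: emeasure_eq_measure prob_measures_on_def)
 qed
 have I: "mutual_energy d \<mu> \<nu> = ennreal m" if hm: "\<mu> \<in> prob_measures_on K" for \<mu>
 proof -
  interpret two_prob \<mu> \<nu> by (rule two_prob.intro) (rule prob_measures_onD[OF hm] prob_measures_onD[OF hn])+
  have "mutual_energy d \<mu> \<nu> = (\<integral>\<^sup>+z. \<integral>\<^sup>+w. shifted_log_kernel d z w \<partial>\<nu> \<partial>\<mu>)"
   unfolding mutual_energy_def by (subst \<nu>.nn_integral_fst[symmetric]) auto
  also have "\<dots> = (\<integral>\<^sup>+z. ennreal m \<partial>\<mu>)"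
   by (rule nn_integral_cong_AE, use AEK[OF hm] in eventually_elim) (rule pot)
  finally show ?thesis using \<mu>.emeasure_space_1 by simp
 qed
 have main: "mutual_energy d \<mu> \<mu> = ennreal m + (\<integral>\<^sup>+t. indicator {0<..} t * ennreal (gauss_discrepancy t \<mu> \<nu> / (2 * t)) \<partial>lborel)"
  if hm: "\<mu> \<in> prob_measures_on K" for \<mu>
 proof -
  interpret two_prob \<mu> \<nu> by (rule two_prob.intro) (rule prob_measures_onD[OF hm] prob_measures_onD[OF hn])+
  have "mutual_energy d \<mu> \<mu> + ennreal m = 2 * ennreal m + (\<integral>\<^sup>+t. indicator {0<..} t * ennreal (gauss_discrepancy t \<mu> \<nu> / (2 * t)) \<partial>lborel)"
   using mutual_energy_polarization[OF d0 K AEK[OF hm] AEK[OF hn] diam] I[OF hm] I[OF hn] by simp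
  then have "ennreal m + mutual_energy d \<mu> \<mu> = ennreal m + (ennreal m + (\<integral>\<^sup>+t. indicator {0<..} t * ennreal (gauss_discrepancy t \<mu> \<nu> / (2 * t)) \<partial>lborel))"
   unfolding mult_2 by (simp only: ac_simps)
  then show ?thesis by (simp add: ennreal_add_left_cancel)
 qed
 have E: "log_energy \<mu> = enn2ereal (mutual_energy d \<mu> \<mu>) - ereal (ln d)" if "\<mu> \<in> prob_measures_on K" for \<mu>
  by (rule log_energy_eq_mutual_energy[OF d K that diam])
 have Enu: "log_energy \<nu> = enn2ereal (ennreal m) - ereal (ln d)" using E[OF hn] I[OF hn] by simp
 show ?thesis unfolding equilibrium_measure_def
 proof (rule the_equality)
  have "log_energy \<nu> \<le> log_energy \<mu>" if hm: "\<mu> \<in> prob_measures_on K" for \<mu>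
   unfolding Enu E[OF hm] main[OF hm] by (intro ereal_minus_mono) (auto simp: less_eq_ennreal.rep_eq[symmetric])
  then show "\<nu> \<in> prob_measures_on K \<and> (\<forall>\<mu>\<in>prob_measures_on K. log_energy \<nu> \<le> log_energy \<mu>)" using hn by blast
 next
  fix \<mu> assume *: "\<mu> \<in> prob_measures_on K \<and> (\<forall>\<nu>\<in>prob_measures_on K. log_energy \<mu> \<le> log_energy \<nu>)"
  then have hm: "\<mu> \<in> prob_measures_on K" by blast
  interpret two_prob \<mu> \<nu> by (rule two_prob.intro) (rule prob_measures_onD[OF hm] prob_measures_onD[OF hn])+
  have "log_energy \<mu> \<le> log_energy \<nu>" using * hn by blast
  then have "enn2ereal (mutual_energy d \<mu> \<mu>) \<le> enn2ereal (ennreal m)"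
   unfolding Enu E[OF hm] by (simp only: ereal_diff_right_le_iff)
  then have "mutual_energy d \<mu> \<mu> \<le> ennreal m" by (simp add: less_eq_ennreal.rep_eq)
  then have le: "ennreal m + (\<integral>\<^sup>+t. indicator {0<..} t * ennreal (gauss_discrepancy t \<mu> \<nu> / (2 * t)) \<partial>lborel) \<le> ennreal m + 0"
   unfolding main[OF hm] by simp
  have "(\<integral>\<^sup>+t. indicator {0<..} t * ennreal (gauss_discrepancy t \<mu> \<nu> / (2 * t)) \<partial>lborel) \<le> 0"
   using le by (subst (asm) ennreal_add_left_cancel_le) auto
  then have "AE t in lborel. indicator {0<..} t * ennreal (gauss_discrepancy t \<mu> \<nu> / (2 * t)) = 0"
   by (subst (asm) le_zero_eq, subst (asm) nn_integral_0_iff_AE) auto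
  then have "AE t in lborel. t > 0 \<longrightarrow> gauss_discrepancy t \<mu> \<nu> = 0"
  proof eventually_elim
   case (elim t)
   then show ?case using gauss_discrepancy_nonneg[of t] by (auto simp: ennreal_eq_0_iff divide_le_0_iff)
  qed
  then show "\<mu> = \<nu>" by (rule measures_eq_if_discrepancies_vanish)
 qed
qed

section \<open>Holomorphic extension of a real-analytic curve\<close>

lemma holomorphicI_local:
 assumes "\<And>z. z \<in> S \<Longrightarrow> \<exists>T. z \<in> T \<and> open T \<and> f holomorphic_on T"
 shows "f holomorphic_on S"
 unfolding holomorphic_on_def
proof
 fix z assume "z \<in> S"
 then obtain T where "z \<in> T" "open T" "f holomorphic_on T" using assms by blast
 then have "f field_differentiable at z" by (intro holomorphic_on_imp_differentiable_at)
 then show "f field_differentiable at z within S" by (rule field_differentiable_at_within)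
qed

lemma real_analytic_local_extension:
 assumes "real_analytic (f :: real \<Rightarrow> complex)"
 shows "\<exists>r>0. \<exists>F. F holomorphic_on ball (of_real t) r \<and> (\<forall>s. \<bar>s - t\<bar> < r \<longrightarrow> F (of_real s) = f s)"
proof -
 obtain r c where r: "r > 0" and c: "\<And>s. \<bar>s - t\<bar> < r \<Longrightarrow> (\<lambda>n. ((s - t) ^ n) *\<^sub>R c n) sums f s"
  using assms unfolding real_analytic_def by meson
 define F where "F z = (\<Sum>n. c n * (z - of_real t) ^ n)" for z :: complex
 have sF: "(\<lambda>n. c n * (z - of_real t) ^ n) sums F z" if "z \<in> ball (of_real t) r" for z
 proof -
  have n: "cmod (z - of_real t) < r" using that by (simp add: dist_norm norm_minus_commute)
  then obtain x where x: "cmod (z - of_real t) < x" "x < r" using dense by blast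
  then have x0: "x > 0" by (meson le_less_trans norm_ge_zero)
  have "summable (\<lambda>n. ((t + x - t) ^ n) *\<^sub>R c n)"
   using c[of "t + x"] x x0 by (intro sums_summable[of _ "f (t + x)"]) auto
  then have "summable (\<lambda>n. c n * (complex_of_real x) ^ n)"
   by (simp add: scaleR_conv_of_real mult.commute)
  then have "summable (\<lambda>n. c n * (z - of_real t) ^ n)"
   by (rule powser_inside) (use x x0 in simp)
  then show ?thesis unfolding F_def by (rule summable_sums)
 qed
 have "F holomorphic_on ball (of_real t) r"
  by (rule power_series_holomorphic[of _ _ c]) (rule sF)
 moreover have "F (of_real s) = f s" if "\<bar>s - t\<bar> < r" for s
 proof -
  have "(\<lambda>n. c n * (of_real s - of_real t) ^ n) sums F (of_real s)"
   using that by (intro sF) (simp add: dist_norm norm_minus_commute of_real_diff[symmetric] del: of_real_diff)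
  moreover have "(\<lambda>n. c n * (of_real s - of_real t) ^ n) = (\<lambda>n. ((s - t) ^ n) *\<^sub>R c n)"
   by (simp add: scaleR_conv_of_real mult.commute)
  ultimately show ?thesis using c[OF that] sums_unique2 by metis
 qed
 ultimately show ?thesis using r by blast
qed

lemma holomorphic_eq_if_eq_on_reals:
 assumes F: "F holomorphic_on S" and G: "G holomorphic_on S" and S: "open S" "connected S"
  and x: "complex_of_real x \<in> S" and eq: "\<And>s. complex_of_real s \<in> S \<Longrightarrow> F (of_real s) = G (of_real s)"
  and z: "z \<in> S"
 shows "F z = G z"
proof -
 define U where "U = complex_of_real ` {s. complex_of_real s \<in> S}"
 obtain e where e: "e > 0" "ball (complex_of_real x) e \<subseteq> S" using S(1) x open_contains_ball by blast
 have lim: "complex_of_real x islimpt U"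
  unfolding islimpt_approachable
 proof (intro allI impI)
  fix d :: real assume d: "d > 0"
  define y where "y = x + min d e / 2"
  have y: "0 < y - x" "y - x < d" "y - x < e" using d e(1) by (auto simp: y_def min_def)
  have dy: "dist (complex_of_real y) (of_real x) = y - x"
   using y(1) by (simp add: dist_norm of_real_diff[symmetric] del: of_real_diff)
  have "complex_of_real y \<in> S" using e(2) y(3) dy by (auto simp: dist_commute)
  then show "\<exists>x'\<in>U. x' \<noteq> complex_of_real x \<and> dist x' (complex_of_real x) < d"
   using y dy unfolding U_def by (intro bexI[of _ "complex_of_real y"]) auto
 qed
 have "F z - G z = 0"
  by (rule analytic_continuation[of "\<lambda>z. F z - G z" S U "complex_of_real x"])
    (use F G S x eq z lim in \<open>auto simp: U_def intro!: holomorphic_intros\<close>)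
 then show ?thesis by simp
qed

lemma periodic_int:
 fixes f :: "'a :: ring_1 \<Rightarrow> 'b"
 assumes "\<And>t. f (t + 1) = f t" shows "f (t + of_int n) = f t"
proof (induction n rule: int_induct[where k=0])
 case (step1 i)
 then show ?case using assms[of "t + of_int i"] by (simp add: add.assoc)
next
 case (step2 i)
 then show ?case using assms[of "t + of_int (i - 1)"] by (simp add: add.assoc)
qed simp

text \<open>The power series of \<open>f\<close> at the points of the line extend it to discs, and on overlaps the extensions agree since they agree on the line. Compactness of a period gives a strip covered by the discs.\<close>
lemma real_analytic_periodic_strip_extension:
 assumes an: "real_analytic (f :: real \<Rightarrow> complex)" and per: "\<And>t. f (t + 1) = f t"
 shows "\<exists>e \<Gamma>. e > 0 \<and> \<Gamma> holomorphic_on {z. \<bar>Im z\<bar> < e} \<and> (\<forall>t. \<Gamma> (of_real t) = f t) \<and>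
  (\<forall>z. \<bar>Im z\<bar> < e \<longrightarrow> \<Gamma> (z + 1) = \<Gamma> z)"
proof -
 have "\<forall>t. \<exists>r. r > 0 \<and> (\<exists>F. F holomorphic_on ball (complex_of_real t) r \<and> (\<forall>s. \<bar>s - t\<bar> < r \<longrightarrow> F (of_real s) = f s))"
  using real_analytic_local_extension[OF an] by blast
 from choice[OF this] obtain r where rF: "\<forall>t. r t > 0 \<and> (\<exists>F. F holomorphic_on ball (complex_of_real t) (r t) \<and> (\<forall>s. \<bar>s - t\<bar> < r t \<longrightarrow> F (of_real s) = f s))"
  by (elim exE)
 then have "\<forall>t. \<exists>F. F holomorphic_on ball (complex_of_real t) (r t) \<and> (\<forall>s. \<bar>s - t\<bar> < r t \<longrightarrow> F (of_real s) = f s)"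
  by simp
 from choice[OF this] obtain F where F': "\<forall>t. F t holomorphic_on ball (complex_of_real t) (r t) \<and> (\<forall>s. \<bar>s - t\<bar> < r t \<longrightarrow> F t (of_real s) = f s)"
  by (elim exE)
 have r: "r t > 0" and F: "F t holomorphic_on ball (complex_of_real t) (r t)"
  and Ff: "\<bar>s - t\<bar> < r t \<Longrightarrow> F t (of_real s) = f s" for t s
  using rF F' by simp_all
 let ?K = "complex_of_real ` {0..1}"
 have K: "compact ?K" by (intro compact_continuous_image continuous_intros) auto
 obtain e where e: "e > 0" "\<And>x. x \<in> ?K \<Longrightarrow> \<exists>B\<in>(\<lambda>t. ball (complex_of_real t) (r t)) ` UNIV. ball x e \<subseteq> B"
 proof (rule Heine_Borel_lemma[OF K, of "(\<lambda>t. ball (complex_of_real t) (r t)) ` UNIV"])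
  show "?K \<subseteq> \<Union> ((\<lambda>t. ball (complex_of_real t) (r t)) ` UNIV)"
  proof
   fix x assume "x \<in> ?K"
   then obtain t where "x = complex_of_real t" by blast
   then have "x \<in> ball (complex_of_real t) (r t)" using r[of t] by simp
   then show "x \<in> \<Union> ((\<lambda>t. ball (complex_of_real t) (r t)) ` UNIV)" by blast
  qed
 qed auto
 have fint: "f (t + of_int n) = f t" for t n by (rule periodic_int[of f, OF per])
 have "\<exists>F. F holomorphic_on ball (complex_of_real t) e \<and> (\<forall>s. \<bar>s - t\<bar> < e \<longrightarrow> F (of_real s) = f s)" for t
 proof -
  have "complex_of_real (frac t) \<in> ?K" using frac_ge_0[of t] frac_lt_1[of t] by (intro imageI) auto
  then obtain t' where t': "ball (complex_of_real (frac t)) e \<subseteq> ball (complex_of_real t') (r t')" using e(2) by blast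
  define H where "H z = F t' (z - of_int \<lfloor>t\<rfloor>)" for z
  have tf: "complex_of_real t - of_int \<lfloor>t\<rfloor> = complex_of_real (frac t)" by (simp add: frac_def)
  have sub: "z - of_int \<lfloor>t\<rfloor> \<in> ball (complex_of_real (frac t)) e" if "z \<in> ball (complex_of_real t) e" for z
   using that unfolding tf[symmetric] by (simp add: dist_norm)
  have "H holomorphic_on ball (complex_of_real t) e"
   unfolding H_def
   by (rule holomorphic_on_compose_gen[OF _ F[of t'], unfolded o_def])
     (use sub t' in \<open>auto intro!: holomorphic_intros\<close>)
  moreover have "H (of_real s) = f s" if "\<bar>s - t\<bar> < e" for s
  proof -
   have "complex_of_real s \<in> ball (complex_of_real t) e"
    using that by (simp add: dist_norm of_real_diff[symmetric] abs_minus_commute del: of_real_diff)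
   then have "complex_of_real s - of_int \<lfloor>t\<rfloor> \<in> ball (complex_of_real t') (r t')" using sub t' by blast
   moreover have eq: "complex_of_real s - of_int \<lfloor>t\<rfloor> = complex_of_real (s - of_int \<lfloor>t\<rfloor>)" by simp
   ultimately have "complex_of_real (s - of_int \<lfloor>t\<rfloor>) \<in> ball (complex_of_real t') (r t')" by metis
   then have "\<bar>(s - of_int \<lfloor>t\<rfloor>) - t'\<bar> < r t'"
    unfolding mem_ball dist_norm of_real_diff[symmetric] norm_of_real by linarith
   then have "F t' (complex_of_real (s - of_int \<lfloor>t\<rfloor>)) = f (s - of_int \<lfloor>t\<rfloor>)" by (rule Ff)
   then show ?thesis unfolding H_def eq using fint[of "s - of_int \<lfloor>t\<rfloor>" "\<lfloor>t\<rfloor>"] by simp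
  qed
  ultimately show ?thesis by blast
 qed
 then have "\<forall>t. \<exists>F. F holomorphic_on ball (complex_of_real t) e \<and> (\<forall>s. \<bar>s - t\<bar> < e \<longrightarrow> F (of_real s) = f s)"
  by (rule allI)
 from choice[OF this] obtain G where G': "\<forall>t. G t holomorphic_on ball (complex_of_real t) e \<and> (\<forall>s. \<bar>s - t\<bar> < e \<longrightarrow> G t (of_real s) = f s)"
  by (elim exE)
 have G: "G t holomorphic_on ball (complex_of_real t) e"
  and Gf: "\<bar>s - t\<bar> < e \<Longrightarrow> G t (of_real s) = f s" for t s
  using G' by simp_all
 have Geq: "G t z = G t' z" if z: "z \<in> ball (complex_of_real t) e" "z \<in> ball (complex_of_real t') e" for t t' z
 proof -
  have re: "complex_of_real (Re z) \<in> ball (complex_of_real u) e" if "z \<in> ball (complex_of_real u) e" for u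
  proof -
   have "\<bar>Re (complex_of_real u - z)\<bar> \<le> cmod (complex_of_real u - z)" by (rule abs_Re_le_cmod)
   then show ?thesis using that by (simp add: dist_norm of_real_diff[symmetric] del: of_real_diff)
  qed
  have b: "\<bar>s - u\<bar> < e" if "complex_of_real s \<in> ball (complex_of_real u) e" for s u
   using that unfolding mem_ball dist_norm of_real_diff[symmetric] norm_of_real by linarith
  show ?thesis
  proof (rule holomorphic_eq_if_eq_on_reals[where F="G t" and G="G t'" and z=z and S="ball (complex_of_real t) e \<inter> ball (complex_of_real t') e" and x="Re z"])
   show "G t holomorphic_on ball (complex_of_real t) e \<inter> ball (complex_of_real t') e"
      "G t' holomorphic_on ball (complex_of_real t) e \<inter> ball (complex_of_real t') e"
    using G by (auto intro: holomorphic_on_subset)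
   show "connected (ball (complex_of_real t) e \<inter> ball (complex_of_real t') e)"
    by (intro convex_connected convex_Int) auto
  qed (use z re Gf b in auto)
 qed
 define \<Gamma> where "\<Gamma> z = G (Re z) z" for z
 have in_ball: "z \<in> ball (complex_of_real (Re z)) e" if "\<bar>Im z\<bar> < e" for z
 proof -
  have "complex_of_real (Re z) - z = - (\<i> * of_real (Im z))" by (simp add: complex_eq_iff)
  then show ?thesis using that by (simp add: dist_norm norm_mult)
 qed
 have hol: "\<Gamma> holomorphic_on {z. \<bar>Im z\<bar> < e}"
 proof (rule holomorphicI_local)
  fix z assume "z \<in> {z. \<bar>Im z\<bar> < e}"
  then have zb: "z \<in> ball (complex_of_real (Re z)) e" using in_ball by blast
  define T where "T = ball (complex_of_real (Re z)) e \<inter> {z. \<bar>Im z\<bar> < e}"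
  have "\<Gamma> w = G (Re z) w" if "w \<in> T" for w
   unfolding \<Gamma>_def using that in_ball[of w] by (intro Geq) (auto simp: T_def)
  then have "\<Gamma> holomorphic_on T"
   using holomorphic_on_subset[OF G[of "Re z"], of T] by (subst holomorphic_cong[OF refl]) (auto simp: T_def)
  moreover have "open T" unfolding T_def
   by (intro open_Int open_ball open_Collect_less continuous_intros)
  ultimately show "\<exists>T. z \<in> T \<and> open T \<and> \<Gamma> holomorphic_on T"
   using zb \<open>z \<in> {z. \<bar>Im z\<bar> < e}\<close> by (intro exI[of _ T]) (auto simp: T_def)
 qed
 have real: "\<Gamma> (of_real t) = f t" for t unfolding \<Gamma>_def using Gf[of t t] e(1) by simp
 have "\<Gamma> (z + 1) = \<Gamma> z" if z: "\<bar>Im z\<bar> < e" for z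
 proof (rule holomorphic_eq_if_eq_on_reals[where F="\<lambda>z. \<Gamma> (z + 1)" and G=\<Gamma> and z=z and S="{z. \<bar>Im z\<bar> < e}" and x=0])
  show "(\<lambda>z. \<Gamma> (z + 1)) holomorphic_on {z. \<bar>Im z\<bar> < e}"
   by (rule holomorphic_on_compose_gen[OF _ hol, unfolded o_def]) (auto intro!: holomorphic_intros)
  show "open {z. \<bar>Im z\<bar> < e}" by (intro open_Collect_less continuous_intros)
  have "{z. \<bar>Im z\<bar> < e} = {z. Im z < e} \<inter> {z. Im z > -e}" by auto
  then show "connected {z. \<bar>Im z\<bar> < e}"
   by (auto intro!: convex_connected convex_Int convex_halfspace_Im_lt convex_halfspace_Im_gt)
  show "\<Gamma> (complex_of_real s + 1) = \<Gamma> (complex_of_real s)" for s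
   using real[of s] real[of "s + 1"] per[of s] by simp
 qed (use hol z e(1) in auto)
 then show ?thesis using e(1) hol real by blast
qed

definition annulus :: "real \<Rightarrow> complex set" where
 "annulus R = {w. 1 / R < cmod w \<and> cmod w < R}"

lemma open_annulus: "open (annulus R)"
 unfolding annulus_def by (intro open_Collect_conj open_Collect_less continuous_intros)

lemma annulus_mono: "0 < R' \<Longrightarrow> R' \<le> R \<Longrightarrow> annulus R' \<subseteq> annulus R"
 using frac_le[of 1 1 R' R] by (auto simp: annulus_def)

lemma zero_notin_annulus: "R > 0 \<Longrightarrow> 0 \<notin> annulus R"
 by (simp add: annulus_def)

lemma sphere_subset_annulus: "R > 1 \<Longrightarrow> sphere 0 1 \<subseteq> annulus R"
 by (auto simp: annulus_def)

text \<open>The substitution $w = e^{2 \pi i z}$ turns 1-periodic functions on a strip around the real line into functions on an annulus around the unit circle.\<close>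
lemma real_analytic_periodic_annulus_extension:
 assumes an: "real_analytic (f :: real \<Rightarrow> complex)" and per: "\<And>t. f (t + 1) = f t"
 shows "\<exists>R>1. \<exists>G. G holomorphic_on annulus R \<and> (\<forall>t. G (cis (2 * pi * t)) = f t)"
proof -
 obtain e \<Gamma> where e: "e > 0" and hol: "\<Gamma> holomorphic_on {z. \<bar>Im z\<bar> < e}" and real: "\<And>t. \<Gamma> (of_real t) = f t"
  and p: "\<And>z. \<bar>Im z\<bar> < e \<Longrightarrow> \<Gamma> (z + 1) = \<Gamma> z"
  using real_analytic_periodic_strip_extension[of f, OF an per] by blast
 have pint: "\<Gamma> (z + of_int n) = \<Gamma> z" if "\<bar>Im z\<bar> < e" for z n
 proof (induction n rule: int_induct[where k=0])
  case (step1 i)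
  then show ?case using p[of "z + of_int i"] that by (simp add: add.assoc)
 next
  case (step2 i)
  then show ?case using p[of "z + of_int (i - 1)"] that by (simp add: add.assoc)
 qed simp
 define R where "R = exp (2 * pi * e)"
 have R: "R > 1" using e by (simp add: R_def)
 define G where "G w = \<Gamma> (Ln w / (2 * pi * \<i>))" for w
 have im: "\<bar>Im (u / (2 * pi * \<i>))\<bar> < e" if "exp u \<in> annulus R" for u
 proof -
  have "cmod (exp u) = exp (Re u)" by (rule norm_exp_eq_Re)
  then have "exp (- (2 * pi * e)) < exp (Re u)" "exp (Re u) < exp (2 * pi * e)"
   using that by (auto simp: annulus_def R_def exp_minus inverse_eq_divide)
  then have "\<bar>Re u\<bar> < 2 * pi * e" by auto
  moreover have "Im (u / (2 * pi * \<i>)) = - Re u / (2 * pi)"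
   by (simp add: Im_divide power2_eq_square)
  ultimately show ?thesis by (simp only: abs_divide abs_minus_cancel) (simp add: field_simps)
 qed
 have key: "G (exp u) = \<Gamma> (u / (2 * pi * \<i>))" if u: "exp u \<in> annulus R" for u
 proof -
  have "exp (Ln (exp u)) = exp u" by simp
  then obtain n where n: "Ln (exp u) = u + (of_int (2 * n) * pi) * \<i>"
   using exp_eq[of "Ln (exp u)" u] by auto
  have "Ln (exp u) / (2 * pi * \<i>) = u / (2 * pi * \<i>) + of_int n"
   unfolding n by (simp add: field_simps)
  then show ?thesis unfolding G_def using pint[OF im[OF u]] by simp
 qed
 have "G holomorphic_on annulus R"
 proof (rule holomorphicI_local)
  fix w0 assume w0: "w0 \<in> annulus R"
  then have nz: "w0 \<noteq> 0" using zero_notin_annulus[of R] R by auto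
  define T where "T = annulus R \<inter> ball w0 (cmod w0)"
  define l where "l w = Ln w0 + Ln (w / w0)" for w
  have Rpos: "Re (w / w0) > 0" if "w \<in> T" for w
  proof -
   have "cmod (w / w0 - 1) < 1"
   proof -
    have "w / w0 - 1 = (w - w0) / w0" using nz by (simp add: field_simps)
    then show ?thesis using that nz by (simp add: norm_divide T_def dist_norm norm_minus_commute)
   qed
   then have "\<bar>Re (w / w0 - 1)\<bar> < 1" using abs_Re_le_cmod[of "w / w0 - 1"] by linarith
   then show ?thesis by simp
  qed
  have el: "exp (l w) = w" if "w \<in> T" for w
  proof -
   have "w / w0 \<noteq> 0" using Rpos[OF that] by auto
   then show ?thesis using nz by (simp add: l_def exp_add)
  qed
  have "(\<lambda>w. \<Gamma> (l w / (2 * pi * \<i>))) holomorphic_on T"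
  proof (rule holomorphic_on_compose_gen[OF _ hol, unfolded o_def])
   have "w / w0 \<notin> \<real>\<^sub>\<le>\<^sub>0" if "w \<in> T" for w
    using Rpos[OF that] by (auto simp: complex_nonpos_Reals_iff)
   then show "(\<lambda>w. l w / (2 * pi * \<i>)) holomorphic_on T"
    unfolding l_def using nz by (intro holomorphic_intros) auto
   show "(\<lambda>w. l w / (2 * pi * \<i>)) ` T \<subseteq> {z. \<bar>Im z\<bar> < e}"
   proof safe
    fix w assume "w \<in> T"
    then show "\<bar>Im (l w / (2 * pi * \<i>))\<bar> < e" using el[of w] by (intro im) (auto simp: T_def)
   qed
  qed
  moreover have "G w = \<Gamma> (l w / (2 * pi * \<i>))" if "w \<in> T" for w
  proof -
   have "exp (l w) \<in> annulus R" using el[OF that] that by (simp add: T_def)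
   from key[OF this] show ?thesis using el[OF that] by simp
  qed
  ultimately have "G holomorphic_on T" by (subst holomorphic_cong[OF refl]) auto
  moreover have "open T" "w0 \<in> T" unfolding T_def using w0 nz by (auto intro: open_annulus)
  ultimately show "\<exists>T. w0 \<in> T \<and> open T \<and> G holomorphic_on T" by blast
 qed
 moreover have "G (cis (2 * pi * t)) = f t" for t
 proof -
  have c: "cis (2 * pi * t) = exp (\<i> * of_real (2 * pi * t))" by (rule cis_conv_exp)
  have "G (exp (\<i> * of_real (2 * pi * t))) = \<Gamma> ((\<i> * of_real (2 * pi * t)) / (2 * pi * \<i>))"
   by (rule key) (use R sphere_subset_annulus[of R] in \<open>simp add: c[symmetric] subset_iff\<close>)
  also have "(\<i> * of_real (2 * pi * t)) / (2 * pi * \<i>) = complex_of_real t" by simp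
  finally show ?thesis unfolding c using real by simp
 qed
 ultimately show ?thesis using R by blast
qed

text \<open>Otherwise distinct points with equal images accumulate at points of the circle. By injectivity on the circle the two limits coincide, which contradicts injectivity near a point where the derivative is not 0.\<close>
lemma holomorphic_injective_near_circle:
 assumes R: "R > 1" and G: "G holomorphic_on annulus R" and inj: "inj_on G (sphere 0 1)"
  and d: "\<And>w. cmod w = 1 \<Longrightarrow> deriv G w \<noteq> 0"
 shows "\<exists>R'. 1 < R' \<and> R' \<le> R \<and> inj_on G (annulus R')"
proof (rule ccontr)
 assume neg: "\<not> (\<exists>R'. 1 < R' \<and> R' \<le> R \<and> inj_on G (annulus R'))"
 have no: "\<not> inj_on G (annulus R')" if "1 < R'" "R' \<le> R" for R' using that neg by blast
 define q where "q n = 1 + (R - 1) / real (Suc n)" for n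
 have q: "1 < q n" "q n \<le> R" for n
 proof -
  have "(R - 1) / real (Suc n) \<le> (R - 1) / 1" using R by (intro divide_left_mono) auto
  then show "1 < q n" "q n \<le> R" using R by (auto simp: q_def)
 qed
 have ql: "q \<longlonglongrightarrow> 1" unfolding q_def by real_asymp
 have "\<forall>n. \<exists>w v. w \<in> annulus (q n) \<and> v \<in> annulus (q n) \<and> w \<noteq> v \<and> G w = G v"
  using no[OF q] unfolding inj_on_def by blast
 from choice[OF this] obtain w where "\<forall>n. \<exists>v. w n \<in> annulus (q n) \<and> v \<in> annulus (q n) \<and> w n \<noteq> v \<and> G (w n) = G v"
  by (elim exE)
 from choice[OF this] obtain v where wv: "\<forall>n. w n \<in> annulus (q n) \<and> v n \<in> annulus (q n) \<and> w n \<noteq> v n \<and> G (w n) = G (v n)"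
  by (elim exE)
 have w: "w n \<in> annulus (q n)" and v: "v n \<in> annulus (q n)" and ne: "w n \<noteq> v n" and eq: "G (w n) = G (v n)" for n
  using wv by simp_all
 have bd: "cmod x \<le> R" if "x \<in> annulus (q n)" for x n using that q[of n] by (auto simp: annulus_def)
 have "compact (cball (0::complex) R \<times> cball (0::complex) R)" by (intro compact_Times compact_cball)
 moreover have "\<forall>n. (w n, v n) \<in> cball 0 R \<times> cball 0 R" using bd w v by auto
 ultimately obtain l r where r: "strict_mono r" and lim: "((\<lambda>n. (w n, v n)) \<circ> r) \<longlonglongrightarrow> l"
  unfolding compact_def by meson
 have wl: "(\<lambda>n. w (r n)) \<longlonglongrightarrow> fst l" and vl: "(\<lambda>n. v (r n)) \<longlonglongrightarrow> snd l"
  using tendsto_fst[OF lim] tendsto_snd[OF lim] by (simp_all add: o_def)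
 have one: "cmod x = 1" if xl: "(\<lambda>n. X (r n)) \<longlonglongrightarrow> x" and X: "\<And>n. X n \<in> annulus (q n)" for X x
 proof -
  have qr: "(\<lambda>n. q (r n)) \<longlonglongrightarrow> 1" using LIMSEQ_subseq_LIMSEQ[OF ql r] by (simp add: o_def)
  then have "(\<lambda>n. 1 / q (r n)) \<longlonglongrightarrow> 1 / 1" by (intro tendsto_intros) auto
  moreover have "(\<lambda>n. cmod (X (r n))) \<longlonglongrightarrow> cmod x" by (intro tendsto_norm xl)
  moreover have "1 / q (r n) \<le> cmod (X (r n))" "cmod (X (r n)) \<le> q (r n)" for n using X[of "r n"] by (auto simp: annulus_def)
  ultimately have "1 / 1 \<le> cmod x" "cmod x \<le> 1" using qr by (blast intro: LIMSEQ_le)+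
  then show ?thesis by simp
 qed
 have w1: "cmod (fst l) = 1" by (rule one[OF wl w])
 have v1: "cmod (snd l) = 1" by (rule one[OF vl v])
 have cont: "isCont G x" if "cmod x = 1" for x
  using that R holomorphic_on_imp_continuous_on[OF G] sphere_subset_annulus[of R]
  by (auto simp: continuous_on_eq_continuous_at[OF open_annulus] subset_iff)
 have "(\<lambda>n. G (w (r n))) \<longlonglongrightarrow> G (fst l)" "(\<lambda>n. G (v (r n))) \<longlonglongrightarrow> G (snd l)"
  using isCont_tendsto_compose[OF cont[OF w1] wl] isCont_tendsto_compose[OF cont[OF v1] vl] by auto
 then have "G (fst l) = G (snd l)" using eq LIMSEQ_unique by simp
 then have same: "fst l = snd l" using inj w1 v1 by (auto dest!: inj_onD)
 obtain \<rho> where \<rho>: "\<rho> > 0" "inj_on G (ball (fst l) \<rho>)"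
 proof -
  have "fst l \<in> annulus R" using w1 R by (simp add: annulus_def)
  from has_complex_derivative_locally_injective[OF G this open_annulus d[OF w1]] show ?thesis using that by metis
 qed
 have "\<forall>\<^sub>F n in sequentially. w (r n) \<in> ball (fst l) \<rho>" "\<forall>\<^sub>F n in sequentially. v (r n) \<in> ball (fst l) \<rho>"
  using tendstoD[OF wl \<rho>(1)] tendstoD[OF vl \<rho>(1)] same by (auto simp: dist_commute)
 then have "\<forall>\<^sub>F n in sequentially. False"
 proof eventually_elim
  case (elim n)
  then show ?case using inj_onD[OF \<rho>(2) eq[of "r n"]] ne[of "r n"] by blast
 qed
 then show False by simp
qed

section \<open>Reflection across the unit circle\<close>

abbreviation cauchy_circle :: "(complex \<Rightarrow> complex) \<Rightarrow> real \<Rightarrow> complex \<Rightarrow> complex" where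
 "cauchy_circle f r z \<equiv> contour_integral (circlepath 0 r) (\<lambda>w. f w / (w - z))"

lemma circlepath_integrals_eq:
 assumes f: "f holomorphic_on {w. \<alpha> < cmod w \<and> cmod w < \<beta>}" and "0 \<le> \<alpha>" "\<alpha> < r" "r < \<beta>" "\<alpha> < s" "s < \<beta>"
 shows "contour_integral (circlepath 0 r) f = contour_integral (circlepath 0 s) f"
proof (rule Cauchy_theorem_homotopic_loops)
 let ?A = "{w. \<alpha> < cmod w \<and> cmod w < \<beta>}"
 show "open ?A" by (intro open_Collect_conj open_Collect_less continuous_intros)
 show "homotopic_loops ?A (circlepath 0 r) (circlepath 0 s)"
 proof (rule homotopic_loops_linear)
  fix t :: real
  show "closed_segment (circlepath 0 r t) (circlepath 0 s t) \<subseteq> ?A"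
  proof
   fix w assume "w \<in> closed_segment (circlepath 0 r t) (circlepath 0 s t)"
   then obtain u where u: "0 \<le> u" "u \<le> 1" "w = (1 - u) *\<^sub>R circlepath 0 r t + u *\<^sub>R circlepath 0 s t"
    by (auto simp: closed_segment_def)
   have w: "w = of_real ((1 - u) * r + u * s) * exp (2 * of_real pi * \<i> * of_real t)"
    unfolding u(3) circlepath by (simp add: scaleR_conv_of_real algebra_simps)
   have e: "cmod (exp (2 * of_real pi * \<i> * of_real t)) = 1" by simp
   have "(1 - u) * r + u * s > \<alpha>" "(1 - u) * r + u * s < \<beta>"
    using convex_bound_lt[of r \<beta> s "1 - u" u] convex_bound_lt[of "-r" "-\<alpha>" "-s" "1 - u" u] u assms by (auto simp: algebra_simps)
   moreover have "cmod w = \<bar>(1 - u) * r + u * s\<bar>" unfolding w norm_mult e norm_of_real by simp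
   ultimately show "w \<in> ?A" using assms(2) by simp
  qed
 qed auto
qed (use f in auto)

lemma cauchy_circle_eq:
 assumes f: "f holomorphic_on {w. \<alpha> < cmod w \<and> cmod w < \<beta>}" and "0 \<le> \<alpha>" "\<alpha> < r" "r < \<beta>" "\<alpha> < s" "s < \<beta>"
  and z: "cmod z \<le> \<alpha> \<or> \<beta> \<le> cmod z"
 shows "cauchy_circle f r z = cauchy_circle f s z"
 by (rule circlepath_integrals_eq[of _ \<alpha> \<beta>]) (use assms in \<open>auto intro!: holomorphic_intros\<close>)

lemma cauchy_circle_annulus:
 assumes f: "f holomorphic_on {w. \<alpha> < cmod w \<and> cmod w < \<beta>}" and \<alpha>: "0 \<le> \<alpha>"
  and r: "\<alpha> < r" "r < cmod z" and s: "cmod z < s" "s < \<beta>"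
 shows "cauchy_circle f s z - cauchy_circle f r z = 2 * of_real pi * \<i> * f z"
proof -
 let ?A = "{w. \<alpha> < cmod w \<and> cmod w < \<beta>}"
 have op: "open ?A" by (intro open_Collect_conj open_Collect_less continuous_intros)
 have zA: "z \<in> ?A" using r s by simp
 define g where "g w = (if w = z then deriv f z else (f w - f z) / (w - z))" for w
 have g: "g holomorphic_on ?A" unfolding g_def
  by (rule pole_lemma[OF f]) (use zA op in \<open>simp add: interior_open\<close>)
 have eq: "contour_integral (circlepath 0 r) g = contour_integral (circlepath 0 s) g"
  by (rule circlepath_integrals_eq[OF g]) (use \<alpha> r s in auto)
 have split: "contour_integral (circlepath 0 q) g = cauchy_circle f q z - f z * contour_integral (circlepath 0 q) (\<lambda>w. 1 / (w - z))"
  if q: "\<alpha> < q" "q < \<beta>" "q \<noteq> cmod z" for q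
 proof -
  have q0: "q > 0" using q \<alpha> by simp
  have sub: "sphere 0 q \<subseteq> ?A - {z}" using q by auto
  have c: "continuous_on (sphere 0 q) f"
   using holomorphic_on_imp_continuous_on[OF f] by (rule continuous_on_subset) (use sub in auto)
  have i1: "(\<lambda>w. f w / (w - z)) contour_integrable_on circlepath 0 q"
   using q0 sub by (intro contour_integrable_continuous_circlepath continuous_intros) (auto intro: c)
  have i2: "(\<lambda>w. f z * (1 / (w - z))) contour_integrable_on circlepath 0 q"
   using q0 sub by (intro contour_integrable_continuous_circlepath continuous_intros) auto
  have "contour_integral (circlepath 0 q) g = contour_integral (circlepath 0 q) (\<lambda>w. f w / (w - z) - f z * (1 / (w - z)))"
   using q q0 by (intro contour_integral_eq) (auto simp: g_def diff_divide_distrib)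
  also have "\<dots> = cauchy_circle f q z - contour_integral (circlepath 0 q) (\<lambda>w. f z * (1 / (w - z)))"
   by (rule contour_integral_diff[OF i1 i2])
  also have "contour_integral (circlepath 0 q) (\<lambda>w. f z * (1 / (w - z))) = f z * contour_integral (circlepath 0 q) (\<lambda>w. 1 / (w - z))"
   using q0 sub by (intro contour_integral_lmul contour_integrable_continuous_circlepath continuous_intros) auto
  finally show ?thesis .
 qed
 have s1: "contour_integral (circlepath 0 s) (\<lambda>w. 1 / (w - z)) = 2 * of_real pi * \<i>"
  using contour_integral_unique[OF Cauchy_integral_circlepath_simple[of "\<lambda>_. 1" 0 s z]] s by simp
 have r1: "contour_integral (circlepath 0 r) (\<lambda>w. 1 / (w - z)) = 0"
 proof (rule contour_integral_unique, rule Cauchy_theorem_disc_simple[of _ 0 "cmod z"])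
  show "path_image (circlepath 0 r) \<subseteq> ball 0 (cmod z)" using r \<alpha> by auto
 qed (auto intro!: holomorphic_intros)
 show ?thesis using eq split[of r] split[of s] s1 r1 r s by (simp add: algebra_simps)
qed

lemma has_contour_integral_circlepath_scale:
 "(f has_contour_integral i) (circlepath 0 s) \<longleftrightarrow> ((\<lambda>w. of_real s * f (of_real s * w)) has_contour_integral i) (circlepath 0 1)"
 unfolding has_contour_integral vector_derivative_circlepath
 unfolding circlepath by (simp add: mult_ac)

lemma holomorphicI_of_derivative:
 assumes "\<And>w. w \<in> S \<Longrightarrow> (f has_field_derivative f' w) (at w)"
 shows "f holomorphic_on S"
 unfolding holomorphic_on_def field_differentiable_def
 using assms has_field_derivative_at_within by blast

lemma holomorphic_cauchy_circle:
 assumes r: "r > 0" and f: "continuous_on (sphere 0 r) f"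
 shows "(\<lambda>z. cauchy_circle f r z) holomorphic_on - sphere 0 r"
proof -
 have pi: "path_image (circlepath 0 r) = sphere (0::complex) r" using r by simp
 have "((\<lambda>z. cauchy_circle f r z) has_field_derivative (of_nat 1 * contour_integral (circlepath 0 r) (\<lambda>u. f u / (u - w) ^ Suc 1))) (at w)"
  if w: "w \<notin> sphere 0 r" for w
 proof (rule Cauchy_next_derivative(2)[where B="2 * pi * \<bar>r\<bar>" and S=UNIV])
  show "continuous_on (path_image (circlepath 0 r)) f" using f pi by simp
  show "norm (vector_derivative (circlepath 0 r) (at t)) \<le> 2 * pi * \<bar>r\<bar>" for t
   by (simp add: vector_derivative_circlepath norm_mult)
  show "((\<lambda>u. f u / (u - z) ^ 1) has_contour_integral cauchy_circle f r z) (circlepath 0 r)"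
   if "z \<in> UNIV - path_image (circlepath 0 r)" for z
  proof -
   have "(\<lambda>u. f u / (u - z)) contour_integrable_on circlepath 0 r"
    using r that pi by (intro contour_integrable_continuous_circlepath continuous_intros) (auto intro: f)
   then show ?thesis by (simp add: has_contour_integral_integral)
  qed
  show "w \<in> UNIV - path_image (circlepath 0 r)" using w pi by simp
 qed auto
 then show ?thesis
  by (rule holomorphicI_of_derivative) auto
qed

text \<open>Scaling by $1/s^2$ carries the circle of radius \<open>s\<close> to that of radius $1/s$, and the reflected function at the image of \<open>w\<close> is $1/\overline{f(w)}$, which is close to $f(w)$ because $|f(w)|$ is close to 1.\<close>
lemma reflected_circle_integrals_close:
 assumes s: "1/2 < s" "s < 1" and z: "\<bar>cmod z - s\<bar> > \<delta>" "\<bar>cmod z - 1/s\<bar> > \<delta>" and \<delta>: "\<delta> > 0"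
  and e: "e > 0" "e < 1/2" and fe: "\<And>w. cmod w = s \<Longrightarrow> \<bar>cmod (f w) - 1\<bar> < e"
  and f: "continuous_on (sphere 0 s) f"
 defines "f' \<equiv> (\<lambda>w. 1 / cnj (f (1 / cnj w)))"
 shows "cmod (cauchy_circle f s z - cauchy_circle f' (1/s) z) \<le> 2 * pi * (10 * e / \<delta> + 2 * cmod z * (1/s - s) / \<delta>\<^sup>2)"
proof -
 have s0: "s > 0" using s by simp
 have fnz: "f w \<noteq> 0" if "cmod w = s" for w using fe[OF that] e by auto
 have f'c: "continuous_on (sphere 0 (1/s)) f'"
 proof -
  have "continuous_on (sphere 0 (1/s)) (\<lambda>w. f (1 / cnj w))"
   by (rule continuous_on_compose2[OF f]) (use s0 in \<open>auto intro!: continuous_intros simp: norm_divide\<close>)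
  then show ?thesis unfolding f'_def
   using s0 fnz by (intro continuous_intros) (auto simp: norm_divide)
 qed
 have i1: "(\<lambda>w. f w / (w - z)) contour_integrable_on circlepath 0 s"
  using s0 z \<delta> by (intro contour_integrable_continuous_circlepath continuous_intros) (auto intro: f)
 have i2: "(\<lambda>w. f' w / (w - z)) contour_integrable_on circlepath 0 (1/s)"
  using s0 z \<delta> by (intro contour_integrable_continuous_circlepath continuous_intros) (auto intro: f'c)
 define q where "q w = of_real s * (f (of_real s * w) / (of_real s * w - z)) - of_real (1/s) * (f' (of_real (1/s) * w) / (of_real (1/s) * w - z))" for w
 have "(q has_contour_integral (cauchy_circle f s z - cauchy_circle f' (1/s) z)) (circlepath 0 1)"
  unfolding q_def
  by (intro has_contour_integral_diff has_contour_integral_circlepath_scale[THEN iffD1] has_contour_integral_integral i1 i2)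
 then have "cmod (cauchy_circle f s z - cauchy_circle f' (1/s) z) \<le> (10 * e / \<delta> + 2 * cmod z * (1/s - s) / \<delta>\<^sup>2) * (2 * pi * 1)"
 proof (rule has_contour_integral_bound_circlepath)
  have "1/s - s > 0"
  proof -
   have "1/s > 1" using s by simp
   then show ?thesis using s by linarith
  qed
  then show "0 \<le> 10 * e / \<delta> + 2 * cmod z * (1/s - s) / \<delta>\<^sup>2" using e \<delta> by simp
  fix w :: complex assume "cmod (w - 0) = 1"
  then have w: "cmod w = 1" by simp
  define a where "a = f (of_real s * w)"
  have a1: "\<bar>cmod a - 1\<bar> < e" unfolding a_def using w s0 by (intro fe) (simp add: norm_mult)
  then have a: "cmod a > 1/2" "cmod a < 3/2" using e by linarith+
  have wc: "1 / cnj (of_real (1/s) * w) = of_real s * w"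
  proof -
   have "w * cnj w = 1" using w by (simp add: complex_norm_square[symmetric])
   moreover have "w \<noteq> 0" using w by auto
   ultimately show ?thesis using s0 by (simp add: field_simps)
  qed
  have f': "f' (of_real (1/s) * w) = 1 / cnj a" unfolding f'_def wc a_def ..
  define u where "u = of_real s * w - z"
  define v where "v = of_real (1/s) * w - z"
  have u: "cmod u > \<delta>"
   using norm_triangle_ineq3[of "of_real s * w" z] z(1) w s0 unfolding u_def by (simp add: norm_mult abs_minus_commute)
  have v: "cmod v > \<delta>"
   using norm_triangle_ineq3[of "of_real (1/s) * w" z] z(2) w s0 unfolding v_def by (simp add: norm_mult norm_divide abs_minus_commute)
  have u0: "u \<noteq> 0" and v0: "v \<noteq> 0" and a0: "a \<noteq> 0" using u v \<delta> a by auto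
  have q: "w * q w = a * (of_real s * w / u) - (1 / cnj a) * (of_real (1/s) * w / v)"
   unfolding q_def f' a_def[symmetric] u_def[symmetric] v_def[symmetric] by (simp add: algebra_simps)
  have k: "of_real s * w / u - of_real (1/s) * w / v = z * (of_real (1/s) * w - of_real s * w) / (u * v)"
  proof -
   have "of_real s * w / u - of_real (1/s) * w / v = (of_real s * w * v - of_real (1/s) * w * u) / (u * v)"
    by (rule diff_frac_eq[OF u0 v0])
   also have "of_real s * w * v - of_real (1/s) * w * u = z * (of_real (1/s) * w - of_real s * w)"
    unfolding u_def v_def by (simp add: algebra_simps)
   finally show ?thesis .
  qed
  have gen: "x * A - c * B = (x - c) * B + x * (A - B)" for x A B c :: complex
   by (simp add: algebra_simps)
  have q2: "w * q w = (a - 1 / cnj a) * (of_real (1/s) * w / v) + a * (z * (of_real (1/s) * w - of_real s * w) / (u * v))"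
   unfolding q k[symmetric] by (rule gen)
  have d: "cmod (a - 1 / cnj a) \<le> 5 * e"
  proof -
   have "a - 1 / cnj a = (of_real ((cmod a)\<^sup>2) - 1) / cnj a"
    unfolding complex_norm_square using a0 by (simp add: diff_divide_distrib)
   then have "cmod (a - 1 / cnj a) = \<bar>(cmod a)\<^sup>2 - 1\<bar> / cmod a"
    by (simp add: norm_divide) (metis norm_of_real of_real_1 of_real_diff of_real_power)
   also have "\<bar>(cmod a)\<^sup>2 - 1\<bar> = \<bar>cmod a - 1\<bar> * (cmod a + 1)"
   proof -
    have "(cmod a)\<^sup>2 - 1 = (cmod a - 1) * (cmod a + 1)" by (simp add: power2_eq_square algebra_simps)
    then show ?thesis by (simp add: abs_mult)
   qed
   also have "\<dots> / cmod a \<le> (e * (5/2)) / (1/2)"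
    using a a1 by (intro frac_le mult_mono) auto
   finally show ?thesis by simp
  qed
  have s2: "1/s < 2" using s by (simp add: field_simps)
  have "cmod (q w) = cmod (w * q w)" using w by (simp add: norm_mult)
  also have "\<dots> \<le> cmod ((a - 1 / cnj a) * (of_real (1/s) * w / v)) + cmod (a * (z * (of_real (1/s) * w - of_real s * w) / (u * v)))"
   unfolding q2 by (rule norm_triangle_ineq)
  also have "cmod ((a - 1 / cnj a) * (of_real (1/s) * w / v)) = cmod (a - 1 / cnj a) * ((1/s) / cmod v)"
   using w s0 by (simp add: norm_mult norm_divide)
  also have "\<dots> \<le> (5 * e) * (2 / \<delta>)"
   using d s2 v \<delta> s0 e by (intro mult_mono frac_le) auto
  also have "(5 * e) * (2 / \<delta>) = 10 * e / \<delta>" by simp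
  also have "cmod (a * (z * (of_real (1/s) * w - of_real s * w) / (u * v))) \<le> 2 * cmod z * (1/s - s) / \<delta>\<^sup>2"
  proof -
   have "of_real (1/s) * w - of_real s * w = of_real (1/s - s) * w" by (simp add: algebra_simps)
   then have "cmod (of_real (1/s) * w - of_real s * w) = 1/s - s"
    using w \<open>1/s - s > 0\<close> by (simp only: norm_mult norm_of_real) simp
   then have "cmod (a * (z * (of_real (1/s) * w - of_real s * w) / (u * v))) = cmod a * (cmod z * (1/s - s)) / (cmod u * cmod v)"
    by (simp add: norm_mult norm_divide)
   also have "\<dots> \<le> 2 * (cmod z * (1/s - s)) / (\<delta> * \<delta>)"
    using a u v \<delta> \<open>1/s - s > 0\<close> by (intro frac_le mult_mono) auto
   finally show ?thesis by (simp add: power2_eq_square)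
  qed
  finally show "cmod (q w) \<le> 10 * e / \<delta> + 2 * cmod z * (1/s - s) / \<delta>\<^sup>2" by simp
 qed auto
 then show ?thesis by (simp add: mult.commute)
qed

text \<open>The reflection principle without boundary values of \<open>f\<close>: only its modulus is known to tend to 1. The Cauchy integrals of \<open>f\<close> over radius $s < 1$ and of the reflected function over radius $1/s$ agree, since they are independent of \<open>s\<close> and become close as $s \to 1$. Hence the two functions are given by one Cauchy formula, which is holomorphic across the circle.\<close>
theorem circle_reflection:
 assumes R: "R > 1" and f: "f holomorphic_on {w. 1/R < cmod w \<and> cmod w < 1}"
  and lim: "\<And>e. e > 0 \<Longrightarrow> \<exists>\<eta><1. \<forall>w. \<eta> < cmod w \<and> cmod w < 1 \<longrightarrow> \<bar>cmod (f w) - 1\<bar> < e"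
 shows "\<exists>R'. 1 < R' \<and> R' \<le> R \<and> (\<exists>F. F holomorphic_on annulus R' \<and>
   (\<forall>w. 1/R' < cmod w \<and> cmod w < 1 \<longrightarrow> F w = f w \<and> f w \<noteq> 0) \<and>
   (\<forall>w. 1 < cmod w \<and> cmod w < R' \<longrightarrow> F w = 1 / cnj (f (1 / cnj w))))"
proof -
 obtain \<eta>0 where \<eta>0: "\<eta>0 < 1" "\<And>w. \<eta>0 < cmod w \<Longrightarrow> cmod w < 1 \<Longrightarrow> \<bar>cmod (f w) - 1\<bar> < 1/2"
  using lim[of "1/2"] by auto
 define \<rho> where "\<rho> = max (max \<eta>0 (1/R)) (1/2)"
 have \<rho>: "\<eta>0 \<le> \<rho>" "1/R \<le> \<rho>" "1/2 \<le> \<rho>" "\<rho> < 1" using \<eta>0 R by (auto simp: \<rho>_def)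
 have fnz: "f w \<noteq> 0" if "\<rho> < cmod w" "cmod w < 1" for w using \<eta>0(2)[of w] that \<rho> by auto
 define f' where "f' w = 1 / cnj (f (1 / cnj w))" for w
 have fA: "f holomorphic_on {w. \<rho> < cmod w \<and> cmod w < 1}"
  by (rule holomorphic_on_subset[OF f]) (use \<rho> in auto)
 have f'A: "f' holomorphic_on {w. 1 < cmod w \<and> cmod w < 1/\<rho>}"
 proof -
  let ?B = "{w. 1 < cmod w \<and> cmod w < 1/\<rho>}"
  have inv: "(\<lambda>w. 1 / w) ` ?B \<subseteq> {w. \<rho> < cmod w \<and> cmod w < 1}"
  proof safe
   fix w assume w: "1 < cmod w" "cmod w < 1 / \<rho>"
   then have "cmod w > 0" by linarith
   then show "\<rho> < cmod (1 / w)" "cmod (1 / w) < 1" using w \<rho> by (simp_all add: norm_divide field_simps)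
  qed
  have "(\<lambda>w. f (1 / w)) holomorphic_on ?B"
   by (rule holomorphic_on_compose_gen[OF _ fA inv, unfolded o_def]) (intro holomorphic_intros, auto)
  moreover have "f (1 / w) \<noteq> 0" if "w \<in> ?B" for w using fnz[of "1/w"] inv that by blast
  ultimately have h: "(\<lambda>w. 1 / f (1 / w)) holomorphic_on ?B" by (intro holomorphic_intros) auto
  have cB: "cnj ` ?B = ?B"
  proof -
   have "cnj w \<in> ?B" if "w \<in> ?B" for w using that by simp
   moreover have "w \<in> cnj ` ?B" if "w \<in> ?B" for w using that by (intro image_eqI[of _ _ "cnj w"]) auto
   ultimately show ?thesis by blast
  qed
  have op: "open ?B" by (intro open_Collect_conj open_Collect_less continuous_intros)
  have "cnj \<circ> (\<lambda>w. 1 / f (1 / w)) \<circ> cnj holomorphic_on ?B"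
   by (rule holomorphic_on_compose_cnj_cnj[OF _ op]) (use h cB in simp)
  also have "cnj \<circ> (\<lambda>w. 1 / f (1 / w)) \<circ> cnj = f'" by (auto simp: f'_def fun_eq_iff)
  finally show ?thesis .
 qed
 have match: "cauchy_circle f s z = cauchy_circle f' (1/s) z"
  if s: "\<rho> < s" "s < 1" and z: "cmod z < s \<or> 1/s < cmod z" and z1: "\<rho> < cmod z" "cmod z < 1/\<rho>" for s z
 proof -
  have s0: "s > 0" using s \<rho> by simp
  have small: "cmod (cauchy_circle f s z - cauchy_circle f' (1/s) z) \<le> K * e"
   if e: "0 < e" "e < 1/2" and K: "K = 2 * pi * (10 / (\<bar>cmod z - 1\<bar> / 3) + 2 * cmod z / (\<bar>cmod z - 1\<bar> / 3)\<^sup>2)" for e K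
  proof -
   define \<delta> where "\<delta> = \<bar>cmod z - 1\<bar> / 3"
   have "1/s > 1" using s s0 by simp
   then have "cmod z \<noteq> 1" using z s by auto
   then have \<delta>: "\<delta> > 0" by (simp add: \<delta>_def)
   obtain \<eta> where \<eta>: "\<eta> < 1" "\<And>w. \<eta> < cmod w \<Longrightarrow> cmod w < 1 \<Longrightarrow> \<bar>cmod (f w) - 1\<bar> < e"
    using lim[OF e(1)] by blast
   have "((\<lambda>x. 1/x) \<longlongrightarrow> 1/1) (at_left (1::real))" by (intro tendsto_intros) auto
   then have "((\<lambda>x. 1/x - x) \<longlongrightarrow> 1/1 - 1) (at_left (1::real))" by (intro tendsto_intros) auto
   then have "((\<lambda>x. 1/x - x) \<longlongrightarrow> 0) (at_left (1::real))" by simp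
   then have "\<forall>\<^sub>F x in at_left (1::real). dist (1/x - x) 0 < min e \<delta>"
    by (rule tendstoD) (use e(1) \<delta> in simp)
   then have ev: "\<forall>\<^sub>F x in at_left (1::real). \<bar>1/x - x\<bar> < min e \<delta>"
    by (simp only: dist_real_def diff_zero)
   have "\<forall>\<^sub>F x in at_left (1::real). x \<in> {max (max \<eta> s) (1/2)<..<1}"
    by (rule eventually_at_leftI[of "max (max \<eta> s) (1/2)"]) (use \<eta> s in auto)
   with ev have "\<forall>\<^sub>F x in at_left (1::real). \<bar>1/x - x\<bar> < min e \<delta> \<and> x \<in> {max (max \<eta> s) (1/2)<..<1}"
    by (rule eventually_conj)
   then obtain x where x: "\<bar>1/x - x\<bar> < min e \<delta>" "max (max \<eta> s) (1/2) < x" "x < 1"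
    using eventually_happens'[OF trivial_limit_at_left_real] by (metis (no_types, lifting) greaterThanLessThan_iff)
   have x0: "x > 0" using x by auto
   have x1: "1/x > 1" using x x0 by simp
   have xd: "1/x - x < e" "1/x - x < \<delta>" using x(1) by auto
   have "\<bar>cmod z - 1\<bar> = 3 * \<delta>" by (simp add: \<delta>_def)
   then have zz: "\<bar>cmod z - x\<bar> > \<delta>" "\<bar>cmod z - 1/x\<bar> > \<delta>" using xd x1 x(3) \<delta> by linarith+
   have sx: "cauchy_circle f s z = cauchy_circle f x z" and s'x: "cauchy_circle f' (1/s) z = cauchy_circle f' (1/x) z"
   proof -
    have sx1: "1/x < 1/s" using x s0 by (intro divide_strict_left_mono) auto
    have "1/s < 1/\<rho>" using s \<rho> by (intro divide_strict_left_mono) auto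
    show "cauchy_circle f s z = cauchy_circle f x z"
    proof (cases "cmod z < s")
     case True
     show ?thesis
      by (rule cauchy_circle_eq[where \<alpha>="cmod z" and \<beta>=1]) (use True x s z1 \<rho> in \<open>auto intro: holomorphic_on_subset[OF fA]\<close>)
    next
     case False
     then have "1 < cmod z" using z \<open>1/s > 1\<close> by simp
     then show ?thesis
      by (intro cauchy_circle_eq[where \<alpha>=\<rho> and \<beta>=1] fA) (use x s \<rho> in auto)
    qed
    show "cauchy_circle f' (1/s) z = cauchy_circle f' (1/x) z"
    proof (cases "cmod z < s")
     case True
     then show ?thesis
      by (intro cauchy_circle_eq[where \<alpha>=1 and \<beta>="1/\<rho>"] f'A) (use x1 sx1 \<open>1/s < 1/\<rho>\<close> \<open>1/s > 1\<close> s in auto)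
    next
     case False
     then have z3: "1/s < cmod z" using z by simp
     show ?thesis
      by (rule cauchy_circle_eq[where \<alpha>=1 and \<beta>="cmod z"])
        (use z3 x1 sx1 \<open>1/s > 1\<close> z1 in \<open>auto intro: holomorphic_on_subset[OF f'A]\<close>)
    qed
   qed
   have "cmod (cauchy_circle f x z - cauchy_circle f' (1/x) z) \<le> 2 * pi * (10 * e / \<delta> + 2 * cmod z * (1/x - x) / \<delta>\<^sup>2)"
    unfolding f'_def
   proof (rule reflected_circle_integrals_close[OF _ x(3) zz \<delta> e])
    show "continuous_on (sphere 0 x) f"
     by (rule continuous_on_subset[OF holomorphic_on_imp_continuous_on[OF fA]]) (use x s in auto)
   qed (use x \<eta> in auto)
   also have "\<dots> \<le> 2 * pi * (10 * e / \<delta> + 2 * cmod z * e / \<delta>\<^sup>2)"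
    using xd(1) \<delta> by (intro mult_left_mono add_left_mono divide_right_mono) auto
   also have "\<dots> = K * e" unfolding K \<delta>_def[symmetric] by (simp add: algebra_simps)
   finally show ?thesis unfolding sx s'x .
  qed
  define K where "K = 2 * pi * (10 / (\<bar>cmod z - 1\<bar> / 3) + 2 * cmod z / (\<bar>cmod z - 1\<bar> / 3)\<^sup>2)"
  have K0: "K \<ge> 0" by (simp add: K_def)
  have "cmod (cauchy_circle f s z - cauchy_circle f' (1/s) z) \<le> 0"
  proof (rule field_le_epsilon)
   fix \<epsilon> :: real assume \<epsilon>: "\<epsilon> > 0"
   define e where "e = min (1/4) (\<epsilon> / (K + 1))"
   have e: "0 < e" "e < 1/2" using \<epsilon> K0 by (auto simp: e_def)
   have "cmod (cauchy_circle f s z - cauchy_circle f' (1/s) z) \<le> K * e" by (rule small[OF e K_def])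
   also have "\<dots> \<le> (K + 1) * (\<epsilon> / (K + 1))" using K0 e by (intro mult_mono) (auto simp: e_def)
   also have "\<dots> = \<epsilon>" using K0 by simp
   finally show "cmod (cauchy_circle f s z - cauchy_circle f' (1/s) z) \<le> 0 + \<epsilon>" by simp
  qed
  then show ?thesis by simp
 qed
 define r where "r = (\<rho> + 1) / 2"
 have r: "\<rho> < r" "r < 1" "r > 0" using \<rho> by (auto simp: r_def)
 have r': "1/r > 1" "1/r < 1/\<rho>" using r \<rho> by (auto intro!: divide_strict_left_mono)
 define F where "F z = (cauchy_circle f' (1/r) z - cauchy_circle f r z) / (2 * of_real pi * \<i>)" for z
 have cf: "continuous_on (sphere 0 r) f"
  by (rule continuous_on_subset[OF holomorphic_on_imp_continuous_on[OF fA]]) (use r in auto)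
 have cf': "continuous_on (sphere 0 (1/r)) f'"
  by (rule continuous_on_subset[OF holomorphic_on_imp_continuous_on[OF f'A]]) (use r' in auto)
 have ann: "annulus (1/r) = {w. r < cmod w \<and> cmod w < 1/r}" by (simp add: annulus_def)
 have Fh: "F holomorphic_on annulus (1/r)"
  unfolding F_def ann using r r'
  by (intro holomorphic_intros holomorphic_on_subset[OF holomorphic_cauchy_circle[OF _ cf]]
     holomorphic_on_subset[OF holomorphic_cauchy_circle[OF _ cf']]) auto
 have F1: "F z = f z" if z: "r < cmod z" "cmod z < 1" for z
 proof -
  define s where "s = (cmod z + 1) / 2"
  have s: "cmod z < s" "s < 1" "\<rho> < s" using z r by (auto simp: s_def)
  have s1: "1/s > 1" "1/s < 1/\<rho>" using s \<rho> by (auto intro!: divide_strict_left_mono)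
  have "cauchy_circle f s z - cauchy_circle f r z = 2 * of_real pi * \<i> * f z"
   by (rule cauchy_circle_annulus[OF fA]) (use r s z \<rho> in auto)
  moreover have "cauchy_circle f s z = cauchy_circle f' (1/s) z"
  proof (rule match)
   show "\<rho> < cmod z" "cmod z < 1/\<rho>" using z r r' by linarith+
  qed (use s in auto)
  moreover have "cauchy_circle f' (1/s) z = cauchy_circle f' (1/r) z"
   by (rule cauchy_circle_eq[OF f'A]) (use s1 r' z in auto)
  ultimately show ?thesis unfolding F_def by simp
 qed
 have F2: "F z = f' z" if z: "1 < cmod z" "cmod z < 1/r" for z
 proof -
  define q where "q = (cmod z + 1) / 2"
  have q: "1 < q" "q < cmod z" using z by (auto simp: q_def)
  define s where "s = 1/q"
  have sq: "1/s = q" by (simp add: s_def)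
  have s: "s < 1" "r < s"
  proof -
   show "s < 1" using q by (simp add: s_def)
   have "q < 1/r" using q z by simp
   then show "r < s" using q r by (simp add: s_def field_simps)
  qed
  have "cauchy_circle f' (1/r) z - cauchy_circle f' q z = 2 * of_real pi * \<i> * f' z"
   by (rule cauchy_circle_annulus[OF f'A]) (use q r' z in auto)
  moreover have "cauchy_circle f s z = cauchy_circle f' (1/s) z"
   by (rule match) (use s r q z r' sq \<rho> in auto)
  moreover have "cauchy_circle f s z = cauchy_circle f r z"
   by (rule cauchy_circle_eq[OF fA]) (use s r z \<rho> in auto)
  ultimately show ?thesis unfolding F_def sq by simp
 qed
 have "1/r \<le> R"
 proof -
  have "1/r \<le> 1/(1/R)" using r \<rho> R by (intro divide_left_mono) auto
  then show ?thesis by simp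
 qed
 then show ?thesis
  using r' Fh F1 F2 fnz r unfolding f'_def by (intro exI[of _ "1/r"] conjI exI[of _ F]) auto
qed

section \<open>The exterior conformal map\<close>

lemma analytic_jordan_curve_extension:
 assumes \<gamma>: "analytic_jordan_curve \<gamma>"
 shows "\<exists>R>1. \<exists>G. G holomorphic_on annulus R \<and> inj_on G (annulus R) \<and> (\<forall>t. G (cis (2 * pi * t)) = \<gamma> t)"
proof -
 have an: "real_analytic \<gamma>" and per: "\<And>t. \<gamma> (t + 1) = \<gamma> t" and inj: "inj_on \<gamma> {0..<1}"
  and reg: "\<And>t. vector_derivative \<gamma> (at t) \<noteq> 0"
  using \<gamma> by (auto simp: analytic_jordan_curve_def)
 obtain R G where R: "R > 1" and G: "G holomorphic_on annulus R" and G\<gamma>: "\<And>t. G (cis (2 * pi * t)) = \<gamma> t"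
  using real_analytic_periodic_annulus_extension[of \<gamma>, OF an per] by blast
 have rep: "w = cis (2 * pi * (Arg2pi w / (2 * pi)))" "Arg2pi w / (2 * pi) \<in> {0..<1}" if "cmod w = 1" for w
 proof -
  show "w = cis (2 * pi * (Arg2pi w / (2 * pi)))"
   using Arg2pi[of w] that by (simp add: cis_conv_exp is_Arg_def)
  show "Arg2pi w / (2 * pi) \<in> {0..<1}"
   using Arg2pi[of w] by (simp add: divide_less_eq)
 qed
 have "inj_on G (sphere 0 1)"
 proof (rule inj_onI)
  fix w v assume "w \<in> sphere 0 1" "v \<in> sphere 0 1" and eq: "G w = G v"
  then have w: "cmod w = 1" and v: "cmod v = 1" by auto
  have "\<gamma> (Arg2pi w / (2 * pi)) = \<gamma> (Arg2pi v / (2 * pi))"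
   using eq G\<gamma>[of "Arg2pi w / (2 * pi)"] G\<gamma>[of "Arg2pi v / (2 * pi)"] rep(1)[OF w] rep(1)[OF v] by metis
  then have "Arg2pi w / (2 * pi) = Arg2pi v / (2 * pi)"
   using inj_onD[OF inj _ rep(2)[OF w] rep(2)[OF v]] by blast
  then show "w = v" using rep(1)[OF w] rep(1)[OF v] by metis
 qed
 moreover have "deriv G w \<noteq> 0" if w: "cmod w = 1" for w
 proof
  assume d0: "deriv G w = 0"
  define t where "t = Arg2pi w / (2 * pi)"
  have wt: "w = cis (2 * pi * t)" using rep(1)[OF w] by (simp add: t_def)
  have "w \<in> annulus R" using w R by (simp add: annulus_def)
  then have "(G has_field_derivative 0) (at (cis (2 * pi * t)))"
   using holomorphic_derivI[OF G open_annulus] d0 wt by metis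
  moreover have "((\<lambda>t. cis (2 * pi * t)) has_vector_derivative (2 * pi * \<i> * cis (2 * pi * t))) (at t)"
  proof -
   have "((\<lambda>z. exp (2 * pi * \<i> * z)) has_field_derivative (2 * pi * \<i> * cis (2 * pi * t))) (at (complex_of_real t))"
    by (auto intro!: derivative_eq_intros simp: cis_conv_exp mult_ac)
   from has_vector_derivative_real_field[OF this] show ?thesis
    by (simp add: cis_conv_exp mult_ac)
  qed
  ultimately have "((G \<circ> (\<lambda>t. cis (2 * pi * t))) has_vector_derivative ((2 * pi * \<i> * cis (2 * pi * t)) * 0)) (at t)"
   by (rule field_vector_diff_chain_at[rotated])
  moreover have "G \<circ> (\<lambda>t. cis (2 * pi * t)) = \<gamma>" using G\<gamma> by (auto simp: fun_eq_iff)
  ultimately show False using reg[of t] by (simp add: vector_derivative_at)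
 qed
 ultimately obtain R' where R': "1 < R'" "R' \<le> R" "inj_on G (annulus R')"
  using holomorphic_injective_near_circle[OF R G] by blast
 have "G holomorphic_on annulus R'"
  using annulus_mono[of R' R] R' by (intro holomorphic_on_subset[OF G]) auto
 then show ?thesis using R' G\<gamma> by blast
qed

text \<open>A connected set that meets \<open>\<Omega>\<close> and avoids its frontier lies in \<open>\<Omega>\<close>; so \<open>\<Omega>\<close> is a union of components of the complement of the curve, and being bounded it is the inside.\<close>
lemma jordan_interior_exterior:
 fixes \<Omega> :: "complex set" and \<gamma> :: "real \<Rightarrow> complex"
 assumes "open \<Omega>" "connected \<Omega>" "\<Omega> \<noteq> {}" "bounded \<Omega>" and sp: "simple_path \<gamma>" "pathfinish \<gamma> = pathstart \<gamma>"
  and fr: "frontier \<Omega> = path_image \<gamma>"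
 shows "\<Omega> = inside (path_image \<gamma>)" "- closure \<Omega> = outside (path_image \<gamma>)"
proof -
 note J = Jordan_inside_outside[OF sp]
 have disj: "\<Omega> \<inter> path_image \<gamma> = {}" using fr assms(1) by (metis Int_commute frontier_disjoint_eq)
 have sub: "X \<subseteq> \<Omega>" if "connected X" "X \<inter> path_image \<gamma> = {}" "X \<inter> \<Omega> \<noteq> {}" for X
  using connected_Int_frontier[OF that(1), of \<Omega>] that fr by blast
 have "\<Omega> \<inter> outside (path_image \<gamma>) = {}"
 proof (rule ccontr)
  assume "\<Omega> \<inter> outside (path_image \<gamma>) \<noteq> {}"
  then have "outside (path_image \<gamma>) \<subseteq> \<Omega>" using J by (intro sub) auto
  then show False using J assms(4) bounded_subset by blast
 qed
 then have 1: "\<Omega> \<subseteq> inside (path_image \<gamma>)" using J disj by blast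
 then have "inside (path_image \<gamma>) \<subseteq> \<Omega>" using J assms(3) by (intro sub) auto
 with 1 show eq: "\<Omega> = inside (path_image \<gamma>)" by blast
 have "closure \<Omega> = \<Omega> \<union> frontier \<Omega>" using closure_Un_frontier by blast
 then have "- closure \<Omega> = - path_image \<gamma> - inside (path_image \<gamma>)" using fr eq by blast
 moreover have "outside (path_image \<gamma>) = - path_image \<gamma> - inside (path_image \<gamma>)"
 proof -
  have "inside (path_image \<gamma>) \<inter> outside (path_image \<gamma>) = {}" "inside (path_image \<gamma>) \<union> outside (path_image \<gamma>) = - path_image \<gamma>"
   using J by simp_all
  then show ?thesis by blast
 qed
 ultimately show "- closure \<Omega> = outside (path_image \<gamma>)" by simp
qed

text \<open>The exterior in the coordinate $u = 1/(z-a)$, with the point at infinity added as $u = 0$.\<close>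
definition inverted_exterior :: "complex set \<Rightarrow> complex \<Rightarrow> complex set" where
 "inverted_exterior \<Omega> a = {u. u = 0 \<or> a + 1 / u \<in> - closure \<Omega>}"

text \<open>Inversion at an interior point of \<open>\<Omega>\<close> makes the exterior bounded and simply connected, as required by the Riemann mapping theorem.\<close>
lemma inverted_exterior_simply_connected:
 assumes \<Omega>: "open \<Omega>" "connected \<Omega>" "bounded \<Omega>" and a: "a \<in> \<Omega>" and E: "connected (- closure \<Omega>)"
 shows "open (inverted_exterior \<Omega> a)" "simply_connected (inverted_exterior \<Omega> a)" "bounded (inverted_exterior \<Omega> a)"
proof -
 let ?D = "inverted_exterior \<Omega> a"
 obtain B where B: "B > 0" "\<And>z. z \<in> closure \<Omega> \<Longrightarrow> cmod z \<le> B"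
  using \<Omega>(3) bounded_closure bounded_pos by metis
 define \<delta> where "\<delta> = 1 / (B + cmod a + 1)"
 have \<delta>: "\<delta> > 0" using B by (simp add: \<delta>_def add_pos_nonneg)
 have ball: "ball 0 \<delta> \<subseteq> ?D"
 proof
  fix u :: complex assume u: "u \<in> ball 0 \<delta>"
  show "u \<in> ?D"
  proof (cases "u = 0")
   case False
   have pos: "B + cmod a + 1 > 0" using B by (simp add: add_pos_nonneg)
   have "cmod u * (B + cmod a + 1) < 1" using u pos by (simp add: \<delta>_def field_simps)
   then have "B + cmod a + 1 < 1 / cmod u" using False by (simp add: field_simps)
   then have "cmod (1 / u) > B + cmod a + 1" by (simp add: norm_divide)
   then have "cmod (a + 1 / u) > B" using norm_triangle_ineq4[of "a + 1/u" a] by simp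
   then show ?thesis using B(2)[of "a + 1/u"] by (auto simp: inverted_exterior_def)
  qed (simp add: inverted_exterior_def)
 qed
 have D: "?D = ball 0 \<delta> \<union> {u \<in> - {0}. a + 1 / u \<in> - closure \<Omega>}"
  using ball \<delta> by (auto simp: inverted_exterior_def)
 have "open ({u \<in> - {0::complex}. a + 1 / u \<in> - closure \<Omega>})"
 proof -
  have "open ((- {0}) \<inter> (\<lambda>u. a + 1 / u) -` (- closure \<Omega>))"
   by (rule continuous_open_preimage) (auto intro!: continuous_intros)
  then show ?thesis by (simp add: Int_def vimage_def)
 qed
 then show oD: "open ?D" unfolding D by (intro open_Un open_ball)
 have D0: "?D - {0} = (\<lambda>z. 1 / (z - a)) ` (- closure \<Omega>)"
 proof (intro set_eqI iffI)
  fix u assume "u \<in> ?D - {0}"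
  then show "u \<in> (\<lambda>z. 1 / (z - a)) ` (- closure \<Omega>)"
   by (intro image_eqI[of _ _ "a + 1 / u"]) (auto simp: inverted_exterior_def)
 next
  fix u assume "u \<in> (\<lambda>z. 1 / (z - a)) ` (- closure \<Omega>)"
  then obtain z where z: "u = 1 / (z - a)" "z \<in> - closure \<Omega>" by blast
  have "z \<noteq> a" using z(2) a closure_subset by blast
  then show "u \<in> ?D - {0}" using z by (simp add: inverted_exterior_def)
 qed
 have "connected (?D - {0})" unfolding D0
 proof (rule connected_continuous_image[OF _ E])
  have "z \<noteq> a" if "z \<in> - closure \<Omega>" for z using that a closure_subset by blast
  then show "continuous_on (- closure \<Omega>) (\<lambda>z. 1 / (z - a))" by (intro continuous_intros) auto
 qed
 moreover have "?D \<subseteq> closure (?D - {0})"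
 proof -
  have "0 islimpt ?D" using oD ball \<delta> by (intro interior_limit_point) (auto simp: interior_open)
  then have "0 \<in> closure (?D - {0})" by (simp add: islimpt_in_closure)
  then show ?thesis using closure_subset[of "?D - {0}"] by blast
 qed
 ultimately have cD: "connected ?D" by (rule connected_intermediate_closure[OF _ Diff_subset])
 obtain d where d: "d > 0" "ball a d \<subseteq> \<Omega>" using \<Omega>(1) a open_contains_ball by blast
 have "cmod u \<le> 1 / d" if "u \<in> ?D" for u
 proof (cases "u = 0")
  case False
  then have "a + 1 / u \<notin> closure \<Omega>" using that by (simp add: inverted_exterior_def)
  then have "a + 1 / u \<notin> ball a d" using d(2) closure_subset[of \<Omega>] by blast
  then have "d \<le> cmod (1 / u)" by (simp add: dist_norm)
  then show ?thesis using False d(1) by (simp add: norm_divide field_simps)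
 qed (use d in simp)
 then show bD: "bounded ?D" by (auto simp: bounded_iff)
 have cD': "- ?D = (\<lambda>z. 1 / (z - a)) ` (closure \<Omega> - {a})"
 proof (intro set_eqI iffI)
  fix u assume "u \<in> - ?D"
  then show "u \<in> (\<lambda>z. 1 / (z - a)) ` (closure \<Omega> - {a})"
   by (intro image_eqI[of _ _ "a + 1 / u"]) (auto simp: inverted_exterior_def)
 qed (auto simp: inverted_exterior_def)
 have "connected (closure \<Omega> - {a})"
 proof (rule connected_intermediate_closure)
  show "connected (\<Omega> - {a})" using \<Omega> by (intro connected_open_delete) auto
  show "\<Omega> - {a} \<subseteq> closure \<Omega> - {a}" using closure_subset by blast
  have "closure \<Omega> = insert a (closure (\<Omega> - {a}))"
   using closure_insert[of a "\<Omega> - {a}"] a by (simp add: insert_absorb)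
  then show "closure \<Omega> - {a} \<subseteq> closure (\<Omega> - {a})" by blast
 qed
 then have "connected (- ?D)" unfolding cD'
  by (intro connected_continuous_image) (auto intro!: continuous_intros)
 then show "simply_connected ?D" using simply_connected_iff_simple[OF oD bD] cD by simp
qed

lemma riemann_map_normalized:
 assumes "open D" "simply_connected D" "bounded D" "0 \<in> D"
 shows "\<exists>h g. h holomorphic_on D \<and> g holomorphic_on ball 0 1 \<and> (\<forall>u\<in>D. h u \<in> ball 0 1 \<and> g (h u) = u) \<and>
  (\<forall>s\<in>ball 0 1. g s \<in> D \<and> h (g s) = s) \<and> h 0 = 0 \<and> g 0 = 0"
proof -
 have "D \<noteq> UNIV" using assms(3) by auto
 then obtain f g where fg: "f holomorphic_on D" "g holomorphic_on ball 0 1" "\<forall>u\<in>D. f u \<in> ball 0 1 \<and> g (f u) = u"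
   "\<forall>s\<in>ball 0 1. g s \<in> D \<and> f (g s) = s"
  using Riemann_mapping_theorem[of D] assms by blast
 have "f 0 \<in> ball 0 1" using fg(3) assms(4) by blast
 then obtain m n where mn: "m (f 0) = 0" "m holomorphic_on ball 0 1" "m ` ball 0 1 \<subseteq> ball 0 1"
   "n holomorphic_on ball 0 1" "n ` ball 0 1 \<subseteq> ball 0 1"
   "\<And>z. z \<in> ball 0 1 \<Longrightarrow> m (n z) = z" "\<And>z. z \<in> ball 0 1 \<Longrightarrow> n (m z) = z"
  by (rule ball_biholomorphism_exists) (rule that)
 have mf: "m (f u) \<in> ball 0 1" if "u \<in> D" for u using fg(3) that mn(3) by blast
 have nb: "n s \<in> ball 0 1" if "s \<in> ball 0 1" for s using mn(5) that by blast
 have gm: "g (n (m (f u))) = u" if "u \<in> D" for u using mn(7)[of "f u"] fg(3) that by auto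
 show ?thesis
 proof (rule exI[of _ "\<lambda>u. m (f u)"], rule exI[of _ "\<lambda>s. g (n s)"], intro conjI ballI)
  show "(\<lambda>u. m (f u)) holomorphic_on D"
   by (rule holomorphic_on_compose_gen[OF fg(1) mn(2), unfolded o_def]) (use fg(3) in blast)
  show "(\<lambda>s. g (n s)) holomorphic_on ball 0 1"
   by (rule holomorphic_on_compose_gen[OF mn(4) fg(2) mn(5), unfolded o_def])
  show "m (f 0) = 0" by (rule mn(1))
  show "g (n 0) = 0" using gm[OF assms(4)] mn(1) by simp
  fix s :: complex assume s: "s \<in> ball 0 1"
  show "g (n s) \<in> D" using fg(4) nb[OF s] by blast
  show "m (f (g (n s))) = s" using fg(4) nb[OF s] mn(6)[OF s] by auto
 qed (use mf gm in auto)
qed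

lemma open_superset_closed_disc:
 assumes "open U" "cball 0 1 \<subseteq> (U :: complex set)"
 shows "\<exists>R>1. ball 0 R \<subseteq> U"
proof -
 obtain e where e: "e > 0" "(\<Union>x\<in>cball 0 1. ball x e) \<subseteq> U"
  using compact_subset_open_imp_ball_epsilon_subset[of "cball 0 1" U] assms by auto
 have "ball 0 (1 + e) \<subseteq> U"
 proof
  fix s :: complex assume s: "s \<in> ball 0 (1 + e)"
  show "s \<in> U"
  proof (cases "cmod s \<le> 1")
   case False
   define x where "x = s / of_real (cmod s)"
   have s0: "s \<noteq> 0" using False by auto
   have "x \<in> cball 0 1" using False by (simp add: x_def norm_divide)
   moreover have "dist x s < e"
   proof -
    have "s - x = of_real (cmod s - 1) * x" using s0 by (simp add: x_def field_simps)
    then have "cmod (s - x) = \<bar>cmod s - 1\<bar> * cmod x" by (metis norm_mult norm_of_real)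
    moreover have "cmod x = 1" using s0 by (simp add: x_def norm_divide)
    ultimately show ?thesis using False s by (simp add: dist_norm norm_minus_commute)
   qed
   ultimately have "s \<in> (\<Union>x\<in>cball 0 1. ball x e)" by (intro UN_I) auto
   then show ?thesis using e(2) by blast
  qed (use assms(2) in auto)
 qed
 then show ?thesis using e(1) by (intro exI[of _ "1 + e"]) auto
qed

text \<open>Each side of the circle is connected and is mapped off the curve, hence into \<open>\<Omega>\<close> or into the exterior. Since the curve bounds both, the two sides go to different sets; the sign \<open>\<sigma>\<close> reverses the parametrisation, if necessary, so that the inner side goes to the exterior.\<close>
lemma curve_annulus_sides:
 assumes \<gamma>: "analytic_jordan_curve \<gamma>" and \<Omega>: "open \<Omega>" and fr: "frontier \<Omega> = \<gamma> ` {0..1}"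
  and fr2: "frontier (- closure \<Omega>) = frontier \<Omega>"
 shows "\<exists>R>1. \<exists>G \<sigma> :: real. (\<sigma> = 1 \<or> \<sigma> = - 1) \<and> G holomorphic_on annulus R \<and> inj_on G (annulus R) \<and>
  (\<forall>t. G (cis (2 * pi * (\<sigma> * t))) = \<gamma> t) \<and> G ` sphere 0 1 = frontier \<Omega> \<and>
  G ` {w. 1/R < cmod w \<and> cmod w < 1} \<subseteq> - closure \<Omega> \<and> G ` {w. 1 < cmod w \<and> cmod w < R} \<subseteq> \<Omega>"
proof -
 obtain R G where R: "R > 1" and G: "G holomorphic_on annulus R" and inj: "inj_on G (annulus R)"
  and G\<gamma>: "\<And>t. G (cis (2 * pi * t)) = \<gamma> t"
  using analytic_jordan_curve_extension[OF \<gamma>] by blast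
 have img: "G ` sphere 0 1 = frontier \<Omega>"
 proof -
  have "G ` sphere 0 1 = \<gamma> ` {0..1}"
  proof (intro set_eqI iffI)
   fix z assume "z \<in> G ` sphere 0 1"
   then obtain w where w: "cmod w = 1" "z = G w" by auto
   define t where "t = Arg2pi w / (2 * pi)"
   have "w = cis (2 * pi * t)" using Arg2pi[of w] w(1) by (simp add: cis_conv_exp t_def is_Arg_def)
   moreover have "t \<in> {0..1}" using Arg2pi[of w] by (simp add: t_def divide_le_eq)
   ultimately show "z \<in> \<gamma> ` {0..1}" using w(2) G\<gamma> by blast
  next
   fix z assume "z \<in> \<gamma> ` {0..1}"
   then obtain t where "z = G (cis (2 * pi * t))" using G\<gamma> by auto
   then show "z \<in> G ` sphere 0 1" by auto
  qed
  then show ?thesis using fr by simp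
 qed
 let ?I = "{w. 1/R < cmod w \<and> cmod w < 1}" and ?O = "{w. 1 < cmod w \<and> cmod w < R}"
 have IA: "?I \<subseteq> annulus R" "?O \<subseteq> annulus R" "sphere 0 1 \<subseteq> annulus R"
  using R by (auto simp: annulus_def intro: less_trans[of _ 1])
 have GI: "continuous_on ?I G" "continuous_on ?O G"
  using holomorphic_on_imp_continuous_on[OF G] IA by (auto intro: continuous_on_subset)
 have con: "connected {w::complex. a < cmod w \<and> cmod w < b}" if "0 \<le> a" for a b
 proof -
  have "connected {w::complex. a < norm (w - 0) \<and> norm (w - 0) < b}"
   by (rule connected_annulus) simp
  then show ?thesis by simp
 qed
 have notfr: "G w \<notin> frontier \<Omega>" if "w \<in> ?I \<or> w \<in> ?O" for w
 proof
  assume "G w \<in> frontier \<Omega>"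
  then obtain v where v: "cmod v = 1" "G v = G w" using img by (metis imageE mem_sphere_0)
  have "v \<in> annulus R" "w \<in> annulus R" using v(1) IA that by (auto simp: subset_iff)
  then have "v = w" using inj_onD[OF inj v(2)] by blast
  then show False using v(1) that by auto
 qed
 have side: "G ` S \<subseteq> \<Omega> \<or> G ` S \<subseteq> - closure \<Omega>" if "S = ?I \<or> S = ?O" for S
 proof (rule ccontr)
  assume "\<not> (G ` S \<subseteq> \<Omega> \<or> G ` S \<subseteq> - closure \<Omega>)"
  moreover have nf: "G ` S \<inter> frontier \<Omega> = {}" using notfr that by blast
  moreover have cl: "closure \<Omega> = \<Omega> \<union> frontier \<Omega>" using closure_Un_frontier by blast
  ultimately have "G ` S \<inter> \<Omega> \<noteq> {}" "G ` S - \<Omega> \<noteq> {}" by blast+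
  moreover have "connected (G ` S)"
   using that GI con[of "1/R" 1] con[of 1 R] R by (auto intro!: connected_continuous_image)
  ultimately have "G ` S \<inter> frontier \<Omega> \<noteq> {}" by (intro connected_Int_frontier) auto
  then show False using nf by blast
 qed
 have oG: "open (G ` annulus R)" by (rule open_mapping_thm3[OF G open_annulus inj])
 have "G 1 \<in> frontier \<Omega>" using img by force
 moreover have "G 1 \<in> G ` annulus R" using R by (intro imageI) (simp add: annulus_def)
 ultimately have "G 1 \<in> G ` annulus R \<inter> closure \<Omega>" "G 1 \<in> G ` annulus R \<inter> closure (- closure \<Omega>)"
  using fr2 by (auto simp: frontier_def)
 then have meet: "G ` annulus R \<inter> \<Omega> \<noteq> {}" "G ` annulus R \<inter> - closure \<Omega> \<noteq> {}"
  using open_Int_closure_eq_empty[OF oG] by blast+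
 have ann: "annulus R = ?I \<union> sphere 0 1 \<union> ?O"
  using IA by (auto simp: annulus_def)
 have notboth: "\<not> (G ` ?I \<subseteq> \<Omega> \<and> G ` ?O \<subseteq> \<Omega>)" "\<not> (G ` ?I \<subseteq> - closure \<Omega> \<and> G ` ?O \<subseteq> - closure \<Omega>)"
 proof -
  have cl: "\<Omega> \<subseteq> closure \<Omega>" "frontier \<Omega> \<subseteq> closure \<Omega>" "frontier \<Omega> \<inter> \<Omega> = {}"
   using closure_subset \<Omega> frontier_disjoint_eq[of \<Omega>] by (auto simp: frontier_def)
  have un: "G ` annulus R = G ` ?I \<union> frontier \<Omega> \<union> G ` ?O" unfolding ann image_Un img ..
  show "\<not> (G ` ?I \<subseteq> \<Omega> \<and> G ` ?O \<subseteq> \<Omega>)" using meet(2) cl unfolding un by blast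
  show "\<not> (G ` ?I \<subseteq> - closure \<Omega> \<and> G ` ?O \<subseteq> - closure \<Omega>)" using meet(1) cl unfolding un by blast
 qed
 have sides: "G ` ?I \<subseteq> \<Omega> \<or> G ` ?I \<subseteq> - closure \<Omega>" "G ` ?O \<subseteq> \<Omega> \<or> G ` ?O \<subseteq> - closure \<Omega>"
  using side by blast+
 show ?thesis
 proof (cases "G ` ?I \<subseteq> - closure \<Omega>")
  case True
  then have "G ` ?O \<subseteq> \<Omega>" using sides notboth by blast
  then have "(1 = (1::real) \<or> 1 = - (1::real)) \<and> G holomorphic_on annulus R \<and> inj_on G (annulus R) \<and>
   (\<forall>t. G (cis (2 * pi * (1 * t))) = \<gamma> t) \<and> G ` sphere 0 1 = frontier \<Omega> \<and> G ` ?I \<subseteq> - closure \<Omega> \<and> G ` ?O \<subseteq> \<Omega>"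
   using True G inj G\<gamma> img by simp
  then show ?thesis
   by - (rule exI[of _ R], rule conjI[OF R], rule exI[of _ G], rule exI[of _ 1], assumption)
 next
  case False
  then have gI: "G ` ?I \<subseteq> \<Omega>" and gO: "G ` ?O \<subseteq> - closure \<Omega>" using sides notboth by blast+
  define G' where "G' w = G (1 / w)" for w
  have inv: "1 / w \<in> annulus R" if "w \<in> annulus R" for w
  proof -
   have "1 / R < cmod w" "cmod w < R" "cmod w > 0" using that R by (auto simp: annulus_def intro: less_trans[of 0 "1/R"])
   then show ?thesis using R by (simp add: annulus_def norm_divide field_simps)
  qed
  have "G' holomorphic_on annulus R" unfolding G'_def
   by (rule holomorphic_on_compose_gen[OF _ G, unfolded o_def])
     (use inv zero_notin_annulus[of R] R in \<open>auto intro!: holomorphic_intros\<close>)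
  moreover have "inj_on G' (annulus R)"
  proof (rule inj_onI)
   fix w v assume "w \<in> annulus R" "v \<in> annulus R" "G' w = G' v"
   then have "1 / w = 1 / v" unfolding G'_def using inj_onD[OF inj _ inv inv] by blast
   then show "w = v" by simp
  qed
  moreover have "G' (cis (2 * pi * (- 1 * t))) = \<gamma> t" for t
  proof -
   have "1 / cis (2 * pi * (- 1 * t)) = cis (2 * pi * t)" by (simp add: divide_inverse)
   then show ?thesis unfolding G'_def using G\<gamma>[of t] by simp
  qed
  moreover have "G' ` sphere 0 1 = frontier \<Omega>"
  proof -
   have "(\<lambda>w. 1 / w) ` sphere (0::complex) 1 = sphere 0 1"
   proof (intro set_eqI iffI)
    fix w :: complex assume "w \<in> sphere 0 1"
    then show "w \<in> (\<lambda>w. 1 / w) ` sphere 0 1" by (intro image_eqI[of _ _ "1 / w"]) (auto simp: norm_divide)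
   qed (auto simp: norm_divide)
   then show ?thesis unfolding G'_def using img by (metis (mono_tags, lifting) image_cong image_image)
  qed
  moreover have "G' ` ?I \<subseteq> - closure \<Omega>"
  proof
   fix z assume "z \<in> G' ` ?I"
   then obtain w where w: "1 / R < cmod w" "cmod w < 1" "z = G (1 / w)" by (auto simp: G'_def)
   have "cmod w > 0" using w(1) R by (auto intro: less_trans[of 0 "1/R"])
   then have "1 / w \<in> ?O" using w R by (simp add: norm_divide field_simps)
   then show "z \<in> - closure \<Omega>" using gO w(3) by blast
  qed
  moreover have "G' ` ?O \<subseteq> \<Omega>"
  proof
   fix z assume "z \<in> G' ` ?O"
   then obtain w where w: "1 < cmod w" "cmod w < R" "z = G (1 / w)" by (auto simp: G'_def)
   have "cmod w > 0" using w(1) by linarith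
   then have "1 / w \<in> ?I" using w R by (simp add: norm_divide field_simps)
   then show "z \<in> \<Omega>" using gI w(3) by blast
  qed
  ultimately have "(- 1 = (1::real) \<or> - 1 = - (1::real)) \<and> G' holomorphic_on annulus R \<and> inj_on G' (annulus R) \<and>
   (\<forall>t. G' (cis (2 * pi * (- 1 * t))) = \<gamma> t) \<and> G' ` sphere 0 1 = frontier \<Omega> \<and> G' ` ?I \<subseteq> - closure \<Omega> \<and> G' ` ?O \<subseteq> \<Omega>"
   by blast
  then show ?thesis
   by - (rule exI[of _ R], rule conjI[OF R], rule exI[of _ G'], rule exI[of _ "- 1"], assumption)
 qed
qed

lemma circle_parametrization_derivative:
 assumes R: "R > 1" and G: "G holomorphic_on annulus R"
 shows "((\<lambda>t. G (cis (2 * pi * (\<sigma> * t)))) has_vector_derivative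
      (2 * pi * \<i> * \<sigma> * cis (2 * pi * (\<sigma> * t)) * deriv G (cis (2 * pi * (\<sigma> * t))))) (at t)"
  and "continuous_on UNIV (\<lambda>t. 2 * pi * \<i> * \<sigma> * cis (2 * pi * (\<sigma> * t)) * deriv G (cis (2 * pi * (\<sigma> * t))))"
proof -
 have A: "cis x \<in> annulus R" for x using R by (simp add: annulus_def)
 have c: "((\<lambda>t. cis (2 * pi * (\<sigma> * t))) has_vector_derivative (2 * pi * \<i> * \<sigma> * cis (2 * pi * (\<sigma> * t)))) (at t)"
 proof -
  have "((\<lambda>z. exp (2 * pi * \<i> * \<sigma> * z)) has_field_derivative (2 * pi * \<i> * \<sigma> * cis (2 * pi * (\<sigma> * t)))) (at (complex_of_real t))"
   by (auto intro!: derivative_eq_intros simp: cis_conv_exp mult_ac)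
  from has_vector_derivative_real_field[OF this] show ?thesis
   by (simp add: cis_conv_exp mult_ac)
 qed
 have g: "(G has_field_derivative deriv G (cis (2 * pi * (\<sigma> * t)))) (at (cis (2 * pi * (\<sigma> * t))))"
  by (rule holomorphic_derivI[OF G open_annulus A])
 show "((\<lambda>t. G (cis (2 * pi * (\<sigma> * t)))) has_vector_derivative
      (2 * pi * \<i> * \<sigma> * cis (2 * pi * (\<sigma> * t)) * deriv G (cis (2 * pi * (\<sigma> * t))))) (at t)"
  using field_vector_diff_chain_at[OF c g] by (simp add: o_def)
 have cd: "continuous_on (annulus R) (deriv G)"
  by (intro holomorphic_on_imp_continuous_on holomorphic_deriv G open_annulus)
 have "continuous_on UNIV (\<lambda>t. deriv G (cis (2 * pi * (\<sigma> * t))))"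
  by (rule continuous_on_compose2[OF cd]) (use A in \<open>auto intro!: continuous_intros\<close>)
 then show "continuous_on UNIV (\<lambda>t. 2 * pi * \<i> * \<sigma> * cis (2 * pi * (\<sigma> * t)) * deriv G (cis (2 * pi * (\<sigma> * t))))"
  by (intro continuous_intros)
qed

lemma analytic_jordan_curve_C1:
 assumes \<gamma>: "analytic_jordan_curve \<gamma>"
 shows "\<exists>\<gamma>'. continuous_on UNIV \<gamma>' \<and> (\<forall>t. (\<gamma> has_vector_derivative \<gamma>' t) (at t))"
proof -
 obtain R G where R: "R > 1" and G: "G holomorphic_on annulus R" and G\<gamma>: "\<And>t. G (cis (2 * pi * t)) = \<gamma> t"
  using analytic_jordan_curve_extension[OF \<gamma>] by blast
 have e: "(\<lambda>t. G (cis (2 * pi * (1 * t)))) = \<gamma>" using G\<gamma> by simp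
 show ?thesis using circle_parametrization_derivative[OF R G, of 1] unfolding e by blast
qed

lemma analytic_jordan_curve_simple_path:
 assumes \<gamma>: "analytic_jordan_curve \<gamma>"
 shows "simple_path \<gamma>" "pathfinish \<gamma> = pathstart \<gamma>"
proof -
 obtain \<gamma>' where "\<And>t. (\<gamma> has_vector_derivative \<gamma>' t) (at t)" using analytic_jordan_curve_C1[OF \<gamma>] by blast
 then have "isCont \<gamma> t" for t using has_vector_derivative_continuous by blast
 then have "path \<gamma>" by (simp add: path_def continuous_at_imp_continuous_on)
 have per: "\<gamma> (t + 1) = \<gamma> t" and inj: "inj_on \<gamma> {0..<1}" for t using \<gamma> by (auto simp: analytic_jordan_curve_def)
 have g1: "\<gamma> 1 = \<gamma> 0" using per[of 0] by simp
 then show "pathfinish \<gamma> = pathstart \<gamma>" by (simp add: pathfinish_def pathstart_def)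
 have "loop_free \<gamma>"
  unfolding loop_free_def
 proof (intro ballI impI)
  fix x y :: real assume xy: "x \<in> {0..1}" "y \<in> {0..1}" "\<gamma> x = \<gamma> y"
  define x' where "x' = (if x = 1 then 0 else x)"
  define y' where "y' = (if y = 1 then 0 else y)"
  have "\<gamma> x' = \<gamma> x" "\<gamma> y' = \<gamma> y" using g1 by (auto simp: x'_def y'_def)
  with xy(3) have "\<gamma> x' = \<gamma> y'" by simp
  moreover have "x' \<in> {0..<1}" "y' \<in> {0..<1}" using xy by (auto simp: x'_def y'_def)
  ultimately have "x' = y'" using inj_onD[OF inj] by blast
  then show "x = y \<or> x = 0 \<and> y = 1 \<or> x = 1 \<and> y = 0" by (auto simp: x'_def y'_def split: if_splits)
 qed
 with \<open>path \<gamma>\<close> show "simple_path \<gamma>" by (simp add: simple_path_def)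
qed

lemma open_not_subset_sphere:
 assumes "open V" "v \<in> (V :: complex set)"
 shows "\<exists>x\<in>V. cmod x \<noteq> 1"
proof (cases "cmod v = 1")
 case True
 obtain e where e: "e > 0" "ball v e \<subseteq> V" using assms open_contains_ball by blast
 define x where "x = v * of_real (1 + e / 2)"
 have "v - x = - (v * of_real (e / 2))" by (simp add: x_def algebra_simps)
 then have "cmod (v - x) = e / 2" using True e(1) by (simp only: norm_minus_cancel norm_mult norm_of_real)
 then have "x \<in> V" using e by (auto simp: dist_norm)
 moreover have "cmod x = 1 + e / 2" unfolding x_def norm_mult norm_of_real using True e(1) by simp
 ultimately show ?thesis using e(1) by (intro bexI[of _ x]) auto
qed (use assms in blast)

text \<open>Compactness: if the values of \<open>h\<close> stayed in a smaller disc along points tending to the circle, then a limit of them would be mapped by \<open>g\<close> to a point of the open inverted exterior, whereas \<open>G\<close> maps the limit of the points to the frontier.\<close>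
lemma boundary_modulus_tendsto_1:
 assumes \<Omega>: "open \<Omega>" and a: "a \<in> \<Omega>" and R: "R > 1" and G: "G holomorphic_on annulus R"
  and Gs: "G ` sphere 0 1 \<subseteq> frontier \<Omega>" and GI: "G ` {w. 1/R < cmod w \<and> cmod w < 1} \<subseteq> - closure \<Omega>"
  and h: "\<And>u. u \<in> inverted_exterior \<Omega> a \<Longrightarrow> h u \<in> ball 0 1 \<and> g (h u) = u"
  and g: "g holomorphic_on ball 0 1" "\<And>s. s \<in> ball 0 1 \<Longrightarrow> g s \<in> inverted_exterior \<Omega> a"
  and e: "e > 0"
 shows "\<exists>\<eta><1. \<forall>w. \<eta> < cmod w \<and> cmod w < 1 \<longrightarrow> \<bar>cmod (h (1 / (G w - a))) - 1\<bar> < e"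
proof (rule ccontr)
 assume neg: "\<not> (\<exists>\<eta><1. \<forall>w. \<eta> < cmod w \<and> cmod w < 1 \<longrightarrow> \<bar>cmod (h (1 / (G w - a))) - 1\<bar> < e)"
 define q where "q n = max (1/R) (1 - 1 / real (Suc n))" for n
 have q: "q n < 1" "1/R \<le> q n" "1 - 1 / real (Suc n) \<le> q n" for n using R by (auto simp: q_def)
 have "\<forall>n. \<exists>w. q n < cmod w \<and> cmod w < 1 \<and> \<not> \<bar>cmod (h (1 / (G w - a))) - 1\<bar> < e"
  using neg q(1) by blast
 from choice[OF this] obtain w where w: "\<forall>n. q n < cmod (w n) \<and> cmod (w n) < 1 \<and> \<not> \<bar>cmod (h (1 / (G (w n) - a))) - 1\<bar> < e"
  by (elim exE)
 have wI: "G (w n) \<in> - closure \<Omega>" for n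
 proof -
  have "1/R < cmod (w n)" "cmod (w n) < 1" using w q(2)[of n] by (auto intro: le_less_trans)
  then show ?thesis using GI by blast
 qed
 have inD: "1 / (G (w n) - a) \<in> inverted_exterior \<Omega> a" for n
  using wI[of n] by (simp add: inverted_exterior_def)
 define s where "s n = h (1 / (G (w n) - a))" for n
 have sb: "s n \<in> ball 0 1" and gs: "g (s n) = 1 / (G (w n) - a)" for n using h[OF inD[of n]] by (auto simp: s_def)
 have s1: "cmod (s n) \<le> 1 - e" for n
 proof -
  have "\<not> \<bar>cmod (s n) - 1\<bar> < e" using spec[OF w, of n] by (simp add: s_def)
  moreover have "cmod (s n) < 1" using sb[of n] by simp
  ultimately show ?thesis by linarith
 qed
 have "compact (cball (0::complex) (1 - e) \<times> cball (0::complex) 1)" by (intro compact_Times compact_cball)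
 moreover have "\<forall>n. (s n, w n) \<in> cball 0 (1 - e) \<times> cball 0 1" using s1 w by (auto simp: less_imp_le)
 ultimately obtain l r where l: "l \<in> cball 0 (1 - e) \<times> cball 0 1" and r: "strict_mono r" and lim: "((\<lambda>n. (s n, w n)) \<circ> r) \<longlonglongrightarrow> l"
  unfolding compact_def by meson
 have sl: "(\<lambda>n. s (r n)) \<longlonglongrightarrow> fst l" and wl: "(\<lambda>n. w (r n)) \<longlonglongrightarrow> snd l"
  using tendsto_fst[OF lim] tendsto_snd[OF lim] by (simp_all add: o_def)
 have "(\<lambda>n. 1 - 1 / real (Suc n)) \<longlonglongrightarrow> 1" by real_asymp
 from LIMSEQ_subseq_LIMSEQ[OF this r] have "(\<lambda>n. 1 - 1 / real (Suc (r n))) \<longlonglongrightarrow> 1" by (simp add: o_def)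
 moreover have "1 - 1 / real (Suc (r n)) \<le> cmod (w (r n))" for n using w q(3)[of "r n"] by (auto intro: order_trans less_imp_le)
 ultimately have "1 \<le> cmod (snd l)" using tendsto_norm[OF wl] by (intro LIMSEQ_le) auto
 then have w1: "cmod (snd l) = 1" using l by auto
 then have fr: "G (snd l) \<in> frontier \<Omega>" using Gs by auto
 have "snd l \<in> annulus R" using w1 R by (simp add: annulus_def)
 then have "isCont G (snd l)"
  using holomorphic_on_imp_continuous_on[OF G] by (simp add: continuous_on_eq_continuous_at[OF open_annulus])
 then have Gl: "(\<lambda>n. G (w (r n))) \<longlonglongrightarrow> G (snd l)" using isCont_tendsto_compose wl by blast
 have na: "G (snd l) \<noteq> a" using fr a \<Omega> frontier_disjoint_eq[of \<Omega>] by blast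
 have "cmod (fst l) \<le> 1 - e" using l by auto
 then have fl: "fst l \<in> ball 0 1" using e by simp
 then have "isCont g (fst l)"
  using holomorphic_on_imp_continuous_on[OF g(1)] by (simp add: continuous_on_eq_continuous_at)
 then have "(\<lambda>n. g (s (r n))) \<longlonglongrightarrow> g (fst l)" using isCont_tendsto_compose sl by blast
 moreover have "(\<lambda>n. g (s (r n))) \<longlonglongrightarrow> 1 / (G (snd l) - a)"
  unfolding gs using na by (intro tendsto_intros Gl) auto
 ultimately have "g (fst l) = 1 / (G (snd l) - a)" by (rule LIMSEQ_unique)
 then have "1 / (G (snd l) - a) \<in> inverted_exterior \<Omega> a" using g(2)[OF fl] by simp
 then have "G (snd l) \<in> - closure \<Omega>" using na by (simp add: inverted_exterior_def)
 then show False using fr by (simp add: frontier_def)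
qed

text \<open>The map respects the two sides of the circle and is injective on each. If two points of the circle had the same image, the images of disjoint neighbourhoods would overlap in an open set, which contains points off the circle.\<close>
lemma reflected_map_injective:
 assumes R: "R > 1" and F: "F holomorphic_on annulus R"
  and I: "\<And>w. 1/R < cmod w \<Longrightarrow> cmod w < 1 \<Longrightarrow> cmod (F w) < 1"
  and O: "\<And>w. 1 < cmod w \<Longrightarrow> cmod w < R \<Longrightarrow> cmod (F w) > 1"
  and S: "\<And>w. cmod w = 1 \<Longrightarrow> cmod (F w) = 1"
  and injI: "inj_on F {w. 1/R < cmod w \<and> cmod w < 1}" and injO: "inj_on F {w. 1 < cmod w \<and> cmod w < R}"
 shows "inj_on F (annulus R)"
proof (rule inj_onI)
 fix w1 w2 assume w: "w1 \<in> annulus R" "w2 \<in> annulus R" "F w1 = F w2"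
 have cA: "connected (annulus R)"
 proof -
  have "connected {w::complex. 1/R < norm (w - 0) \<and> norm (w - 0) < R}" by (rule connected_annulus) simp
  then show ?thesis by (simp add: annulus_def)
 qed
 have nc: "\<not> F constant_on annulus R"
 proof
  assume "F constant_on annulus R"
  then obtain c where c: "\<And>w. w \<in> annulus R \<Longrightarrow> F w = c" unfolding constant_on_def by blast
  define x where "x = complex_of_real ((1 + R) / 2)"
  have x: "cmod x = (1 + R) / 2" unfolding x_def norm_of_real using R by simp
  have "1 / R < 1" using R by simp
  then have "1 / R < cmod x" using R unfolding x by (intro less_trans[of "1/R" 1 "(1 + R)/2"]) simp_all
  moreover have "cmod x < R" using R unfolding x by simp
  ultimately have "x \<in> annulus R" "1 \<in> annulus R" using R \<open>1 / R < 1\<close> unfolding annulus_def by simp_all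
  then have "F x = F 1" using c by simp
  moreover have "cmod (F x) > 1" using x R by (intro O) auto
  ultimately show False using S[of 1] by simp
 qed
 have trich: "cmod (F w) < 1 \<longleftrightarrow> cmod w < 1" "cmod (F w) > 1 \<longleftrightarrow> cmod w > 1" if "w \<in> annulus R" for w
  using that I[of w] O[of w] S[of w] unfolding annulus_def by (cases "cmod w < 1"; cases "cmod w > 1"; force)+
 show "w1 = w2"
 proof (rule ccontr)
  assume ne: "w1 \<noteq> w2"
  obtain U1 U2 where U: "open U1" "open U2" "w1 \<in> U1" "w2 \<in> U2" "U1 \<inter> U2 = {}"
   using hausdorff[OF ne] by blast
  have op: "open (F ` (U \<inter> annulus R))" if "open U" for U
   by (rule open_mapping_thm[OF F open_annulus cA _ _ nc]) (use that open_annulus in auto)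
  have "open (F ` (U1 \<inter> annulus R) \<inter> F ` (U2 \<inter> annulus R))" using op U by (intro open_Int) auto
  moreover have "F w1 \<in> F ` (U1 \<inter> annulus R) \<inter> F ` (U2 \<inter> annulus R)"
  proof
   show "F w1 \<in> F ` (U1 \<inter> annulus R)" using w U by blast
   show "F w1 \<in> F ` (U2 \<inter> annulus R)" unfolding w(3) using w U by blast
  qed
  ultimately obtain v where v: "v \<in> F ` (U1 \<inter> annulus R)" "v \<in> F ` (U2 \<inter> annulus R)" "cmod v \<noteq> 1"
   using open_not_subset_sphere by blast
  obtain x1 where x1: "x1 \<in> U1" "x1 \<in> annulus R" "v = F x1" using v(1) by blast
  obtain x2 where x2: "x2 \<in> U2" "x2 \<in> annulus R" "v = F x2" using v(2) by blast
  have "x1 = x2"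
  proof (cases "cmod v < 1")
   case True
   have "F x1 = F x2" using x1(3) x2(3) by simp
   moreover have "cmod x1 < 1" "cmod x2 < 1" using True trich(1)[OF x1(2)] trich(1)[OF x2(2)] x1(3) x2(3) by simp_all
   moreover have "1/R < cmod x1" "1/R < cmod x2" using x1(2) x2(2) unfolding annulus_def by simp_all
   ultimately show ?thesis using inj_onD[OF injI, of x1 x2] by simp
  next
   case False
   then have "cmod v > 1" using v(3) by simp
   then have "cmod x1 > 1" "cmod x2 > 1" using trich(2)[OF x1(2)] trich(2)[OF x2(2)] x1(3) x2(3) by simp_all
   moreover have "F x1 = F x2" using x1(3) x2(3) by simp
   moreover have "cmod x1 < R" "cmod x2 < R" using x1(2) x2(2) unfolding annulus_def by simp_all
   ultimately show ?thesis using inj_onD[OF injO, of x1 x2] by simp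
  qed
  then show False using x1 x2 U(5) by blast
 qed
qed

text \<open>The map \<open>f\<close> below is the extended curve seen in the coordinate of the Riemann map \<open>h\<close>; its reflection \<open>F\<close> is injective on an annulus. The exterior coordinate \<open>\<psi>\<close> is given by the inverse Riemann map \<open>g\<close> in the disc and by \<open>G\<close> after the inverse of \<open>F\<close> near the circle. Multiplication by \<open>s\<close> removes the simple pole of \<open>\<psi>\<close> at 0, which corresponds to infinity. The curve \<open>\<eta>\<close> is the lift of \<open>\<gamma>\<close> to the unit circle.\<close>
theorem exterior_map:
 fixes \<Omega> :: "complex set"
 assumes \<Omega>: "open \<Omega>" "connected \<Omega>" "\<Omega> \<noteq> {}" "bounded \<Omega>" and \<gamma>: "analytic_jordan_curve \<gamma>"
  and fr: "frontier \<Omega> = \<gamma> ` {0..1}"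
 shows "\<exists>R>1. \<exists>H \<eta> \<eta>'. H holomorphic_on ball 0 R \<and> H 0 \<noteq> 0 \<and> inj_on (\<lambda>s. H s / s) (ball 0 R - {0}) \<and>
  (\<lambda>s. H s / s) ` (ball 0 1 - {0}) = - closure \<Omega> \<and> (\<lambda>s. H s / s) ` sphere 0 1 = frontier \<Omega> \<and>
  (\<forall>t::real. cmod (\<eta> t) = 1 \<and> H (\<eta> t) / \<eta> t = \<gamma> t \<and> (\<eta> has_vector_derivative \<eta>' t) (at t)) \<and> continuous_on UNIV \<eta>'"
proof -
 note sp = analytic_jordan_curve_simple_path[OF \<gamma>]
 note J = Jordan_inside_outside[OF sp]
 have pim: "path_image \<gamma> = \<gamma> ` {0..1}" by (simp add: path_image_def)
 have out: "- closure \<Omega> = outside (path_image \<gamma>)"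
  by (rule jordan_interior_exterior(2)[OF \<Omega> sp]) (simp add: fr pim)
 have E: "connected (- closure \<Omega>)" and fr2: "frontier (- closure \<Omega>) = frontier \<Omega>"
  using J unfolding out fr pim by simp_all
 from curve_annulus_sides[OF \<gamma> \<Omega>(1) fr fr2]
 obtain R1 G and \<sigma> :: real where R1: "R1 > 1" and \<sigma>: "\<sigma> = 1 \<or> \<sigma> = - 1" and G: "G holomorphic_on annulus R1" and injG: "inj_on G (annulus R1)"
  and G\<gamma>: "\<And>t. G (cis (2 * pi * (\<sigma> * t))) = \<gamma> t" and Gs: "G ` sphere 0 1 = frontier \<Omega>"
  and GI: "G ` {w. 1/R1 < cmod w \<and> cmod w < 1} \<subseteq> - closure \<Omega>" and GO: "G ` {w. 1 < cmod w \<and> cmod w < R1} \<subseteq> \<Omega>"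
  by (elim exE conjE) simp
 obtain a where a: "a \<in> \<Omega>" using \<Omega>(3) by blast
 let ?D = "inverted_exterior \<Omega> a"
 note D = inverted_exterior_simply_connected[OF \<Omega>(1,2,4) a E]
 have D0: "0 \<in> ?D" by (simp add: inverted_exterior_def)
 obtain h g where h: "h holomorphic_on ?D" and g: "g holomorphic_on ball 0 1"
  and hg: "\<And>u. u \<in> ?D \<Longrightarrow> h u \<in> ball 0 1 \<and> g (h u) = u"
  and gh: "\<And>s. s \<in> ball 0 1 \<Longrightarrow> g s \<in> ?D \<and> h (g s) = s" and h0: "h 0 = 0" and g0: "g 0 = 0"
  using riemann_map_normalized[OF D D0] by blast
 have aE: "z \<noteq> a" if "z \<in> - closure \<Omega>" for z using that a closure_subset by blast
 have uD: "1 / (z - a) \<in> ?D" if "z \<in> - closure \<Omega>" for z using that by (simp add: inverted_exterior_def)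
 define f where "f w = h (1 / (G w - a))" for w
 let ?I = "{w. 1/R1 < cmod w \<and> cmod w < 1}"
 have IA: "?I \<subseteq> annulus R1" using R1 by (auto simp: annulus_def)
 have fb: "cmod (f w) < 1" and gf: "g (f w) = 1 / (G w - a)" and fnz: "f w \<noteq> 0" if "w \<in> ?I" for w
 proof -
  have Gw: "G w \<in> - closure \<Omega>" using GI that by blast
  show "cmod (f w) < 1" and gf: "g (f w) = 1 / (G w - a)" using hg[OF uD[OF Gw]] by (auto simp: f_def)
  show "f w \<noteq> 0"
  proof
   assume "f w = 0"
   then have "1 / (G w - a) = 0" using gf g0 by simp
   then show False using aE[OF Gw] by simp
  qed
 qed
 have fhol: "f holomorphic_on ?I"
  unfolding f_def
 proof (rule holomorphic_on_compose_gen[OF _ h, unfolded o_def])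
  show "(\<lambda>w. 1 / (G w - a)) holomorphic_on ?I"
   using GI aE by (intro holomorphic_intros holomorphic_on_subset[OF G IA]) auto
  show "(\<lambda>w. 1 / (G w - a)) ` ?I \<subseteq> ?D" using GI uD by blast
 qed
 have finj: "inj_on f ?I"
 proof (rule inj_onI)
  fix w v assume wv: "w \<in> ?I" "v \<in> ?I" "f w = f v"
  then have "1 / (G w - a) = 1 / (G v - a)" using gf by metis
  then have "G w = G v" by simp
  moreover have "w \<in> annulus R1" "v \<in> annulus R1" using IA wv(1,2) by blast+
  ultimately show "w = v" using inj_onD[OF injG] by blast
 qed
 have flim: "\<exists>\<eta><1. \<forall>w. \<eta> < cmod w \<and> cmod w < 1 \<longrightarrow> \<bar>cmod (f w) - 1\<bar> < e" if "e > 0" for e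
  unfolding f_def using Gs gh by (intro boundary_modulus_tendsto_1[OF \<Omega>(1) a R1 G _ GI hg g _ that]) auto
 obtain R2 F where R2: "1 < R2" "R2 \<le> R1" and F: "F holomorphic_on annulus R2"
  and FI: "\<And>w. 1/R2 < cmod w \<Longrightarrow> cmod w < 1 \<Longrightarrow> F w = f w \<and> f w \<noteq> 0"
  and FO: "\<And>w. 1 < cmod w \<Longrightarrow> cmod w < R2 \<Longrightarrow> F w = 1 / cnj (f (1 / cnj w))"
  using circle_reflection[OF R1 fhol flim] by blast
 have R21: "1/R1 \<le> 1/R2" using R2 by (intro divide_left_mono) auto
 have I2: "w \<in> ?I" if "1/R2 < cmod w" "cmod w < 1" for w using that R21 by auto
 have I3: "1 / cnj w \<in> ?I" "1/R2 < cmod (1 / cnj w)" "cmod (1 / cnj w) < 1" if "1 < cmod w" "cmod w < R2" for w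
 proof -
  have "cmod (1 / cnj w) = 1 / cmod w" by (simp add: norm_divide)
  moreover have "1/R2 < 1 / cmod w" using that R2 by (intro divide_strict_left_mono mult_pos_pos) auto
  moreover have "1 / cmod w < 1" using that(1) by (subst divide_less_eq_1_pos) linarith+
  ultimately show "1/R2 < cmod (1 / cnj w)" "cmod (1 / cnj w) < 1" by simp_all
  then show "1 / cnj w \<in> ?I" using I2 by blast
 qed
 have mI: "cmod (F w) < 1" if "1/R2 < cmod w" "cmod w < 1" for w using FI[OF that] fb[OF I2[OF that]] by simp
 have mO: "cmod (F w) > 1" if "1 < cmod w" "cmod w < R2" for w
  using FO[OF that] fb[OF I3(1)[OF that]] fnz[OF I3(1)[OF that]] by (simp add: norm_divide)
 have mS: "cmod (F w) = 1" if w: "cmod w = 1" for w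
 proof -
  have "w \<in> annulus R2" using w R2 by (simp add: annulus_def)
  then have "isCont F w" using holomorphic_on_imp_continuous_on[OF F] by (simp add: continuous_on_eq_continuous_at[OF open_annulus])
  define x where "x n = of_real (1 - 1 / real (Suc (Suc n))) * w" for n
  have xn: "cmod (x n) = 1 - 1 / real (Suc (Suc n))" for n
   unfolding x_def norm_mult norm_of_real using w by (simp add: abs_of_nonneg)
  have "(\<lambda>n. 1 - 1 / real (Suc (Suc n))) \<longlonglongrightarrow> 1" by real_asymp
  then have nl: "(\<lambda>n. 1 - 1 / real (Suc (Suc n))) \<longlonglongrightarrow> 1" .
  then have "x \<longlonglongrightarrow> of_real 1 * w" unfolding x_def by (intro tendsto_intros)
  then have "x \<longlonglongrightarrow> w" by simp
  then have Fl: "(\<lambda>n. cmod (F (x n))) \<longlonglongrightarrow> cmod (F w)" using isCont_tendsto_compose[OF \<open>isCont F w\<close>] by (intro tendsto_norm)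
  have "(\<lambda>n. cmod (F (x n))) \<longlonglongrightarrow> 1"
  proof (rule tendstoI)
   fix e :: real assume "e > 0"
   then obtain \<eta> where \<eta>: "\<eta> < 1" "\<And>w. \<eta> < cmod w \<Longrightarrow> cmod w < 1 \<Longrightarrow> \<bar>cmod (f w) - 1\<bar> < e" using flim by blast
   have "max \<eta> (1/R2) < 1" using \<eta> R2 by simp
   from order_tendstoD(1)[OF nl this] show "\<forall>\<^sub>F n in sequentially. dist (cmod (F (x n))) 1 < e"
   proof eventually_elim
    case (elim n)
    have "F (x n) = f (x n)" using FI[of "x n"] elim xn[of n] by auto
    moreover have "\<bar>cmod (f (x n)) - 1\<bar> < e" using elim xn[of n] by (intro \<eta>(2)) auto
    ultimately show ?case by (simp add: dist_real_def)
   qed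
  qed
  then show ?thesis using Fl LIMSEQ_unique by blast
 qed
 have injF: "inj_on F (annulus R2)"
 proof (rule reflected_map_injective[OF R2(1) F mI mO mS])
  show "inj_on F {w. 1/R2 < cmod w \<and> cmod w < 1}"
  proof (rule inj_onI)
   fix w v assume "w \<in> {w. 1/R2 < cmod w \<and> cmod w < 1}" "v \<in> {w. 1/R2 < cmod w \<and> cmod w < 1}" "F w = F v"
   then show "w = v" using FI[of w] FI[of v] inj_onD[OF finj, of w v] I2[of w] I2[of v] by simp
  qed
  show "inj_on F {w. 1 < cmod w \<and> cmod w < R2}"
  proof (rule inj_onI)
   fix w v assume wv: "w \<in> {w. 1 < cmod w \<and> cmod w < R2}" "v \<in> {w. 1 < cmod w \<and> cmod w < R2}" "F w = F v"
   then have "cnj (f (1 / cnj w)) = cnj (f (1 / cnj v))" using FO[of w] FO[of v] by simp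
   then have "f (1 / cnj w) = f (1 / cnj v)" by (simp only: complex_cnj_cancel_iff)
   then have "1 / cnj w = 1 / cnj v" using inj_onD[OF finj] I3(1)[of w] I3(1)[of v] wv by blast
   then show "w = v" by simp
  qed
 qed
 have trich: "cmod (F w) < 1 \<longleftrightarrow> cmod w < 1" "cmod (F w) = 1 \<longleftrightarrow> cmod w = 1" if "w \<in> annulus R2" for w
  using that mI[of w] mO[of w] mS[of w] unfolding annulus_def by (cases "cmod w < 1"; cases "cmod w > 1"; force)+
 have oF: "open (F ` annulus R2)" by (rule open_mapping_thm3[OF F open_annulus injF])
 have sA: "sphere 0 1 \<subseteq> annulus R2" by (rule sphere_subset_annulus[OF R2(1)])
 have Fs: "F ` sphere 0 1 = sphere 0 1"
 proof -
  have eq: "F ` sphere 0 1 = sphere 0 1 \<inter> F ` annulus R2"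
   using sA trich(2) mS by auto
  have "openin (top_of_set (sphere 0 1)) (F ` sphere 0 1)"
   unfolding eq using oF by (intro openin_open_Int)
  moreover have "closedin (top_of_set (sphere 0 1)) (F ` sphere 0 1)"
  proof (rule closed_subset)
   have "compact (F ` sphere 0 1)"
    by (intro compact_continuous_image continuous_on_subset[OF holomorphic_on_imp_continuous_on[OF F] sA] compact_sphere)
   then show "closed (F ` sphere 0 1)" by (rule compact_imp_closed)
  qed (use mS in auto)
  moreover have "connected (sphere (0::complex) 1)" by (rule connected_sphere) simp
  moreover have "F ` sphere 0 1 \<noteq> {}" by (metis image_is_empty mem_sphere_0 norm_one empty_iff)
  ultimately show ?thesis by (metis connected_clopen)
 qed
 obtain Fi where Fi: "Fi holomorphic_on (F ` annulus R2)" and FiF: "\<And>w. w \<in> annulus R2 \<Longrightarrow> Fi (F w) = w"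
  using holomorphic_has_inverse[OF F open_annulus injF] by metis
 have "cball 0 1 \<subseteq> ball 0 1 \<union> F ` annulus R2" using Fs sA by fastforce
 then obtain R where R: "R > 1" "ball 0 R \<subseteq> ball 0 1 \<union> F ` annulus R2"
  using open_superset_closed_disc[of "ball 0 1 \<union> F ` annulus R2"] oF by blast
 define \<psi> where "\<psi> s = (if cmod s < 1 then a + 1 / g s else G (Fi s))" for s
 define H where "H s = (if s = 0 then 1 / deriv g 0 else s * \<psi> s)" for s
 have H\<psi>: "H s / s = \<psi> s" if "s \<noteq> 0" for s using that by (simp add: H_def)
 have gnz: "g s \<noteq> 0" if "s \<in> ball 0 1" "s \<noteq> 0" for s using gh[OF that(1)] h0 that(2) by metis
 have ginj: "inj_on g (ball 0 1)" using gh by (metis inj_onI)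
 have dg: "deriv g 0 \<noteq> 0" by (rule holomorphic_injective_imp_regular[OF g open_ball ginj]) simp
 have \<psi>F: "\<psi> (F w) = G w" if w: "w \<in> annulus R2" for w
 proof (cases "cmod (F w) < 1")
  case True
  then have "1/R2 < cmod w" "cmod w < 1" using trich(1)[OF w] w by (auto simp: annulus_def)
  then have "F w = f w" and wI: "w \<in> ?I" using FI I2 by blast+
  then have "g (F w) = 1 / (G w - a)" using gf by simp
  then show ?thesis using True by (simp add: \<psi>_def)
 qed (simp add: \<psi>_def FiF[OF w])
 have FnZ: "F w \<noteq> 0" if "w \<in> annulus R2" for w
  using that FI[of w] mO[of w] mS[of w] unfolding annulus_def by (cases "cmod w < 1"; cases "cmod w = 1"; force)
 have Hhol: "H holomorphic_on ball 0 R"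
 proof (rule holomorphicI_local)
  fix s :: complex assume "s \<in> ball 0 R"
  then consider "s \<in> ball 0 1" | "s \<in> F ` annulus R2" using R(2) by blast
  then show "\<exists>T. s \<in> T \<and> open T \<and> H holomorphic_on T"
  proof cases
   case 1
   define k where "k s = (if s = 0 then deriv g 0 else (g s - g 0) / (s - 0))" for s
   have "k holomorphic_on ball 0 1" unfolding k_def by (rule pole_lemma[OF g]) simp
   moreover have "k s \<noteq> 0" if "s \<in> ball 0 1" for s using that dg gnz[of s] g0 by (auto simp: k_def)
   ultimately have "(\<lambda>s. a * s + 1 / k s) holomorphic_on ball 0 1" by (intro holomorphic_intros) auto
   moreover have "H s = a * s + 1 / k s" if "s \<in> ball 0 1" for s
    using that gnz[of s] g0 by (auto simp: H_def \<psi>_def k_def field_simps)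
   ultimately have "H holomorphic_on ball 0 1" by (subst holomorphic_cong[OF refl]) auto
   then show ?thesis using 1 by blast
  next
   case 2
   have "(\<lambda>s. G (Fi s)) holomorphic_on F ` annulus R2"
   proof (rule holomorphic_on_compose_gen[OF Fi G, unfolded o_def])
    show "Fi ` F ` annulus R2 \<subseteq> annulus R1"
     using FiF annulus_mono[of R2 R1] R2 by auto
   qed
   then have "(\<lambda>s. s * G (Fi s)) holomorphic_on F ` annulus R2" by (intro holomorphic_intros)
   moreover have "H s = s * G (Fi s)" if "s \<in> F ` annulus R2" for s
    using that FnZ \<psi>F FiF by (auto simp: H_def)
   ultimately have "H holomorphic_on F ` annulus R2" by (subst holomorphic_cong[OF refl]) auto
   then show ?thesis using 2 oF by blast
  qed
 qed
 have \<psi>in: "\<psi> s \<in> - closure \<Omega>" if "cmod s < 1" "s \<noteq> 0" for s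
  using gh[of s] gnz[of s] that by (auto simp: \<psi>_def inverted_exterior_def)
 have \<psi>out: "\<exists>w\<in>annulus R2. s = F w \<and> \<psi> s = G w \<and> G w \<in> closure \<Omega>" if s: "s \<in> ball 0 R" "\<not> cmod s < 1" for s
 proof -
  have "s \<in> F ` annulus R2" using R(2) s by auto
  then obtain w where w: "w \<in> annulus R2" "s = F w" by blast
  then have "\<not> cmod w < 1" using trich(1) s(2) by blast
  then have "cmod w = 1 \<or> (1 < cmod w \<and> cmod w < R1)" using w(1) R2 by (auto simp: annulus_def)
  then have "G w \<in> frontier \<Omega> \<or> G w \<in> \<Omega>" using Gs GO by auto
  then have "G w \<in> closure \<Omega>" using closure_subset by (auto simp: frontier_def)
  then show ?thesis using w \<psi>F by blast
 qed
 have inj\<psi>: "inj_on \<psi> (ball 0 R - {0})"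
 proof (rule inj_onI)
  fix s t assume s: "s \<in> ball 0 R - {0}" and t: "t \<in> ball 0 R - {0}" and eq: "\<psi> s = \<psi> t"
  show "s = t"
  proof (cases "cmod s < 1")
   case True
   then have "\<psi> t \<notin> closure \<Omega>" using \<psi>in[of s] eq s by auto
   then have st: "cmod t < 1" using \<psi>out[of t] t by (cases "cmod t < 1") auto
   then have "1 / g s = 1 / g t" using True eq by (simp add: \<psi>_def)
   then have "g s = g t" by simp
   then show ?thesis using inj_onD[OF ginj] True st by auto
  next
   case False
   then have "\<psi> s \<in> closure \<Omega>" using \<psi>out[of s] s by (metis DiffD1)
   then have nt: "\<not> cmod t < 1" using \<psi>in[of t] eq t by auto
   obtain w where w: "w \<in> annulus R2" "s = F w" "\<psi> s = G w" using \<psi>out[OF _ False] s by blast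
   obtain v where v: "v \<in> annulus R2" "t = F v" "\<psi> t = G v" using \<psi>out[OF _ nt] t by blast
   have "w \<in> annulus R1" "v \<in> annulus R1" using w(1) v(1) annulus_mono[of R2 R1] R2 by auto
   then have "w = v" using inj_onD[OF injG, of w v] w v eq by simp
   then show ?thesis using w v by simp
  qed
 qed
 have im1: "\<psi> ` (ball 0 1 - {0}) = - closure \<Omega>"
 proof (intro set_eqI iffI)
  fix z assume "z \<in> \<psi> ` (ball 0 1 - {0})"
  then show "z \<in> - closure \<Omega>" using \<psi>in by auto
 next
  fix z assume z: "z \<in> - closure \<Omega>"
  define s where "s = h (1 / (z - a))"
  have s: "s \<in> ball 0 1" "g s = 1 / (z - a)" using hg[OF uD[OF z]] by (auto simp: s_def)
  have "s \<noteq> 0" using s(2) g0 aE[OF z] by auto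
  moreover have "\<psi> s = z" using s by (simp add: \<psi>_def)
  ultimately show "z \<in> \<psi> ` (ball 0 1 - {0})" using s(1) by blast
 qed
 have im2: "\<psi> ` sphere 0 1 = frontier \<Omega>"
 proof -
  have "\<psi> ` F ` sphere 0 1 = G ` sphere 0 1" using \<psi>F sA by (auto simp: image_image intro!: image_cong)
  then show ?thesis using Fs Gs by simp
 qed
 define \<eta> where "\<eta> t = F (cis (2 * pi * (\<sigma> * t)))" for t
 define \<eta>' where "\<eta>' t = 2 * pi * \<i> * \<sigma> * cis (2 * pi * (\<sigma> * t)) * deriv F (cis (2 * pi * (\<sigma> * t)))" for t
 have \<eta>1: "cmod (\<eta> t) = 1" and \<eta>2: "H (\<eta> t) / \<eta> t = \<gamma> t" for t
 proof -
  show 1: "cmod (\<eta> t) = 1" unfolding \<eta>_def by (rule mS) simp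
  have "cis (2 * pi * (\<sigma> * t)) \<in> annulus R2" using sA by auto
  then have "\<psi> (\<eta> t) = \<gamma> t" unfolding \<eta>_def using \<psi>F G\<gamma> by simp
  moreover have "\<eta> t \<noteq> 0" using 1 by auto
  ultimately show "H (\<eta> t) / \<eta> t = \<gamma> t" using H\<psi> by simp
 qed
 have \<eta>3: "(\<eta> has_vector_derivative \<eta>' t) (at t)" for t
  unfolding \<eta>_def[abs_def] \<eta>'_def by (rule circle_parametrization_derivative(1)[OF R2(1) F])
 have \<eta>4: "continuous_on UNIV \<eta>'"
  unfolding \<eta>'_def[abs_def] by (rule circle_parametrization_derivative(2)[OF R2(1) F])
 have 5: "inj_on (\<lambda>s. H s / s) (ball 0 R - {0})"
  using inj\<psi> by (subst inj_on_cong[of _ _ \<psi>]) (auto simp: H\<psi>)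
 have 6: "(\<lambda>s. H s / s) ` (ball 0 1 - {0}) = - closure \<Omega>"
  unfolding im1[symmetric] by (rule image_cong) (auto simp: H\<psi>)
 have 7: "(\<lambda>s. H s / s) ` sphere 0 1 = frontier \<Omega>"
  unfolding im2[symmetric] by (rule image_cong) (auto intro!: H\<psi>)
 have 8: "H 0 \<noteq> 0" using dg by (simp add: H_def)
 show ?thesis
  by (rule exI[of _ R], rule conjI[OF R(1)], rule exI[of _ H], rule exI[of _ \<eta>], rule exI[of _ \<eta>'])
    (intro conjI allI Hhol 8 5 6 7 \<eta>1 \<eta>2 \<eta>3 \<eta>4)
qed

section \<open>Circle averages and the Green function of the exterior\<close>

abbreviation unit_measure :: "real measure" where
 "unit_measure \<equiv> restrict_space lborel {0..1}"

lemma prob_space_unit_interval: "prob_space unit_measure"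
 by (rule prob_space_restrict_space) auto

lemma measure_unit_interval [simp]: "measure unit_measure {0..1} = 1"
 by (subst measure_restrict_space) auto

lemma integral_unit_interval:
 fixes f :: "real \<Rightarrow> 'a::euclidean_space"
 assumes "continuous_on UNIV f"
 shows "integrable unit_measure f" "(\<integral>t. f t \<partial>unit_measure) = integral {0..1} f"
proof -
 have 1: "set_integrable lborel {0..1} f"
  unfolding set_integrable_def
  by (rule borel_integrable_compact[OF compact_Icc continuous_on_subset[OF assms subset_UNIV]])
 then show "integrable unit_measure f"
  by (subst integrable_restrict_space) (auto simp: set_integrable_def)
 have "(\<integral>t. f t \<partial>unit_measure) = (\<integral>t. indicator {0..1} t *\<^sub>R f t \<partial>lborel)"
  by (rule integral_restrict_space) auto
 also have "\<dots> = integral {0..1} f"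
  using set_borel_integral_eq_integral(2)[OF 1] by (simp add: set_lebesgue_integral_def)
 finally show "(\<integral>t. f t \<partial>unit_measure) = integral {0..1} f" .
qed

lemma AE_unit_interval:
 assumes "AE t in lborel. P t"
 shows "AE t in unit_measure. P t"
 using assms by (subst AE_restrict_space_iff) auto

lemma AE_cis_neq: "AE t in unit_measure. cis (2 * pi * t) \<noteq> s"
proof (rule AE_unit_interval, cases "\<exists>t0. cis (2 * pi * t0) = s")
 case True
 then obtain t0 where t0: "cis (2 * pi * t0) = s" by blast
 have "{t. cis (2 * pi * t) = s} \<subseteq> (\<lambda>n::int. t0 + n) ` UNIV"
 proof
  fix t assume "t \<in> {t. cis (2 * pi * t) = s}"
  then have "exp (\<i> * of_real (2 * pi * t)) = exp (\<i> * of_real (2 * pi * t0))"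
   using t0 by (simp add: cis_conv_exp)
  then obtain n :: int where "\<i> * of_real (2 * pi * t) = \<i> * of_real (2 * pi * t0) + of_real (of_int (2 * n) * pi) * \<i>"
   unfolding exp_eq by auto
  then have "2 * pi * t = 2 * pi * t0 + of_int (2 * n) * pi"
   by (auto simp: complex_eq_iff)
  then have "2 * pi * t = 2 * pi * (t0 + n)" by (simp add: algebra_simps)
  then have "t = t0 + n" by simp
  then show "t \<in> (\<lambda>n::int. t0 + n) ` UNIV" by blast
 qed
 then have "countable {t. cis (2 * pi * t) = s}" by (rule countable_subset) simp
 then have "{t. cis (2 * pi * t) = s} \<in> null_sets lborel" by (rule countable_imp_null_set_lborel)
 from AE_not_in[OF this] show "AE t in lborel. cis (2 * pi * t) \<noteq> s" by simp
qed simp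

lemma mean_value_circle:
 assumes R: "R > 1" and g: "g holomorphic_on ball 0 R"
 shows "(\<integral>t. g (cis (2 * pi * t)) \<partial>unit_measure) = g 0"
proof -
 have S: "cis x \<in> ball 0 R" for x using R by simp
 have c: "continuous_on UNIV (\<lambda>t. g (cis (2 * pi * t)))"
  by (rule continuous_on_compose2[OF holomorphic_on_imp_continuous_on[OF g]]) (use S in \<open>auto intro!: continuous_intros\<close>)
 have "((\<lambda>u. g u / (u - 0)) has_contour_integral (2 * of_real pi * \<i> * g 0)) (circlepath 0 1)"
  by (rule Cauchy_integral_circlepath_simple[OF holomorphic_on_subset[OF g]]) (use R in auto)
 then have "((\<lambda>t. g (cis (2 * pi * t)) / cis (2 * pi * t) * (2 * of_real pi * \<i> * cis (2 * pi * t))) has_integral (2 * of_real pi * \<i> * g 0)) {0..1}"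
  unfolding has_contour_integral unfolding vector_derivative_circlepath unfolding circlepath by (simp add: cis_conv_exp mult_ac)
 then have "((\<lambda>t. (2 * of_real pi * \<i>) * g (cis (2 * pi * t))) has_integral (2 * of_real pi * \<i> * g 0)) {0..1}"
  by (simp add: mult_ac)
 then have "((\<lambda>t. g (cis (2 * pi * t))) has_integral g 0) {0..1}"
  by (subst (asm) has_integral_mult_right_iff) auto
 then show ?thesis using integral_unit_interval(2)[OF c] by (simp add: integral_unique)
qed

text \<open>A zero-free function has a holomorphic logarithm on a slightly larger disc, whose real part has the mean value property.\<close>
lemma mean_ln_norm:
 assumes R: "R > 1" and f: "f holomorphic_on ball 0 R" and nz: "\<And>s. cmod s \<le> 1 \<Longrightarrow> f s \<noteq> 0"
 shows "integrable unit_measure (\<lambda>t. ln (cmod (f (cis (2 * pi * t)))))"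
  and "(\<integral>t. ln (cmod (f (cis (2 * pi * t)))) \<partial>unit_measure) = ln (cmod (f 0))"
proof -
 have op: "open (ball 0 R \<inter> f -` (- {0}))"
  by (rule continuous_open_preimage[OF holomorphic_on_imp_continuous_on[OF f]]) auto
 obtain r where r: "r > 1" "ball 0 r \<subseteq> ball 0 R \<inter> f -` (- {0})"
  using open_superset_closed_disc[OF op] nz R by force
 have "f holomorphic_on ball 0 r" using r(2) by (intro holomorphic_on_subset[OF f]) auto
 moreover have "f z \<noteq> 0" if "z \<in> ball 0 r" for z using r(2) that by blast
 ultimately obtain g where g: "g holomorphic_on ball 0 r" and fg: "\<And>z. z \<in> ball 0 r \<Longrightarrow> f z = exp (g z)"
  using contractible_imp_holomorphic_log[of f "ball 0 r"] convex_imp_contractible[OF convex_ball] by metis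
 have ln: "ln (cmod (f z)) = Re (g z)" if "z \<in> ball 0 r" for z using fg[OF that] by simp
 have S: "cis x \<in> ball 0 r" for x using r by simp
 have c: "continuous_on UNIV (\<lambda>t. g (cis (2 * pi * t)))"
  by (rule continuous_on_compose2[OF holomorphic_on_imp_continuous_on[OF g]]) (use S in \<open>auto intro!: continuous_intros\<close>)
 note i = integral_unit_interval(1)[OF c]
 show "integrable unit_measure (\<lambda>t. ln (cmod (f (cis (2 * pi * t)))))"
  unfolding ln[OF S] using i by simp
 have "(\<integral>t. ln (cmod (f (cis (2 * pi * t)))) \<partial>unit_measure) = Re (\<integral>t. g (cis (2 * pi * t)) \<partial>unit_measure)"
  unfolding ln[OF S] using i by simp
 also have "\<dots> = ln (cmod (f 0))" using mean_value_circle[OF r(1) g] ln[of 0] r(1) by simp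
 finally show "(\<integral>t. ln (cmod (f (cis (2 * pi * t)))) \<partial>unit_measure) = ln (cmod (f 0))" .
qed

text \<open>On the unit circle $|\sigma - s| = |1 - \bar s \sigma|$, and the function on the right-hand side is zero-free on the closed disc with value 1 at 0.\<close>
lemma mean_ln_distance_inside:
 assumes s: "cmod s < 1"
 shows "integrable unit_measure (\<lambda>t. ln (cmod (cis (2 * pi * t) - s)))"
  and "(\<integral>t. ln (cmod (cis (2 * pi * t) - s)) \<partial>unit_measure) = 0"
proof -
 have e: "cmod (cis x - s) = cmod (1 - cnj s * cis x)" for x
 proof -
  have "1 - cnj s * cis x = cis x * cnj (cis x - s)" by (simp add: algebra_simps cis_cnj cis_mult)
  then show ?thesis by (simp only: norm_mult complex_mod_cnj norm_cis mult_1)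
 qed
 have nz: "1 - cnj s * w \<noteq> 0" if "cmod w \<le> 1" for w
 proof
  assume "1 - cnj s * w = 0"
  then have "cmod (cnj s * w) = 1" by (metis eq_iff_diff_eq_0 norm_one)
  moreover have "cmod (cnj s * w) \<le> cmod s * 1" unfolding norm_mult complex_mod_cnj using that by (intro mult_left_mono) auto
  ultimately show False using s by simp
 qed
 have h: "(\<lambda>w. 1 - cnj s * w) holomorphic_on ball 0 2" by (intro holomorphic_intros)
 have two: "(1::real) < 2" by simp
 show "integrable unit_measure (\<lambda>t. ln (cmod (cis (2 * pi * t) - s)))"
  unfolding e by (rule mean_ln_norm(1)[OF two h nz])
 show "(\<integral>t. ln (cmod (cis (2 * pi * t) - s)) \<partial>unit_measure) = 0"
  unfolding e using mean_ln_norm(2)[OF two h nz] by simp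
qed

text \<open>Approach \<open>s\<close> along the radius. As $|\sigma - s| \le 2 |\sigma - r s|$, the logarithm at \<open>s\<close> dominates all others; its integrability follows from Fatou's lemma.\<close>
lemma mean_ln_distance_boundary:
 assumes s: "cmod s = 1"
 shows "integrable unit_measure (\<lambda>t. ln (cmod (cis (2 * pi * t) - s)))"
  and "(\<integral>t. ln (cmod (cis (2 * pi * t) - s)) \<partial>unit_measure) = 0"
proof -
 interpret prob_space unit_measure by (rule prob_space_unit_interval)
 define r where "r n = 1 - 1 / real (Suc n)" for n
 have r: "0 \<le> r n" "r n < 1" for n by (auto simp: r_def)
 have rl: "r \<longlonglongrightarrow> 1" unfolding r_def by real_asymp
 have rs: "cmod (of_real (r n) * s) = r n" for n unfolding norm_mult norm_of_real using r s by simp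
 have rs1: "cmod (of_real (r n) * s) < 1" for n unfolding rs by (rule r)
 define f where "f n t = ln 2 - ln (cmod (cis (2 * pi * t) - of_real (r n) * s))" for n t
 define g where "g t = ln 2 - ln (cmod (cis (2 * pi * t) - s))" for t
 have near: "cmod (cis x - of_real (r n) * s) > 0" "cmod (cis x - of_real (r n) * s) \<le> 2"
  "cmod (cis x - s) \<le> 2 * cmod (cis x - of_real (r n) * s)" for x n
 proof -
  have "1 - r n \<le> cmod (cis x - of_real (r n) * s)" using norm_triangle_ineq2[of "cis x" "of_real (r n) * s"] rs[of n] by simp
  then show "cmod (cis x - of_real (r n) * s) > 0" using r[of n] by linarith
  show "cmod (cis x - of_real (r n) * s) \<le> 2" using norm_triangle_ineq4[of "cis x" "of_real (r n) * s"] rs[of n] r[of n] by simp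
  have "cmod (of_real (r n) * s - s) = 1 - r n"
  proof -
   have "of_real (r n) * s - s = - (of_real (1 - r n) * s)" by (simp add: algebra_simps)
   then have "cmod (of_real (r n) * s - s) = \<bar>1 - r n\<bar> * cmod s" by (simp only: norm_minus_cancel norm_mult norm_of_real)
   then show ?thesis using r[of n] s by simp
  qed
  moreover have "cmod (cis x - s) \<le> cmod (cis x - of_real (r n) * s) + cmod (of_real (r n) * s - s)"
   using norm_triangle_ineq[of "cis x - of_real (r n) * s" "of_real (r n) * s - s"] by simp
  ultimately show "cmod (cis x - s) \<le> 2 * cmod (cis x - of_real (r n) * s)"
   using \<open>1 - r n \<le> cmod (cis x - of_real (r n) * s)\<close> by linarith
 qed
 have f0: "f n t \<ge> 0" for n t
 proof -
  have "ln (cmod (cis (2 * pi * t) - of_real (r n) * s)) \<le> ln 2" using near(1,2) by (subst ln_le_cancel_iff) auto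
  then show ?thesis by (simp add: f_def)
 qed
 have fi: "integrable unit_measure (f n)" and fI: "(\<integral>t. f n t \<partial>unit_measure) = ln 2" for n
  using mean_ln_distance_inside[OF rs1[of n]] unfolding f_def by (auto simp: prob_space)
 have g0: "g t \<ge> 0" for t
 proof (cases "cis (2 * pi * t) = s")
  case False
  then have "cmod (cis (2 * pi * t) - s) > 0" by simp
  moreover have "cmod (cis (2 * pi * t) - s) \<le> 2" using norm_triangle_ineq4[of "cis (2 * pi * t)" s] s by simp
  ultimately have "ln (cmod (cis (2 * pi * t) - s)) \<le> ln 2" by (subst ln_le_cancel_iff) auto
  then show ?thesis by (simp add: g_def)
 qed (simp add: g_def)
 have [measurable]: "(\<lambda>t. cis (2 * pi * t)) \<in> borel_measurable borel"
  by (intro borel_measurable_continuous_onI continuous_intros)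
 have [measurable]: "g \<in> borel_measurable unit_measure" "\<And>n. f n \<in> borel_measurable unit_measure"
  unfolding g_def f_def by (rule measurable_restrict_space1, measurable)+
 have lim: "(\<lambda>n. f n t) \<longlonglongrightarrow> g t" if "cis (2 * pi * t) \<noteq> s" for t
 proof -
  have "(\<lambda>n. cmod (cis (2 * pi * t) - of_real (r n) * s)) \<longlonglongrightarrow> cmod (cis (2 * pi * t) - of_real 1 * s)"
   by (intro tendsto_intros rl)
  then have "(\<lambda>n. cmod (cis (2 * pi * t) - of_real (r n) * s)) \<longlonglongrightarrow> cmod (cis (2 * pi * t) - s)" by simp
  from tendsto_ln[OF this] show ?thesis unfolding f_def g_def using that by (intro tendsto_diff[OF tendsto_const]) simp
 qed
 have AElim: "AE t in unit_measure. (\<lambda>n. f n t) \<longlonglongrightarrow> g t"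
  using AE_cis_neq[of s] by eventually_elim (rule lim)
 have "(\<integral>\<^sup>+t. ennreal (g t) \<partial>unit_measure) \<le> (\<integral>\<^sup>+t. liminf (\<lambda>n. ennreal (f n t)) \<partial>unit_measure)"
 proof (rule nn_integral_mono_AE)
  show "AE t in unit_measure. ennreal (g t) \<le> liminf (\<lambda>n. ennreal (f n t))"
   using AElim
  proof eventually_elim
   case (elim t)
   from lim_imp_Liminf[OF _ tendsto_ennrealI[OF elim]] show ?case by simp
  qed
 qed
 also have "\<dots> \<le> liminf (\<lambda>n. \<integral>\<^sup>+t. ennreal (f n t) \<partial>unit_measure)"
  by (rule nn_integral_liminf) measurable
 also have "(\<lambda>n. \<integral>\<^sup>+t. ennreal (f n t) \<partial>unit_measure) = (\<lambda>n. ennreal (ln 2))"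
  using nn_integral_eq_integral[OF fi] f0 fI by auto
 finally have "(\<integral>\<^sup>+t. ennreal (g t) \<partial>unit_measure) \<le> ennreal (ln 2)" by (simp add: Liminf_const)
 then have "(\<integral>\<^sup>+t. ennreal (g t) \<partial>unit_measure) < \<infinity>" by (rule le_less_trans) simp
 then have gi: "integrable unit_measure g" by (intro integrableI_nonneg) (auto simp: g0)
 have bound: "AE t in unit_measure. norm (f n t) \<le> ln 2 + g t" for n
  using AE_cis_neq[of s]
 proof eventually_elim
  case (elim t)
  have "ln (cmod (cis (2 * pi * t) - s)) \<le> ln (2 * cmod (cis (2 * pi * t) - of_real (r n) * s))"
   using elim near(1)[of "2 * pi * t" n] near(3)[of "2 * pi * t" n] by (subst ln_le_cancel_iff) auto
  also have "\<dots> = ln 2 + ln (cmod (cis (2 * pi * t) - of_real (r n) * s))" by (rule ln_mult_pos) (use near(1) in auto)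
  finally show ?case using f0[of n t] by (simp add: f_def g_def)
 qed
 have "(\<lambda>n. \<integral>t. f n t \<partial>unit_measure) \<longlonglongrightarrow> (\<integral>t. g t \<partial>unit_measure)"
  by (rule integral_dominated_convergence[where w="\<lambda>t. ln 2 + g t"]) (use gi AElim bound in auto)
 then have gI: "(\<integral>t. g t \<partial>unit_measure) = ln 2" unfolding fI using LIMSEQ_unique tendsto_const by blast
 have e: "(\<lambda>t. ln (cmod (cis (2 * pi * t) - s))) = (\<lambda>t. ln 2 - g t)" by (simp add: g_def)
 show "integrable unit_measure (\<lambda>t. ln (cmod (cis (2 * pi * t) - s)))"
  unfolding e using gi by simp
 show "(\<integral>t. ln (cmod (cis (2 * pi * t) - s)) \<partial>unit_measure) = 0"
  unfolding e using gi gI by (simp add: prob_space)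
qed

text \<open>The exterior parametrised by the punctured disc through $s \mapsto H(s)/s$, with infinity at $s = 0$, where \<open>H\<close> is holomorphic beyond the unit circle.\<close>
locale exterior_uniformization =
 fixes \<Omega> :: "complex set" and R :: real and H :: "complex \<Rightarrow> complex"
 assumes open_\<Omega>: "open \<Omega>" and R: "R > 1" and H: "H holomorphic_on ball 0 R" and H0: "H 0 \<noteq> 0"
  and inj: "inj_on (\<lambda>s. H s / s) (ball 0 R - {0})"
  and exterior: "(\<lambda>s. H s / s) ` (ball 0 1 - {0}) = - closure \<Omega>"
  and boundary: "(\<lambda>s. H s / s) ` sphere 0 1 = frontier \<Omega>"
begin

abbreviation \<psi> :: "complex \<Rightarrow> complex" where "\<psi> s \<equiv> H s / s"

text \<open>The divided difference of \<open>\<psi>\<close>, cleared of denominators and with its limit on the diagonal.\<close>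
definition quot :: "complex \<Rightarrow> complex \<Rightarrow> complex" where
 "quot s \<sigma> = (if \<sigma> = s then s * deriv H s - H s else (s * H \<sigma> - \<sigma> * H s) / (\<sigma> - s))"

lemma quot_eq: "\<sigma> \<noteq> s \<Longrightarrow> s * H \<sigma> - \<sigma> * H s = (\<sigma> - s) * quot s \<sigma>"
 by (simp add: quot_def)

lemma \<psi>_diff: "\<sigma> \<noteq> s \<Longrightarrow> \<sigma> \<noteq> 0 \<Longrightarrow> s \<noteq> 0 \<Longrightarrow> \<psi> \<sigma> - \<psi> s = (\<sigma> - s) * quot s \<sigma> / (\<sigma> * s)"
 using quot_eq[of \<sigma> s] by (simp add: field_simps)

lemma H_deriv: "s \<in> ball 0 R \<Longrightarrow> (H has_field_derivative deriv H s) (at s)"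
 by (rule holomorphic_derivI[OF H open_ball])

lemma quot_holomorphic:
 assumes s: "s \<in> ball 0 R"
 shows "quot s holomorphic_on ball 0 R"
proof -
 have "deriv (\<lambda>\<sigma>. s * H \<sigma> - \<sigma> * H s) s = s * deriv H s - H s"
  by (rule DERIV_imp_deriv) (auto intro!: derivative_eq_intros H_deriv[OF s])
 then have "quot s = (\<lambda>\<sigma>. if \<sigma> = s then deriv (\<lambda>\<sigma>. s * H \<sigma> - \<sigma> * H s) s else ((s * H \<sigma> - \<sigma> * H s) - (s * H s - s * H s)) / (\<sigma> - s))"
  by (auto simp: quot_def)
 moreover have "(\<lambda>\<sigma>. if \<sigma> = s then deriv (\<lambda>\<sigma>. s * H \<sigma> - \<sigma> * H s) s else ((s * H \<sigma> - \<sigma> * H s) - (s * H s - s * H s)) / (\<sigma> - s)) holomorphic_on ball 0 R"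
  by (rule pole_lemma) (use s in \<open>auto intro!: holomorphic_intros H\<close>)
 ultimately show ?thesis by simp
qed

lemma quot_nonzero:
 assumes s: "s \<in> ball 0 R" "s \<noteq> 0" and \<sigma>: "\<sigma> \<in> ball 0 R"
 shows "quot s \<sigma> \<noteq> 0"
proof (cases "\<sigma> = s")
 case True
 have "deriv \<psi> s \<noteq> 0"
  by (rule holomorphic_injective_imp_regular[OF _ _ inj])
    (use s in \<open>auto intro!: holomorphic_intros holomorphic_on_subset[OF H] open_Diff\<close>)
 moreover have "deriv \<psi> s = (s * deriv H s - H s) / (s * s)"
  by (rule DERIV_imp_deriv) (use s in \<open>auto intro!: derivative_eq_intros H_deriv simp: mult.commute\<close>)
 ultimately show ?thesis using True by (auto simp: quot_def)
next
 case False
 have "s * H \<sigma> \<noteq> \<sigma> * H s"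
 proof (cases "\<sigma> = 0")
  case False
  show ?thesis
  proof
   assume "s * H \<sigma> = \<sigma> * H s"
   then have "\<psi> \<sigma> = \<psi> s" using False s(2) by (simp add: field_simps)
   then show False using inj_onD[OF inj, of \<sigma> s] \<open>\<sigma> \<noteq> s\<close> s \<sigma> False by simp
  qed
 qed (use s H0 in simp)
 then show ?thesis using False by (simp add: quot_def)
qed

lemma quot_0: "s \<noteq> 0 \<Longrightarrow> quot s 0 = - H 0"
 by (simp add: quot_def)

text \<open>The difference $\psi(\sigma) - \psi(s)$ splits into $\sigma - s$, whose logarithm has mean 0, and a factor zero-free in \<open>\<sigma>\<close>, whose value at 0 is known.\<close>
lemma potential_exterior:
 assumes s: "s \<noteq> 0" "cmod s \<le> 1"
 shows "integrable unit_measure (\<lambda>t. ln (cmod (\<psi> (cis (2 * pi * t)) - \<psi> s)))"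
  and "(\<integral>t. ln (cmod (\<psi> (cis (2 * pi * t)) - \<psi> s)) \<partial>unit_measure) = ln (cmod (H 0)) - ln (cmod s)"
proof -
 interpret prob_space unit_measure by (rule prob_space_unit_interval)
 let ?g = "\<lambda>t. ln (cmod (cis (2 * pi * t) - s)) + ln (cmod (quot s (cis (2 * pi * t)))) - ln (cmod s)"
 have sR: "s \<in> ball 0 R" using s R by simp
 have nz: "quot s \<sigma> \<noteq> 0" if "cmod \<sigma> \<le> 1" for \<sigma> using quot_nonzero[OF sR s(1)] that R by simp
 note q = mean_ln_norm[OF R quot_holomorphic[OF sR] nz]
 have d: "integrable unit_measure (\<lambda>t. ln (cmod (cis (2 * pi * t) - s)))"
  "(\<integral>t. ln (cmod (cis (2 * pi * t) - s)) \<partial>unit_measure) = 0"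
  using mean_ln_distance_inside[of s] mean_ln_distance_boundary[of s] s(2) by (cases "cmod s < 1"; simp)+
 have AE: "AE t in unit_measure. ln (cmod (\<psi> (cis (2 * pi * t)) - \<psi> s)) = ?g t"
  using AE_cis_neq[of s]
 proof eventually_elim
  case (elim t)
  have eq: "cmod (\<psi> (cis (2 * pi * t)) - \<psi> s) = cmod (cis (2 * pi * t) - s) * cmod (quot s (cis (2 * pi * t))) / cmod s"
   unfolding \<psi>_diff[OF elim cis_neq_zero s(1)] by (simp only: norm_divide norm_mult norm_cis mult_1)
  have "cmod (cis (2 * pi * t) - s) > 0" "cmod (quot s (cis (2 * pi * t))) > 0" "cmod s > 0"
   using elim nz[of "cis (2 * pi * t)"] s by simp_all
  then show ?case unfolding eq by (simp add: ln_div ln_mult)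
 qed
 have gi: "integrable unit_measure ?g" using d(1) q(1) by simp
 have cH: "continuous_on (ball 0 R) H" by (rule holomorphic_on_imp_continuous_on[OF H])
 have "continuous_on UNIV (\<lambda>t. H (cis (2 * pi * t)))"
  by (rule continuous_on_compose2[OF cH]) (use R in \<open>auto intro!: continuous_intros\<close>)
 then have "continuous_on UNIV (\<lambda>t. \<psi> (cis (2 * pi * t)) - \<psi> s)" by (intro continuous_intros) auto
 then have [measurable]: "(\<lambda>t. \<psi> (cis (2 * pi * t)) - \<psi> s) \<in> borel_measurable borel" by (rule borel_measurable_continuous_onI)
 have m: "(\<lambda>t. ln (cmod (\<psi> (cis (2 * pi * t)) - \<psi> s))) \<in> borel_measurable unit_measure"
  by (rule measurable_restrict_space1) measurable
 show "integrable unit_measure (\<lambda>t. ln (cmod (\<psi> (cis (2 * pi * t)) - \<psi> s)))"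
  using integrable_cong_AE[OF m borel_measurable_integrable[OF gi] AE] gi by simp
 have "(\<integral>t. ln (cmod (\<psi> (cis (2 * pi * t)) - \<psi> s)) \<partial>unit_measure) = (\<integral>t. ?g t \<partial>unit_measure)"
  by (rule integral_cong_AE[OF m borel_measurable_integrable[OF gi] AE])
 also have "\<dots> = ln (cmod (quot s 0)) - ln (cmod s)" using d q by (simp add: prob_space)
 finally show "(\<integral>t. ln (cmod (\<psi> (cis (2 * pi * t)) - \<psi> s)) \<partial>unit_measure) = ln (cmod (H 0)) - ln (cmod s)"
  using quot_0[OF s(1)] by simp
qed

lemma \<psi>_not_interior: "s \<noteq> 0 \<Longrightarrow> cmod s \<le> 1 \<Longrightarrow> \<psi> s \<notin> \<Omega>"
proof (cases "cmod s < 1")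
 case True
 assume "s \<noteq> 0"
 then have "\<psi> s \<in> \<psi> ` (ball 0 1 - {0})" using True by (intro imageI) simp
 then show ?thesis unfolding exterior using closure_subset by blast
next
 case False
 assume "cmod s \<le> 1"
 then have "\<psi> s \<in> \<psi> ` sphere 0 1" using False by (intro imageI) simp
 then show ?thesis unfolding boundary using frontier_disjoint_eq[of \<Omega>] open_\<Omega> by blast
qed

text \<open>For \<open>z\<close> in \<open>\<Omega>\<close> the function $H(\sigma) - z \sigma$ is zero-free on the closed disc.\<close>
lemma potential_interior:
 assumes z: "z \<in> \<Omega>"
 shows "integrable unit_measure (\<lambda>t. ln (cmod (\<psi> (cis (2 * pi * t)) - z)))"
  and "(\<integral>t. ln (cmod (\<psi> (cis (2 * pi * t)) - z)) \<partial>unit_measure) = ln (cmod (H 0))"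
proof -
 have nz: "H \<sigma> - z * \<sigma> \<noteq> 0" if "cmod \<sigma> \<le> 1" for \<sigma>
 proof (cases "\<sigma> = 0")
  case False
  then have "\<psi> \<sigma> \<noteq> z" using \<psi>_not_interior[OF False that] z by blast
  then show ?thesis using False by (simp add: field_simps)
 qed (use H0 in simp)
 have h: "(\<lambda>\<sigma>. H \<sigma> - z * \<sigma>) holomorphic_on ball 0 R" by (intro holomorphic_intros H)
 have e: "cmod (\<psi> (cis x) - z) = cmod (H (cis x) - z * cis x)" for x
 proof -
  have "\<psi> (cis x) - z = (H (cis x) - z * cis x) / cis x" by (simp add: diff_divide_distrib)
  then show ?thesis by (simp only: norm_divide norm_cis div_by_1)
 qed
 show "integrable unit_measure (\<lambda>t. ln (cmod (\<psi> (cis (2 * pi * t)) - z)))"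
  unfolding e by (rule mean_ln_norm(1)[OF R h nz])
 show "(\<integral>t. ln (cmod (\<psi> (cis (2 * pi * t)) - z)) \<partial>unit_measure) = ln (cmod (H 0))"
  unfolding e using mean_ln_norm(2)[OF R h nz] by simp
qed

text \<open>The Green function of the exterior with pole at infinity, extended by 0 to the domain. The definition as a logarithmic potential makes its Laplacian visible; \<open>green_eq\<close> gives its values.\<close>
definition green :: "complex \<Rightarrow> real" where
 "green z = (\<integral>t. ln (cmod (\<psi> (cis (2 * pi * t)) - z)) \<partial>unit_measure) - ln (cmod (H 0))"

lemma exterior_cases:
 obtains "z \<in> \<Omega>" | s where "s \<noteq> 0" "cmod s \<le> 1" "z = \<psi> s"
proof (cases "z \<in> \<Omega>")
 case False
 have "z \<in> \<psi> ` (ball 0 1 - {0}) \<union> \<psi> ` sphere 0 1"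
  using False interior_subset[of \<Omega>] open_\<Omega> unfolding exterior boundary by (auto simp: frontier_def interior_open)
 then obtain s where "s \<in> (ball 0 1 - {0}) \<union> sphere 0 1" "z = \<psi> s" by (auto simp only: image_Un[symmetric])
 moreover from this(1) have "s \<noteq> 0" "cmod s \<le> 1" by (cases "s = 0"; force)+
 ultimately show ?thesis using that(2)[of s] by blast
qed

lemma green_eq: "z \<in> \<Omega> \<Longrightarrow> green z = 0" "s \<noteq> 0 \<Longrightarrow> cmod s \<le> 1 \<Longrightarrow> green (\<psi> s) = - ln (cmod s)"
 using potential_interior(2) potential_exterior(2) by (auto simp: green_def)

text \<open>Harmonic measure of the exterior seen from infinity.\<close>
definition boundary_measure :: "complex measure" where
 "boundary_measure = distr unit_measure borel (\<lambda>t. \<psi> (cis (2 * pi * t)))"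

lemma continuous_boundary_map: "continuous_on UNIV (\<lambda>t. \<psi> (cis (2 * pi * t)))"
proof -
 have "continuous_on UNIV (\<lambda>t. H (cis (2 * pi * t)))"
  by (rule continuous_on_compose2[OF holomorphic_on_imp_continuous_on[OF H]]) (use R in \<open>auto intro!: continuous_intros\<close>)
 then show ?thesis by (intro continuous_intros) auto
qed

lemma measurable_boundary_map [measurable]: "(\<lambda>t. \<psi> (cis (2 * pi * t))) \<in> borel_measurable unit_measure"
 by (rule measurable_restrict_space1) (use borel_measurable_continuous_onI[OF continuous_boundary_map] in simp)

lemma \<psi>_cis_frontier: "\<psi> (cis x) \<in> frontier \<Omega>"
 unfolding boundary[symmetric] by (rule imageI) simp

text \<open>By the two potential lemmas the potential of the boundary measure is constant on the closure of \<open>\<Omega>\<close>, boundary points included.\<close>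
theorem equilibrium_measure_eq:
 assumes b: "bounded \<Omega>"
 shows "equilibrium_measure (closure \<Omega>) = boundary_measure"
proof -
 interpret prob_space unit_measure by (rule prob_space_unit_interval)
 obtain B where B: "\<And>z. z \<in> closure \<Omega> \<Longrightarrow> cmod z \<le> B" using bounded_closure[OF b] unfolding bounded_iff by blast
 define d where "d = max 1 (2 * B)"
 have diam: "\<forall>z\<in>closure \<Omega>. \<forall>w\<in>closure \<Omega>. cmod (z - w) \<le> d"
 proof (intro ballI)
  fix z w assume "z \<in> closure \<Omega>" "w \<in> closure \<Omega>"
  then have "cmod z \<le> B" "cmod w \<le> B" using B by blast+
  then show "cmod (z - w) \<le> d" using norm_triangle_ineq4[of z w] by (simp add: d_def)
 qed
 have d: "d \<ge> 1" by (simp add: d_def)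
 have fc: "\<psi> (cis x) \<in> closure \<Omega>" for x using \<psi>_cis_frontier[of x] by (simp add: frontier_def)
 show ?thesis
 proof (rule equilibrium_measure_eqI[OF d _ _ diam])
  show K: "closure \<Omega> \<in> sets borel" by simp
  have "prob_space boundary_measure" unfolding boundary_measure_def by (rule prob_space_distr) measurable
  moreover have "emeasure boundary_measure (closure \<Omega>) = 1"
  proof -
   have "(\<lambda>t. \<psi> (cis (2 * pi * t))) -` closure \<Omega> \<inter> space unit_measure = space unit_measure"
    using fc by auto
   then show ?thesis unfolding boundary_measure_def by (subst emeasure_distr) (use emeasure_space_1 in auto)
  qed
  ultimately show "boundary_measure \<in> prob_measures_on (closure \<Omega>)"
   by (simp add: prob_measures_on_def boundary_measure_def)
  fix z assume z: "z \<in> closure \<Omega>"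
  let ?g = "\<lambda>t. ln d - ln (cmod (\<psi> (cis (2 * pi * t)) - z))"
  have "integrable unit_measure (\<lambda>t. ln (cmod (\<psi> (cis (2 * pi * t)) - z))) \<and>
   (\<integral>t. ln (cmod (\<psi> (cis (2 * pi * t)) - z)) \<partial>unit_measure) = ln (cmod (H 0)) \<and>
   (AE t in unit_measure. \<psi> (cis (2 * pi * t)) \<noteq> z)"
  proof (cases "z \<in> \<Omega>")
   case True
   then show ?thesis using potential_interior[OF True] \<psi>_not_interior[OF cis_neq_zero] by auto
  next
   case False
   then have "z \<in> frontier \<Omega>" using z open_\<Omega> by (simp add: frontier_def interior_open)
   then obtain s where s: "cmod s = 1" "z = \<psi> s" unfolding boundary[symmetric] by auto
   then have s0: "s \<noteq> 0" "cmod s \<le> 1" by auto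
   have "AE t in unit_measure. \<psi> (cis (2 * pi * t)) \<noteq> z"
    using AE_cis_neq[of s]
   proof eventually_elim
    case (elim t)
    then show ?case using inj_onD[OF inj, of "cis (2 * pi * t)" s] s R s0 by auto
   qed
   then show ?thesis using potential_exterior[OF s0] s by simp
  qed
  then have i: "integrable unit_measure ?g" and I: "(\<integral>t. ?g t \<partial>unit_measure) = ln d - ln (cmod (H 0))"
   and AE: "AE t in unit_measure. \<psi> (cis (2 * pi * t)) \<noteq> z" by (auto simp: prob_space)
  have nn: "?g t \<ge> 0" if "\<psi> (cis (2 * pi * t)) \<noteq> z" for t
  proof -
   have "cmod (\<psi> (cis (2 * pi * t)) - z) \<le> d" using diam fc z by blast
   then have "ln (cmod (\<psi> (cis (2 * pi * t)) - z)) \<le> ln d" using that d by (subst ln_le_cancel_iff) auto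
   then show ?thesis by simp
  qed
  have "(\<integral>\<^sup>+w. shifted_log_kernel d z w \<partial>boundary_measure) = (\<integral>\<^sup>+t. shifted_log_kernel d z (\<psi> (cis (2 * pi * t))) \<partial>unit_measure)"
   unfolding boundary_measure_def by (rule nn_integral_distr) (auto simp: shifted_log_kernel_def)
  also have "\<dots> = (\<integral>\<^sup>+t. ennreal (?g t) \<partial>unit_measure)"
  proof (rule nn_integral_cong_AE, use AE in eventually_elim)
   case (elim t)
   then have "cmod (z - \<psi> (cis (2 * pi * t))) > 0" by simp
   then have "ln (d / cmod (z - \<psi> (cis (2 * pi * t)))) = ?g t" using d by (simp add: ln_div norm_minus_commute)
   then show ?case using elim by (auto simp: shifted_log_kernel_def)
  qed
  also have "\<dots> = ennreal (\<integral>t. ?g t \<partial>unit_measure)"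
  proof (rule nn_integral_eq_integral[OF i])
   show "AE t in unit_measure. 0 \<le> ?g t" using AE by eventually_elim (rule nn)
  qed
  finally show "(\<integral>\<^sup>+w. shifted_log_kernel d z w \<partial>boundary_measure) = ennreal (ln d - ln (cmod (H 0)))" unfolding I .
 qed
qed

end

section \<open>Faber polynomials and polynomials on a weighted curve\<close>

text \<open>Comparing coefficients in \<open>\<Phi> * (B - z X) = A\<close> expresses the coefficient of order \<open>n\<close> through the lower ones, and the factor \<open>z\<close> meets only the one of order \<open>n - 1\<close>.\<close>
lemma fps_rational_coeff_poly:
 fixes A B :: "complex fps"
 assumes B: "fps_nth B 0 \<noteq> 0"
 shows "\<exists>F. \<forall>n. degree (F n) \<le> n \<and> (\<forall>z. poly (F n) z = fps_nth (A / (B - fps_const z * fps_X)) n)"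
proof -
 define \<Phi> where "\<Phi> z = A / (B - fps_const z * fps_X)" for z
 have \<Phi>: "\<Phi> z * B - fps_const z * (\<Phi> z * fps_X) = A" for z
 proof -
  have nz: "fps_nth (B - fps_const z * fps_X) 0 \<noteq> 0" using B by simp
  have "\<Phi> z * (B - fps_const z * fps_X) = A * (inverse (B - fps_const z * fps_X) * (B - fps_const z * fps_X))"
   unfolding \<Phi>_def fps_divide_unit[OF nz] by (simp only: mult.assoc)
  then show ?thesis unfolding inverse_mult_eq_1[OF nz] by (simp add: algebra_simps)
 qed
 have rec: "fps_nth (\<Phi> z) n = (fps_nth A n + z * (if n = 0 then 0 else fps_nth (\<Phi> z) (n - 1)) - (\<Sum>i<n. fps_nth (\<Phi> z) i * fps_nth B (n - i))) / fps_nth B 0" for z n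
 proof -
  have "fps_nth A n = fps_nth (\<Phi> z * B) n - z * (if n = 0 then 0 else fps_nth (\<Phi> z) (n - 1))"
   by (subst \<Phi>[of z, symmetric]) simp
  moreover have "fps_nth (\<Phi> z * B) n = (\<Sum>i<n. fps_nth (\<Phi> z) i * fps_nth B (n - i)) + fps_nth (\<Phi> z) n * fps_nth B 0"
  proof -
   have "{0..n} = insert n {..<n}" by auto
   then show ?thesis by (simp add: fps_mult_nth)
  qed
  ultimately have "fps_nth (\<Phi> z) n * fps_nth B 0 = fps_nth A n + z * (if n = 0 then 0 else fps_nth (\<Phi> z) (n - 1)) - (\<Sum>i<n. fps_nth (\<Phi> z) i * fps_nth B (n - i))"
   by simp
  then show ?thesis using B by (simp add: eq_divide_eq)
 qed
 have "\<exists>p. degree p \<le> n \<and> (\<forall>z. poly p z = fps_nth (\<Phi> z) n)" for n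
 proof (induction n rule: less_induct)
  case (less n)
  then have "\<forall>i. \<exists>p. i < n \<longrightarrow> degree p \<le> i \<and> (\<forall>z. poly p z = fps_nth (\<Phi> z) i)" by blast
  from choice[OF this] obtain p where p: "\<forall>i. i < n \<longrightarrow> degree (p i) \<le> i \<and> (\<forall>z. poly (p i) z = fps_nth (\<Phi> z) i)" by (elim exE)
  define r where "r = (if n = 0 then 0 else pCons 0 (p (n - 1)))"
  define q where "q = smult (1 / fps_nth B 0) ([:fps_nth A n:] + r - (\<Sum>i<n. smult (fps_nth B (n - i)) (p i)))"
  have r: "degree r \<le> n" "poly r z = z * (if n = 0 then 0 else fps_nth (\<Phi> z) (n - 1))" for z
   using spec[OF p, of "n - 1"] by (auto simp: r_def degree_pCons_eq_if)
  have "degree (\<Sum>i<n. smult (fps_nth B (n - i)) (p i)) \<le> n"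
  proof (rule degree_sum_le)
   fix i assume "i \<in> {..<n}"
   then have "degree (p i) \<le> n" using spec[OF p, of i] by simp
   then show "degree (smult (fps_nth B (n - i)) (p i)) \<le> n" using degree_smult_le[of "fps_nth B (n - i)" "p i"] by linarith
  qed simp
  then have "degree q \<le> n"
   unfolding q_def using r(1) by (intro order_trans[OF degree_smult_le] degree_diff_le degree_add_le) simp_all
  moreover have "poly q z = fps_nth (\<Phi> z) n" for z
  proof -
   have "(\<Sum>i<n. fps_nth B (n - i) * poly (p i) z) = (\<Sum>i<n. fps_nth (\<Phi> z) i * fps_nth B (n - i))"
    by (rule sum.cong) (use p in \<open>auto simp: mult.commute\<close>)
   then show ?thesis unfolding q_def by (subst rec) (simp add: poly_sum r(2))
  qed
  ultimately show ?case by blast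
 qed
 then have "\<forall>n. \<exists>p. degree p \<le> n \<and> (\<forall>z. poly p z = fps_nth (\<Phi> z) n)" by blast
 from choice[OF this] show ?thesis unfolding \<Phi>_def .
qed

lemma continuous_on_compact_bounded_norm:
 assumes "compact K" "continuous_on K f"
 shows "\<exists>B. \<forall>x\<in>K. norm (f x) \<le> B"
 using compact_imp_bounded[OF compact_continuous_image[OF assms(2,1)]] by (simp add: bounded_iff)

text \<open>Cauchy's formula for a Jordan curve, on which the winding number is 1 or -1 inside; the factor $1/(2\pi)$ is estimated by 1.\<close>
lemma cauchy_estimate:
 assumes S: "convex S" "open S" and f: "f holomorphic_on S"
  and der: "\<And>t. (c has_vector_derivative c' t) (at t)" and cc: "continuous_on UNIV c'"
  and sp: "simple_path c" "pathfinish c = pathstart c" and im: "path_image c \<subseteq> S"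
  and z: "z \<in> S" "z \<in> inside (path_image c)"
  and B: "\<And>t. t \<in> {0..1} \<Longrightarrow> cmod (c' t) / cmod (c t - z) \<le> B"
 shows "cmod (f z) \<le> B * integral {0..1} (\<lambda>t. cmod (f (c t)))"
proof -
 have zp: "z \<notin> path_image c" using z(2) inside_no_overlap[of "path_image c"] by blast
 have zc: "c t \<noteq> z" "c t \<in> S" if "t \<in> {0..1}" for t
 proof -
  have "c t \<in> path_image c" unfolding path_image_def using that by (rule imageI)
  then show "c t \<noteq> z" "c t \<in> S" using zp im by blast+
 qed
 have vd: "vector_derivative c (at t) = c' t" for t by (rule vector_derivative_at[OF der])
 have cont: "continuous_on UNIV c"
  by (intro continuous_at_imp_continuous_on ballI has_vector_derivative_continuous[OF der])
 have "c C1_differentiable_on {0..1}"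
  unfolding C1_differentiable_on_eq vd using der cc
  by (auto intro: differentiableI_vector continuous_on_subset)
 then have vp: "valid_path c" unfolding valid_path_def by (rule C1_differentiable_imp_piecewise)
 have "((\<lambda>w. f w / (w - z)) has_contour_integral (2 * pi * \<i> * winding_number c z * f z)) c"
 proof (rule Cauchy_integral_formula_convex_simple[OF S(1) f _ _ _ sp(2)])
  show "valid_path c" by (rule vp)
  show "z \<in> interior S" using S(2) z(1) by (simp add: interior_open)
  show "path_image c \<subseteq> S - {z}" using im zp by blast
 qed
 then have I: "((\<lambda>t. f (c t) / (c t - z) * c' t) has_integral (2 * pi * \<i> * winding_number c z * f z)) {0..1}"
  unfolding has_contour_integral vd .
 have fc: "continuous_on {0..1} (\<lambda>t. f (c t))"
  by (rule continuous_on_compose2[OF holomorphic_on_imp_continuous_on[OF f] continuous_on_subset[OF cont]]) (use zc in auto)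
 have "cmod (integral {0..1} (\<lambda>t. f (c t) / (c t - z) * c' t)) \<le> integral {0..1} (\<lambda>t. B * cmod (f (c t)))"
 proof (rule integral_norm_bound_integral)
  show "(\<lambda>t. f (c t) / (c t - z) * c' t) integrable_on {0..1}" using I by blast
  show "(\<lambda>t. B * cmod (f (c t))) integrable_on {0..1}"
   by (intro integrable_continuous_interval continuous_intros fc)
  fix t :: real assume t: "t \<in> {0..1}"
  have "cmod (f (c t) / (c t - z) * c' t) = cmod (f (c t)) * (cmod (c' t) / cmod (c t - z))"
   by (simp add: norm_mult norm_divide)
  also have "\<dots> \<le> cmod (f (c t)) * B" using B[OF t] by (intro mult_left_mono) auto
  finally show "cmod (f (c t) / (c t - z) * c' t) \<le> B * cmod (f (c t))" by (simp add: mult.commute)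
 qed
 also have "integral {0..1} (\<lambda>t. f (c t) / (c t - z) * c' t) = 2 * pi * \<i> * winding_number c z * f z"
  using I by (rule integral_unique)
 finally have le: "cmod (2 * pi * \<i> * winding_number c z * f z) \<le> B * integral {0..1} (\<lambda>t. cmod (f (c t)))"
  by simp
 have "cmod (winding_number c z) = 1"
  using simple_closed_path_winding_number_inside[OF sp(1)] z(2) by (metis norm_minus_cancel norm_one)
 then have "cmod (2 * pi * \<i> * winding_number c z * f z) = 2 * pi * cmod (f z)"
  by (simp add: norm_mult)
 moreover have "1 * cmod (f z) \<le> 2 * pi * cmod (f z)"
  using pi_ge_two by (intro mult_right_mono) auto
 ultimately show ?thesis using le by simp
qed

text \<open>The variance of \<open>f\<close> is nonnegative.\<close>
lemma integral_square_le:
 fixes f :: "real \<Rightarrow> real"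
 assumes f: "continuous_on {0..1} f"
 shows "(integral {0..1} f)\<^sup>2 \<le> integral {0..1} (\<lambda>t. (f t)\<^sup>2)"
proof -
 define c where "c = integral {0..1} f"
 have "0 \<le> integral {0..1} (\<lambda>t. (f t - c)\<^sup>2)"
  by (intro integral_nonneg integrable_continuous_interval continuous_intros f) auto
 also have "(\<lambda>t. (f t - c)\<^sup>2) = (\<lambda>t. (f t)\<^sup>2 - 2 * c * f t + c\<^sup>2)"
  by (auto simp: power2_eq_square algebra_simps)
 also have "integral {0..1} \<dots> = integral {0..1} (\<lambda>t. (f t)\<^sup>2) - 2 * c * c + c\<^sup>2"
 proof -
  have 1: "(\<lambda>t. (f t)\<^sup>2) integrable_on {0..1}" "(\<lambda>t. 2 * c * f t) integrable_on {0..1}" "(\<lambda>t. c\<^sup>2) integrable_on {0..1::real}"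
   by (intro integrable_continuous_interval continuous_intros f)+
  show ?thesis using 1 by (simp add: integral_add integral_diff integrable_diff c_def)
 qed
 finally show ?thesis by (simp add: c_def power2_eq_square)
qed

locale weighted_curve =
 fixes \<gamma> \<gamma>' :: "real \<Rightarrow> complex" and \<rho> :: "complex \<Rightarrow> real"
 assumes \<gamma>_deriv: "\<And>t. (\<gamma> has_vector_derivative \<gamma>' t) (at t)" and \<gamma>'_cont: "continuous_on UNIV \<gamma>'"
  and \<rho>_cont: "continuous_on UNIV (\<lambda>t. \<rho> (\<gamma> t))"
  and weight_pos: "\<And>t. t \<in> {0..1} \<Longrightarrow> \<rho> (\<gamma> t) * cmod (\<gamma>' t) > 0"
begin

abbreviation "weight t \<equiv> \<rho> (\<gamma> t) * cmod (\<gamma>' t)"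
abbreviation "curve_norm2 p \<equiv> Re (curve_inner \<gamma> \<rho> p p)"

lemma \<gamma>_cont: "continuous_on UNIV \<gamma>"
 by (intro continuous_at_imp_continuous_on ballI has_vector_derivative_continuous[OF \<gamma>_deriv])

lemma weight_cont: "continuous_on UNIV (\<lambda>t. weight t)"
 by (intro continuous_intros \<rho>_cont \<gamma>'_cont)

lemma curve_inner_eq:
 "curve_inner \<gamma> \<rho> f g = integral {0..1} (\<lambda>t. poly f (\<gamma> t) * cnj (poly g (\<gamma> t)) * of_real (weight t))"
 unfolding curve_inner_def vector_derivative_at[OF \<gamma>_deriv] ..

lemma integrable_on_curve: "continuous_on UNIV f \<Longrightarrow> (f :: real \<Rightarrow> 'a::banach) integrable_on {0..1}"
 by (rule integrable_continuous_interval, erule continuous_on_subset) simp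

lemma poly_\<gamma>_cont: "continuous_on UNIV (\<lambda>t. poly p (\<gamma> t))"
 by (intro continuous_intros \<gamma>_cont)

lemma curve_inner_sum:
 "curve_inner \<gamma> \<rho> (\<Sum>j\<le>(N::nat). smult (a j) (P j)) (\<Sum>k\<le>N. smult (b k) (P k)) =
   (\<Sum>j\<le>N. \<Sum>k\<le>N. a j * cnj (b k) * curve_inner \<gamma> \<rho> (P j) (P k))"
proof -
 let ?g = "\<lambda>j k t. poly (P j) (\<gamma> t) * cnj (poly (P k) (\<gamma> t)) * of_real (weight t)"
 have i: "?g j k integrable_on {0..1}" for j k
  by (intro integrable_on_curve continuous_intros poly_\<gamma>_cont \<rho>_cont \<gamma>'_cont)
 have "(\<lambda>t. poly (\<Sum>j\<le>N. smult (a j) (P j)) (\<gamma> t) * cnj (poly (\<Sum>k\<le>N. smult (b k) (P k)) (\<gamma> t)) * of_real (weight t))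
   = (\<lambda>t. \<Sum>j\<le>N. \<Sum>k\<le>N. a j * cnj (b k) * ?g j k t)"
  unfolding poly_sum poly_smult cnj_sum unfolding sum_product unfolding sum_distrib_right
  by (intro ext sum.cong refl) (simp add: mult_ac del: of_real_mult)
 then show ?thesis unfolding curve_inner_eq
  using i by (simp add: integral_sum integrable_sum integrable_on_mult_right del: of_real_mult)
qed

lemma curve_norm2_eq: "curve_inner \<gamma> \<rho> p p = of_real (integral {0..1} (\<lambda>t. (cmod (poly p (\<gamma> t)))\<^sup>2 * weight t))"
proof -
 have "integral {0..1} (of_real \<circ> (\<lambda>t. (cmod (poly p (\<gamma> t)))\<^sup>2 * weight t)) = complex_of_real (integral {0..1} (\<lambda>t. (cmod (poly p (\<gamma> t)))\<^sup>2 * weight t))"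
  by (rule integral_linear[OF _ bounded_linear_of_real])
    (intro integrable_on_curve continuous_intros poly_\<gamma>_cont \<rho>_cont \<gamma>'_cont)
 moreover have "of_real \<circ> (\<lambda>t. (cmod (poly p (\<gamma> t)))\<^sup>2 * weight t) = (\<lambda>t. poly p (\<gamma> t) * cnj (poly p (\<gamma> t)) * of_real (weight t))"
  by (rule ext) (simp add: complex_norm_square[symmetric])
 ultimately show ?thesis unfolding curve_inner_eq by simp
qed

lemma weight_bounds: "\<exists>m M. 0 < m \<and> 0 < M \<and> (\<forall>t\<in>{0..1}. m \<le> weight t \<and> weight t \<le> M)"
proof -
 have c: "continuous_on {0..1} (\<lambda>t. weight t)" using weight_cont by (rule continuous_on_subset) simp
 obtain a where a: "a \<in> {0..1}" "\<forall>t\<in>{0..1}. weight a \<le> weight t"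
  using continuous_attains_inf[OF compact_Icc _ c] by auto
 obtain b where b: "b \<in> {0..1}" "\<forall>t\<in>{0..1}. weight t \<le> weight b"
  using continuous_attains_sup[OF compact_Icc _ c] by auto
 show ?thesis
  by (rule exI[of _ "weight a"], rule exI[of _ "weight b"]) (use a b weight_pos[OF a(1)] weight_pos[OF b(1)] in blast)
qed

lemma curve_norm2_lower:
 assumes m: "\<And>t. t \<in> {0..1} \<Longrightarrow> m \<le> weight t"
 shows "m * integral {0..1} (\<lambda>t. (cmod (poly p (\<gamma> t)))\<^sup>2) \<le> curve_norm2 p"
proof -
 have "integral {0..1} (\<lambda>t. m * (cmod (poly p (\<gamma> t)))\<^sup>2) \<le> integral {0..1} (\<lambda>t. (cmod (poly p (\<gamma> t)))\<^sup>2 * weight t)"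
 proof (rule integral_le)
  fix t :: real assume "t \<in> {0..1}"
  then show "m * (cmod (poly p (\<gamma> t)))\<^sup>2 \<le> (cmod (poly p (\<gamma> t)))\<^sup>2 * weight t"
   using mult_left_mono[OF m, of t "(cmod (poly p (\<gamma> t)))\<^sup>2"] by (simp add: mult_ac)
 qed (intro integrable_on_curve continuous_intros poly_\<gamma>_cont \<rho>_cont \<gamma>'_cont)+
 then show ?thesis by (simp add: curve_norm2_eq)
qed

lemma curve_norm2_upper:
 assumes M: "\<And>t. t \<in> {0..1} \<Longrightarrow> weight t \<le> M" and B: "\<And>t. t \<in> {0..1} \<Longrightarrow> cmod (poly p (\<gamma> t)) \<le> B"
 shows "curve_norm2 p \<le> M * B\<^sup>2"
proof -
 have "integral {0..1} (\<lambda>t. (cmod (poly p (\<gamma> t)))\<^sup>2 * weight t) \<le> integral {0..1} (\<lambda>t::real. M * B\<^sup>2)"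
 proof (rule integral_le)
  fix t :: real assume t: "t \<in> {0..1}"
  have "(cmod (poly p (\<gamma> t)))\<^sup>2 * weight t \<le> B\<^sup>2 * M"
   using B[OF t] M[OF t] weight_pos[OF t] by (intro mult_mono power_mono) auto
  then show "(cmod (poly p (\<gamma> t)))\<^sup>2 * weight t \<le> M * B\<^sup>2" by (simp add: mult_ac)
 qed (intro integrable_on_curve continuous_intros poly_\<gamma>_cont \<rho>_cont \<gamma>'_cont)+
 then show ?thesis by (simp add: curve_norm2_eq)
qed

context
 fixes N :: nat and P :: "nat \<Rightarrow> complex poly"
 assumes ob: "orthonormal_basis (curve_inner \<gamma> \<rho>) N P"
begin

lemma curve_norm2_expansion: "curve_norm2 (\<Sum>j\<le>N. smult (a j) (P j)) = (\<Sum>j\<le>N. (cmod (a j))\<^sup>2)"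
proof -
 have "curve_inner \<gamma> \<rho> (\<Sum>j\<le>N. smult (a j) (P j)) (\<Sum>j\<le>N. smult (a j) (P j)) =
   (\<Sum>j\<le>N. \<Sum>k\<le>N. a j * cnj (a k) * (if j = k then 1 else 0))"
  unfolding curve_inner_sum by (intro sum.cong refl) (use ob in \<open>auto simp: orthonormal_basis_def\<close>)
 also have "\<dots> = (\<Sum>j\<le>N. a j * cnj (a j))"
  by (intro sum.cong refl) (simp add: if_distrib sum.delta' cong: if_cong)
 also have "\<dots> = of_real (\<Sum>j\<le>N. (cmod (a j))\<^sup>2)" by (simp add: complex_norm_square[symmetric])
 finally show ?thesis by (simp only: Re_complex_of_real)
qed

text \<open>The polynomial $\sum_j \overline{P_j(z)} P_j$ has both value at \<open>z\<close> and squared norm equal to the kernel.\<close>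
lemma kernel_diag_le:
 assumes A: "A \<ge> 0" and le: "\<And>p. degree p \<le> N \<Longrightarrow> (cmod (poly p z))\<^sup>2 \<le> A * curve_norm2 p"
 shows "kernel_diag N P z \<le> A"
proof -
 let ?p = "\<Sum>j\<le>N. smult (cnj (poly (P j) z)) (P j)"
 let ?K = "kernel_diag N P z"
 have K0: "?K \<ge> 0" unfolding kernel_diag_def by (rule sum_nonneg) simp
 have "degree ?p \<le> N"
  by (rule degree_sum_le) (use ob in \<open>auto simp: orthonormal_basis_def intro: order_trans[OF degree_smult_le]\<close>)
 from le[OF this] have "(cmod (poly ?p z))\<^sup>2 \<le> A * ?K"
  unfolding curve_norm2_expansion by (simp add: kernel_diag_def)
 moreover have "poly ?p z = of_real ?K"
  by (simp add: poly_sum kernel_diag_def complex_norm_square[symmetric] mult.commute[of "cnj _"])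
 ultimately have "?K * ?K \<le> A * ?K" using K0 by (simp add: power2_eq_square)
 then show ?thesis using A K0 by (cases "?K = 0") auto
qed

text \<open>The Cauchy--Schwarz inequality for the expansion of \<open>p\<close> in the orthonormal basis.\<close>
lemma kernel_diag_ge:
 assumes d: "degree p \<le> N"
 shows "(cmod (poly p z))\<^sup>2 \<le> kernel_diag N P z * curve_norm2 p"
proof -
 obtain a where a: "p = (\<Sum>j\<le>N. smult (a j) (P j))" using ob d unfolding orthonormal_basis_def by blast
 have "cmod (poly p z) \<le> (\<Sum>j\<le>N. cmod (a j) * cmod (poly (P j) z))"
  unfolding a poly_sum poly_smult by (rule order_trans[OF norm_sum]) (simp add: norm_mult)
 then have "(cmod (poly p z))\<^sup>2 \<le> (\<Sum>j\<le>N. cmod (a j) * cmod (poly (P j) z))\<^sup>2" by (rule power_mono) simp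
 also have "\<dots> \<le> (\<Sum>j\<le>N. (cmod (a j))\<^sup>2) * (\<Sum>j\<le>N. (cmod (poly (P j) z))\<^sup>2)" by (rule Cauchy_Schwarz_ineq_sum)
 also have "(\<Sum>j\<le>N. (cmod (a j))\<^sup>2) = curve_norm2 p" unfolding a by (rule curve_norm2_expansion[symmetric])
 finally show ?thesis by (simp add: kernel_diag_def mult.commute)
qed

end

end

context exterior_uniformization
begin

lemma quot_bound: "\<exists>Q>0. \<forall>s \<sigma>. cmod s \<le> 1 \<longrightarrow> cmod \<sigma> \<le> 1 \<longrightarrow> \<sigma> \<noteq> s \<longrightarrow> cmod (quot s \<sigma>) \<le> Q"
proof -
 have sub: "cball 0 1 \<subseteq> ball 0 R" using R by auto
 obtain B1 where B1: "\<And>s. s \<in> cball 0 1 \<Longrightarrow> cmod (H s) \<le> B1"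
  using continuous_on_compact_bounded_norm[OF compact_cball continuous_on_subset[OF holomorphic_on_imp_continuous_on[OF H] sub]] by metis
 have "deriv H holomorphic_on ball 0 R" by (intro holomorphic_deriv H open_ball)
 from continuous_on_compact_bounded_norm[OF compact_cball continuous_on_subset[OF holomorphic_on_imp_continuous_on[OF this] sub]]
 obtain B2 where B2: "\<And>s. s \<in> cball 0 1 \<Longrightarrow> cmod (deriv H s) \<le> B2" by metis
 have pos: "B1 \<ge> 0" "B2 \<ge> 0" using B1[of 0] B2[of 0] norm_ge_zero[of "H 0"] norm_ge_zero[of "deriv H 0"] by (simp_all del: norm_ge_zero)
 show ?thesis
 proof (rule exI[of _ "B1 + B2 + 1"], intro conjI allI impI)
  show "0 < B1 + B2 + 1" using pos by simp
  fix s \<sigma> :: complex assume s: "cmod s \<le> 1" and \<sigma>: "cmod \<sigma> \<le> 1" and ne: "\<sigma> \<noteq> s"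
  have "cmod (H \<sigma> - H s) \<le> B2 * cmod (\<sigma> - s)"
   by (rule field_differentiable_bound[of "cball 0 1" H "deriv H"])
     (use B2 s \<sigma> R in \<open>auto intro!: has_field_derivative_at_within[OF H_deriv]\<close>)
  then have "cmod s * cmod (H \<sigma> - H s) \<le> 1 * (B2 * cmod (\<sigma> - s))" using s by (intro mult_mono) auto
  moreover have "cmod (\<sigma> - s) * cmod (H s) \<le> cmod (\<sigma> - s) * B1" using B1[of s] s by (intro mult_left_mono) auto
  moreover have "cmod (s * (H \<sigma> - H s) - (\<sigma> - s) * H s) \<le> cmod s * cmod (H \<sigma> - H s) + cmod (\<sigma> - s) * cmod (H s)"
   by (rule order_trans[OF norm_triangle_ineq4]) (simp add: norm_mult)
  moreover have eq: "s * (H \<sigma> - H s) - (\<sigma> - s) * H s = (\<sigma> - s) * quot s \<sigma>"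
   unfolding quot_eq[OF ne, symmetric] by (simp add: algebra_simps)
  ultimately have "cmod ((\<sigma> - s) * quot s \<sigma>) \<le> B2 * cmod (\<sigma> - s) + cmod (\<sigma> - s) * B1" unfolding eq by linarith
  then have "cmod (\<sigma> - s) * cmod (quot s \<sigma>) \<le> cmod (\<sigma> - s) * (B1 + B2)"
   unfolding norm_mult by (simp add: distrib_left distrib_right mult.commute)
  then have "cmod (quot s \<sigma>) \<le> B1 + B2" using ne by (simp add: mult_le_cancel_left)
  then show "cmod (quot s \<sigma>) \<le> B1 + B2 + 1" by simp
 qed
qed

text \<open>The Faber polynomials are the coefficients in the expansion of $(H(\sigma) - \sigma H'(\sigma)) / (H(\sigma) - z \sigma)$ in powers of \<open>\<sigma>\<close>. For $z = \psi(s)$ this function has a simple pole at $\sigma = s$; subtracting $1/(1 - \sigma/s)$, whose coefficients are $s^{-N}$, removes it. What is left is holomorphic on a disc of radius greater than 1 and bounded there independently of \<open>s\<close>, so by Cauchy's inequality its coefficients are bounded.\<close>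
theorem faber_polynomials:
 "\<exists>F C. \<forall>N. degree (F N) \<le> N \<and> (\<forall>s. s \<noteq> 0 \<longrightarrow> cmod s \<le> 1 \<longrightarrow> cmod (poly (F N) (\<psi> s) - (1 / s) ^ N) \<le> C)"
proof -
 define A where "A \<sigma> = H \<sigma> - \<sigma> * deriv H \<sigma>" for \<sigma>
 have Ah: "A holomorphic_on ball 0 R" unfolding A_def by (intro holomorphic_intros H holomorphic_deriv) auto
 have b0: "(0::complex) \<in> ball 0 R" using R by simp
 note Ae = has_fps_expansion_fps_expansion[OF open_ball b0 Ah]
 note He = has_fps_expansion_fps_expansion[OF open_ball b0 H]
 define a b where "a = fps_expansion A 0" and "b = fps_expansion H 0"
 have b: "fps_nth b 0 \<noteq> 0" using has_fps_expansion_imp_0_eq_fps_nth_0[OF He] H0 by (simp add: b_def)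
 obtain F where F: "\<forall>n. degree (F n) \<le> n \<and> (\<forall>z. poly (F n) z = fps_nth (a / (b - fps_const z * fps_X)) n)"
  using fps_rational_coeff_poly[OF b, of a] by (elim exE)
 define r where "r = (1 + R) / 2"
 have r: "1 < r" "r < R" using R by (auto simp: r_def)
 have rsub: "sphere 0 r \<subseteq> ball 0 R" "cball 0 1 \<subseteq> ball (0::complex) R" "cball 0 r \<subseteq> ball (0::complex) R" using r R by auto
 note cH = holomorphic_on_imp_continuous_on[OF H] and cA = holomorphic_on_imp_continuous_on[OF Ah]
 obtain CA where "\<And>\<sigma>. \<sigma> \<in> sphere 0 r \<Longrightarrow> cmod (A \<sigma>) \<le> CA"
  using continuous_on_compact_bounded_norm[OF compact_sphere continuous_on_subset[OF cA rsub(1)]] by metis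
 then have CA: "\<And>\<sigma>. cmod \<sigma> = r \<Longrightarrow> cmod (A \<sigma>) \<le> CA" by simp
 define D where "D p = cmod (snd p * H (fst p) - fst p * H (snd p))" for p
 have Dc: "continuous_on (sphere 0 r \<times> cball 0 1) D"
  unfolding D_def
  by (intro continuous_intros continuous_on_compose2[OF cH continuous_on_fst[OF continuous_on_id]]
     continuous_on_compose2[OF cH continuous_on_snd[OF continuous_on_id]]) (use rsub in auto)
 have Dpos: "D p > 0" if "p \<in> sphere 0 r \<times> cball 0 1" for p
 proof (cases "snd p = 0")
  case True
  then show ?thesis using that r H0 by (auto simp: D_def)
 next
  case False
  have 1: "fst p \<in> ball 0 R" "snd p \<in> ball 0 R" "fst p \<noteq> snd p" using that r R by auto
  have "D p = cmod ((fst p - snd p) * quot (snd p) (fst p))" unfolding D_def using quot_eq[OF 1(3)] by simp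
  then show ?thesis using quot_nonzero[OF 1(2) False 1(1)] 1(3) by simp
 qed
 have ne: "sphere (0::complex) r \<times> cball (0::complex) 1 \<noteq> {}"
  using r by (auto simp: ex_in_conv[symmetric] intro!: exI[of _ "of_real r"] exI[of _ 0])
 obtain p0 where p0: "p0 \<in> sphere 0 r \<times> cball 0 1" "\<forall>p\<in>sphere 0 r \<times> cball 0 1. D p0 \<le> D p"
  using continuous_attains_inf[OF compact_Times[OF compact_sphere compact_cball] ne Dc] by auto
 define \<delta> where "\<delta> = D p0"
 have \<delta>: "\<delta> > 0" using Dpos[OF p0(1)] by (simp add: \<delta>_def)
 define C where "C = CA / \<delta> + 1 / (r - 1)"
 have CA0: "CA \<ge> 0" using CA[of "of_real r"] r norm_ge_zero[of "A (of_real r)"] by (simp del: norm_ge_zero)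
 have C0: "C \<ge> 0" unfolding C_def using CA0 \<delta> r by simp
 have main: "cmod (poly (F N) (\<psi> s) - (1 / s) ^ N) \<le> C" if s: "s \<noteq> 0" "cmod s \<le> 1" for s N
 proof -
  have sR: "s \<in> ball 0 R" using s R by simp
  define m where "m \<sigma> = s * (A \<sigma> / quot s \<sigma> + 1)" for \<sigma>
  \<comment> \<open>Since \<open>m\<close> vanishes at \<open>s\<close>, its divided difference is holomorphic, although each of the two terms in \<open>Meq\<close> has a pole at \<open>s\<close>.\<close>
  define M where "M \<sigma> = (if \<sigma> = s then deriv m s else (m \<sigma> - m s) / (\<sigma> - s))" for \<sigma>
  have "m holomorphic_on ball 0 R"
   unfolding m_def using quot_nonzero[OF sR s(1)] by (intro holomorphic_intros Ah quot_holomorphic[OF sR]) auto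
  then have Mh: "M holomorphic_on ball 0 R" unfolding M_def by (rule pole_lemma) (use sR in simp)
  have ms: "m s = 0"
  proof -
   have "quot s s = - A s" by (simp add: quot_def A_def)
   then show ?thesis using quot_nonzero[OF sR s(1) sR] by (simp add: m_def)
  qed
  have Meq: "M \<sigma> = s * A \<sigma> / (s * H \<sigma> - \<sigma> * H s) + s / (\<sigma> - s)" if "\<sigma> \<noteq> s" for \<sigma>
  proof -
   have "M \<sigma> = s * (A \<sigma> / quot s \<sigma> + 1) / (\<sigma> - s)" using that ms by (simp add: M_def m_def)
   also have "\<dots> = s * A \<sigma> / ((\<sigma> - s) * quot s \<sigma>) + s / (\<sigma> - s)"
    using that by (simp add: add_divide_distrib distrib_left)
   finally show ?thesis using quot_eq[OF that] by simp
  qed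
  have e1: "(\<lambda>\<sigma>. A \<sigma> / (H \<sigma> - \<psi> s * \<sigma>)) has_fps_expansion (a / (b - fps_const (\<psi> s) * fps_X))"
   unfolding a_def b_def by (intro fps_expansion_intros Ae He) (use b in \<open>simp add: b_def\<close>)
  have e2: "(\<lambda>\<sigma>. 1 / (1 - (1 / s) * \<sigma>)) has_fps_expansion (1 / (1 - fps_const (1 / s) * fps_X))"
   by (intro fps_expansion_intros) simp
  have e2n: "fps_nth (1 / (1 - fps_const (1 / s) * fps_X)) n = (1 / s) ^ n" for n
  proof -
   have "1 / (1 - fps_const (1 / s) * fps_X) = inverse ((1 - fps_const (1 / s) * fps_X) ^ 1)"
    by (subst fps_divide_unit) simp_all
   also have "\<dots> = Abs_fps (\<lambda>k. of_nat ((1 + k - 1) choose k) * (1 / s) ^ k)"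
    by (rule one_minus_const_fps_X_neg_power') simp
   finally show ?thesis by simp
  qed
  have e3: "(\<lambda>\<sigma>. A \<sigma> / (H \<sigma> - \<psi> s * \<sigma>) - 1 / (1 - (1 / s) * \<sigma>)) has_fps_expansion
    (a / (b - fps_const (\<psi> s) * fps_X) - 1 / (1 - fps_const (1 / s) * fps_X))"
   by (rule has_fps_expansion_diff[OF e1 e2])
  have "eventually (\<lambda>\<sigma>. \<sigma> \<in> - {s}) (nhds 0)" by (rule eventually_nhds_in_open) (use s in auto)
  then have ev: "eventually (\<lambda>\<sigma>. A \<sigma> / (H \<sigma> - \<psi> s * \<sigma>) - 1 / (1 - (1 / s) * \<sigma>) = M \<sigma>) (nhds 0)"
  proof eventually_elim
   case (elim \<sigma>)
   then have n: "\<sigma> \<noteq> s" by simp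
   have "H \<sigma> - \<psi> s * \<sigma> = (s * H \<sigma> - \<sigma> * H s) / s" using s(1) by (simp add: field_simps)
   then have "A \<sigma> / (H \<sigma> - \<psi> s * \<sigma>) = s * A \<sigma> / (s * H \<sigma> - \<sigma> * H s)" using s(1) by (simp add: mult.commute)
   moreover have "1 / (1 - (1 / s) * \<sigma>) = - (s / (\<sigma> - s))"
   proof -
    have "1 - (1 / s) * \<sigma> = (s - \<sigma>) / s" using s(1) by (simp add: field_simps)
    then have "1 / (1 - (1 / s) * \<sigma>) = s / (s - \<sigma>)" by simp
    then show ?thesis by (metis minus_diff_eq minus_divide_right)
   qed
   ultimately show ?case using Meq[OF n] by simp
  qed
  have "M has_fps_expansion (a / (b - fps_const (\<psi> s) * fps_X) - 1 / (1 - fps_const (1 / s) * fps_X))"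
   using e3 has_fps_expansion_cong[OF ev refl] by blast
  from fps_nth_fps_expansion[OF this, of N]
  have eq: "poly (F N) (\<psi> s) - (1 / s) ^ N = (deriv ^^ N) M 0 / fact N"
   using F e2n[of N] by simp
  have "cmod ((deriv ^^ N) M 0) \<le> fact N * C / r ^ N"
  proof (rule Cauchy_inequality)
   show "M holomorphic_on ball 0 r" using r by (intro holomorphic_on_subset[OF Mh]) auto
   show "continuous_on (cball 0 r) M" by (rule continuous_on_subset[OF holomorphic_on_imp_continuous_on[OF Mh] rsub(3)])
   show "0 < r" using r by simp
   fix \<sigma> :: complex assume "cmod (0 - \<sigma>) = r"
   then have \<sigma>: "cmod \<sigma> = r" by simp
   then have ne: "\<sigma> \<noteq> s" using s r by auto
   have "\<delta> \<le> cmod (s * H \<sigma> - \<sigma> * H s)" using p0(2) \<sigma> s by (force simp: D_def \<delta>_def)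
   then have "cmod (s * A \<sigma> / (s * H \<sigma> - \<sigma> * H s)) \<le> 1 * CA / \<delta>"
    unfolding norm_divide norm_mult using s CA[OF \<sigma>] CA0 \<delta> by (intro frac_le mult_mono mult_nonneg_nonneg) auto
   moreover have "r - 1 \<le> cmod (\<sigma> - s)" using norm_triangle_ineq2[of \<sigma> s] \<sigma> s by linarith
   then have "cmod (s / (\<sigma> - s)) \<le> 1 / (r - 1)"
    unfolding norm_divide using s r by (intro frac_le) auto
   ultimately show "cmod (M \<sigma>) \<le> C"
    unfolding Meq[OF ne] C_def using norm_triangle_ineq[of "s * A \<sigma> / (s * H \<sigma> - \<sigma> * H s)" "s / (\<sigma> - s)"] by linarith
  qed
  then have "cmod ((deriv ^^ N) M 0 / fact N) \<le> C / r ^ N"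
   by (simp add: norm_divide field_simps)
  also have "C / r ^ N \<le> C / 1" using C0 r by (intro divide_left_mono) auto
  finally show ?thesis unfolding eq by simp
 qed
 show ?thesis by (rule exI[of _ F], rule exI[of _ C]) (use F main in blast)
qed

end

text \<open>A weighted Jordan curve as the frontier of a uniformised domain; \<open>\<eta>\<close> is the lift of \<open>\<gamma>\<close> to the unit circle. With it the Cauchy integrals inside and outside are taken in the same parameter, and the measure $|dz|$ need not be transformed.\<close>
locale exterior_curve = exterior_uniformization \<Omega> R H + weighted_curve \<gamma> \<gamma>' \<rho>
 for \<Omega> :: "complex set" and R :: real and H :: "complex \<Rightarrow> complex"
  and \<gamma> \<gamma>' :: "real \<Rightarrow> complex" and \<rho> :: "complex \<Rightarrow> real" +
 fixes \<eta> \<eta>' :: "real \<Rightarrow> complex"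
 assumes \<eta>_circle: "\<And>t. cmod (\<eta> t) = 1" and \<psi>_\<eta>: "\<And>t. H (\<eta> t) / \<eta> t = \<gamma> t"
  and \<eta>_deriv: "\<And>t. (\<eta> has_vector_derivative \<eta>' t) (at t)" and \<eta>'_cont: "continuous_on UNIV \<eta>'"
  and \<gamma>_simple: "simple_path \<gamma>" "pathfinish \<gamma> = pathstart \<gamma>"
  and \<Omega>_inside: "\<Omega> = inside (path_image \<gamma>)" and frontier_\<Omega>: "frontier \<Omega> = path_image \<gamma>"
begin

lemma \<psi>_inj_circle: "cmod \<sigma> = 1 \<Longrightarrow> cmod \<tau> = 1 \<Longrightarrow> \<psi> \<sigma> = \<psi> \<tau> \<Longrightarrow> \<sigma> = \<tau>"
 by (cases "\<sigma> = 0"; cases "\<tau> = 0") (use inj_onD[OF inj, of \<sigma> \<tau>] R in auto)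

lemma \<eta>_simple: "simple_path \<eta>" "pathfinish \<eta> = pathstart \<eta>"
proof -
 have "path \<eta>" unfolding path_def
  by (intro continuous_at_imp_continuous_on ballI has_vector_derivative_continuous[OF \<eta>_deriv])
 moreover have "loop_free \<eta>"
  using \<gamma>_simple(1) \<psi>_\<eta> unfolding simple_path_def loop_free_def by metis
 ultimately show "simple_path \<eta>" by (simp add: simple_path_def)
 show "pathfinish \<eta> = pathstart \<eta>"
  using \<gamma>_simple(2) \<psi>_\<eta> \<psi>_inj_circle[OF \<eta>_circle \<eta>_circle] unfolding pathfinish_def pathstart_def by metis
qed

lemma path_image_\<eta>: "path_image \<eta> = sphere 0 1"
proof
 show "path_image \<eta> \<subseteq> sphere 0 1" using \<eta>_circle by (auto simp: path_image_def)
 show "sphere 0 1 \<subseteq> path_image \<eta>"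
 proof
  fix \<sigma> :: complex assume \<sigma>: "\<sigma> \<in> sphere 0 1"
  then have "\<psi> \<sigma> \<in> \<gamma> ` {0..1}" using boundary frontier_\<Omega> unfolding path_image_def by blast
  then obtain t where t: "t \<in> {0..1}" "\<psi> \<sigma> = \<gamma> t" by blast
  then have "\<sigma> = \<eta> t" using \<psi>_inj_circle[OF _ \<eta>_circle, of \<sigma> t] \<sigma> \<psi>_\<eta>[of t] by simp
  then show "\<sigma> \<in> path_image \<eta>" using t(1) by (simp add: path_image_def)
 qed
qed

lemma inside_\<eta>: "inside (path_image \<eta>) = ball 0 1"
 by (rule jordan_interior_exterior(1)[of "ball 0 1" \<eta>, symmetric])
   (use \<eta>_simple path_image_\<eta> in auto)

text \<open>Near $s = 0$ the map \<open>\<psi>\<close> is large, so bounded points of the exterior have parameters bounded away from 0.\<close>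
lemma small_parameter: "\<exists>s0>0. \<forall>s. s \<noteq> 0 \<longrightarrow> cmod s \<le> 1 \<longrightarrow> cmod (\<psi> s) \<le> r \<longrightarrow> s0 \<le> cmod s"
proof -
 have "isCont H 0" using holomorphic_on_imp_continuous_on[OF H] R by (simp add: continuous_on_eq_continuous_at)
 then have "((\<lambda>s. cmod (H s)) \<longlongrightarrow> cmod (H 0)) (at 0)" by (intro tendsto_norm) (simp add: isCont_def)
 then have "\<forall>\<^sub>F s in at 0. cmod (H 0) / 2 < cmod (H s)" by (rule order_tendstoD) (use H0 in simp)
 then obtain \<delta> where \<delta>: "\<delta> > 0" "\<And>s. s \<noteq> 0 \<Longrightarrow> cmod s < \<delta> \<Longrightarrow> cmod (H 0) / 2 < cmod (H s)"
  unfolding eventually_at by (auto simp: dist_norm)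
 define q where "q = cmod (H 0) / (2 * max r 1)"
 have q: "q > 0" using H0 by (simp add: q_def)
 show ?thesis
 proof (rule exI[of _ "min \<delta> q"], intro conjI allI impI)
  show "0 < min \<delta> q" using \<delta> q by simp
  fix s :: complex assume s: "s \<noteq> 0" "cmod s \<le> 1" "cmod (\<psi> s) \<le> r"
  show "min \<delta> q \<le> cmod s"
  proof (rule ccontr)
   assume n: "\<not> min \<delta> q \<le> cmod s"
   then have "cmod (H 0) / 2 < cmod (H s)" using \<delta>(2)[OF s(1)] by simp
   also have "cmod (H s) = cmod s * cmod (\<psi> s)" using s(1) by (simp add: norm_divide)
   also have "\<dots> \<le> q * max r 1" using n s(3) q by (intro mult_mono) auto
   also have "\<dots> = cmod (H 0) / 2" by (simp add: q_def field_simps)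
   finally show False by simp
  qed
 qed
qed

lemma exp_green: "s \<noteq> 0 \<Longrightarrow> cmod s \<le> 1 \<Longrightarrow> exp (real N * green (\<psi> s)) = (1 / cmod s) ^ N"
 by (simp add: green_eq(2) exp_of_nat_mult exp_minus inverse_eq_divide power_one_over)

text \<open>Inside, this is Cauchy's formula over \<open>\<gamma>\<close>. Outside, $s^N p(\psi(s))$ is holomorphic on the whole disc, since \<open>p\<close> composed with \<open>\<psi>\<close> has a pole of order at most \<open>N\<close> at 0; Cauchy's formula over the lift \<open>\<eta>\<close> applies to it, and dividing by $|s|^N$ produces the exponential. The bound for \<open>quot\<close> compares the distance of $\eta(t)$ to \<open>s\<close> with that of $\gamma(t)$ to \<open>z\<close>.\<close>
theorem polynomial_growth:
 "\<exists>C>0. \<forall>N p z d. degree p \<le> N \<longrightarrow> cmod z \<le> r \<longrightarrow> d > 0 \<longrightarrow> (\<forall>t\<in>{0..1}. d \<le> cmod (\<gamma> t - z)) \<longrightarrow>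
   cmod (poly p z) \<le> C / d * exp (real N * green z) * integral {0..1} (\<lambda>t. cmod (poly p (\<gamma> t)))"
proof -
 obtain L1 where L1: "\<And>t. t \<in> {0..1} \<Longrightarrow> cmod (\<gamma>' t) \<le> L1"
  using continuous_on_compact_bounded_norm[OF compact_Icc continuous_on_subset[OF \<gamma>'_cont subset_UNIV]] by metis
 obtain L2 where L2: "\<And>t. t \<in> {0..1} \<Longrightarrow> cmod (\<eta>' t) \<le> L2"
  using continuous_on_compact_bounded_norm[OF compact_Icc continuous_on_subset[OF \<eta>'_cont subset_UNIV]] by metis
 obtain Q where Q: "Q > 0" "\<forall>s \<sigma>. cmod s \<le> 1 \<longrightarrow> cmod \<sigma> \<le> 1 \<longrightarrow> \<sigma> \<noteq> s \<longrightarrow> cmod (quot s \<sigma>) \<le> Q"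
  using quot_bound by blast
 obtain s0 where s0: "s0 > 0" "\<forall>s. s \<noteq> 0 \<longrightarrow> cmod s \<le> 1 \<longrightarrow> cmod (\<psi> s) \<le> r \<longrightarrow> s0 \<le> cmod s"
  using small_parameter by blast
 have L0: "L1 \<ge> 0" "L2 \<ge> 0" using L1[of 0] L2[of 0] norm_ge_zero[of "\<gamma>' 0"] norm_ge_zero[of "\<eta>' 0"] by (simp_all del: norm_ge_zero)
 define C where "C = L1 + L2 * Q / s0 + 1"
 have "L2 * Q / s0 \<ge> 0" using L0(2) Q(1) s0(1) by (intro divide_nonneg_pos mult_nonneg_nonneg) auto
 then have C1: "L1 \<le> C" "L2 * Q / s0 \<le> C" and C0: "C > 0" using L0(1) unfolding C_def by linarith+
 have J0: "0 \<le> integral {0..1} (\<lambda>t. cmod (poly p (\<gamma> t)))" for p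
  by (intro integral_nonneg integrable_on_curve continuous_intros poly_\<gamma>_cont) auto
 have main: "cmod (poly p z) \<le> C / d * exp (real N * green z) * integral {0..1} (\<lambda>t. cmod (poly p (\<gamma> t)))"
  if p: "degree p \<le> N" and z: "cmod z \<le> r" and d: "d > 0" and dist: "\<And>t. t \<in> {0..1} \<Longrightarrow> d \<le> cmod (\<gamma> t - z)" for N p z d
 proof (cases rule: exterior_cases[of z])
  case 1
  have "cmod (poly p z) \<le> L1 / d * integral {0..1} (\<lambda>t. cmod (poly p (\<gamma> t)))"
  proof (rule cauchy_estimate[OF convex_UNIV open_UNIV _ \<gamma>_deriv \<gamma>'_cont \<gamma>_simple])
   show "poly p holomorphic_on UNIV" by (intro holomorphic_intros)
   show "z \<in> inside (path_image \<gamma>)" using 1 \<Omega>_inside by simp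
   fix t :: real assume t: "t \<in> {0..1}"
   show "cmod (\<gamma>' t) / cmod (\<gamma> t - z) \<le> L1 / d" using L1[OF t] dist[OF t] d L0 by (intro frac_le) auto
  qed auto
  also have "\<dots> \<le> C / d * integral {0..1} (\<lambda>t. cmod (poly p (\<gamma> t)))"
   using C1(1) d J0 by (intro mult_right_mono divide_right_mono) auto
  finally show ?thesis using green_eq(1)[OF 1] by simp
 next
  case (2 s)
  have s1: "cmod s < 1"
  proof (rule ccontr)
   assume "\<not> cmod s < 1"
   then have "s \<in> path_image \<eta>" using 2(2) path_image_\<eta> by simp
   then obtain t where "t \<in> {0..1}" "s = \<eta> t" by (auto simp: path_image_def)
   then show False using dist[of t] d 2(3) \<psi>_\<eta>[of t] by simp
  qed
  have ss: "s0 \<le> cmod s" using s0(2) 2 z by blast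
  define q where "q \<sigma> = (\<Sum>k\<le>N. coeff p k * \<sigma> ^ (N - k) * H \<sigma> ^ k)" for \<sigma>
  have qh: "q holomorphic_on ball 0 R" unfolding q_def by (intro holomorphic_intros H)
  have qeq: "q \<sigma> = \<sigma> ^ N * poly p (\<psi> \<sigma>)" if "\<sigma> \<noteq> 0" for \<sigma>
  proof -
   have "poly p (\<psi> \<sigma>) = (\<Sum>k\<le>N. coeff p k * \<psi> \<sigma> ^ k)"
    unfolding poly_altdef by (rule sum.mono_neutral_left) (use p in \<open>auto simp: coeff_eq_0\<close>)
   moreover have "\<sigma> ^ N * (coeff p k * \<psi> \<sigma> ^ k) = coeff p k * \<sigma> ^ (N - k) * H \<sigma> ^ k" if "k \<le> N" for k
   proof -
    have "\<sigma> ^ N = \<sigma> ^ (N - k) * \<sigma> ^ k" using that by (simp add: power_add[symmetric])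
    then show ?thesis using \<open>\<sigma> \<noteq> 0\<close> by (simp add: power_divide)
   qed
   ultimately show ?thesis unfolding q_def by (simp only: sum_distrib_left) (rule sum.cong, simp_all only: atMost_iff)
  qed
  have "cmod (q s) \<le> L2 * Q / (d * s0) * integral {0..1} (\<lambda>t. cmod (q (\<eta> t)))"
  proof (rule cauchy_estimate[OF convex_ball open_ball qh \<eta>_deriv \<eta>'_cont \<eta>_simple])
   show "path_image \<eta> \<subseteq> ball 0 R" using R by (auto simp: path_image_\<eta>)
   show "s \<in> ball 0 R" using s1 R by simp
   show "s \<in> inside (path_image \<eta>)" using s1 inside_\<eta> by simp
   fix t :: real assume t: "t \<in> {0..1}"
   have ne: "\<eta> t \<noteq> s" "\<eta> t \<noteq> 0" using \<eta>_circle[of t] s1 by auto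
   have "cmod (\<gamma> t - z) = cmod (\<eta> t - s) * cmod (quot s (\<eta> t)) / cmod s"
    unfolding 2(3) \<psi>_\<eta>[symmetric] \<psi>_diff[OF ne 2(1)] norm_divide norm_mult \<eta>_circle by simp
   also have "\<dots> \<le> cmod (\<eta> t - s) * Q / s0"
    using Q ss s0(1) ne 2(2) \<eta>_circle[of t] by (intro frac_le mult_left_mono mult_nonneg_nonneg) auto
   finally have "cmod (\<gamma> t - z) * s0 \<le> cmod (\<eta> t - s) * Q" using s0(1) by (simp add: pos_le_divide_eq)
   moreover have "d * s0 \<le> cmod (\<gamma> t - z) * s0" using dist[OF t] s0(1) by (intro mult_right_mono) auto
   ultimately have "d * s0 \<le> cmod (\<eta> t - s) * Q" by linarith
   then have "d * s0 / Q \<le> cmod (\<eta> t - s)" using Q(1) by (simp add: pos_divide_le_eq)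
   then have "cmod (\<eta>' t) / cmod (\<eta> t - s) \<le> L2 / (d * s0 / Q)"
    using L2[OF t] L0 d s0(1) Q(1) by (intro frac_le) auto
   then show "cmod (\<eta>' t) / cmod (\<eta> t - s) \<le> L2 * Q / (d * s0)" by simp
  qed
  also have "(\<lambda>t. cmod (q (\<eta> t))) = (\<lambda>t. cmod (poly p (\<gamma> t)))"
  proof (rule ext)
   fix t
   have "\<eta> t \<noteq> 0" using \<eta>_circle[of t] by auto
   from qeq[OF this] show "cmod (q (\<eta> t)) = cmod (poly p (\<gamma> t))"
    by (simp only: \<psi>_\<eta> norm_mult norm_power \<eta>_circle power_one mult_1)
  qed
  also have "L2 * Q / (d * s0) = (L2 * Q / s0) / d" by (simp add: mult.commute)
  also have "(L2 * Q / s0) / d * integral {0..1} (\<lambda>t. cmod (poly p (\<gamma> t))) \<le> C / d * integral {0..1} (\<lambda>t. cmod (poly p (\<gamma> t)))"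
   using C1(2) d J0 by (intro mult_right_mono divide_right_mono) auto
  finally have le: "cmod s ^ N * cmod (poly p z) \<le> C / d * integral {0..1} (\<lambda>t. cmod (poly p (\<gamma> t)))"
   using qeq[OF 2(1)] 2(3) by (simp add: norm_mult norm_power)
  have "cmod (poly p z) = (1 / cmod s) ^ N * (cmod s ^ N * cmod (poly p z))"
   using 2(1) by (simp add: power_one_over)
  also have "\<dots> \<le> (1 / cmod s) ^ N * (C / d * integral {0..1} (\<lambda>t. cmod (poly p (\<gamma> t))))"
   using le by (intro mult_left_mono) auto
  finally show ?thesis using exp_green[OF 2(1,2), of N] 2(3) by (simp add: mult_ac)
 qed
 show ?thesis by (rule exI[of _ C]) (use C0 main in blast)
qed

lemma kernel_diag_upper:
 "\<exists>C>0. \<forall>N P z d. orthonormal_basis (curve_inner \<gamma> \<rho>) N P \<longrightarrow> cmod z \<le> r \<longrightarrow> d > 0 \<longrightarrow> (\<forall>t\<in>{0..1}. d \<le> cmod (\<gamma> t - z)) \<longrightarrow>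
   kernel_diag N P z \<le> C / d\<^sup>2 * exp (2 * real N * green z)"
proof -
 obtain C where C: "C > 0" "\<forall>N p z d. degree p \<le> N \<longrightarrow> cmod z \<le> r \<longrightarrow> d > 0 \<longrightarrow> (\<forall>t\<in>{0..1}. d \<le> cmod (\<gamma> t - z)) \<longrightarrow>
   cmod (poly p z) \<le> C / d * exp (real N * green z) * integral {0..1} (\<lambda>t. cmod (poly p (\<gamma> t)))"
  using polynomial_growth[of r] by (elim exE conjE)
 obtain m M where m: "m > 0" and w: "\<forall>t\<in>{0..1}. m \<le> weight t \<and> weight t \<le> M" using weight_bounds by blast
 have main: "kernel_diag N P z \<le> (C\<^sup>2 / m) / d\<^sup>2 * exp (2 * real N * green z)"
  if ob: "orthonormal_basis (curve_inner \<gamma> \<rho>) N P" and z: "cmod z \<le> r" "d > 0" "\<forall>t\<in>{0..1}. d \<le> cmod (\<gamma> t - z)" for N P z d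
 proof (rule kernel_diag_le[OF ob])
  show "0 \<le> C\<^sup>2 / m / d\<^sup>2 * exp (2 * real N * green z)" using m by simp
  fix p :: "complex poly" assume p: "degree p \<le> N"
  let ?I = "integral {0..1} (\<lambda>t. cmod (poly p (\<gamma> t)))" and ?E = "exp (real N * green z)"
  have E: "?E\<^sup>2 = exp (2 * real N * green z)" by (simp add: exp_double[symmetric] mult.assoc)
  have "cmod (poly p z) \<le> C / d * ?E * ?I" using C(2) p z by blast
  then have "(cmod (poly p z))\<^sup>2 \<le> (C / d * ?E * ?I)\<^sup>2" by (rule power_mono) simp
  also have "\<dots> = C\<^sup>2 / d\<^sup>2 * ?E\<^sup>2 * ?I\<^sup>2" by (simp add: power_mult_distrib power_divide)
  also have "\<dots> \<le> C\<^sup>2 / d\<^sup>2 * ?E\<^sup>2 * (curve_norm2 p / m)"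
  proof (intro mult_left_mono)
   have "?I\<^sup>2 \<le> integral {0..1} (\<lambda>t. (cmod (poly p (\<gamma> t)))\<^sup>2)"
    by (rule integral_square_le) (intro continuous_on_subset[OF continuous_on_norm[OF poly_\<gamma>_cont]] subset_UNIV)
   then have "m * ?I\<^sup>2 \<le> m * integral {0..1} (\<lambda>t. (cmod (poly p (\<gamma> t)))\<^sup>2)" using m by (intro mult_left_mono) auto
   also have "\<dots> \<le> curve_norm2 p" by (rule curve_norm2_lower) (use w in blast)
   finally show "?I\<^sup>2 \<le> curve_norm2 p / m" using m by (simp add: pos_le_divide_eq mult.commute)
  qed auto
  also have "\<dots> = C\<^sup>2 / m / d\<^sup>2 * exp (2 * real N * green z) * curve_norm2 p" unfolding E by simp
  finally show "(cmod (poly p z))\<^sup>2 \<le> C\<^sup>2 / m / d\<^sup>2 * exp (2 * real N * green z) * curve_norm2 p" .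
 qed
 show ?thesis by (rule exI[of _ "C\<^sup>2 / m"]) (use C(1) m main in auto)
qed

text \<open>The constant polynomial serves inside and wherever $|s|^{-N}$ is bounded; elsewhere the Faber polynomial has modulus at least $|s|^{-N}/2$ at \<open>z\<close>, whereas on the curve it is bounded.\<close>
lemma kernel_diag_lower:
 "\<exists>c>0. \<forall>N P z. orthonormal_basis (curve_inner \<gamma> \<rho>) N P \<longrightarrow> c * exp (2 * real N * green z) \<le> kernel_diag N P z"
proof -
 obtain F C0 where F0: "\<forall>N. degree (F N) \<le> N \<and> (\<forall>s. s \<noteq> 0 \<longrightarrow> cmod s \<le> 1 \<longrightarrow> cmod (poly (F N) (\<psi> s) - (1 / s) ^ N) \<le> C0)"
  using faber_polynomials by (elim exE)
 define C where "C = max C0 1"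
 have C: "C \<ge> 1" by (simp add: C_def)
 have F: "degree (F N) \<le> N" "s \<noteq> 0 \<Longrightarrow> cmod s \<le> 1 \<Longrightarrow> cmod (poly (F N) (\<psi> s) - (1 / s) ^ N) \<le> C" for N s
  using F0 by (auto simp: C_def intro: max.coboundedI1)
 obtain m M where M: "M > 0" and w: "\<forall>t\<in>{0..1}. m \<le> weight t \<and> weight t \<le> M" using weight_bounds by blast
 then have wM: "\<And>t. t \<in> {0..1} \<Longrightarrow> weight t \<le> M" by blast
 \<comment> \<open>The constant covers both cases below, in which $|s|^{-N}$ is compared with \<open>2 C\<close>.\<close>
 define c where "c = 1 / (4 * M * (1 + C)\<^sup>2)"
 have c: "c > 0" using M C by (simp add: c_def)
 have main: "c * exp (2 * real N * green z) \<le> kernel_diag N P z" if ob: "orthonormal_basis (curve_inner \<gamma> \<rho>) N P" for N P z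
 proof -
  let ?K = "kernel_diag N P z"
  have K0: "?K \<ge> 0" unfolding kernel_diag_def by (rule sum_nonneg) simp
  have "curve_norm2 1 \<le> M * 1\<^sup>2" by (rule curve_norm2_upper[OF wM]) auto
  then have "?K * curve_norm2 1 \<le> ?K * M" using K0 by (intro mult_left_mono) auto
  then have K1: "1 \<le> ?K * M" using kernel_diag_ge[OF ob, of 1 z] by simp
  show ?thesis
  proof (cases rule: exterior_cases[of z])
   case 1
   have "1 * 1 \<le> 4 * (1 + C)\<^sup>2" using C by (intro mult_mono one_le_power) auto
   then have "?K * M * 1 \<le> ?K * M * (4 * (1 + C)\<^sup>2)" using K0 M by (intro mult_left_mono) auto
   then have "1 \<le> ?K * (4 * M * (1 + C)\<^sup>2)" using K1 by (simp add: mult_ac)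
   then show ?thesis using green_eq(1)[OF 1] M C by (simp add: c_def pos_divide_le_eq)
  next
   case (2 s)
   define x where "x = (1 / cmod s) ^ N"
   have x: "exp (2 * real N * green z) = x\<^sup>2"
    unfolding x_def 2(3) exp_green[OF 2(1,2), symmetric] by (simp add: exp_double[symmetric] mult.assoc)
   have x0: "x \<ge> 0" by (simp add: x_def)
   have "x\<^sup>2 \<le> ?K * (4 * M * (1 + C)\<^sup>2)"
   proof (cases "2 * C \<le> x")
    case True
    have nF: "curve_norm2 (F N) \<le> M * (1 + C)\<^sup>2"
    proof (rule curve_norm2_upper[OF wM])
     fix t :: real assume "t \<in> {0..1}"
     have e: "\<eta> t \<noteq> 0" "cmod (\<eta> t) \<le> 1" using \<eta>_circle[of t] by auto
     have "cmod (poly (F N) (\<gamma> t) - (1 / \<eta> t) ^ N) \<le> C" using F(2)[OF e, of N] \<psi>_\<eta> by simp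
     moreover have "cmod ((1 / \<eta> t) ^ N) = 1" by (simp add: norm_power norm_divide \<eta>_circle)
     moreover have "cmod (poly (F N) (\<gamma> t)) \<le> cmod (poly (F N) (\<gamma> t) - (1 / \<eta> t) ^ N) + cmod ((1 / \<eta> t) ^ N)"
      using norm_triangle_ineq[of "poly (F N) (\<gamma> t) - (1 / \<eta> t) ^ N" "(1 / \<eta> t) ^ N"] by simp
     ultimately show "cmod (poly (F N) (\<gamma> t)) \<le> 1 + C" by linarith
    qed auto
    have "x \<le> cmod (poly (F N) z) + C"
    proof -
     have "cmod ((1 / s) ^ N) = x" by (simp add: x_def norm_power norm_divide)
     moreover have "cmod ((1 / s) ^ N) \<le> cmod (poly (F N) z) + cmod (poly (F N) z - (1 / s) ^ N)"
      using norm_triangle_sub[of "(1 / s) ^ N" "poly (F N) z"] by (simp add: norm_minus_commute)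
     ultimately show ?thesis using F(2)[OF 2(1,2), of N] 2(3) by simp
    qed
    then have "x / 2 \<le> cmod (poly (F N) z)" using True by simp
    then have "(x / 2)\<^sup>2 \<le> (cmod (poly (F N) z))\<^sup>2" using x0 by (intro power_mono) auto
    also have "\<dots> \<le> ?K * curve_norm2 (F N)" by (rule kernel_diag_ge[OF ob F(1)])
    also have "\<dots> \<le> ?K * (M * (1 + C)\<^sup>2)" using nF K0 by (intro mult_left_mono)
    finally show ?thesis by (simp add: power_divide mult_ac)
   next
    case False
    then have "x\<^sup>2 \<le> (2 * C)\<^sup>2" using x0 by (intro power_mono) auto
    also have "\<dots> \<le> 4 * (1 + C)\<^sup>2" using C by (simp add: power2_eq_square algebra_simps)
    also have "\<dots> \<le> (?K * M) * (4 * (1 + C)\<^sup>2)" using mult_right_mono[OF K1, of "4 * (1 + C)\<^sup>2"] by simp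
    finally show ?thesis by (simp add: mult_ac)
   qed
   then show ?thesis unfolding x using M C by (simp add: c_def pos_divide_le_eq)
  qed
 qed
 show ?thesis by (rule exI[of _ c]) (use c main in blast)
qed

end

section \<open>Comparison of the kernel with the Green function\<close>

context weighted_curve
begin

text \<open>An integrable substitute for a power of the distance to the curve: it dominates the logarithm of the distance, and Fubini's theorem integrates it over the plane.\<close>
definition curve_potential :: "complex \<Rightarrow> ennreal" where
 "curve_potential z = (\<integral>\<^sup>+t. ennreal (cmod (z - \<gamma> t) powr (-3/2)) \<partial>unit_measure)"

lemma measurable_\<gamma> [measurable]: "\<gamma> \<in> borel_measurable unit_measure"
 by (rule measurable_restrict_space1) (use borel_measurable_continuous_onI[OF \<gamma>_cont] in simp)

lemma \<gamma>_lipschitz: "\<exists>L\<ge>1. \<forall>s\<in>{0..1}. \<forall>t\<in>{0..1}. cmod (\<gamma> s - \<gamma> t) \<le> L * \<bar>s - t\<bar>"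
proof -
 obtain L where L: "\<And>t. t \<in> {0..1} \<Longrightarrow> cmod (\<gamma>' t) \<le> L"
  using continuous_on_compact_bounded_norm[OF compact_Icc continuous_on_subset[OF \<gamma>'_cont subset_UNIV]] by metis
 have lip: "cmod (\<gamma> s - \<gamma> t) \<le> max L 1 * \<bar>s - t\<bar>" if "s \<in> {0..1}" "t \<in> {0..1}" for s t
 proof -
  have "norm (\<gamma> s - \<gamma> t) \<le> max L 1 * norm (s - t)"
  proof (rule differentiable_bound[of "{0..1}" \<gamma> "\<lambda>u h. h *\<^sub>R \<gamma>' u"])
   fix u :: real assume u: "u \<in> {0..1}"
   show "(\<gamma> has_derivative (\<lambda>h. h *\<^sub>R \<gamma>' u)) (at u within {0..1})"
    using \<gamma>_deriv[of u] unfolding has_vector_derivative_def by (rule has_derivative_at_withinI)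
   have "onorm (\<lambda>h::real. h *\<^sub>R \<gamma>' u) \<le> cmod (\<gamma>' u)"
    by (rule onorm_bound) (auto simp: mult.commute)
   then show "onorm (\<lambda>h::real. h *\<^sub>R \<gamma>' u) \<le> max L 1" using L[OF u] by linarith
  qed (use that in auto)
  then show ?thesis by simp
 qed
 show ?thesis by (rule exI[of _ "max L 1"]) (use lip in auto)
qed

text \<open>Around the point of the curve nearest to \<open>z\<close>, at distance \<open>d\<close>, a parameter interval of length \<open>d\<close> stays within $(1+L) d$ of \<open>z\<close>. It contributes at least a multiple of $d \cdot d^{-3/2} = d^{-1/2}$ to the potential, which exceeds the logarithm.\<close>
lemma ln_distance_le_curve_potential:
 "\<exists>A>0. \<forall>z d t0. t0 \<in> {0..1} \<longrightarrow> cmod (\<gamma> t0 - z) = d \<longrightarrow> d > 0 \<longrightarrow> (\<forall>t\<in>{0..1}. d \<le> cmod (\<gamma> t - z)) \<longrightarrow>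
   ennreal (ln (1 / d)) \<le> 1 + ennreal A * curve_potential z"
proof -
 obtain L where L: "L \<ge> 1" "\<forall>s\<in>{0..1}. \<forall>t\<in>{0..1}. cmod (\<gamma> s - \<gamma> t) \<le> L * \<bar>s - t\<bar>" using \<gamma>_lipschitz by blast
 define A where "A = 2 * (1 + L) powr (3/2)"
 have A: "A > 0" using L(1) by (simp add: A_def)
 have main: "ennreal (ln (1 / d)) \<le> 1 + ennreal A * curve_potential z"
  if t0: "t0 \<in> {0..1}" and d0: "cmod (\<gamma> t0 - z) = d" and d: "d > 0" and dm: "\<forall>t\<in>{0..1}. d \<le> cmod (\<gamma> t - z)" for z d t0
 proof (cases "d \<le> 1/2")
  case False
  have "ln (1 / d) \<le> 1 / d - 1" by (rule ln_le_minus_one) (use d in simp)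
  also have "\<dots> \<le> 1" using False by (simp add: pos_divide_le_eq)
  finally have "ennreal (ln (1 / d)) \<le> ennreal 1" by (rule ennreal_leI)
  then show ?thesis by (simp add: add_increasing2)
 next
  case True
  define J where "J = (if t0 \<le> 1/2 then {t0..t0 + d} else {t0 - d..t0})"
  have J: "J \<subseteq> {0..1}" "J \<in> sets lborel" "emeasure lborel J = ennreal d" "\<And>t. t \<in> J \<Longrightarrow> \<bar>t - t0\<bar> \<le> d"
   using t0 True d by (auto simp: J_def split: if_splits)
  let ?c = "((1 + L) * d) powr (-3/2)"
  have pt: "indicator J t * ennreal ?c \<le> ennreal (cmod (z - \<gamma> t) powr (-3/2))" for t
  proof (cases "t \<in> J")
   case tJ: True
   have "cmod (z - \<gamma> t) \<le> cmod (z - \<gamma> t0) + cmod (\<gamma> t0 - \<gamma> t)"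
    using norm_triangle_ineq[of "z - \<gamma> t0" "\<gamma> t0 - \<gamma> t"] by simp
   also have "\<dots> \<le> d + L * \<bar>t0 - t\<bar>" using L(2) t0 tJ J(1) d0 by (intro add_mono) (auto simp: norm_minus_commute)
   also have "L * \<bar>t0 - t\<bar> \<le> L * d" using J(4)[OF tJ] L(1) by (intro mult_left_mono) auto
   finally have "cmod (z - \<gamma> t) \<le> (1 + L) * d" by (simp add: algebra_simps)
   moreover have "d \<le> cmod (\<gamma> t - z)" using dm J(1) tJ by blast
   then have "0 < cmod (z - \<gamma> t)" using d by (simp only: norm_minus_commute less_le_trans)
   ultimately have "?c \<le> cmod (z - \<gamma> t) powr (-3/2)" by (intro powr_mono2') auto
   then show ?thesis using tJ by (simp add: ennreal_leI)
  qed simp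
  have "ennreal (ln (1 / d)) \<le> ennreal (A * (d * ?c))"
  proof (rule ennreal_leI)
   have "ln (1 / d) = 2 * ln (d powr (-1/2))" using d by (simp add: ln_powr ln_div)
   also have "\<dots> \<le> 2 * d powr (-1/2)" using ln_le_minus_one[of "d powr (-1/2)"] d by simp
   also have "\<dots> = A * (d * ?c)"
   proof -
    have "?c = (1 + L) powr (-3/2) * d powr (-3/2)" using L(1) d by (simp add: powr_mult)
    moreover have e1: "d * d powr (-3/2) = d powr (-1/2)"
     using d powr_add[of d 1 "-3/2"] by simp
    moreover have e2: "(1 + L) powr (3/2) * (1 + L) powr (-3/2) = 1"
     using L(1) powr_add[of "1 + L" "3/2" "-3/2"] by simp
    ultimately have "A * (d * ?c) = 2 * ((1 + L) powr (3/2) * (1 + L) powr (-3/2)) * (d * d powr (-3/2))"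
     by (simp only: A_def mult_ac)
    then show ?thesis unfolding e1 e2 by (simp only: mult_1_right)
   qed
   finally show "ln (1 / d) \<le> A * (d * ?c)" .
  qed
  also have "\<dots> = ennreal A * (ennreal ?c * ennreal d)"
   using A d L(1) by (simp add: ennreal_mult[symmetric] mult_ac)
  also have "ennreal ?c * ennreal d = (\<integral>\<^sup>+t. ennreal ?c * indicator J t \<partial>unit_measure)"
  proof -
   have "emeasure unit_measure J = ennreal d"
    using J by (subst emeasure_restrict_space) auto
   moreover have "J \<in> sets unit_measure" using J by (subst sets_restrict_space_iff) auto
   ultimately show ?thesis by (simp add: nn_integral_cmult_indicator)
  qed
  also have "\<dots> \<le> curve_potential z" unfolding curve_potential_def
   by (rule nn_integral_mono) (use pt in \<open>simp add: mult.commute\<close>)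
  finally have "ennreal (ln (1 / d)) \<le> ennreal A * curve_potential z" by (auto simp: mult_left_mono)
  then show ?thesis by (simp add: add_increasing)
 qed
 show ?thesis by (rule exI[of _ A]) (use A main in blast)
qed

lemma curve_potential_integrable:
 "\<exists>B. (\<integral>\<^sup>+z. indicator (cball 0 r) z * curve_potential z \<partial>lborel) \<le> ennreal B"
proof -
 interpret U: prob_space unit_measure by (rule prob_space_unit_interval)
 interpret pr: pair_sigma_finite unit_measure "lborel :: complex measure" ..
 obtain G where G: "\<And>t. t \<in> {0..1} \<Longrightarrow> cmod (\<gamma> t) \<le> G"
  using continuous_on_compact_bounded_norm[OF compact_Icc continuous_on_subset[OF \<gamma>_cont subset_UNIV]] by metis
 obtain C where C: "\<forall>w. cmod w \<le> G \<longrightarrow>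
   (\<integral>\<^sup>+z. indicator (cball 0 r) z * ennreal (cmod (z - w) powr (-3/2)) \<partial>lborel) \<le> ennreal C"
  using nn_integral_cmod_diff_powr_uniform[of G r] by blast
 have "(\<integral>\<^sup>+z. indicator (cball 0 r) z * curve_potential z \<partial>lborel) =
  (\<integral>\<^sup>+z. (\<integral>\<^sup>+t. indicator (cball 0 r) z * ennreal (cmod (z - \<gamma> t) powr (-3/2)) \<partial>unit_measure) \<partial>lborel)"
  unfolding curve_potential_def by (intro nn_integral_cong nn_integral_cmult[symmetric]) measurable
 also have "\<dots> = (\<integral>\<^sup>+t. (\<integral>\<^sup>+z. indicator (cball 0 r) z * ennreal (cmod (z - \<gamma> t) powr (-3/2)) \<partial>lborel) \<partial>unit_measure)"
  by (rule pr.Fubini') measurable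
 also have "\<dots> \<le> (\<integral>\<^sup>+t. ennreal C \<partial>unit_measure)"
  by (rule nn_integral_mono) (use C G in auto)
 also have "\<dots> = ennreal C" using U.emeasure_space_1 by simp
 finally show ?thesis by blast
qed

lemma AE_not_on_curve: "AE z in lborel. z \<notin> \<gamma> ` {0..1}"
proof -
 have "negligible (\<gamma> ` {0..1})"
 proof (rule negligible_differentiable_image_lowdim)
  show "\<gamma> differentiable_on {0..1}" unfolding differentiable_on_def
   using differentiableI_vector[OF has_vector_derivative_at_within[OF \<gamma>_deriv]] by blast
 qed simp
 then have "\<gamma> ` {0..1} \<in> null_sets lebesgue" by (simp add: negligible_iff_null_sets)
 moreover have "compact (\<gamma> ` {0..1})"
  by (intro compact_continuous_image continuous_on_subset[OF \<gamma>_cont]) auto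
 then have "\<gamma> ` {0..1} \<in> sets lborel" by (simp add: borel_compact)
 ultimately have "\<gamma> ` {0..1} \<in> null_sets lborel" by (simp add: null_sets_def emeasure_completion)
 then show ?thesis by (rule AE_not_in)
qed

end

context exterior_curve
begin

text \<open>The upper bound for the kernel exceeds the lower bound only by a constant multiple of the inverse square of the distance to the curve, and the logarithm of the distance is integrable near the curve.\<close>
lemma kernel_diag_green_L1:
 "\<exists>B\<ge>0. \<forall>N P. orthonormal_basis (curve_inner \<gamma> \<rho>) N P \<longrightarrow>
   (\<integral>\<^sup>+z. indicator (cball 0 r) z * ennreal \<bar>ln (kernel_diag N P z) - 2 * real N * green z\<bar> \<partial>lborel) \<le> ennreal B"
proof -
 obtain c where c: "c > 0" "\<forall>N P z. orthonormal_basis (curve_inner \<gamma> \<rho>) N P \<longrightarrow> c * exp (2 * real N * green z) \<le> kernel_diag N P z"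
  using kernel_diag_lower by blast
 obtain C where C: "C > 0" "\<forall>N P z d. orthonormal_basis (curve_inner \<gamma> \<rho>) N P \<longrightarrow> cmod z \<le> r \<longrightarrow> d > 0 \<longrightarrow> (\<forall>t\<in>{0..1}. d \<le> cmod (\<gamma> t - z)) \<longrightarrow>
   kernel_diag N P z \<le> C / d\<^sup>2 * exp (2 * real N * green z)"
  using kernel_diag_upper[of r] by (elim exE conjE)
 obtain A where A: "A > 0" "\<forall>z d t0. t0 \<in> {0..1} \<longrightarrow> cmod (\<gamma> t0 - z) = d \<longrightarrow> d > 0 \<longrightarrow> (\<forall>t\<in>{0..1}. d \<le> cmod (\<gamma> t - z)) \<longrightarrow>
   ennreal (ln (1 / d)) \<le> 1 + ennreal A * curve_potential z"
  using ln_distance_le_curve_potential by (elim exE conjE)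
 obtain B where B: "(\<integral>\<^sup>+z. indicator (cball 0 r) z * curve_potential z \<partial>lborel) \<le> ennreal B"
  using curve_potential_integrable by blast
 define B' where "B' = max B 0"
 have B': "B' \<ge> 0" "ennreal B \<le> ennreal B'" by (auto simp: B'_def intro: ennreal_leI)
 define D where "D = \<bar>ln C\<bar> + \<bar>ln c\<bar> + 2"
 have D: "D \<ge> 0" by (simp add: D_def)
 define V where "V = measure lborel (cball (0::complex) r)"
 have V: "emeasure lborel (cball (0::complex) r) = ennreal V"
  unfolding V_def by (rule emeasure_eq_ennreal_measure) (use emeasure_lborel_cball_finite[of "0::complex" r] in auto)
 have V0: "V \<ge> 0" by (simp add: V_def)
 have bound: "ennreal \<bar>ln (kernel_diag N P z) - 2 * real N * green z\<bar> \<le> ennreal D + ennreal (2 * A) * curve_potential z"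
  if ob: "orthonormal_basis (curve_inner \<gamma> \<rho>) N P" and z: "cmod z \<le> r" "z \<notin> \<gamma> ` {0..1}" for N P z
 proof -
  have "continuous_on {0..1} (\<lambda>t. cmod (\<gamma> t - z))" by (intro continuous_intros continuous_on_subset[OF \<gamma>_cont]) auto
  then obtain t0 where t0: "t0 \<in> {0..1}" "\<forall>t\<in>{0..1}. cmod (\<gamma> t0 - z) \<le> cmod (\<gamma> t - z)"
   using continuous_attains_inf[OF compact_Icc, of 0 1 "\<lambda>t. cmod (\<gamma> t - z)"] by auto
  define d where "d = cmod (\<gamma> t0 - z)"
  have d: "d > 0" using z(2) t0(1) by (auto simp: d_def)
  have dm: "\<forall>t\<in>{0..1}. d \<le> cmod (\<gamma> t - z)" using t0(2) by (simp add: d_def)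
  let ?K = "kernel_diag N P z" and ?e = "2 * real N * green z"
  have lo: "c * exp ?e \<le> ?K" using c(2) ob by blast
  have cpos: "c * exp ?e > 0" using c(1) by simp
  have Kpos: "?K > 0" using less_le_trans[OF cpos lo] .
  have "ln (c * exp ?e) \<le> ln ?K" using lo cpos Kpos by (subst ln_le_cancel_iff) auto
  then have l1: "ln c + ?e \<le> ln ?K" using c(1) by (simp add: ln_mult)
  have up: "?K \<le> C / d\<^sup>2 * exp ?e" using C(2) ob z(1) d dm by blast
  then have "ln ?K \<le> ln (C / d\<^sup>2 * exp ?e)" using Kpos by (subst ln_le_cancel_iff) auto
  also have "\<dots> = ln C + 2 * ln (1 / d) + ?e" using C(1) d by (simp add: ln_mult ln_div ln_realpow)
  finally have l2: "ln ?K \<le> ln C + 2 * ln (1 / d) + ?e" .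
  have "\<bar>ln ?K - ?e\<bar> \<le> \<bar>ln C\<bar> + \<bar>ln c\<bar> + 2 * max 0 (ln (1 / d))"
   using l1 l2 by (auto simp: abs_if max_def)
  then have "ennreal \<bar>ln ?K - ?e\<bar> \<le> ennreal (\<bar>ln C\<bar> + \<bar>ln c\<bar> + 2 * max 0 (ln (1 / d)))" by (rule ennreal_leI)
  also have "\<dots> = ennreal (\<bar>ln C\<bar> + \<bar>ln c\<bar>) + ennreal (2 * max 0 (ln (1 / d)))"
   by (rule ennreal_plus) auto
  also have "ennreal (2 * max 0 (ln (1 / d))) = ennreal 2 * ennreal (max 0 (ln (1 / d)))"
   by (rule ennreal_mult) auto
  also have "ennreal (max 0 (ln (1 / d))) = ennreal (ln (1 / d))" by (simp add: max_def ennreal_neg)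
  also have "ennreal 2 * ennreal (ln (1 / d)) \<le> ennreal 2 * (1 + ennreal A * curve_potential z)"
   using A(2) t0(1) d_def d dm by (intro mult_left_mono) auto
  also have "ennreal (\<bar>ln C\<bar> + \<bar>ln c\<bar>) + ennreal 2 * (1 + ennreal A * curve_potential z) = ennreal D + ennreal (2 * A) * curve_potential z"
  proof -
   have "ennreal D = ennreal (\<bar>ln C\<bar> + \<bar>ln c\<bar>) + ennreal 2" unfolding D_def by (rule ennreal_plus) auto
   moreover have "ennreal (2 * A) = ennreal 2 * ennreal A" using A(1) by (intro ennreal_mult) auto
   ultimately show ?thesis by (simp add: distrib_left mult.assoc add.assoc)
  qed
  finally show ?thesis by (simp add: add_left_mono)
 qed
 have pot_meas: "(\<lambda>z. indicator (cball 0 r) z * curve_potential z) \<in> borel_measurable lborel"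
 proof -
  interpret U: prob_space unit_measure by (rule prob_space_unit_interval)
  have "curve_potential \<in> borel_measurable borel"
   unfolding curve_potential_def[abs_def] by measurable
  then show ?thesis by simp
 qed
 have main: "(\<integral>\<^sup>+z. indicator (cball 0 r) z * ennreal \<bar>ln (kernel_diag N P z) - 2 * real N * green z\<bar> \<partial>lborel) \<le> ennreal (D * V + 2 * A * B')"
  if ob: "orthonormal_basis (curve_inner \<gamma> \<rho>) N P" for N P
 proof -
  have "(\<integral>\<^sup>+z. indicator (cball 0 r) z * ennreal \<bar>ln (kernel_diag N P z) - 2 * real N * green z\<bar> \<partial>lborel)
   \<le> (\<integral>\<^sup>+z. ennreal D * indicator (cball 0 r) z + ennreal (2 * A) * (indicator (cball 0 r) z * curve_potential z) \<partial>lborel)"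
  proof (rule nn_integral_mono_AE, use AE_not_on_curve in eventually_elim)
   case (elim z)
   then show ?case using bound[OF ob, of z] by (cases "cmod z \<le> r") (auto simp: indicator_def)
  qed
  also have "\<dots> = ennreal D * ennreal V + ennreal (2 * A) * (\<integral>\<^sup>+z. indicator (cball 0 r) z * curve_potential z \<partial>lborel)"
   using pot_meas by (subst nn_integral_add) (auto simp: nn_integral_cmult V nn_integral_cmult_indicator)
  also have "\<dots> \<le> ennreal D * ennreal V + ennreal (2 * A) * ennreal (B')"
   by (intro add_left_mono mult_left_mono order_trans[OF B B'(2)]) auto
  also have "\<dots> = ennreal (D * V + 2 * A * B')"
   using D V0 A(1) B'(1) by (simp add: ennreal_mult)
  finally show ?thesis .
 qed
 show ?thesis by (rule exI[of _ "D * V + 2 * A * B'"]) (use D V0 A(1) B'(1) main in auto)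
qed

end

context exterior_uniformization
begin

text \<open>The Green function is an average of fundamental solutions with poles distributed by the boundary measure; Fubini's theorem and \<open>green_representation\<close> give its Laplacian. The additive constant disappears, since Laplacians have integral 0.\<close>
lemma green_laplacian:
 assumes sm: "\<forall>k. cont_diff k \<phi>" and 0: "\<And>z. cmod z > r \<Longrightarrow> \<phi> z = 0"
 shows "integrable lborel (\<lambda>z. green z *\<^sub>R laplacian \<phi> z)"
  and "2 *\<^sub>R (\<integral>z. green z *\<^sub>R laplacian \<phi> z \<partial>lborel) = green_const *\<^sub>R (\<integral>z. \<phi> z \<partial>boundary_measure)"
proof -
 let ?U = unit_measure and ?L = "laplacian \<phi>"
 define \<Gamma> where "\<Gamma> t = \<psi> (cis (2 * pi * t))" for t
 interpret U: prob_space ?U by (rule prob_space_unit_interval)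
 interpret pr: pair_sigma_finite ?U "lborel :: complex measure" ..
 have [measurable]: "\<Gamma> \<in> borel_measurable ?U" unfolding \<Gamma>_def by measurable
 have cL: "continuous_on UNIV ?L" by (rule continuous_laplacian[OF sm])
 have [measurable]: "?L \<in> borel_measurable borel" using cL by (rule borel_measurable_continuous_onI)
 have L0: "?L z = 0" if "cmod z > r" for z using laplacian_zero_outside[of r \<phi> z] 0 that by blast
 have Li: "integrable lborel ?L" by (rule integrable_continuous_bounded_support[OF cL L0])
 obtain M where M: "\<And>z. z \<in> cball 0 r \<Longrightarrow> cmod (?L z) \<le> M"
  using continuous_on_compact_bounded_norm[OF compact_cball continuous_on_subset[OF cL subset_UNIV]] by metis
 obtain G where G: "\<And>t. t \<in> {0..1} \<Longrightarrow> cmod (\<Gamma> t) \<le> G"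
  using continuous_on_compact_bounded_norm[OF compact_Icc continuous_on_subset[OF continuous_boundary_map subset_UNIV]] unfolding \<Gamma>_def by metis
 obtain C where C: "\<forall>w. cmod w \<le> G \<longrightarrow> (\<integral>\<^sup>+z. indicator (cball 0 r) z * ennreal (cmod (z - w) powr (-3/2)) \<partial>lborel) \<le> ennreal C"
  using nn_integral_cmod_diff_powr_uniform[of G r] by blast
 define f where "f t z = ln ((cmod (z - \<Gamma> t))\<^sup>2) *\<^sub>R ?L z" for t z
 have [measurable]: "(\<lambda>(t, z). f t z) \<in> borel_measurable (?U \<Otimes>\<^sub>M lborel)" unfolding f_def by measurable
 define V where "V = emeasure lborel (cball (0::complex) r)"
 have V: "V < \<infinity>" unfolding V_def by (rule emeasure_lborel_cball_finite)
 define E where "E = ennreal (2 * \<bar>M\<bar> * (\<bar>r\<bar> + \<bar>G\<bar>)) * V + ennreal (2 * \<bar>M\<bar>) * ennreal C"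
 have E: "E < \<infinity>" unfolding E_def using V by (simp add: ennreal_mult_less_top)
 have inner: "(\<integral>\<^sup>+z. ennreal (cmod (f t z)) \<partial>lborel) \<le> E" if t: "t \<in> {0..1}" for t
 proof -
  have "ennreal (cmod (f t z)) \<le> ennreal (2 * \<bar>M\<bar> * (\<bar>r\<bar> + \<bar>G\<bar>)) * indicator (cball 0 r) z +
    ennreal (2 * \<bar>M\<bar>) * (indicator (cball 0 r) z * ennreal (cmod (z - \<Gamma> t) powr (-3/2)))" for z
  proof (cases "cmod z \<le> r")
   case True
   have x: "cmod (z - \<Gamma> t) \<le> \<bar>r\<bar> + \<bar>G\<bar>" using norm_triangle_ineq4[of z "\<Gamma> t"] True G[OF t] by linarith
   have ln: "\<bar>ln ((cmod (z - \<Gamma> t))\<^sup>2)\<bar> \<le> 2 * ((\<bar>r\<bar> + \<bar>G\<bar>) + cmod (z - \<Gamma> t) powr (-3/2))"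
   proof (cases "z = \<Gamma> t")
    case False
    then have p: "cmod (z - \<Gamma> t) > 0" by simp
    then have "ln ((cmod (z - \<Gamma> t))\<^sup>2) = 2 * ln (cmod (z - \<Gamma> t))" by (simp add: ln_realpow)
    then show ?thesis using abs_ln_le_powr[OF p] x by (simp add: abs_mult)
   qed simp
   have "cmod (f t z) \<le> (2 * ((\<bar>r\<bar> + \<bar>G\<bar>) + cmod (z - \<Gamma> t) powr (-3/2))) * \<bar>M\<bar>"
    unfolding f_def norm_scaleR using ln M[of z] True by (intro mult_mono) auto
   also have "\<dots> = 2 * \<bar>M\<bar> * (\<bar>r\<bar> + \<bar>G\<bar>) + 2 * \<bar>M\<bar> * cmod (z - \<Gamma> t) powr (-3/2)" by (simp add: algebra_simps)
   finally have "ennreal (cmod (f t z)) \<le> ennreal (2 * \<bar>M\<bar> * (\<bar>r\<bar> + \<bar>G\<bar>) + 2 * \<bar>M\<bar> * cmod (z - \<Gamma> t) powr (-3/2))" by (rule ennreal_leI)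
   also have "\<dots> = ennreal (2 * \<bar>M\<bar> * (\<bar>r\<bar> + \<bar>G\<bar>)) + ennreal (2 * \<bar>M\<bar>) * ennreal (cmod (z - \<Gamma> t) powr (-3/2))"
    by (subst ennreal_plus) (auto simp: ennreal_mult)
   finally show ?thesis using True by simp
  next
   case False
   then have "f t z = 0" using L0 by (simp add: f_def)
   then show ?thesis by simp
  qed
  then have "(\<integral>\<^sup>+z. ennreal (cmod (f t z)) \<partial>lborel) \<le> (\<integral>\<^sup>+z. ennreal (2 * \<bar>M\<bar> * (\<bar>r\<bar> + \<bar>G\<bar>)) * indicator (cball 0 r) z +
    ennreal (2 * \<bar>M\<bar>) * (indicator (cball 0 r) z * ennreal (cmod (z - \<Gamma> t) powr (-3/2))) \<partial>lborel)"
   by (intro nn_integral_mono)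
  also have "\<dots> = ennreal (2 * \<bar>M\<bar> * (\<bar>r\<bar> + \<bar>G\<bar>)) * V + ennreal (2 * \<bar>M\<bar>) * (\<integral>\<^sup>+z. indicator (cball 0 r) z * ennreal (cmod (z - \<Gamma> t) powr (-3/2)) \<partial>lborel)"
   unfolding V_def by (subst nn_integral_add) (auto simp: nn_integral_cmult nn_integral_cmult_indicator)
  also have "\<dots> \<le> E" unfolding E_def using C G[OF t] by (intro add_left_mono mult_left_mono) auto
  finally show ?thesis .
 qed
 have fi: "integrable (?U \<Otimes>\<^sub>M lborel) (case_prod f)"
 proof (rule integrableI_bounded)
  have "(\<integral>\<^sup>+p. ennreal (norm (case_prod f p)) \<partial>(?U \<Otimes>\<^sub>M lborel)) = (\<integral>\<^sup>+t. (\<integral>\<^sup>+z. ennreal (cmod (f t z)) \<partial>lborel) \<partial>?U)"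
   by (subst lborel.nn_integral_fst[symmetric]) auto
  also have "\<dots> \<le> (\<integral>\<^sup>+t. E \<partial>?U)" by (rule nn_integral_mono) (use inner in auto)
  also have "\<dots> = E" using U.emeasure_space_1 by simp
  finally show "(\<integral>\<^sup>+p. ennreal (norm (case_prod f p)) \<partial>(?U \<Otimes>\<^sub>M lborel)) < \<infinity>" using E by (rule le_less_trans)
 qed measurable
 have pot: "(\<integral>t. f t z \<partial>?U) = (2 * (green z + ln (cmod (H 0)))) *\<^sub>R ?L z" for z
 proof -
  have i: "integrable ?U (\<lambda>t. ln (cmod (\<Gamma> t - z)))"
   unfolding \<Gamma>_def by (cases rule: exterior_cases[of z]) (use potential_interior(1) potential_exterior(1) in auto)
  have e: "f t z = (2 * ln (cmod (\<Gamma> t - z))) *\<^sub>R ?L z" for t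
   by (cases "z = \<Gamma> t") (simp_all add: f_def norm_minus_commute ln_realpow)
  have "(\<integral>t. f t z \<partial>?U) = (\<integral>t. 2 * ln (cmod (\<Gamma> t - z)) \<partial>?U) *\<^sub>R ?L z"
   unfolding e using i by (intro integral_scaleR_left) simp
  then show ?thesis by (simp add: green_def \<Gamma>_def)
 qed
 have "integrable lborel (\<lambda>z. (2 * (green z + ln (cmod (H 0)))) *\<^sub>R ?L z)"
  using pr.integrable_snd[OF fi] unfolding pot .
 then have "integrable lborel (\<lambda>z. (1/2) *\<^sub>R ((2 * (green z + ln (cmod (H 0)))) *\<^sub>R ?L z) - ln (cmod (H 0)) *\<^sub>R ?L z)"
  using Li by (intro Bochner_Integration.integrable_diff integrable_scaleR_right)
 then show gi: "integrable lborel (\<lambda>z. green z *\<^sub>R ?L z)" by (simp add: algebra_simps)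
 have "(\<integral>z. (2 * (green z + ln (cmod (H 0)))) *\<^sub>R ?L z \<partial>lborel) = (\<integral>t. (\<integral>z. f t z \<partial>lborel) \<partial>?U)"
  unfolding pot[symmetric] by (rule pr.Fubini_integral[OF fi])
 also have "\<dots> = (\<integral>t. green_const *\<^sub>R \<phi> (\<Gamma> t) \<partial>?U)"
  unfolding f_def using green_representation[OF sm 0] by (intro Bochner_Integration.integral_cong refl) blast
 also have "\<dots> = green_const *\<^sub>R (\<integral>t. \<phi> (\<Gamma> t) \<partial>?U)" by simp
 also have "(\<integral>t. \<phi> (\<Gamma> t) \<partial>?U) = (\<integral>z. \<phi> z \<partial>boundary_measure)"
  unfolding boundary_measure_def \<Gamma>_def
  by (rule integral_distr[symmetric]) (use borel_measurable_continuous_onI[OF smooth_imp_continuous[OF sm]] in auto)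
 finally have eq: "(\<integral>z. (2 * (green z + ln (cmod (H 0)))) *\<^sub>R ?L z \<partial>lborel) = green_const *\<^sub>R (\<integral>z. \<phi> z \<partial>boundary_measure)" .
 have "(\<integral>z. (2 * (green z + ln (cmod (H 0)))) *\<^sub>R ?L z \<partial>lborel) = (\<integral>z. 2 *\<^sub>R (green z *\<^sub>R ?L z) + (2 * ln (cmod (H 0))) *\<^sub>R ?L z \<partial>lborel)"
  by (rule Bochner_Integration.integral_cong) (auto simp: algebra_simps)
 also have "\<dots> = 2 *\<^sub>R (\<integral>z. green z *\<^sub>R ?L z \<partial>lborel) + (2 * ln (cmod (H 0))) *\<^sub>R (\<integral>z. ?L z \<partial>lborel)"
 proof -
  have i1: "integrable lborel (\<lambda>z. 2 *\<^sub>R (green z *\<^sub>R ?L z))" and i2: "integrable lborel (\<lambda>z. (2 * ln (cmod (H 0))) *\<^sub>R ?L z)"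
   by (intro integrable_scaleR_right gi Li)+
  show ?thesis unfolding Bochner_Integration.integral_add[OF i1 i2] by (simp only: integral_scaleR_right)
 qed
 also have "(\<integral>z. ?L z \<partial>lborel) = 0" by (rule integral_laplacian_eq_0[OF sm 0])
 finally show "2 *\<^sub>R (\<integral>z. green z *\<^sub>R ?L z \<partial>lborel) = green_const *\<^sub>R (\<integral>z. \<phi> z \<partial>boundary_measure)"
  unfolding eq by simp
qed

end

context exterior_curve
begin

text \<open>Replacing $\ln K_N$ by $2 N g$ in \<open>expected_zeros\<close> costs a bounded amount by \<open>kernel_diag_green_L1\<close>, and $2 N g$ pairs with the Laplacian of \<open>\<phi>\<close> to \<open>N\<close> times the integral over the boundary measure.\<close>
theorem expected_zeros_near_boundary_measure:
 assumes sm: "\<forall>k. cont_diff k \<phi>" and 0: "\<And>z. cmod z > r \<Longrightarrow> \<phi> z = 0"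
 shows "\<exists>C. \<forall>N P. N \<ge> 1 \<longrightarrow> orthonormal_basis (curve_inner \<gamma> \<rho>) N P \<longrightarrow>
  cmod ((\<integral>f. zero_distribution N f \<phi> \<partial>gaussian_poly N P) - (\<integral>z. \<phi> z \<partial>boundary_measure)) \<le> C / real N"
proof -
 let ?L = "laplacian \<phi>"
 have cL: "continuous_on UNIV ?L" by (rule continuous_laplacian[OF sm])
 have L0: "?L z = 0" if "cmod z > r" for z using laplacian_zero_outside[of r \<phi> z] 0 that by blast
 obtain M where M: "\<And>z. z \<in> cball 0 r \<Longrightarrow> cmod (?L z) \<le> M"
  using continuous_on_compact_bounded_norm[OF compact_cball continuous_on_subset[OF cL subset_UNIV]] by metis
 obtain B where B: "B \<ge> 0" "\<forall>N P. orthonormal_basis (curve_inner \<gamma> \<rho>) N P \<longrightarrow>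
   (\<integral>\<^sup>+z. indicator (cball 0 r) z * ennreal \<bar>ln (kernel_diag N P z) - 2 * real N * green z\<bar> \<partial>lborel) \<le> ennreal B"
  using kernel_diag_green_L1[of r] by (elim exE conjE)
 obtain c where c: "c > 0" "\<forall>N P z. orthonormal_basis (curve_inner \<gamma> \<rho>) N P \<longrightarrow> c * exp (2 * real N * green z) \<le> kernel_diag N P z"
  using kernel_diag_lower by blast
 define A where "A = 2 * enn2real log_gauss_const * (\<integral>z. cmod (?L z) \<partial>lborel)"
 have main: "cmod ((\<integral>f. zero_distribution N f \<phi> \<partial>gaussian_poly N P) - (\<integral>z. \<phi> z \<partial>boundary_measure)) \<le> ((A + \<bar>M\<bar> * B) / green_const) / real N"
  if N: "N \<ge> 1" and ob: "orthonormal_basis (curve_inner \<gamma> \<rho>) N P" for N P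
 proof -
  let ?K = "kernel_diag N P"
  let ?X = "\<integral>f. zero_distribution N f \<phi> \<partial>gaussian_poly N P" and ?Y = "\<integral>z. \<phi> z \<partial>boundary_measure"
  have pos: "?K z > 0" for z
  proof -
   have "0 < c * exp (2 * real N * green z)" using c(1) by simp
   also have "\<dots> \<le> ?K z" using c(2) ob by blast
   finally show ?thesis .
  qed
  have "P 0 \<noteq> 0"
  proof
   assume "P 0 = 0"
   then have "curve_inner \<gamma> \<rho> (P 0) (P 0) = 0" by (simp add: curve_inner_def)
   then show False using ob unfolding orthonormal_basis_def by auto
  qed
  then have 1: "cmod ((green_const * real N) *\<^sub>R ?X - (\<integral>z. ln (?K z) *\<^sub>R ?L z \<partial>lborel)) \<le> A"
   unfolding A_def using ob by (intro expected_zeros[OF sm 0 N _ pos]) (auto simp: orthonormal_basis_def)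
  have Ki: "integrable lborel (\<lambda>z. ln (?K z) *\<^sub>R ?L z)"
  proof (rule integrable_continuous_bounded_support)
   show "continuous_on UNIV (\<lambda>z. ln (?K z) *\<^sub>R ?L z)"
    by (intro continuous_intros continuous_kernel_diag cL) (use pos in \<open>auto simp: less_le\<close>)
   show "ln (?K z) *\<^sub>R ?L z = 0" if "cmod z > r" for z using L0[OF that] by simp
  qed
  have gi: "integrable lborel (\<lambda>z. green z *\<^sub>R ?L z)" by (rule green_laplacian(1)[OF sm 0])
  have gI: "2 *\<^sub>R (\<integral>z. green z *\<^sub>R ?L z \<partial>lborel) = green_const *\<^sub>R ?Y" by (rule green_laplacian(2)[OF sm 0])
  have gi': "integrable lborel (\<lambda>z. (2 * real N) *\<^sub>R (green z *\<^sub>R ?L z))" by (intro integrable_scaleR_right gi)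
  let ?D = "\<lambda>z. ln (?K z) *\<^sub>R ?L z - (2 * real N) *\<^sub>R (green z *\<^sub>R ?L z)"
  have Di: "integrable lborel ?D" by (rule Bochner_Integration.integrable_diff[OF Ki gi'])
  have DI: "(\<integral>z. ?D z \<partial>lborel) = (\<integral>z. ln (?K z) *\<^sub>R ?L z \<partial>lborel) - (green_const * real N) *\<^sub>R ?Y"
  proof -
   have "(2 * real N) *\<^sub>R (\<integral>z. green z *\<^sub>R ?L z \<partial>lborel) = real N *\<^sub>R (2 *\<^sub>R (\<integral>z. green z *\<^sub>R ?L z \<partial>lborel))"
    by (simp only: scaleR_scaleR mult.commute)
   also have "\<dots> = (green_const * real N) *\<^sub>R ?Y" unfolding gI by (simp only: scaleR_scaleR mult.commute)
   finally show ?thesis unfolding Bochner_Integration.integral_diff[OF Ki gi'] by (simp only: integral_scaleR_right)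
  qed
  have "ennreal (cmod (\<integral>z. ?D z \<partial>lborel)) \<le> (\<integral>\<^sup>+z. ennreal (cmod (?D z)) \<partial>lborel)"
   by (rule integral_norm_bound_ennreal[OF Di])
  also have "\<dots> \<le> (\<integral>\<^sup>+z. ennreal \<bar>M\<bar> * (indicator (cball 0 r) z * ennreal \<bar>ln (?K z) - 2 * real N * green z\<bar>) \<partial>lborel)"
  proof (rule nn_integral_mono)
   fix z
   have Dz: "?D z = (ln (?K z) - 2 * real N * green z) *\<^sub>R ?L z" by (simp add: scaleR_left_diff_distrib)
   show "ennreal (cmod (?D z)) \<le> ennreal \<bar>M\<bar> * (indicator (cball 0 r) z * ennreal \<bar>ln (?K z) - 2 * real N * green z\<bar>)"
   proof (cases "cmod z \<le> r")
    case True
    have "cmod (?D z) \<le> \<bar>M\<bar> * \<bar>ln (?K z) - 2 * real N * green z\<bar>"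
     unfolding Dz norm_scaleR using M[of z] True by (subst mult.commute) (intro mult_right_mono, auto)
    then show ?thesis using True by (simp add: ennreal_mult[symmetric] ennreal_leI)
   next
    case False
    then have "?L z = 0" using L0[of z] by simp
    then show ?thesis by simp
   qed
  qed
  also have "\<dots> = ennreal \<bar>M\<bar> * (\<integral>\<^sup>+z. indicator (cball 0 r) z * ennreal \<bar>ln (?K z) - 2 * real N * green z\<bar> \<partial>lborel)"
  proof (rule nn_integral_cmult)
   interpret U: prob_space unit_measure by (rule prob_space_unit_interval)
   have [measurable]: "green \<in> borel_measurable borel" unfolding green_def[abs_def] by measurable
   have [measurable]: "?K \<in> borel_measurable borel" by (rule borel_measurable_continuous_onI[OF continuous_kernel_diag])
   show "(\<lambda>z. indicator (cball 0 r) z * ennreal \<bar>ln (?K z) - 2 * real N * green z\<bar>) \<in> borel_measurable lborel" by measurable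
  qed
  also have "\<dots> \<le> ennreal \<bar>M\<bar> * ennreal B" using B(2) ob by (intro mult_left_mono) auto
  also have "\<dots> = ennreal (\<bar>M\<bar> * B)" using B(1) by (simp add: ennreal_mult)
  finally have 2: "cmod (\<integral>z. ?D z \<partial>lborel) \<le> \<bar>M\<bar> * B" using B(1) by (simp add: ennreal_le_iff)
  have "(green_const * real N) *\<^sub>R (?X - ?Y) = ((green_const * real N) *\<^sub>R ?X - (\<integral>z. ln (?K z) *\<^sub>R ?L z \<partial>lborel)) + (\<integral>z. ?D z \<partial>lborel)"
   unfolding DI by (simp add: scaleR_diff_right)
  then have "cmod ((green_const * real N) *\<^sub>R (?X - ?Y)) \<le> A + \<bar>M\<bar> * B"
   by (simp only:) (rule order_trans[OF norm_triangle_ineq add_mono[OF 1 2]])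
  then have "green_const * real N * cmod (?X - ?Y) \<le> A + \<bar>M\<bar> * B"
   using green_const_pos N by (simp add: abs_of_pos)
  then have "cmod (?X - ?Y) \<le> (A + \<bar>M\<bar> * B) / (green_const * real N)"
   using green_const_pos N by (simp add: pos_le_divide_eq mult.commute)
  then show ?thesis by (simp add: divide_divide_eq_left)
 qed
 show ?thesis by (rule exI[of _ "(A + \<bar>M\<bar> * B) / green_const"]) (use main in blast)
qed

end

section \<open>Convergence to the equilibrium measure\<close>

lemma continuous_real_analytic_periodic:
 fixes f :: "real \<Rightarrow> real"
 assumes an: "real_analytic f" and per: "\<And>t. f (t + 1) = f t"
 shows "continuous_on UNIV f"
proof -
 let ?g = "\<lambda>t. complex_of_real (f t)"
 have "real_analytic ?g"
  unfolding real_analytic_def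
 proof
  fix t
  obtain r c where rc: "r > 0" "\<forall>s. \<bar>s - t\<bar> < r \<longrightarrow> (\<lambda>n. ((s - t) ^ n) *\<^sub>R c n) sums f s"
   using an unfolding real_analytic_def by blast
  have "\<forall>s. \<bar>s - t\<bar> < r \<longrightarrow> (\<lambda>n. ((s - t) ^ n) *\<^sub>R complex_of_real (c n)) sums ?g s"
  proof (intro allI impI)
   fix s assume "\<bar>s - t\<bar> < r"
   then have "(\<lambda>n. complex_of_real (((s - t) ^ n) *\<^sub>R c n)) sums ?g s" using rc(2) by (intro sums_of_real) blast
   then show "(\<lambda>n. ((s - t) ^ n) *\<^sub>R complex_of_real (c n)) sums ?g s" by (simp add: scaleR_conv_of_real)
  qed
  then show "\<exists>r>0. \<exists>c. \<forall>s. \<bar>s - t\<bar> < r \<longrightarrow> (\<lambda>n. ((s - t) ^ n) *\<^sub>R c n) sums ?g s"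
   by (intro exI[of _ r] conjI rc(1) exI[of _ "\<lambda>n. complex_of_real (c n)"])
 qed
 moreover have "?g (t + 1) = ?g t" for t using per by simp
 ultimately obtain R G where R: "R > 1" and G: "G holomorphic_on annulus R" and Gf: "\<And>t. G (cis (2 * pi * t)) = ?g t"
  using real_analytic_periodic_annulus_extension[of ?g] by blast
 have c: "continuous_on UNIV (\<lambda>t. G (cis (2 * pi * t)))"
  by (rule continuous_on_compose2[OF holomorphic_on_imp_continuous_on[OF G]])
    (use R in \<open>auto simp: annulus_def intro!: continuous_intros\<close>)
 have "continuous_on UNIV (\<lambda>t. Re (G (cis (2 * pi * t))))" by (intro continuous_on_Re c)
 then show ?thesis unfolding Gf by simp
qed

theorem theorem1:
 fixes \<Omega> :: "complex set" and \<gamma> :: "real \<Rightarrow> complex" and \<rho> :: "complex \<Rightarrow> real"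
 assumes "open \<Omega>" and "connected \<Omega>" and "\<Omega> \<noteq> {}" and "bounded \<Omega>" and "simply_connected \<Omega>"
  and "analytic_jordan_curve \<gamma>" and "frontier \<Omega> = \<gamma> ` {0..1}"
  and "real_analytic (\<lambda>t. \<rho> (\<gamma> t))" and "\<forall>z\<in>frontier \<Omega>. \<rho> z > 0"
 shows "\<forall>\<phi>. test_function \<phi> \<longrightarrow>
  (\<exists>C::real. \<forall>N::nat. \<forall>P. N \<ge> 1 \<longrightarrow> orthonormal_basis (curve_inner \<gamma> \<rho>) N P \<longrightarrow>
   cmod ((\<integral>f. zero_distribution N f \<phi> \<partial>gaussian_poly N P) -
      (\<integral>z. \<phi> z \<partial>equilibrium_measure (closure \<Omega>))) \<le> C / real N)"
proof (intro allI impI)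
 fix \<phi> assume \<phi>: "test_function \<phi>"
 note \<Omega> = assms(1-4) and \<gamma> = assms(6) and fr = assms(7)
 note sp = analytic_jordan_curve_simple_path[OF \<gamma>]
 have frp: "frontier \<Omega> = path_image \<gamma>" using fr by (simp add: path_image_def)
 obtain \<gamma>' where \<gamma>': "continuous_on UNIV \<gamma>'" "\<forall>t. (\<gamma> has_vector_derivative \<gamma>' t) (at t)"
  using analytic_jordan_curve_C1[OF \<gamma>] by (elim exE conjE)
 have per: "\<gamma> (t + 1) = \<gamma> t" and reg: "vector_derivative \<gamma> (at t) \<noteq> 0" for t
  using \<gamma> by (auto simp: analytic_jordan_curve_def)
 have "\<gamma>' t \<noteq> 0" for t using reg[of t] vector_derivative_at[of \<gamma> "\<gamma>' t" t] \<gamma>'(2) by auto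
 then interpret wc: weighted_curve \<gamma> \<gamma>' \<rho>
  using \<gamma>' assms(9) fr continuous_real_analytic_periodic[OF assms(8)] per by unfold_locales auto
 from exterior_map[OF \<Omega> \<gamma> fr] obtain R H \<eta> \<eta>' where R: "R > 1" and H: "H holomorphic_on ball 0 R" "H 0 \<noteq> 0"
  "inj_on (\<lambda>s. H s / s) (ball 0 R - {0})" "(\<lambda>s. H s / s) ` (ball 0 1 - {0}) = - closure \<Omega>" "(\<lambda>s. H s / s) ` sphere 0 1 = frontier \<Omega>"
  and \<eta>: "\<forall>t::real. cmod (\<eta> t) = 1 \<and> H (\<eta> t) / \<eta> t = \<gamma> t \<and> (\<eta> has_vector_derivative \<eta>' t) (at t)" "continuous_on UNIV \<eta>'"
  by (elim exE conjE)
 interpret ec: exterior_curve \<Omega> R H \<gamma> \<gamma>' \<rho> \<eta> \<eta>'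
  by unfold_locales (use R H \<eta> \<Omega>(1) sp frp jordan_interior_exterior(1)[OF \<Omega> sp frp] in auto)
 have "bounded {z. \<phi> z \<noteq> 0}"
  using \<phi> closure_subset compact_imp_bounded bounded_subset unfolding test_function_def by metis
 then obtain r where r: "\<forall>z\<in>{z. \<phi> z \<noteq> 0}. cmod z \<le> r" unfolding bounded_iff by (elim exE)
 have 0: "\<phi> z = 0" if "cmod z > r" for z using r that by force
 have sm: "\<forall>k. cont_diff k \<phi>" using \<phi> by (simp add: test_function_def)
 show "\<exists>C::real. \<forall>N::nat. \<forall>P. N \<ge> 1 \<longrightarrow> orthonormal_basis (curve_inner \<gamma> \<rho>) N P \<longrightarrow>
   cmod ((\<integral>f. zero_distribution N f \<phi> \<partial>gaussian_poly N P) -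
      (\<integral>z. \<phi> z \<partial>equilibrium_measure (closure \<Omega>))) \<le> C / real N"
  unfolding ec.equilibrium_measure_eq[OF \<Omega>(4)] by (rule ec.expected_zeros_near_boundary_measure[OF sm 0])
qed

end
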